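(* Let $u\in L^3(0,T;L^3(D_+))$ be a weak solution of the Euler equations on $D_+\times[0,T]$ (i.e. $(u,p)$ is a weak solution on $D_+\times[0,T]$ for some $p\in\mathcal{D}'(\partial D_+\times[0,T])$), let $0\le t_1<t_2\le T$, and suppose that (i) $u\in L^3(0,T;L^\infty(\mathbb{T}^2\times[0,\delta)))$ for some $\delta>0$; (ii) $u(\cdot,t)\in C_{\partial D_+}$ for almost every $t$; (iii) $$\lim_{|y|\to 0}\frac{1}{|y|}\int_{t_1}^{t_2}\iint_{\mathbb{T}^2}\int_{|y|}^\infty|u(t,x+y)-u(t,x)|^3\,dx_3\,dx_1\,dx_2\,dt=0 .$$ Then $u$ conserves energy on $D_+\times[t_1,t_2]$.
   Context: $T>0$ is fixed, $\mathbb{T}=\mathbb{R}/2\pi\mathbb{Z}$, $D_+:=\mathbb{T}^2\times[0,\infty)$, and $\partial D_+=\{x_3=0\}=\mathbb{T}^2\times\{0\}$ with normal $n=(0,0,-1)$, so that $\phi\cdot n=-\phi_3$. The vector $y$ in (iii) ranges over $\mathbb{R}^3\setminus\{0\}$, and addition in the first two coordinates is understood periodically. $\mathcal{S}(\mathbb{T}^2\times\mathbb{R})$ is the set of $C^\infty$ functions $\phi$ with $\sup_x|\partial^\alpha\phi(x)||x_3|^k<\infty$ for all multi-indices $\alpha$ and all $k\ge0$; $\mathcal{S}_\sigma(\mathbb{T}^2\times\mathbb{R})$ is the set of divergence-free vector fields in it. $\mathcal{S}(D_+)$ and $\mathcal{S}_\sigma(D_+)$ are the sets of restrictions to $D_+$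 of elements of $\mathcal{S}(\mathbb{T}^2\times\mathbb{R})$ and $\mathcal{S}_\sigma(\mathbb{T}^2\times\mathbb{R})$. $H_\sigma(D_+)$ is the completion in the norm of $L^2(D_+)$ of $\{\phi\in\mathcal{S}(D_+):\nabla\cdot\phi=0,\ \phi_3=0\text{ on }\partial D_+\}$ (vector-valued $\phi$); equivalently, of the smooth divergence-free fields with compact support in the interior of $D_+$. $C_{\rm w}([0,T];H_\sigma(D_+))$ is the set of functions $u:[0,T]\to H_\sigma(D_+)$ such that $t\mapsto\langle u(t),\phi\rangle_{D_+}$ is continuous for every $\phi\in L^2(D_+)$. $\mathcal{S}_\sigma^T(D_+):=\{\psi\in C^\infty(D_+\times[0,T]):\psi(\cdot,t)\in\mathcal{S}_\sigma(D_+)\text{ for every }t\in[0,T]\}$. Notation: $\langle f,g\rangle_{D_+}=\int_{D_+}f_ig_i\,dx$ and $\langle F:G\rangle_{D_+}=\int_{D_+}F_{ij}G_{ij}\,dx$ (summation convention); $\langle p,g\rangle_{\partial D_+\times[0,t]}$ is the pairing of the boundary distribution $p$ with $g$ over $\partial D_+\times[0,t]$ (for smooth $p$ it is $\int_0^t\int_{\partial D_+}pg\,dS\,d\tau$). Weak solution on $D_+\times[0,T]$: a pair $(u,p)$ with $u\in C_{\rm w}([0,T];H_\sigma(D_+))$ and $p\in\mathcal{D}'(\partial D_+\times[0,T])$ such that $$\langle u(t),\phi(t)\rangle_{D_+}-\langle u(0),\phi(0)\rangle_{D_+}-\int_0^t\langle u(\tau),\partial_t\phi(\tau)\rangle_{D_+}d\tau=\int_0^t\langle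 u(\tau)\otimes u(\tau):\nabla\phi(\tau)\rangle_{D_+}d\tau-\langle p,\phi\cdot n\rangle_{\partial D_+\times[0,t]}$$ for every $t\in[0,T]$ and every $\phi\in\mathcal{S}_\sigma^T(D_+)$. Continuity at a subset: for $\Gamma\subset\Omega$, a function $f$ on $\Omega$ is $C_\Gamma$ if for all $x\in\Gamma$ and each $\varepsilon>0$ there is $\delta>0$ such that $y\in\Omega$ and $|y-x|<\delta$ imply $|f(x)-f(y)|<\varepsilon$. Here $\Omega=D_+$ and $\Gamma=\partial D_+$. $u$ conserves energy on $D_+\times[t_1,t_2]$ means that $\|u(t)\|_{L^2(D_+)}=\|u(t_1)\|_{L^2(D_+)}$ for every $t\in[t_1,t_2]$. *)

theory Defs
  imports "HOL-Analysis.Analysis" "HOL-Probability.Essential_Supremum"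
begin

section \<open>Smooth functions on a set\<close>

text \<open>Iterated partial derivatives along a list of basis vectors, which plays the role of a
  multi-index. Derivatives are taken within \<open>S\<close>, so they are one-sided at boundary points. Only
  sets \<open>S\<close> are used on which the derivative within \<open>S\<close> is unique (products of whole spaces,
  half-spaces and nondegenerate intervals), and there the result depends only on the
  values of \<open>f\<close> on \<open>S\<close>.\<close>

fun pderivs :: "'a::euclidean_space set \<Rightarrow> 'a list \<Rightarrow> ('a \<Rightarrow> 'b::real_normed_vector) \<Rightarrow> 'a \<Rightarrow> 'b" where
  "pderivs S [] f = f"
| "pderivs S (b # bs) f = (\<lambda>x. frechet_derivative (pderivs S bs f) (at x within S) b)"

definition smooth_within :: "'a::euclidean_space set \<Rightarrow> ('a \<Rightarrow> 'b::real_normed_vector) \<Rightarrow> bool" where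
  "smooth_within S f \<longleftrightarrow> (\<forall>bs. set bs \<subseteq> Basis \<longrightarrow> pderivs S bs f differentiable_on S)"

section \<open>The domain\<close>

text \<open>Functions on \<open>\<T>\<^sup>2 \<times> \<real>\<close> and on \<open>D\<^sub>+\<close> are functions on \<open>\<real>\<^sup>3\<close>, respectively on the half-space,
  that are \<open>2\<pi>\<close>-periodic in the first two coordinates. They are integrated over one period cell.
  An element of a Lebesgue space is given by a representative.\<close>

definition D_plus :: "(real^3) set" where
  "D_plus = {x. 0 \<le> x $ 3}"

definition bdry_D_plus :: "(real^3) set" where
  "bdry_D_plus = {x. x $ 3 = 0}"

definition cell :: "(real^3) set" where
  "cell = {x \<in> D_plus. x $ 1 \<in> {0..<2 * pi} \<and> x $ 2 \<in> {0..<2 * pi}}"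

definition horiz_periodic_on :: "(real^3) set \<Rightarrow> (real^3 \<Rightarrow> 'b) \<Rightarrow> bool" where
  "horiz_periodic_on S f \<longleftrightarrow>
     (\<forall>x\<in>S. f (x + (2 * pi) *\<^sub>R axis 1 1) = f x \<and> f (x + (2 * pi) *\<^sub>R axis 2 1) = f x)"

section \<open>Schwartz fields\<close>

definition divergence_within :: "(real^3) set \<Rightarrow> (real^3 \<Rightarrow> real^3) \<Rightarrow> real^3 \<Rightarrow> real" where
  "divergence_within S \<phi> x = (\<Sum>i\<in>UNIV. frechet_derivative \<phi> (at x within S) (axis i 1) $ i)"

definition schwartz :: "(real^3 \<Rightarrow> real^3) set" where
  "schwartz = {\<phi>. horiz_periodic_on UNIV \<phi> \<and> smooth_within UNIV \<phi> \<and>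
     (\<forall>bs k. set bs \<subseteq> Basis \<longrightarrow>
        bdd_above (range (\<lambda>x. norm (pderivs UNIV bs \<phi> x) * \<bar>x $ 3\<bar> ^ k)))}"

definition schwartz_sigma :: "(real^3 \<Rightarrow> real^3) set" where
  "schwartz_sigma = {\<phi> \<in> schwartz. \<forall>x. divergence_within UNIV \<phi> x = 0}"

definition schwartz_D :: "(real^3 \<Rightarrow> real^3) set" where
  "schwartz_D = {\<phi>. \<exists>\<Phi>\<in>schwartz. \<forall>x\<in>D_plus. \<phi> x = \<Phi> x}"

definition schwartz_sigma_D :: "(real^3 \<Rightarrow> real^3) set" where
  "schwartz_sigma_D = {\<phi>. \<exists>\<Phi>\<in>schwartz_sigma. \<forall>x\<in>D_plus. \<phi> x = \<Phi> x}"

definition schwartz_sigma_time_D :: "real \<Rightarrow> (real \<Rightarrow> real^3 \<Rightarrow> real^3) set" where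
  "schwartz_sigma_time_D T = {\<psi>. smooth_within (D_plus \<times> {0..T}) (\<lambda>(x, t). \<psi> t x) \<and>
     (\<forall>t\<in>{0..T}. \<psi> t \<in> schwartz_sigma_D)}"

section \<open>Function spaces on the half-space\<close>

definition L2_D :: "(real^3 \<Rightarrow> real^3) set" where
  "L2_D = {f. horiz_periodic_on D_plus f \<and> f \<in> borel_measurable (lebesgue_on cell) \<and>
     integrable (lebesgue_on cell) (\<lambda>x. (norm (f x))\<^sup>2)}"

definition inner_D :: "(real^3 \<Rightarrow> real^3) \<Rightarrow> (real^3 \<Rightarrow> real^3) \<Rightarrow> real" where
  "inner_D f g = (LINT x|lebesgue_on cell. f x \<bullet> g x)"

definition L2_norm_D :: "(real^3 \<Rightarrow> real^3) \<Rightarrow> real" where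
  "L2_norm_D f = sqrt (LINT x|lebesgue_on cell. (norm (f x))\<^sup>2)"

text \<open>Since \<open>L\<^sup>2\<close> is complete, the completion is the closure in \<open>L\<^sup>2\<close>.\<close>

definition H_sigma_D :: "(real^3 \<Rightarrow> real^3) set" where
  "H_sigma_D = {f \<in> L2_D. \<forall>\<epsilon>>0. \<exists>\<phi>\<in>schwartz_D.
     (\<forall>x\<in>D_plus. divergence_within D_plus \<phi> x = 0) \<and> (\<forall>x\<in>bdry_D_plus. \<phi> x $ 3 = 0) \<and>
     L2_norm_D (\<lambda>x. f x - \<phi> x) < \<epsilon>}"

definition Cw_H_sigma_D :: "real \<Rightarrow> (real \<Rightarrow> real^3 \<Rightarrow> real^3) set" where
  "Cw_H_sigma_D T = {u. (\<forall>t\<in>{0..T}. u t \<in> H_sigma_D) \<and>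
     (\<forall>\<phi>\<in>L2_D. continuous_on {0..T} (\<lambda>t. inner_D (u t) \<phi>))}"

text \<open>The next two predicates record finiteness of the mixed norms. They are applied to
  \<open>u \<in> Cw_H_sigma_D T\<close> only, for which \<open>u t\<close> is measurable and both spatial norms are measurable
  functions of time, being lower semicontinuous under weak convergence.\<close>

definition L3_L3_D :: "real \<Rightarrow> (real \<Rightarrow> real^3 \<Rightarrow> real^3) \<Rightarrow> bool" where
  "L3_L3_D T u \<longleftrightarrow>
     (\<integral>\<^sup>+t\<in>{0..T}. (\<integral>\<^sup>+x\<in>cell. ennreal (norm (u t x) ^ 3) \<partial>lebesgue) \<partial>lebesgue) < \<infinity>"

definition L3_Linf_strip :: "real \<Rightarrow> real \<Rightarrow> (real \<Rightarrow> real^3 \<Rightarrow> real^3) \<Rightarrow> bool" where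
  "L3_Linf_strip T \<delta> u \<longleftrightarrow>
     (\<integral>\<^sup>+t\<in>{0..T}. (esssup (lebesgue_on {x \<in> cell. x $ 3 < \<delta>}) (\<lambda>x. ennreal (norm (u t x)))) ^ 3
        \<partial>lebesgue) < \<infinity>"

definition continuous_at_subset :: "'a::metric_space set \<Rightarrow> 'a set \<Rightarrow> ('a \<Rightarrow> 'b::metric_space) \<Rightarrow> bool" where
  "continuous_at_subset \<Gamma> \<Omega> f \<longleftrightarrow>
     (\<forall>x\<in>\<Gamma>. \<forall>\<epsilon>>0. \<exists>\<delta>>0. \<forall>y\<in>\<Omega>. dist y x < \<delta> \<longrightarrow> dist (f x) (f y) < \<epsilon>)"

text \<open>For an element of a Lebesgue space this means that some representative is continuous at
  the boundary. For periodic functions Euclidean distances may replace those of the torus.\<close>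

definition C_bdry_D :: "(real^3 \<Rightarrow> real^3) \<Rightarrow> bool" where
  "C_bdry_D f \<longleftrightarrow> (\<exists>v. horiz_periodic_on D_plus v \<and> (AE x in lebesgue_on cell. v x = f x) \<and>
     continuous_at_subset bdry_D_plus D_plus v)"

section \<open>Boundary distributions\<close>

text \<open>The set \<open>\<partial>D\<^sub>+ \<times> [0,T]\<close> is compact, so every smooth function on it (up to the end points of
  the time interval) is a test function, and continuity is a bound by finitely many derivatives.\<close>

definition bdry_test :: "real \<Rightarrow> ((real^2) \<times> real \<Rightarrow> real) set" where
  "bdry_test T = {g. smooth_within (UNIV \<times> {0..T}) g \<and>
     (\<forall>x. \<forall>t\<in>{0..T}. \<forall>i. g (x + (2 * pi) *\<^sub>R axis i 1, t) = g (x, t))}"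

definition bdry_distribution :: "real \<Rightarrow> (((real^2) \<times> real \<Rightarrow> real) \<Rightarrow> real) \<Rightarrow> bool" where
  "bdry_distribution T p \<longleftrightarrow>
     (\<forall>f\<in>bdry_test T. \<forall>g\<in>bdry_test T. \<forall>a b. p (\<lambda>z. a * f z + b * g z) = a * p f + b * p g) \<and>
     (\<exists>C N. \<forall>g\<in>bdry_test T. \<forall>B.
        (\<forall>bs. set bs \<subseteq> Basis \<and> length bs \<le> N \<longrightarrow>
           (\<forall>z\<in>UNIV \<times> {0..T}. \<bar>pderivs (UNIV \<times> {0..T}) bs g z\<bar> \<le> B)) \<longrightarrow> \<bar>p g\<bar> \<le> C * B)"

text \<open>The pairing of a distribution over \<open>\<partial>D\<^sub>+ \<times> [0,t]\<close> is the limit of its values on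
  \<open>\<eta>\<^sub>n g\<close> for smooth monotone cutoffs \<open>\<eta>\<^sub>n\<close> decreasing from 1 on \<open>[0,t]\<close> to 0 after \<open>t\<close>. It equals
  \<open>p g\<close> for \<open>t = T\<close>, and \<open>\<integral>\<^sub>0\<^sup>t \<integral> p g\<close> if \<open>p\<close> is a smooth function. The limit need not exist for
  every distribution.\<close>

definition time_cutoffs :: "real \<Rightarrow> (nat \<Rightarrow> real \<Rightarrow> real) \<Rightarrow> bool" where
  "time_cutoffs t \<eta> \<longleftrightarrow> (\<forall>n. smooth_within UNIV (\<eta> n) \<and> antimono (\<eta> n) \<and>
     (\<forall>\<tau>\<le>t. \<eta> n \<tau> = 1) \<and> (\<forall>\<tau>\<ge>t + 1 / real (Suc n). \<eta> n \<tau> = 0))"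

definition has_bdry_pairing ::
    "(((real^2) \<times> real \<Rightarrow> real) \<Rightarrow> real) \<Rightarrow> real \<Rightarrow> ((real^2) \<times> real \<Rightarrow> real) \<Rightarrow> real \<Rightarrow> bool" where
  "has_bdry_pairing p t g c \<longleftrightarrow>
     (\<forall>\<eta>. time_cutoffs t \<eta> \<longrightarrow> (\<lambda>n. p (\<lambda>(x, \<tau>). \<eta> n \<tau> * g (x, \<tau>))) \<longlonglongrightarrow> c)"

definition outer_normal :: "real^3" where
  "outer_normal = vector [0, 0, -1]"

definition normal_trace :: "(real \<Rightarrow> real^3 \<Rightarrow> real^3) \<Rightarrow> (real^2) \<times> real \<Rightarrow> real" where
  "normal_trace \<phi> = (\<lambda>(x, \<tau>). \<phi> \<tau> (vector [x $ 1, x $ 2, 0]) \<bullet> outer_normal)"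

section \<open>Weak solutions\<close>

definition time_deriv :: "real \<Rightarrow> (real \<Rightarrow> real^3 \<Rightarrow> real^3) \<Rightarrow> real \<Rightarrow> real^3 \<Rightarrow> real^3" where
  "time_deriv T \<phi> \<tau> x = vector_derivative (\<lambda>s. \<phi> s x) (at \<tau> within {0..T})"

definition flux_D :: "(real^3 \<Rightarrow> real^3) \<Rightarrow> (real^3 \<Rightarrow> real^3) \<Rightarrow> real" where
  "flux_D v \<phi> = (LINT x|lebesgue_on cell. (\<Sum>i\<in>UNIV. \<Sum>j\<in>UNIV.
     v x $ i * v x $ j * frechet_derivative \<phi> (at x within D_plus) (axis i 1) $ j))"

text \<open>The decay at infinity in \<open>schwartz_sigma_time_D\<close> is not uniform in time, so the two
  time integrals of the weak formulation can diverge for some test fields. The identity is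
  required for those for which they converge. The remaining spatial integrals always do.\<close>

definition weak_terms_defined ::
    "real \<Rightarrow> (real \<Rightarrow> real^3 \<Rightarrow> real^3) \<Rightarrow> (real \<Rightarrow> real^3 \<Rightarrow> real^3) \<Rightarrow> real \<Rightarrow> bool" where
  "weak_terms_defined T u \<phi> t \<longleftrightarrow>
     (AE \<tau> in lebesgue_on {0..t}. integrable (lebesgue_on cell) (\<lambda>x. u \<tau> x \<bullet> time_deriv T \<phi> \<tau> x)) \<and>
     integrable (lebesgue_on {0..t}) (\<lambda>\<tau>. inner_D (u \<tau>) (time_deriv T \<phi> \<tau>)) \<and>
     integrable (lebesgue_on {0..t}) (\<lambda>\<tau>. flux_D (u \<tau>) (\<phi> \<tau>))"

definition weak_solution ::
    "real \<Rightarrow> (real \<Rightarrow> real^3 \<Rightarrow> real^3) \<Rightarrow> (((real^2) \<times> real \<Rightarrow> real) \<Rightarrow> real) \<Rightarrow> bool" where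
  "weak_solution T u p \<longleftrightarrow> u \<in> Cw_H_sigma_D T \<and> bdry_distribution T p \<and>
     (\<forall>t\<in>{0..T}. \<forall>\<phi>\<in>schwartz_sigma_time_D T. weak_terms_defined T u \<phi> t \<longrightarrow>
        (\<exists>c. has_bdry_pairing p t (normal_trace \<phi>) c \<and>
           inner_D (u t) (\<phi> t) - inner_D (u 0) (\<phi> 0)
             - (LINT \<tau>|lebesgue_on {0..t}. inner_D (u \<tau>) (time_deriv T \<phi> \<tau>))
           = (LINT \<tau>|lebesgue_on {0..t}. flux_D (u \<tau>) (\<phi> \<tau>)) - c))"

definition conserves_energy :: "(real \<Rightarrow> real^3 \<Rightarrow> real^3) \<Rightarrow> real \<Rightarrow> real \<Rightarrow> bool" where
  "conserves_energy u t1 t2 \<longleftrightarrow> (\<forall>t\<in>{t1..t2}. L2_norm_D (u t) = L2_norm_D (u t1))"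

end

theory Submission
  imports Defs "HOL-Computational_Algebra.Polynomial"
begin

text \<open>
  Reflecting \<open>u\<close> across \<open>x\<^sub>3 = 0\<close> (oddly in the third component) gives a divergence free field \<open>U\<close> on
  \<open>\<T>\<^sup>2 \<times> \<real>\<close>. Mollifying a reflection symmetric field with a radial kernel keeps its normal component zero on
  the boundary. Such fields are therefore test fields for which the pressure drops out, and \<open>U\<close> satisfies the Euler
  equations mollified in space. For two times \<open>s\<close> and \<open>t\<close> the pairing of \<open>U s\<close> with the mollified \<open>U t\<close> can be
  telescoped along partitions; since \<open>U\<close> is weakly continuous in time, Riemann sums express the change of the mollified
  energy on \<open>[t\<^sub>1, t]\<close> by a flux at scale \<open>\<epsilon>\<close>, without any regularisation in time. By the identity of Duchon and
  Robert the flux is a cubic moment of the increments of \<open>U\<close>. At distance at least \<open>2 \<epsilon>\<close> from the plane it tends to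
  zero by the hypothesis on increments. In the strip of width of order \<open>\<epsilon>\<close> the kernel gradient has size \<open>1 / \<epsilon>\<close>, which
  the volume of the strip compensates; there the increments tend to zero because \<open>u\<close> is continuous at the boundary and
  tangential on it, and the bound in \<open>L\<^sup>3 L\<^sup>\<infinity>\<close> dominates them.\<close>

section \<open>Smooth functions\<close>

text \<open>The fields \<open>u t\<close> are given one time at a time and their Borel versions
  \<open>U t\<close> are picked by choice, so nothing is known about the measurability of
  \<open>U\<close> in time and space jointly. Only mollified fields are jointly continuous;
  measurability in time is obtained from them by limits, and the flux is estimated at a second,
  inner mollification scale that is sent to 0 before the outer one. The inner scale also supplies
  the sup bound that makes the cubic terms of the increment identity integrable. Weak continuity
  bounds each single pairing only; a bound on \<open>nrm (U t)\<close> uniform in time comes from a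
  uniform boundedness principle. Test fields need a divergence free Schwartz extension to the whole
  space, whereas the approximants of \<open>H_sigma_D\<close> are divergence free on the half-space
  only, with an arbitrary extension below it; reflecting and then mollifying repairs this. Finally,
  continuity at the boundary does not include tangency: that the normal component vanishes is
  derived from the divergence condition.\<close>

primrec Ck :: "nat \<Rightarrow> ('a::euclidean_space \<Rightarrow> real) \<Rightarrow> bool" where
  "Ck 0 f \<longleftrightarrow> (\<forall>x. f differentiable at x)"
| "Ck (Suc n) f \<longleftrightarrow> (\<forall>x. f differentiable at x) \<and>
     (\<forall>b\<in>Basis. Ck n (\<lambda>x. frechet_derivative f (at x) b))"

lemma Ck_differentiable: "Ck n f \<Longrightarrow> f differentiable at x"
  by (cases n) auto

lemma Ck_has_derivative: "Ck n f \<Longrightarrow> (f has_derivative frechet_derivative f (at x)) (at x)"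
  using Ck_differentiable frechet_derivative_works by blast

lemma frechet_derivative_eq: "(f has_derivative f') (at x) \<Longrightarrow> frechet_derivative f (at x) b = f' b"
  using frechet_derivative_at by metis

lemma Ck_mono: "Ck (Suc n) f \<Longrightarrow> Ck n f"
  by (induction n arbitrary: f) auto

lemma Ck_const: "Ck n (\<lambda>x. c)"
proof (induction n arbitrary: c)
  case (Suc n)
  show ?case unfolding Ck.simps frechet_derivative_const
    using Suc.IH[of 0] by (intro conjI allI ballI differentiable_const)
qed (simp only: Ck.simps differentiable_const simp_thms)

lemma Ck_add:
  assumes "Ck n f" "Ck n g" shows "Ck n (\<lambda>x. f x + g x)"
  using assms
proof (induction n arbitrary: f g)
  case (Suc n)
  have "frechet_derivative (\<lambda>x. f x + g x) (at x) b
      = frechet_derivative f (at x) b + frechet_derivative g (at x) b" for x b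
    by (rule frechet_derivative_eq[OF has_derivative_add[OF Ck_has_derivative[OF Suc.prems(1)] Ck_has_derivative[OF Suc.prems(2)]]])
  moreover have "Ck n (\<lambda>x. frechet_derivative f (at x) b + frechet_derivative g (at x) b)"
    if "b \<in> Basis" for b
    using Suc.prems that by (intro Suc.IH) auto
  ultimately show ?case using Suc.prems by (auto intro!: differentiable_add)
qed (auto intro!: differentiable_add)

lemma Ck_mult:
  assumes "Ck n f" "Ck n g" shows "Ck n (\<lambda>x. f x * g x)"
  using assms
proof (induction n arbitrary: f g)
  case (Suc n)
  have *: "frechet_derivative (\<lambda>x. f x * g x) (at x) b
      = f x * frechet_derivative g (at x) b + frechet_derivative f (at x) b * g x" for x b
    by (rule frechet_derivative_eq[OF has_derivative_mult[OF Ck_has_derivative[OF Suc.prems(1)] Ck_has_derivative[OF Suc.prems(2)]]])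
  have "Ck n (\<lambda>x. f x * frechet_derivative g (at x) b + frechet_derivative f (at x) b * g x)"
    if "b \<in> Basis" for b
    using Suc.prems that by (intro Ck_add Suc.IH) (auto intro: Ck_mono)
  with Suc.prems show ?case by (auto simp: * intro!: differentiable_mult)
qed (auto intro!: differentiable_mult)

lemma Ck_compose:
  fixes g :: "real \<Rightarrow> real"
  assumes "Ck n g" "Ck n f" shows "Ck n (\<lambda>x. g (f x))"
  using assms
proof (induction n arbitrary: f g)
  case 0
  then show ?case using differentiable_chain_at[of f _ g] by (auto simp: o_def)
next
  case (Suc n)
  have *: "frechet_derivative (\<lambda>x. g (f x)) (at x) b
      = frechet_derivative g (at (f x)) 1 * frechet_derivative f (at x) b" for x b
  proof -
    have "((\<lambda>x. g (f x)) has_derivative (\<lambda>h. frechet_derivative g (at (f x)) (frechet_derivative f (at x) h))) (at x)"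
      by (rule has_derivative_compose[OF Ck_has_derivative[OF Suc.prems(2)] Ck_has_derivative[OF Suc.prems(1)]])
    then have "frechet_derivative (\<lambda>x. g (f x)) (at x) b
        = frechet_derivative g (at (f x)) (frechet_derivative f (at x) b *\<^sub>R 1)"
      by (subst frechet_derivative_eq) auto
    also have "\<dots> = frechet_derivative f (at x) b *\<^sub>R frechet_derivative g (at (f x)) 1"
      using Ck_differentiable[OF Suc.prems(1)] linear_frechet_derivative linear_scale by blast
    finally show ?thesis by simp
  qed
  have "Ck n (\<lambda>x. frechet_derivative g (at (f x)) 1 * frechet_derivative f (at x) b)"
    if "b \<in> Basis" for b
    using Suc.prems that by (intro Ck_mult Suc.IH[of "\<lambda>y. frechet_derivative g (at y) 1"]) (auto intro: Ck_mono)
  moreover have "(\<lambda>x. g (f x)) differentiable at x" for x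
    using differentiable_chain_at[of f _ g] Suc.prems by (auto simp: o_def)
  ultimately show ?case by (simp add: *)
qed

text \<open>The derivative of \<open>1 / f\<close> contains \<open>1 / f\<close> again, one level
  lower; hence the induction is on the order for a fixed \<open>f\<close>.\<close>

lemma Ck_inverse:
  fixes f :: "'a::euclidean_space \<Rightarrow> real"
  assumes "Ck n f" "\<And>x. f x \<noteq> 0" shows "Ck n (\<lambda>x. inverse (f x))"
  using assms(1)
proof (induction n)
  case 0
  then show ?case using assms(2) by (auto intro: differentiable_inverse)
next
  case (Suc n)
  have *: "frechet_derivative (\<lambda>x. inverse (f x)) (at x) b
      = -1 * (inverse (f x) * frechet_derivative f (at x) b * inverse (f x))" for x b
    using Deriv.has_derivative_inverse[OF assms(2) Ck_has_derivative[OF Suc.prems]]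
    by (subst frechet_derivative_eq, assumption, simp)
  have "Ck n (\<lambda>x. -1 * (inverse (f x) * frechet_derivative f (at x) b * inverse (f x)))"
    if "b \<in> Basis" for b
    using Suc that Ck_mono[OF Suc.prems] by (intro Ck_mult Ck_const Suc.IH) auto
  moreover have "(\<lambda>x. inverse (f x)) differentiable at x" for x
    using Ck_differentiable[OF Suc.prems] assms(2) by (rule differentiable_inverse)
  ultimately show ?case by (simp add: *)
qed

lemma Ck_inner: "Ck n (\<lambda>x. x \<bullet> c)"
proof (cases n)
  case (Suc m)
  have "frechet_derivative (\<lambda>x. x \<bullet> c) (at x) = (\<lambda>h. h \<bullet> c)" for x
    by (rule frechet_derivative_at[symmetric]) (auto intro!: derivative_eq_intros)
  with Suc show ?thesis by (simp add: Ck_const)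
qed simp

lemma Ck_sum:
  assumes "finite I" "\<And>i. i \<in> I \<Longrightarrow> Ck n (f i)" shows "Ck n (\<lambda>x. \<Sum>i\<in>I. f i x)"
  using assms by (induction I) (auto intro: Ck_const Ck_add)

lemma pderivs_append: "pderivs S (bs @ cs) f = pderivs S bs (pderivs S cs f)"
  by (induction bs) auto

text \<open>\<open>Ck\<close> strips the derivative taken first, which is the last element of the
  list, while \<open>pderivs\<close> recurses on the head; this is why the list is split from the
  right. Level \<open>n\<close> means that all derivatives of order at most \<open>n\<close> are
  still differentiable, so there is one more derivative than the index suggests.\<close>

lemma Ck_iff_pderivs:
  fixes f :: "'a::euclidean_space \<Rightarrow> real"
  shows "Ck n f \<longleftrightarrow> (\<forall>bs. set bs \<subseteq> Basis \<and> length bs \<le> n \<longrightarrow> (\<forall>x. pderivs UNIV bs f differentiable at x))"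
proof (induction n arbitrary: f)
  case (Suc n)
  show ?case (is "?l = ?r")
  proof
    assume l: ?l
    show ?r
    proof (intro allI impI)
      fix bs :: "'a list" and x assume bs: "set bs \<subseteq> Basis \<and> length bs \<le> Suc n"
      show "pderivs UNIV bs f differentiable at x"
      proof (cases bs rule: rev_cases)
        case (snoc cs b)
        then show ?thesis using l bs Suc by (auto simp: pderivs_append)
      qed (use l in auto)
    qed
  next
    assume r: ?r
    have "pderivs UNIV cs (\<lambda>x. frechet_derivative f (at x) b) differentiable at x"
      if "set cs \<subseteq> Basis" "length cs \<le> n" "b \<in> Basis" for cs b and x :: 'a
      using r[rule_format, of "cs @ [b]" x] that by (auto simp: pderivs_append)
    with r[rule_format, of "[]"] Suc show ?l by auto
  qed
qed simp

lemma smooth_iff_Ck: "smooth_within UNIV f \<longleftrightarrow> (\<forall>n. Ck n f)"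
  unfolding smooth_within_def Ck_iff_pderivs by (auto simp: differentiable_on_def)

lemma smooth_pderivs: "smooth_within UNIV f \<Longrightarrow> set bs \<subseteq> Basis \<Longrightarrow> smooth_within UNIV (pderivs UNIV bs f)"
  unfolding smooth_within_def by (auto simp flip: pderivs_append)

lemma smooth_frechet_derivative:
  "smooth_within UNIV f \<Longrightarrow> b \<in> Basis \<Longrightarrow> smooth_within UNIV (\<lambda>x. frechet_derivative f (at x) b)"
  using smooth_pderivs[of f "[b]"] by simp

section \<open>A smooth bump\<close>

text \<open>The derivatives of \<open>exp (- 1 / s)\<close> stay in this family, which makes it smooth at \<open>0\<close>.\<close>

definition flat_exp :: "real poly \<Rightarrow> real \<Rightarrow> real" where
  "flat_exp p s = (if 0 < s then poly p (1 / s) * exp (- (1 / s)) else 0)"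

text \<open>With \<open>r = 1 / s\<close> this is the flatness of the family at \<open>0\<close>
  from the right.\<close>

lemma poly_exp_tendsto_0: "((\<lambda>r. poly p r * exp (- r)) \<longlongrightarrow> 0) at_top" for p :: "real poly"
proof (induction p)
  case (pCons a p)
  have 1: "((\<lambda>r::real. r * (poly p r * exp (- r))) \<longlongrightarrow> 0) at_top"
  proof -
    have "((\<lambda>r::real. \<Sum>i\<le>degree p. coeff p i * (r ^ Suc i / exp r)) \<longlongrightarrow> (\<Sum>i\<le>degree p. coeff p i * 0)) at_top"
      by (intro tendsto_sum tendsto_mult tendsto_const tendsto_power_div_exp_0)
    moreover have "(\<Sum>i\<le>degree p. coeff p i * (r ^ Suc i / exp r)) = r * (poly p r * exp (- r))" for r
      by (simp add: poly_altdef sum_distrib_left sum_distrib_right exp_minus field_simps)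
    ultimately show ?thesis by simp
  qed
  have 2: "((\<lambda>r::real. a * (r ^ 0 / exp r)) \<longlongrightarrow> a * 0) at_top"
    by (intro tendsto_mult tendsto_const tendsto_power_div_exp_0)
  from tendsto_add[OF 1 2] show ?case by (simp add: algebra_simps exp_minus field_simps)
qed simp

text \<open>For \<open>s > 0\<close> the derivative of \<open>p(1/s) exp(-1/s)\<close> is
  \<open>(p - p')(1/s) exp(-1/s) / s^2\<close>; the polynomial \<open>[:0, 0, 1:]\<close> evaluated
  at \<open>1 / s\<close> is the factor \<open>1 / s^2\<close>.\<close>

lemma flat_exp_has_derivative:
  "(flat_exp p has_real_derivative flat_exp ([:0, 0, 1:] * (p - pderiv p)) s) (at s)"
proof -
  consider "s > 0" | "s < 0" | "s = 0" by linarith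
  then show ?thesis
  proof cases
    case 1
    have "((\<lambda>s. poly p (1 / s) * exp (- (1 / s))) has_real_derivative
        flat_exp ([:0, 0, 1:] * (p - pderiv p)) s) (at s)"
      using 1 by (auto intro!: derivative_eq_intros DERIV_chain'[OF _ poly_DERIV]
          simp: flat_exp_def field_simps power2_eq_square)
    moreover have "\<forall>\<^sub>F x in nhds s. flat_exp p x = poly p (1 / x) * exp (- (1 / x))"
      using eventually_nhds_in_open[of "{0<..}" s] 1 by (auto elim!: eventually_mono simp: flat_exp_def)
    ultimately show ?thesis by (subst DERIV_cong_ev[OF refl _ refl]) auto
  next
    case 2
    have "\<forall>\<^sub>F x in nhds s. flat_exp p x = 0"
      using eventually_nhds_in_open[of "{..<0}" s] 2 by (auto elim!: eventually_mono simp: flat_exp_def)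
    then show ?thesis using 2 by (subst DERIV_cong_ev[OF refl _ refl]) (auto simp: flat_exp_def)
  next
    case 3
    have r: "((\<lambda>h. flat_exp p h / h) \<longlongrightarrow> 0) (at_right 0)"
    proof -
      \<comment> \<open>Dividing by \<open>h\<close> multiplies by \<open>1 / h\<close>, which turns
        \<open>p\<close> into \<open>pCons 0 p\<close>, so the difference quotient at
        \<open>0\<close> is again in the family.\<close>
      have "((\<lambda>h. poly (pCons 0 p) (inverse h) * exp (- inverse h)) \<longlongrightarrow> 0) (at_right 0)"
        using poly_exp_tendsto_0 filterlim_inverse_at_top_right by (rule filterlim_compose)
      moreover have "\<forall>\<^sub>F h in at_right (0::real). poly (pCons 0 p) (inverse h) * exp (- inverse h) = flat_exp p h / h"
        by (auto simp: eventually_at_filter flat_exp_def field_simps)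
      ultimately show ?thesis by (rule Lim_transform_eventually)
    qed
    have l: "((\<lambda>h. flat_exp p h / h) \<longlongrightarrow> 0) (at_left 0)"
      by (rule tendsto_eventually) (auto simp: eventually_at_filter flat_exp_def)
    have "((\<lambda>h. flat_exp p h / h) \<longlongrightarrow> 0) (at 0)" using l r by (simp add: filterlim_split_at)
    then have "((\<lambda>h. (flat_exp p (0 + h) - flat_exp p 0) / h) \<longlongrightarrow> 0) (at 0)"
      by (simp add: flat_exp_def[of p 0])
    then have "(flat_exp p has_real_derivative 0) (at 0)" unfolding DERIV_def .
    then show ?thesis using 3 by (simp add: flat_exp_def)
  qed
qed

lemma Ck_flat_exp: "Ck n (flat_exp p)"
proof (induction n arbitrary: p)
  case 0
  then show ?case using flat_exp_has_derivative by (auto simp: has_field_derivative_def differentiable_def)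
next
  case (Suc n)
  have "frechet_derivative (flat_exp p) (at s) 1 = flat_exp ([:0, 0, 1:] * (p - pderiv p)) s" for s
    using flat_exp_has_derivative[of p s] unfolding has_field_derivative_def
    by (subst frechet_derivative_eq, assumption, simp)
  moreover have "flat_exp p differentiable at s" for s
    using flat_exp_has_derivative[of p s] by (auto simp: has_field_derivative_def differentiable_def)
  ultimately show ?case using Suc by simp
qed

lemma flat_exp_1: "flat_exp 1 s = (if 0 < s then exp (- (1 / s)) else 0)"
  by (simp add: flat_exp_def)

lemma flat_exp_nonneg: "0 \<le> flat_exp 1 s"
  by (simp add: flat_exp_1)

lemma flat_exp_mono: "s \<le> t \<Longrightarrow> flat_exp 1 s \<le> flat_exp 1 t"
  by (cases "0 < s") (auto simp: flat_exp_1 intro!: divide_left_mono mult_pos_pos)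

section \<open>Smooth cutoffs in time\<close>

definition smooth_step :: "real \<Rightarrow> real" where
  "smooth_step s = flat_exp 1 (1 - s) * inverse (flat_exp 1 s + flat_exp 1 (1 - s))"

lemma smooth_step_denominator: "0 < flat_exp 1 s + flat_exp 1 (1 - s)"
proof -
  have "0 < flat_exp 1 s \<or> 0 < flat_exp 1 (1 - s)" by (auto simp: flat_exp_1)
  then show ?thesis using flat_exp_nonneg[of s] flat_exp_nonneg[of "1 - s"] by linarith
qed

lemma smooth_step_le0: "s \<le> 0 \<Longrightarrow> smooth_step s = 1"
  using smooth_step_denominator[of s] by (auto simp: smooth_step_def flat_exp_1)

lemma smooth_step_ge1: "1 \<le> s \<Longrightarrow> smooth_step s = 0"
  by (simp add: smooth_step_def flat_exp_1)

lemma smooth_step_antimono: "s \<le> t \<Longrightarrow> smooth_step t \<le> smooth_step s"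
proof -
  assume st: "s \<le> t"
  define a b c d where "a = flat_exp 1 s" and "b = flat_exp 1 (1 - s)"
    and "c = flat_exp 1 t" and "d = flat_exp 1 (1 - t)"
  have "a \<le> c" "d \<le> b" "0 \<le> a" "0 \<le> d" using flat_exp_mono st
    by (auto simp: a_def b_def c_def d_def flat_exp_nonneg)
  \<comment> \<open>Cleared of denominators, the claim \<open>d / (c + d) <= b / (a + b)\<close> is
    \<open>d a <= b c\<close>.\<close>
  then have "d * a \<le> b * c" by (meson mult_mono order_trans)
  moreover have "0 < a + b" "0 < c + d" using smooth_step_denominator by (auto simp: a_def b_def c_def d_def)
  ultimately show ?thesis
    unfolding smooth_step_def a_def[symmetric] b_def[symmetric] c_def[symmetric] d_def[symmetric]
    by (simp add: field_simps)
qed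

lemma Ck_affine_real: "Ck n (\<lambda>s. a * (s - c) :: real)"
proof -
  have "Ck n (\<lambda>s. (s \<bullet> a) + (- (a * c)))" by (intro Ck_add Ck_inner Ck_const)
  then show ?thesis by (simp add: algebra_simps)
qed

lemma Ck_smooth_step: "Ck n smooth_step"
proof -
  have *: "Ck n (\<lambda>s. flat_exp 1 (1 - s))"
    using Ck_compose[OF Ck_flat_exp Ck_affine_real[where a = "-1" and c = 1]] by simp
  show ?thesis unfolding smooth_step_def[abs_def]
    using smooth_step_denominator by (intro Ck_mult Ck_inverse Ck_add * Ck_flat_exp) (metis less_irrefl)
qed

text \<open>\<open>has_bdry_pairing\<close> quantifies over all cutoff sequences; it determines the
  value of the pairing only because at least one such sequence exists.\<close>

lemma ex_time_cutoffs: "\<exists>\<eta>. time_cutoffs t \<eta>"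
proof -
  have "smooth_within UNIV (\<lambda>s. smooth_step (real (Suc n) * (s - t)))" for n
    unfolding smooth_iff_Ck using Ck_compose[OF Ck_smooth_step Ck_affine_real] by blast
  moreover have "antimono (\<lambda>s. smooth_step (real (Suc n) * (s - t)))" for n
    by (intro antimonoI smooth_step_antimono mult_left_mono) auto
  moreover have "smooth_step (real (Suc n) * (s - t)) = 1" if "s \<le> t" for n s
    using that by (intro smooth_step_le0 mult_nonneg_nonpos) auto
  moreover have "smooth_step (real (Suc n) * (s - t)) = 0" if "t + 1 / real (Suc n) \<le> s" for n s
    using that by (intro smooth_step_ge1) (simp add: field_simps)
  ultimately have "time_cutoffs t (\<lambda>n s. smooth_step (real (Suc n) * (s - t)))"
    unfolding time_cutoffs_def by blast
  then show ?thesis by blast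
qed

definition bump :: "real^3 \<Rightarrow> real" where
  "bump x = flat_exp 1 (1 - x \<bullet> x)"

lemma Ck_bump_scaled: "Ck n (\<lambda>x. bump (r *\<^sub>R x))"
proof -
  have "Ck n (\<lambda>x::real^3. 1 + (- (r * r)) * (\<Sum>b\<in>Basis. (x \<bullet> b) * (x \<bullet> b)))"
    by (rule Ck_add[OF Ck_const Ck_mult[OF Ck_const Ck_sum[OF finite_Basis Ck_mult[OF Ck_inner Ck_inner]]]])
  moreover have "1 + (- (r * r)) * (\<Sum>b\<in>Basis. (x \<bullet> b) * (x \<bullet> b)) = 1 - (r *\<^sub>R x) \<bullet> (r *\<^sub>R x)" for x :: "real^3"
    by (subst euclidean_inner[of x x, symmetric]) simp
  ultimately have "Ck n (\<lambda>x::real^3. 1 - (r *\<^sub>R x) \<bullet> (r *\<^sub>R x))" by (simp only:)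
  from Ck_compose[OF Ck_flat_exp[of n 1] this] show ?thesis
    by (simp only: bump_def)
qed

lemma bump_nonneg: "0 \<le> bump x" by (simp add: bump_def flat_exp_nonneg)

lemma bump_eq_0: "1 \<le> norm x \<Longrightarrow> bump x = 0"
  using one_le_power[of "norm x" 2] by (simp add: bump_def flat_exp_1 power2_norm_eq_inner)

lemma bump_pos: "norm x < 1 \<Longrightarrow> 0 < bump x"
  using power_strict_mono[of "norm x" 1 2] by (simp add: bump_def flat_exp_1 power2_norm_eq_inner)

lemma continuous_Ck: "Ck n f \<Longrightarrow> continuous_on UNIV f"
  by (intro continuous_at_imp_continuous_on ballI differentiable_imp_continuous_within Ck_differentiable)

section \<open>Integration over a period cell\<close>

definition full_cell :: "(real^3) set" where
  "full_cell = {x. x $ 1 \<in> {0..<2 * pi} \<and> x $ 2 \<in> {0..<2 * pi}}"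

text \<open>A density rather than a restricted measure: the space stays the whole of
  \<open>real^3\<close> and the sigma-algebra stays \<open>borel\<close>, so shifts and reflections
  act without leaving the space.\<close>

definition muC :: "(real^3) measure" where
  "muC = density lborel (indicator full_cell)"

definition reflect :: "real^3 \<Rightarrow> real^3" where
  "reflect x = (\<chi> i. if i = 3 then - x $ i else x $ i)"

definition lat :: "int \<Rightarrow> int \<Rightarrow> real^3" where
  "lat m n = (2 * pi * of_int m) *\<^sub>R axis 1 1 + (2 * pi * of_int n) *\<^sub>R axis 2 1"

text \<open>Reduction modulo the period lattice. A shift followed by \<open>wrap\<close> is a
  translation of the torus, read as a map of the cell into itself.\<close>

definition wrap :: "real^3 \<Rightarrow> real^3" where
  "wrap x = x + lat (- \<lfloor>x $ 1 / (2 * pi)\<rfloor>) (- \<lfloor>x $ 2 / (2 * pi)\<rfloor>)"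

abbreviation per :: "(real^3 \<Rightarrow> 'b) \<Rightarrow> bool" where
  "per f \<equiv> horiz_periodic_on UNIV f"

lemma borel_measurable_nth [measurable (raw)]:
  "f \<in> borel_measurable M \<Longrightarrow> (\<lambda>x. f x $ i :: real) \<in> borel_measurable M" for f :: "_ \<Rightarrow> real^'n"
  using borel_measurable_continuous_on[OF _ , of "\<lambda>v. v $ i" f M] by (simp add: continuous_on_component)

lemma borel_measurable_vec_lambda [measurable (raw)]:
  fixes f :: "'n::finite \<Rightarrow> 'a \<Rightarrow> real"
  assumes "\<And>i. f i \<in> borel_measurable M"
  shows "(\<lambda>x. \<chi> i. f i x) \<in> borel_measurable M"
proof (subst borel_measurable_euclidean_space, intro ballI)
  fix b :: "real^'n" assume "b \<in> Basis"
  then obtain i where "b = axis i 1" by (auto simp: Basis_vec_def)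
  with assms show "(\<lambda>x. (\<chi> i. f i x) \<bullet> b) \<in> borel_measurable M" by (simp add: inner_axis)
qed

lemma full_cell_measurable [measurable]: "full_cell \<in> sets borel"
  unfolding full_cell_def by measurable

lemma sets_muC [simp, measurable_cong]: "sets muC = sets borel"
  and space_muC [simp]: "space muC = UNIV"
  by (simp_all add: muC_def)

lemma nn_integral_muC:
  "f \<in> borel_measurable borel \<Longrightarrow> integral\<^sup>N muC f = (\<integral>\<^sup>+x. indicator full_cell x * f x \<partial>lborel)"
  unfolding muC_def by (subst nn_integral_density) auto

lemma integral_muC:
  fixes f :: "real^3 \<Rightarrow> 'b::{banach, second_countable_topology}"
  shows "f \<in> borel_measurable borel \<Longrightarrow> integral\<^sup>L muC f = (\<integral>x. indicator full_cell x *\<^sub>R f x \<partial>lborel)"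
  using integral_density[of f lborel "indicator full_cell"]
  by (simp add: muC_def ennreal_indicator)

interpretation muC: sigma_finite_measure muC
  unfolding muC_def
  by (subst sigma_finite_measure.sigma_finite_iff_density_finite[OF sigma_finite_lborel]) (auto simp: indicator_def)

interpretation muC_lborel: pair_sigma_finite muC lborel ..

lemma reflect_nth [simp]: "reflect x $ i = (if i = 3 then - x $ i else x $ i)"
  by (simp add: reflect_def)

lemma reflect_reflect [simp]: "reflect (reflect x) = x"
  by (simp add: vec_eq_iff)

lemma linear_reflect: "linear reflect"
  by (rule linearI) (simp_all add: vec_eq_iff)

lemma reflect_add: "reflect (x + y) = reflect x + reflect y"
  and reflect_diff: "reflect (x - y) = reflect x - reflect y"
  and reflect_scale: "reflect (c *\<^sub>R x) = c *\<^sub>R reflect x"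
  and reflect_0 [simp]: "reflect 0 = 0"
  by (simp_all add: vec_eq_iff)

lemma inner_3: "x \<bullet> y = x $ 1 * y $ 1 + x $ 2 * y $ 2 + x $ 3 * y $ 3" for x y :: "real^3"
  by (simp add: inner_vec_def sum_3)

lemma inner_reflect: "reflect x \<bullet> reflect y = x \<bullet> y"
  by (simp add: inner_3)

lemma inner_reflect_left: "reflect x \<bullet> y = x \<bullet> reflect y"
  by (simp add: inner_3)

lemma norm_reflect [simp]: "norm (reflect x) = norm x"
  by (simp add: norm_eq_sqrt_inner inner_reflect)

lemma reflect_measurable [measurable]: "reflect \<in> borel \<rightarrow>\<^sub>M borel"
  by (intro borel_measurable_continuous_onI linear_continuous_on linear_conv_bounded_linear[THEN iffD1] linear_reflect)

lemma reflect_full_cell: "reflect x \<in> full_cell \<longleftrightarrow> x \<in> full_cell"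
  by (simp add: full_cell_def)

section \<open>Translations, reflections and dilations of Lebesgue measure\<close>

lemma nn_integral_lborel_shift:
  fixes c :: "'a::euclidean_space"
  assumes [measurable]: "f \<in> borel_measurable borel"
  shows "(\<integral>\<^sup>+x. f (x + c) \<partial>lborel) = integral\<^sup>N lborel f"
proof -
  have "integral\<^sup>N lborel f = integral\<^sup>N (distr lborel borel ((+) c)) f" by (simp add: lborel_distr_plus)
  also have "\<dots> = (\<integral>\<^sup>+x. f (x + c) \<partial>lborel)" by (subst nn_integral_distr) (auto simp: add.commute)
  finally show ?thesis by simp
qed

lemma integral_lborel_shift:
  fixes c :: "'a::euclidean_space" and f :: "'a \<Rightarrow> 'b::{banach, second_countable_topology}"
  assumes [measurable]: "f \<in> borel_measurable borel"
  shows "(\<integral>x. f (x + c) \<partial>lborel) = integral\<^sup>L lborel f"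
proof -
  have "integral\<^sup>L lborel f = integral\<^sup>L (distr lborel borel ((+) c)) f" by (simp add: lborel_distr_plus)
  also have "\<dots> = (\<integral>x. f (x + c) \<partial>lborel)" by (subst integral_distr) (auto simp: add.commute)
  finally show ?thesis by simp
qed

lemma integrable_lborel_shift:
  fixes c :: "'a::euclidean_space" and f :: "'a \<Rightarrow> 'b::{banach, second_countable_topology}"
  assumes [measurable]: "f \<in> borel_measurable borel"
  shows "integrable lborel (\<lambda>x. f (x + c)) \<longleftrightarrow> integrable lborel f"
proof -
  have "integrable lborel f \<longleftrightarrow> integrable (distr lborel borel ((+) c)) f" by (simp add: lborel_distr_plus)
  also have "\<dots> \<longleftrightarrow> integrable lborel (\<lambda>x. f (x + c))"
    by (subst integrable_distr_eq) (auto simp: add.commute)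
  finally show ?thesis by simp
qed

lemma lborel_distr_neg: "distr lborel borel uminus = (lborel :: 'a::euclidean_space measure)"
  using lborel_affine[of "-1" "0::'a"] by (simp add: density_1)

lemma lborel_distr_reflect: "distr lborel borel reflect = lborel"
proof -
  let ?c = "\<lambda>j::real^3. if j = axis 3 1 then -1 else 1 :: real"
  have B: "(\<Prod>j\<in>Basis. \<bar>?c j\<bar>) = 1" by (intro prod.neutral) auto
  have "(\<Sum>j\<in>Basis. (?c j * (x \<bullet> j)) *\<^sub>R j) = reflect x" for x
  proof (rule euclidean_eqI)
    fix b :: "real^3" assume b: "b \<in> Basis"
    then obtain i where i: "b = axis i 1" by (auto simp: Basis_vec_def)
    have "(\<Sum>j\<in>Basis. (?c j * (x \<bullet> j)) *\<^sub>R j) \<bullet> b = ?c b * (x \<bullet> b)"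
      using b by (subst inner_sum_left_Basis) auto
    also have "\<dots> = reflect x \<bullet> b" by (auto simp: i inner_axis axis_eq_axis)
    finally show "(\<Sum>j\<in>Basis. (?c j * (x \<bullet> j)) *\<^sub>R j) \<bullet> b = reflect x \<bullet> b" .
  qed
  then show ?thesis
    using lborel_affine_euclidean[of ?c 0] unfolding B by (simp add: density_1)
qed

lemma nn_integral_lborel_neg:
  fixes f :: "'a::euclidean_space \<Rightarrow> ennreal"
  assumes [measurable]: "f \<in> borel_measurable borel"
  shows "(\<integral>\<^sup>+x. f (- x) \<partial>lborel) = integral\<^sup>N lborel f"
  by (subst (2) lborel_distr_neg[symmetric], subst nn_integral_distr) auto

lemma integral_lborel_neg:
  fixes f :: "'a::euclidean_space \<Rightarrow> 'b::{banach, second_countable_topology}"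
  assumes [measurable]: "f \<in> borel_measurable borel"
  shows "(\<integral>x. f (- x) \<partial>lborel) = integral\<^sup>L lborel f"
  by (subst (2) lborel_distr_neg[symmetric], subst integral_distr) auto

lemma integrable_lborel_neg:
  fixes f :: "'a::euclidean_space \<Rightarrow> 'b::{banach, second_countable_topology}"
  assumes [measurable]: "f \<in> borel_measurable borel"
  shows "integrable lborel (\<lambda>x. f (- x)) \<longleftrightarrow> integrable lborel f"
  by (subst (2) lborel_distr_neg[symmetric], subst integrable_distr_eq) auto

lemma nn_integral_lborel_reflect:
  assumes [measurable]: "f \<in> borel_measurable borel"
  shows "(\<integral>\<^sup>+x. f (reflect x) \<partial>lborel) = integral\<^sup>N lborel f"
  by (subst (2) lborel_distr_reflect[symmetric], subst nn_integral_distr) auto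

lemma integral_lborel_reflect:
  fixes f :: "real^3 \<Rightarrow> 'b::{banach, second_countable_topology}"
  assumes [measurable]: "f \<in> borel_measurable borel"
  shows "(\<integral>x. f (reflect x) \<partial>lborel) = integral\<^sup>L lborel f"
  by (subst (2) lborel_distr_reflect[symmetric], subst integral_distr) auto

lemma nn_integral_lborel_scale:
  fixes f :: "real^3 \<Rightarrow> ennreal"
  assumes [measurable]: "f \<in> borel_measurable borel" and r: "0 < r"
  shows "(\<integral>\<^sup>+x. f (x /\<^sub>R r) \<partial>lborel) = ennreal (r ^ 3) * integral\<^sup>N lborel f"
proof -
  have "(\<integral>\<^sup>+x. f (x /\<^sub>R r) \<partial>lborel) = (\<integral>\<^sup>+x. f (x /\<^sub>R r) \<partial>density (distr lborel borel (\<lambda>x. 0 + r *\<^sub>R x)) (\<lambda>_. \<bar>r\<bar>^DIM(real^3)))"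
    using r by (subst lborel_affine[of r 0]) auto
  also have "\<dots> = (\<integral>\<^sup>+x. ennreal (r ^ 3) * f x \<partial>lborel)"
    using r by (simp add: nn_integral_density nn_integral_distr)
  also have "\<dots> = ennreal (r ^ 3) * integral\<^sup>N lborel f" by (subst nn_integral_cmult) auto
  finally show ?thesis .
qed

lemma integral_lborel_scale:
  fixes f :: "real^3 \<Rightarrow> real"
  assumes [measurable]: "f \<in> borel_measurable borel" and r: "0 < r"
  shows "(\<integral>x. f (x /\<^sub>R r) \<partial>lborel) = r ^ 3 * integral\<^sup>L lborel f"
proof -
  have "(\<integral>x. f (x /\<^sub>R r) \<partial>lborel) = (\<integral>x. f (x /\<^sub>R r) \<partial>density (distr lborel borel (\<lambda>x. 0 + r *\<^sub>R x)) (\<lambda>_. \<bar>r\<bar>^DIM(real^3)))"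
    using r by (subst lborel_affine[of r 0]) auto
  also have "\<dots> = (\<integral>x. (r ^ 3) * f x \<partial>lborel)"
    using r by (simp add: integral_density integral_distr)
  finally show ?thesis by simp
qed

section \<open>The period lattice and translations of the torus\<close>

lemma lat_nth [simp]: "lat m n $ 1 = 2 * pi * of_int m" "lat m n $ 2 = 2 * pi * of_int n" "lat m n $ 3 = 0"
  by (simp_all add: lat_def axis_def)

lemma lat_minus: "lat (- m) (- n) = - lat m n"
  by (simp add: lat_def)

lemma period_int:
  fixes v :: "'a::real_vector"
  assumes "\<And>x. f (x + v) = f x" shows "f (x + of_int m *\<^sub>R v) = f x"
proof (induction m arbitrary: x rule: int_induct[where k = 0])
  case (step1 i)
  have "f (x + of_int (i + 1) *\<^sub>R v) = f ((x + of_int i *\<^sub>R v) + v)" by (simp add: algebra_simps)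
  with step1 assms show ?case by simp
next
  case (step2 i)
  have "f (x + of_int (i - 1) *\<^sub>R v) = f ((x + of_int (i - 1) *\<^sub>R v) + v)" using assms by simp
  also have "\<dots> = f (x + of_int i *\<^sub>R v)" by (simp add: algebra_simps)
  finally show ?case using step2 by simp
qed simp

lemma per_lat: "per f \<Longrightarrow> f (x + lat m n) = f x"
proof -
  assume p: "per f"
  have 1: "f (x + of_int m *\<^sub>R ((2 * pi) *\<^sub>R axis 1 1)) = f x" for x m
    by (rule period_int) (use p in \<open>simp add: horiz_periodic_on_def\<close>)
  have 2: "f (x + of_int m *\<^sub>R ((2 * pi) *\<^sub>R axis 2 1)) = f x" for x m
    by (rule period_int) (use p in \<open>simp add: horiz_periodic_on_def\<close>)
  have "f (x + lat m n) = f ((x + of_int m *\<^sub>R ((2 * pi) *\<^sub>R axis 1 1)) + of_int n *\<^sub>R ((2 * pi) *\<^sub>R axis 2 1))"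
    by (simp add: lat_def algebra_simps)
  then show ?thesis by (simp only: 1 2)
qed

lemma perI_lat: "(\<And>m n x. f (x + lat m n) = f x) \<Longrightarrow> per f"
proof -
  assume "\<And>m n x. f (x + lat m n) = f x"
  from this[of _ 1 0] this[of _ 0 1] show ?thesis by (simp add: horiz_periodic_on_def lat_def)
qed

lemma per_compose: "per f \<Longrightarrow> per (\<lambda>x. g (f x))"
  by (simp add: horiz_periodic_on_def)

lemma per_shift:
  assumes "per f" shows "per (\<lambda>x. f (x + y))"
proof -
  have "f (x + v + y) = f ((x + y) + v)" for x v :: "real^3"
    by (rule arg_cong[of _ _ f]) (simp add: add.assoc add.commute[of v])
  with assms show ?thesis by (simp only: horiz_periodic_on_def ball_UNIV simp_thms)
qed

lemma per_shift_diff: "per f \<Longrightarrow> per (\<lambda>x. f (x - y))"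
  using per_shift[of f "- y"] by simp

lemma per_wrap: "per f \<Longrightarrow> f (wrap x) = f x"
  by (simp add: wrap_def per_lat)

lemma floor_2pi: "(0 \<le> x - 2 * pi * of_int m \<and> x - 2 * pi * of_int m < 2 * pi) \<longleftrightarrow> m = \<lfloor>x / (2 * pi)\<rfloor>"
proof -
  have "(0 \<le> x - 2 * pi * of_int m \<and> x - 2 * pi * of_int m < 2 * pi)
    \<longleftrightarrow> (of_int m \<le> x / (2 * pi) \<and> x / (2 * pi) < of_int m + 1)"
    by (simp add: field_simps)
  also have "\<dots> \<longleftrightarrow> m = \<lfloor>x / (2 * pi)\<rfloor>" by (auto simp: floor_eq_iff intro: sym)
  finally show ?thesis .
qed

lemma lat_full_cell:
  "x + lat m n \<in> full_cell \<longleftrightarrow> m = - \<lfloor>x $ 1 / (2 * pi)\<rfloor> \<and> n = - \<lfloor>x $ 2 / (2 * pi)\<rfloor>"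
  using floor_2pi[of "x $ 1" "- m"] floor_2pi[of "x $ 2" "- n"] by (auto simp: full_cell_def)

lemma wrap_full_cell: "wrap x \<in> full_cell"
  by (simp add: wrap_def lat_full_cell)

lemma wrap_eq: "x \<in> full_cell \<Longrightarrow> wrap x = x"
  using lat_full_cell[of x 0 0] by (simp add: wrap_def) (simp add: lat_def)

lemma per_wrap_self: "per wrap"
proof (rule perI_lat)
  fix m n x
  have "wrap (x + lat m n) = (x + lat m n) + lat (- (m + \<lfloor>x $ 1 / (2 * pi)\<rfloor>)) (- (n + \<lfloor>x $ 2 / (2 * pi)\<rfloor>))"
    by (simp add: wrap_def add_divide_distrib add.commute)
  also have "\<dots> = wrap x" by (simp add: wrap_def lat_def algebra_simps)
  finally show "wrap (x + lat m n) = wrap x" .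
qed

lemma wrap_nth_3 [simp]: "wrap x $ 3 = x $ 3" by (simp add: wrap_def)

lemma wrap_measurable [measurable]: "wrap \<in> borel \<rightarrow>\<^sub>M borel"
proof -
  have "wrap x = (\<chi> i. if i = 3 then x $ 3 else x $ i - 2 * pi * of_int \<lfloor>x $ i / (2 * pi)\<rfloor>)" for x
    by (auto simp: vec_eq_iff forall_3 wrap_def)
  moreover have "(\<lambda>x::real^3. if i = 3 then x $ 3 else x $ i - 2 * pi * of_int \<lfloor>x $ i / (2 * pi)\<rfloor>) \<in> borel_measurable borel" for i
    by measurable
  ultimately show ?thesis by (subst measurable_cong[of _ _ "\<lambda>x. \<chi> i. if i = 3 then x $ 3 else x $ i - 2 * pi * of_int \<lfloor>x $ i / (2 * pi)\<rfloor>"])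
      (auto intro!: borel_measurable_vec_lambda)
qed

text \<open>Exactly one lattice translate of a point lies in the cell. The tiling is written as an
  integral over the counting measure so that it can be exchanged with Lebesgue integrals by
  Tonelli.\<close>

lemma tile_sum: "(\<integral>\<^sup>+z. indicator full_cell (x + lat (fst z) (snd z)) \<partial>count_space UNIV) = 1"
proof -
  let ?z = "(- \<lfloor>x $ 1 / (2 * pi)\<rfloor>, - \<lfloor>x $ 2 / (2 * pi)\<rfloor>)"
  have "indicator full_cell (x + lat (fst z) (snd z)) = (indicator {?z} z :: ennreal)" for z
    using lat_full_cell[of x "fst z" "snd z"] by (cases z) (auto simp: indicator_def)
  then show ?thesis by simp
qed

text \<open>The shifted cell is cut into its intersections with the lattice translates of the cell.
  The tiling identity is inserted as a factor 1, each piece is moved back by its lattice vector,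
  which \<open>h\<close> does not notice, and the pieces are reassembled by the same
  identity.\<close>

lemma nn_integral_muC_shift:
  assumes p: "per h" and [measurable]: "h \<in> borel_measurable borel"
  shows "(\<integral>\<^sup>+x. h (x + y) \<partial>muC) = integral\<^sup>N muC h"
proof -
  let ?I = "\<lambda>x. indicator full_cell x :: ennreal"
  let ?l = "\<lambda>z::int \<times> int. lat (fst z) (snd z)"
  have "(\<integral>\<^sup>+x. h (x + y) \<partial>muC) = (\<integral>\<^sup>+x. ?I x * h (x + y) \<partial>lborel)"
    by (subst nn_integral_muC) auto
  also have "\<dots> = (\<integral>\<^sup>+x. ?I (x - y) * h x \<partial>lborel)"
    using nn_integral_lborel_shift[of "\<lambda>x. ?I (x - y) * h x" y] by simp
  also have "\<dots> = (\<integral>\<^sup>+x. \<integral>\<^sup>+z. ?I (x + ?l z) * (?I (x - y) * h x) \<partial>count_space UNIV \<partial>lborel)"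
    by (subst nn_integral_multc) (auto simp: tile_sum)
  also have "\<dots> = (\<integral>\<^sup>+z. \<integral>\<^sup>+x. ?I (x + ?l z) * (?I (x - y) * h x) \<partial>lborel \<partial>count_space UNIV)"
    by (subst nn_integral_count_space_nn_integral) auto
  also have "\<dots> = (\<integral>\<^sup>+z. \<integral>\<^sup>+x. ?I x * h x * ?I (x - y - ?l z) \<partial>lborel \<partial>count_space UNIV)"
  proof (rule nn_integral_cong)
    fix z
    have "h (x - ?l z) = h x" for x
      using per_lat[OF p, of x "- fst z" "- snd z"] by (simp add: lat_minus)
    then show "(\<integral>\<^sup>+x. ?I (x + ?l z) * (?I (x - y) * h x) \<partial>lborel) = (\<integral>\<^sup>+x. ?I x * h x * ?I (x - y - ?l z) \<partial>lborel)"
      using nn_integral_lborel_shift[of "\<lambda>x. ?I x * (?I (x - ?l z - y) * h (x - ?l z))" "?l z"]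
      by (simp add: ac_simps diff_diff_eq)
  qed
  also have "\<dots> = (\<integral>\<^sup>+x. \<integral>\<^sup>+z. ?I x * h x * ?I (x - y - ?l z) \<partial>count_space UNIV \<partial>lborel)"
    by (subst nn_integral_count_space_nn_integral) auto
  also have "\<dots> = (\<integral>\<^sup>+x. ?I x * h x \<partial>lborel)"
  proof (rule nn_integral_cong)
    fix x
    have "(\<integral>\<^sup>+z. ?I (x - y - ?l z) \<partial>count_space UNIV) = (\<integral>\<^sup>+z. ?I (x - y + ?l z) \<partial>count_space UNIV)"
    proof -
      have b: "bij_betw (\<lambda>z. (- fst z, - snd z) :: int \<times> int) UNIV UNIV"
        by (rule bij_betw_byWitness[where f' = "\<lambda>z. (- fst z, - snd z)"]) auto
      show ?thesis
        using nn_integral_bij_count_space[OF b, of "\<lambda>z. ?I (x - y + ?l z)"] by (simp add: lat_minus)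
    qed
    then show "(\<integral>\<^sup>+z. ?I x * h x * ?I (x - y - ?l z) \<partial>count_space UNIV) = ?I x * h x"
      by (subst nn_integral_cmult) (auto simp: tile_sum)
  qed
  also have "\<dots> = integral\<^sup>N muC h" by (subst nn_integral_muC) auto
  finally show ?thesis .
qed

text \<open>Invariance as an equality of measures carries over to Bochner integrals and to
  integrability without repeating the tiling.\<close>

lemma distr_muC_wrap: "distr muC borel (\<lambda>x. wrap (x + y)) = muC"
proof (rule measure_eqI)
  fix A assume "A \<in> sets (distr muC borel (\<lambda>x. wrap (x + y)))"
  then have A [measurable]: "A \<in> sets borel" by simp
  have "emeasure (distr muC borel (\<lambda>x. wrap (x + y))) A = (\<integral>\<^sup>+x. indicator A (wrap (x + y)) \<partial>muC)"
    by (subst nn_integral_indicator[symmetric], simp, subst nn_integral_distr) auto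
  also have "\<dots> = (\<integral>\<^sup>+x. indicator A (wrap x) \<partial>muC)"
    by (rule nn_integral_muC_shift) (auto intro: per_compose per_wrap_self)
  also have "\<dots> = (\<integral>\<^sup>+x. indicator A x \<partial>muC)"
    by (subst (1 2) nn_integral_muC) (auto intro!: nn_integral_cong simp: indicator_def wrap_eq)
  finally show "emeasure (distr muC borel (\<lambda>x. wrap (x + y))) A = emeasure muC A" by simp
qed simp

lemma integral_muC_shift:
  fixes h :: "real^3 \<Rightarrow> 'b::{banach, second_countable_topology}"
  assumes p: "per h" and [measurable]: "h \<in> borel_measurable borel"
  shows "(\<integral>x. h (x + y) \<partial>muC) = integral\<^sup>L muC h"
    and "integrable muC (\<lambda>x. h (x + y)) \<longleftrightarrow> integrable muC h"
proof -
  have w: "h (wrap x) = h x" for x using p by (rule per_wrap)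
  have "integral\<^sup>L muC h = integral\<^sup>L (distr muC borel (\<lambda>x. wrap (x + y))) h"
    by (simp add: distr_muC_wrap)
  also have "\<dots> = (\<integral>x. h (x + y) \<partial>muC)" by (subst integral_distr) (auto simp: w)
  finally show "(\<integral>x. h (x + y) \<partial>muC) = integral\<^sup>L muC h" by simp
  have "integrable muC h \<longleftrightarrow> integrable (distr muC borel (\<lambda>x. wrap (x + y))) h"
    by (simp add: distr_muC_wrap)
  also have "\<dots> \<longleftrightarrow> integrable muC (\<lambda>x. h (x + y))" by (subst integrable_distr_eq) (auto simp: w)
  finally show "integrable muC (\<lambda>x. h (x + y)) \<longleftrightarrow> integrable muC h" by simp
qed

lemma nn_integral_muC_reflect:
  assumes [measurable]: "h \<in> borel_measurable borel"
  shows "(\<integral>\<^sup>+x. h (reflect x) \<partial>muC) = integral\<^sup>N muC h"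
  using nn_integral_lborel_reflect[of "\<lambda>x. indicator full_cell x * h x"]
  by (simp add: nn_integral_muC reflect_full_cell indicator_def)

lemma distr_muC_reflect: "distr muC borel reflect = muC"
proof (rule measure_eqI)
  fix A assume "A \<in> sets (distr muC borel reflect)"
  then have A [measurable]: "A \<in> sets borel" by simp
  have "emeasure (distr muC borel reflect) A = (\<integral>\<^sup>+x. indicator A (reflect x) \<partial>muC)"
    by (subst nn_integral_indicator[symmetric], simp, subst nn_integral_distr) auto
  also have "\<dots> = (\<integral>\<^sup>+x. indicator A x \<partial>muC)" by (rule nn_integral_muC_reflect) auto
  finally show "emeasure (distr muC borel reflect) A = emeasure muC A" by simp
qed simp

lemma integral_muC_reflect:
  fixes h :: "real^3 \<Rightarrow> 'b::{banach, second_countable_topology}"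
  assumes [measurable]: "h \<in> borel_measurable borel"
  shows "(\<integral>x. h (reflect x) \<partial>muC) = integral\<^sup>L muC h"
    and "integrable muC (\<lambda>x. h (reflect x)) \<longleftrightarrow> integrable muC h"
proof -
  have "integral\<^sup>L (distr muC borel reflect) h = (\<integral>x. h (reflect x) \<partial>muC)" by (subst integral_distr) auto
  then show "(\<integral>x. h (reflect x) \<partial>muC) = integral\<^sup>L muC h" by (simp add: distr_muC_reflect)
  have "integrable (distr muC borel reflect) h \<longleftrightarrow> integrable muC (\<lambda>x. h (reflect x))"
    by (subst integrable_distr_eq) auto
  then show "integrable muC (\<lambda>x. h (reflect x)) \<longleftrightarrow> integrable muC h" by (simp add: distr_muC_reflect)
qed

section \<open>Localisation of compactly supported integrals in one cell\<close>

definition corner :: "real^3 \<Rightarrow> real^3" where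
  "corner x = (\<chi> i. if i = 3 then 0 else pi) - x"

text \<open>The shift by \<open>corner x\<close> moves \<open>x\<close> to the horizontal centre of
  the cell. Since \<open>3 < pi\<close>, the ball of radius 3 fits, so a kernel supported there
  meets no point and its translate at once.\<close>

lemma cball_full_cell: "z \<in> cball x 3 \<Longrightarrow> z + corner x \<in> full_cell"
proof -
  assume "z \<in> cball x 3"
  then have "norm (z - x) \<le> 3" by (simp add: dist_norm norm_minus_commute)
  then have "\<bar>(z - x) $ 1\<bar> \<le> 3" "\<bar>(z - x) $ 2\<bar> \<le> 3"
    by (meson component_le_norm_cart order_trans)+
  then show ?thesis using pi_gt3 by (auto simp: full_cell_def corner_def abs_le_iff)
qed

lemma nn_integral_cball_le:
  assumes p: "per h" and [measurable]: "h \<in> borel_measurable borel"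
  shows "(\<integral>\<^sup>+z. indicator (cball x 3) z * h z \<partial>lborel) \<le> integral\<^sup>N muC h"
proof -
  have "(\<integral>\<^sup>+z. indicator (cball x 3) z * h z \<partial>lborel)
      \<le> (\<integral>\<^sup>+z. indicator full_cell (z + corner x) * h z \<partial>lborel)"
    by (intro nn_integral_mono mult_right_mono) (auto simp: indicator_def cball_full_cell)
  also have "\<dots> = (\<integral>\<^sup>+z. indicator full_cell z * h (z - corner x) \<partial>lborel)"
    using nn_integral_lborel_shift[of "\<lambda>z. indicator full_cell z * h (z - corner x)" "corner x"] by simp
  also have "\<dots> = (\<integral>\<^sup>+z. h (z - corner x) \<partial>muC)" by (subst nn_integral_muC) auto
  also have "\<dots> = integral\<^sup>N muC h"
    using nn_integral_muC_shift[OF p, of "- corner x"] by simp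
  finally show ?thesis .
qed

text \<open>The field paired with \<open>U\<close> on the right is the periodisation of
  \<open>\<psi>\<close>. It is an admissible field for weak continuity, which the compactly
  supported \<open>\<psi>\<close> itself is not.\<close>

lemma integral_local_eq_muC:
  fixes \<psi> U :: "real^3 \<Rightarrow> real^3"
  assumes [measurable]: "\<psi> \<in> borel_measurable borel" "U \<in> borel_measurable borel"
    and p: "per U" and z: "\<And>z. z \<notin> cball x 3 \<Longrightarrow> \<psi> z = 0"
  shows "(\<integral>z. \<psi> z \<bullet> U z \<partial>lborel) = (\<integral>z. \<psi> (wrap (z + corner x) - corner x) \<bullet> U z \<partial>muC)"
proof -
  let ?y = "corner x"
  have "(\<integral>z. \<psi> z \<bullet> U z \<partial>lborel) = (\<integral>z. indicator full_cell (z + ?y) *\<^sub>R (\<psi> z \<bullet> U z) \<partial>lborel)"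
  proof (rule Bochner_Integration.integral_cong[OF refl])
    fix w
    show "\<psi> w \<bullet> U w = indicator full_cell (w + ?y) *\<^sub>R (\<psi> w \<bullet> U w)"
      using z[of w] cball_full_cell[of w x] by (cases "w \<in> cball x 3") (auto simp: indicator_def)
  qed
  also have "\<dots> = (\<integral>z. indicator full_cell z *\<^sub>R (\<psi> (z - ?y) \<bullet> U (z - ?y)) \<partial>lborel)"
    using integral_lborel_shift[of "\<lambda>z. indicator full_cell z *\<^sub>R (\<psi> (z - ?y) \<bullet> U (z - ?y))" ?y] by simp
  also have "\<dots> = (\<integral>z. indicator full_cell z *\<^sub>R (\<psi> (wrap z - ?y) \<bullet> U (z - ?y)) \<partial>lborel)"
    by (rule Bochner_Integration.integral_cong) (auto simp: indicator_def wrap_eq)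
  also have "\<dots> = (\<integral>z. \<psi> (wrap z - ?y) \<bullet> U (z - ?y) \<partial>muC)"
    by (subst integral_muC) auto
  also have "\<dots> = (\<integral>z. \<psi> (wrap (z + ?y) - ?y) \<bullet> U z \<partial>muC)"
  proof -
    have "per (\<lambda>z. \<psi> (wrap (z + ?y) - ?y) \<bullet> U z)"
      using p per_shift[OF per_wrap_self, of ?y] by (simp add: horiz_periodic_on_def)
    from integral_muC_shift(1)[OF this, of "- ?y"] show ?thesis by simp
  qed
  finally show ?thesis .
qed

lemma emeasure_slab:
  assumes "a \<le> b"
  shows "emeasure muC {x. a \<le> x $ 3 \<and> x $ 3 \<le> b} \<le> ennreal ((2 * pi)\<^sup>2 * (b - a))"
proof -
  let ?l = "(\<chi> i. if i = 3 then a else 0) :: real^3" and ?u = "(\<chi> i. if i = 3 then b else 2 * pi) :: real^3"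
  have [measurable]: "{x::real^3. a \<le> x $ 3 \<and> x $ 3 \<le> b} \<in> sets borel" by measurable
  have "emeasure muC {x. a \<le> x $ 3 \<and> x $ 3 \<le> b} = emeasure lborel (full_cell \<inter> {x. a \<le> x $ 3 \<and> x $ 3 \<le> b})"
    unfolding muC_def by (subst emeasure_density) (auto simp: indicator_inter_arith[symmetric] intro!: nn_integral_indicator)
  also have "\<dots> \<le> emeasure lborel (cbox ?l ?u)"
    by (rule emeasure_mono) (auto simp: full_cell_def mem_box_cart forall_3)
  also have "\<dots> = ennreal (measure lborel (cbox ?l ?u))"
    by (rule emeasure_eq_ennreal_measure) (metis emeasure_lborel_cbox_finite less_irrefl infinity_ennreal_def)
  also have "measure lborel (cbox ?l ?u) = (2 * pi)\<^sup>2 * (b - a)"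
  proof -
    have P: "(\<Prod>i\<in>UNIV. f i) = f 1 * f 2 * f 3" for f :: "3 \<Rightarrow> real"
      unfolding UNIV_3 by (simp add: ac_simps)
    show ?thesis
      using assms by (subst content_cbox_cart) (auto simp: P power2_eq_square interval_eq_empty_cart)
  qed
  finally show ?thesis .
qed

text \<open>Comparison with the slabs \<open>k <= |x3| <= k + 1\<close>, whose measures are bounded
  independently of \<open>k\<close>, weighted by the summable \<open>1 / (k + 1)^2\<close>. This is
  the reference weight for fields that decay away from the boundary.\<close>

lemma nn_integral_decay_finite: "(\<integral>\<^sup>+x. ennreal (1 / (1 + \<bar>x $ 3\<bar>)\<^sup>2) \<partial>muC) < \<infinity>"
proof -
  let ?S = "\<lambda>k. {x::real^3. real k \<le> x $ 3 \<and> x $ 3 \<le> real k + 1} \<union> {x. - (real k + 1) \<le> x $ 3 \<and> x $ 3 \<le> - real k}"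
  let ?c = "\<lambda>k. 1 / (real (Suc k))\<^sup>2"
  have [measurable]: "?S k \<in> sets borel" for k by measurable
  have "(\<integral>\<^sup>+x. ennreal (1 / (1 + \<bar>x $ 3\<bar>)\<^sup>2) \<partial>muC) \<le> (\<integral>\<^sup>+x. (\<Sum>k. ennreal (?c k) * indicator (?S k) x) \<partial>muC)"
  proof (rule nn_integral_mono)
    fix x :: "real^3"
    let ?k = "nat \<lfloor>\<bar>x $ 3\<bar>\<rfloor>"
    have k: "real ?k \<le> \<bar>x $ 3\<bar>" "\<bar>x $ 3\<bar> \<le> real ?k + 1" by linarith+
    have S: "x \<in> ?S ?k"
    proof (cases "0 \<le> x $ 3")
      case True then show ?thesis using k by simp
    next
      case False
      then have "\<bar>x $ 3\<bar> = - x $ 3" by simp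
      with k show ?thesis by (simp del: abs_of_neg) linarith
    qed
    have "ennreal (1 / (1 + \<bar>x $ 3\<bar>)\<^sup>2) \<le> ennreal (?c ?k)"
    proof (intro ennreal_leI frac_le power_mono)
      show "real (Suc ?k) \<le> 1 + \<bar>x $ 3\<bar>" using k(1) by simp
      show "0 < (real (Suc ?k))\<^sup>2" by (intro zero_less_power) (simp only: of_nat_0_less_iff zero_less_Suc)
    qed (auto simp del: of_nat_nat)
    also have "\<dots> = (\<Sum>k\<in>{?k}. ennreal (?c k) * indicator (?S k) x)" using S by simp
    also have "\<dots> \<le> (\<Sum>k. ennreal (?c k) * indicator (?S k) x)"
      by (rule sum_le_suminf) auto
    finally show "ennreal (1 / (1 + \<bar>x $ 3\<bar>)\<^sup>2) \<le> (\<Sum>k. ennreal (?c k) * indicator (?S k) x)" .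
  qed
  also have "\<dots> = (\<Sum>k. ennreal (?c k) * emeasure muC (?S k))"
    by (subst nn_integral_suminf) (auto simp: nn_integral_cmult_indicator)
  also have "\<dots> \<le> (\<Sum>k. ennreal (?c k * (2 * (2 * pi)\<^sup>2)))"
  proof (intro suminf_le summableI)
    fix k
    have "emeasure muC (?S k) \<le> emeasure muC {x. real k \<le> x $ 3 \<and> x $ 3 \<le> real k + 1}
        + emeasure muC {x. - (real k + 1) \<le> x $ 3 \<and> x $ 3 \<le> - real k}"
      by (rule emeasure_subadditive) auto
    also have "\<dots> \<le> ennreal ((2 * pi)\<^sup>2 * 1) + ennreal ((2 * pi)\<^sup>2 * 1)"
      using emeasure_slab[of "real k" "real k + 1"] emeasure_slab[of "- (real k + 1)" "- real k"]
      by (intro add_mono) auto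
    also have "\<dots> = ennreal (2 * (2 * pi)\<^sup>2)" by (subst ennreal_plus[symmetric]) auto
    finally show "ennreal (?c k) * emeasure muC (?S k) \<le> ennreal (?c k * (2 * (2 * pi)\<^sup>2))"
      by (subst ennreal_mult) (auto intro: mult_left_mono)
  qed
  also have "\<dots> < \<infinity>"
  proof -
    have "summable (\<lambda>k. ?c k * (2 * (2 * pi)\<^sup>2))"
      using inverse_squares_sums by (intro summable_mult2) (auto simp: sums_iff)
    then show ?thesis by (subst suminf_ennreal2) auto
  qed
  finally show ?thesis .
qed

section \<open>Square integrable periodic fields\<close>

text \<open>Genuine periodic Borel functions, not classes, so that point values, shifts and
  convolutions can be used directly; \<open>nrm\<close> is accordingly only a seminorm.\<close>

definition Lsp :: "(real^3 \<Rightarrow> real^3) set" where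
  "Lsp = {f. per f \<and> f \<in> borel_measurable borel \<and> integrable muC (\<lambda>x. (norm (f x))\<^sup>2)}"

definition nrm :: "(real^3 \<Rightarrow> real^3) \<Rightarrow> real" where
  "nrm f = sqrt (\<integral>x. (norm (f x))\<^sup>2 \<partial>muC)"

lemma LspD:
  assumes "f \<in> Lsp"
  shows "per f" "f \<in> borel_measurable borel" "integrable muC (\<lambda>x. (norm (f x))\<^sup>2)"
  using assms by (auto simp: Lsp_def)

lemma nrm_nonneg [simp]: "0 \<le> nrm f" by (simp add: nrm_def)

lemma nrm_square: "(nrm f)\<^sup>2 = (\<integral>x. (norm (f x))\<^sup>2 \<partial>muC)"
  by (simp add: nrm_def)

lemma nn_integral_nrm:
  assumes "f \<in> Lsp" shows "(\<integral>\<^sup>+x. ennreal ((norm (f x))\<^sup>2) \<partial>muC) = ennreal ((nrm f)\<^sup>2)"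
  using LspD[OF assms] by (simp add: nn_integral_eq_integral nrm_square)

lemma LspI:
  assumes "per f" "f \<in> borel_measurable borel" "(\<integral>\<^sup>+x. ennreal ((norm (f x))\<^sup>2) \<partial>muC) < \<infinity>"
  shows "f \<in> Lsp"
  using assms by (auto simp: Lsp_def integrable_iff_bounded)

lemma nrm_le:
  assumes "f \<in> Lsp" "0 \<le> c" "(\<integral>\<^sup>+x. ennreal ((norm (f x))\<^sup>2) \<partial>muC) \<le> ennreal (c\<^sup>2)"
  shows "nrm f \<le> c"
proof -
  have "(nrm f)\<^sup>2 \<le> c\<^sup>2" using assms(3) nn_integral_nrm[OF assms(1)] by simp
  then show ?thesis using assms(2) by (rule power2_le_imp_le)
qed

lemma Lsp_add:
  assumes "f \<in> Lsp" "g \<in> Lsp" shows "(\<lambda>x. f x + g x) \<in> Lsp"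
proof -
  note [measurable] = LspD(2)[OF assms(1)] LspD(2)[OF assms(2)]
  have "integrable muC (\<lambda>x. 2 * (norm (f x))\<^sup>2 + 2 * (norm (g x))\<^sup>2)"
    using LspD(3)[OF assms(1)] LspD(3)[OF assms(2)] by simp
  then have "integrable muC (\<lambda>x. (norm (f x + g x))\<^sup>2)"
  proof (rule Bochner_Integration.integrable_bound)
    have "(norm (f x + g x))\<^sup>2 \<le> 2 * (norm (f x))\<^sup>2 + 2 * (norm (g x))\<^sup>2" for x
    proof -
      have "(norm (f x + g x))\<^sup>2 \<le> (norm (f x) + norm (g x))\<^sup>2" by (simp add: norm_triangle_ineq power_mono)
      also have "\<dots> \<le> 2 * (norm (f x))\<^sup>2 + 2 * (norm (g x))\<^sup>2"
        using zero_le_power2[of "norm (f x) - norm (g x)"] by (simp add: power2_sum power2_diff)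
      finally show ?thesis .
    qed
    then show "AE x in muC. norm ((norm (f x + g x))\<^sup>2) \<le> norm (2 * (norm (f x))\<^sup>2 + 2 * (norm (g x))\<^sup>2)"
      by (auto intro!: AE_I2)
  qed measurable
  with LspD(1)[OF assms(1)] LspD(1)[OF assms(2)] show ?thesis
    by (simp add: Lsp_def horiz_periodic_on_def)
qed

lemma Lsp_scale: "f \<in> Lsp \<Longrightarrow> (\<lambda>x. c *\<^sub>R f x) \<in> Lsp"
  by (auto simp: Lsp_def horiz_periodic_on_def power_mult_distrib)

lemma Lsp_diff: "f \<in> Lsp \<Longrightarrow> g \<in> Lsp \<Longrightarrow> (\<lambda>x. f x - g x) \<in> Lsp"
  using Lsp_add[of f "\<lambda>x. (-1) *\<^sub>R g x"] Lsp_scale[of g "-1"] by simp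

lemma Lsp_0: "(\<lambda>x. 0) \<in> Lsp"
  by (simp add: Lsp_def horiz_periodic_on_def)

lemma nrm_scale: "nrm (\<lambda>x. c *\<^sub>R f x) = \<bar>c\<bar> * nrm f"
  by (simp add: nrm_def power_mult_distrib real_sqrt_mult)

lemma nrm_minus_commute: "nrm (\<lambda>x. f x - g x) = nrm (\<lambda>x. g x - f x)"
  by (simp add: nrm_def norm_minus_commute)

lemma Lsp_integrable_norm_mult:
  assumes "f \<in> Lsp" "g \<in> Lsp" shows "integrable muC (\<lambda>x. norm (f x) * norm (g x))"
proof -
  note [measurable] = LspD(2)[OF assms(1)] LspD(2)[OF assms(2)]
  have "integrable muC (\<lambda>x. (norm (f x))\<^sup>2 + (norm (g x))\<^sup>2)"
    using LspD(3)[OF assms(1)] LspD(3)[OF assms(2)] by simp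
  then show ?thesis
  proof (rule Bochner_Integration.integrable_bound)
    have "norm (f x) * norm (g x) \<le> (norm (f x))\<^sup>2 + (norm (g x))\<^sup>2" for x
    proof -
      have "0 \<le> norm (f x) * norm (g x)" "0 \<le> (norm (f x) - norm (g x))\<^sup>2" by simp_all
      then show ?thesis unfolding power2_diff by linarith
    qed
    then show "AE x in muC. norm (norm (f x) * norm (g x)) \<le> norm ((norm (f x))\<^sup>2 + (norm (g x))\<^sup>2)"
      by (auto intro!: AE_I2)
  qed measurable
qed

lemma Lsp_integral_norm_mult:
  assumes "f \<in> Lsp" "g \<in> Lsp" shows "(\<integral>x. norm (f x) * norm (g x) \<partial>muC) \<le> nrm f * nrm g"
proof -
  note [measurable] = LspD(2)[OF assms(1)] LspD(2)[OF assms(2)]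
  let ?I = "\<integral>x. norm (f x) * norm (g x) \<partial>muC"
  have "(\<integral>\<^sup>+x. ennreal (norm (f x)) * ennreal (norm (g x)) \<partial>muC)\<^sup>2
     \<le> (\<integral>\<^sup>+x. ennreal (norm (f x)) ^ 2 \<partial>muC) * (\<integral>\<^sup>+x. ennreal (norm (g x)) ^ 2 \<partial>muC)"
    by (rule Cauchy_Schwarz_nn_integral) auto
  then have "(ennreal ?I)\<^sup>2 \<le> ennreal ((nrm f)\<^sup>2) * ennreal ((nrm g)\<^sup>2)"
    using nn_integral_nrm[OF assms(1)] nn_integral_nrm[OF assms(2)]
      nn_integral_eq_integral[OF Lsp_integrable_norm_mult[OF assms]]
    by (simp add: ennreal_mult ennreal_power)
  then have "ennreal (?I\<^sup>2) \<le> ennreal ((nrm f * nrm g)\<^sup>2)"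
    by (simp add: ennreal_power ennreal_mult[symmetric] power_mult_distrib)
  then have "?I\<^sup>2 \<le> (nrm f * nrm g)\<^sup>2" by simp
  then show ?thesis by (rule power2_le_imp_le) simp
qed

lemma Lsp_integrable_inner:
  assumes "f \<in> Lsp" "g \<in> Lsp" shows "integrable muC (\<lambda>x. f x \<bullet> g x)"
proof -
  note [measurable] = LspD(2)[OF assms(1)] LspD(2)[OF assms(2)]
  show ?thesis
    by (rule Bochner_Integration.integrable_bound[OF Lsp_integrable_norm_mult[OF assms]])
       (auto intro!: AE_I2 Cauchy_Schwarz_ineq2)
qed

lemma Lsp_Cauchy_Schwarz:
  assumes "f \<in> Lsp" "g \<in> Lsp" shows "\<bar>\<integral>x. f x \<bullet> g x \<partial>muC\<bar> \<le> nrm f * nrm g"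
proof -
  have "\<bar>\<integral>x. f x \<bullet> g x \<partial>muC\<bar> \<le> (\<integral>x. norm (f x) * norm (g x) \<partial>muC)"
    by (rule order_trans[OF integral_abs_bound integral_mono])
       (auto intro!: integrable_abs Lsp_integrable_inner Lsp_integrable_norm_mult assms Cauchy_Schwarz_ineq2)
  also note Lsp_integral_norm_mult[OF assms]
  finally show ?thesis .
qed

lemma nrm_triangle:
  assumes "f \<in> Lsp" "g \<in> Lsp" shows "nrm (\<lambda>x. f x + g x) \<le> nrm f + nrm g"
proof -
  have "(nrm (\<lambda>x. f x + g x))\<^sup>2 = (\<integral>x. (norm (f x))\<^sup>2 + 2 * (f x \<bullet> g x) + (norm (g x))\<^sup>2 \<partial>muC)"
    unfolding nrm_square by (rule Bochner_Integration.integral_cong)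
      (auto simp: power2_norm_eq_inner inner_add inner_commute)
  also have "\<dots> = (nrm f)\<^sup>2 + 2 * (\<integral>x. f x \<bullet> g x \<partial>muC) + (nrm g)\<^sup>2"
    using Lsp_integrable_inner[OF assms] LspD(3)[OF assms(1)] LspD(3)[OF assms(2)] by (simp add: nrm_square)
  also have "\<dots> \<le> (nrm f + nrm g)\<^sup>2"
    using Lsp_Cauchy_Schwarz[OF assms] by (simp add: power2_sum)
  finally show ?thesis by (rule power2_le_imp_le) simp
qed

section \<open>Convolution with compactly supported kernels\<close>

text \<open>Smooth kernels are supported in the unit ball. The support radius 2 leaves room for
  their increments \<open>\<kappa> (y + h) - \<kappa> y\<close> with \<open>norm h <= 1\<close>,
  which are to be bounded kernels as well.\<close>

definition bk :: "real \<Rightarrow> (real^3 \<Rightarrow> real) \<Rightarrow> bool" where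
  "bk B \<kappa> \<longleftrightarrow> 0 \<le> B \<and> \<kappa> \<in> borel_measurable borel \<and> (\<forall>y. \<bar>\<kappa> y\<bar> \<le> B) \<and> (\<forall>y. 2 < norm y \<longrightarrow> \<kappa> y = 0)"

definition conv :: "(real^3 \<Rightarrow> real) \<Rightarrow> (real^3 \<Rightarrow> real^3) \<Rightarrow> real^3 \<Rightarrow> real^3" where
  "conv \<kappa> f x = (\<integral>z. \<kappa> (x - z) *\<^sub>R f z \<partial>lborel)"

lemma bkD:
  assumes "bk B \<kappa>" shows "0 \<le> B" "\<kappa> \<in> borel_measurable borel" "\<bar>\<kappa> y\<bar> \<le> B" "2 < norm y \<Longrightarrow> \<kappa> y = 0"
  using assms by (auto simp: bk_def)

lemma emeasure_cball_2: "emeasure lborel (cball (x::real^3) 2) \<le> ennreal 64"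
proof -
  have P: "(\<Prod>i\<in>UNIV. f i) = f 1 * f 2 * f 3" for f :: "3 \<Rightarrow> real"
    unfolding UNIV_3 by (simp add: ac_simps)
  have "emeasure lborel (cball x 2) \<le> emeasure lborel (cbox (\<chi> i. x $ i - 2) (\<chi> i. x $ i + 2))"
  proof (rule emeasure_mono)
    show "cball x 2 \<subseteq> cbox (\<chi> i. x $ i - 2) (\<chi> i. x $ i + 2)"
    proof
      fix z assume "z \<in> cball x 2"
      then have "norm (z - x) \<le> 2" by (simp add: dist_norm norm_minus_commute)
      then have "\<bar>(z - x) $ i\<bar> \<le> 2" for i by (meson component_le_norm_cart order_trans)
      then have "\<bar>z $ i - x $ i\<bar> \<le> 2" for i by simp
      then show "z \<in> cbox (\<chi> i. x $ i - 2) (\<chi> i. x $ i + 2)"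
        by (auto simp: mem_box_cart abs_le_iff algebra_simps)
    qed
  qed auto
  also have "\<dots> = ennreal (measure lborel (cbox (\<chi> i. x $ i - 2) (\<chi> i. x $ i + 2)))"
    by (rule emeasure_eq_ennreal_measure) (metis emeasure_lborel_cbox_finite less_irrefl infinity_ennreal_def)
  also have "measure lborel (cbox (\<chi> i. x $ i - 2) (\<chi> i. x $ i + 2)) = 64"
    by (subst content_cbox_cart) (auto simp: P interval_eq_empty_cart)
  finally show ?thesis .
qed

lemma ennreal_power2_le: "X\<^sup>2 \<le> ennreal (c\<^sup>2) \<Longrightarrow> 0 \<le> c \<Longrightarrow> X \<le> ennreal c"
proof (cases X)
  case (real r)
  then show "X\<^sup>2 \<le> ennreal (c\<^sup>2) \<Longrightarrow> 0 \<le> c \<Longrightarrow> X \<le> ennreal c"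
    by (auto simp: ennreal_power intro: power2_le_imp_le ennreal_leI)
qed (simp add: power2_eq_square top_unique)

text \<open>Cauchy-Schwarz on the ball of radius 2. Its volume is at most that of a cube of side 4,
  so 8 is the square root of 64; the local norm of \<open>f\<close> is at most \<open>nrm f\<close>
  because the ball fits into one cell.\<close>

lemma conv_nn_bound:
  assumes \<kappa>: "bk B \<kappa>" and f: "f \<in> Lsp"
  shows "(\<integral>\<^sup>+z. ennreal (norm (\<kappa> (x - z) *\<^sub>R f z)) \<partial>lborel) \<le> ennreal (8 * B * nrm f)"
proof -
  note [measurable] = LspD(2)[OF f] bkD(2)[OF \<kappa>]
  let ?i = "indicator (cball x 2) :: real^3 \<Rightarrow> ennreal"
  have [measurable]: "cball x r \<in> sets borel" for r by simp
  have "(\<integral>\<^sup>+z. ennreal (norm (\<kappa> (x - z) *\<^sub>R f z)) \<partial>lborel) \<le> (\<integral>\<^sup>+z. (ennreal B * ?i z) * (?i z * ennreal (norm (f z))) \<partial>lborel)"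
  proof (rule nn_integral_mono)
    fix z
    show "ennreal (norm (\<kappa> (x - z) *\<^sub>R f z)) \<le> (ennreal B * ?i z) * (?i z * ennreal (norm (f z)))"
    proof (cases "z \<in> cball x 2")
      case True
      then show ?thesis using bkD(3)[OF \<kappa>, of "x - z"] bkD(1)[OF \<kappa>]
        by (auto simp: ennreal_mult[symmetric] intro!: ennreal_leI mult_right_mono)
    next
      case False
      then have "2 < norm (x - z)" by (simp add: dist_norm)
      then show ?thesis using bkD(4)[OF \<kappa>] by simp
    qed
  qed
  also have "(\<integral>\<^sup>+z. (ennreal B * ?i z) * (?i z * ennreal (norm (f z))) \<partial>lborel) \<le> ennreal (8 * B * nrm f)"
  proof (rule ennreal_power2_le)
    show "0 \<le> 8 * B * nrm f" using bkD(1)[OF \<kappa>] by simp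
    have "(\<integral>\<^sup>+z. (ennreal B * ?i z) ^ 2 \<partial>lborel) = (\<integral>\<^sup>+z. ennreal (B\<^sup>2) * ?i z \<partial>lborel)"
      by (rule nn_integral_cong) (auto simp: indicator_def ennreal_power bkD(1)[OF \<kappa>])
    also have "\<dots> \<le> ennreal (B\<^sup>2) * ennreal 64"
      using emeasure_cball_2[of x] by (subst nn_integral_cmult_indicator) (auto intro: mult_left_mono)
    finally have 1: "(\<integral>\<^sup>+z. (ennreal B * ?i z) ^ 2 \<partial>lborel) \<le> ennreal (B\<^sup>2) * ennreal 64" .
    have "(\<integral>\<^sup>+z. (?i z * ennreal (norm (f z))) ^ 2 \<partial>lborel) \<le> (\<integral>\<^sup>+z. indicator (cball x 3) z * ennreal ((norm (f z))\<^sup>2) \<partial>lborel)"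
      by (rule nn_integral_mono) (auto simp: indicator_def ennreal_power)
    also have "\<dots> \<le> (\<integral>\<^sup>+z. ennreal ((norm (f z))\<^sup>2) \<partial>muC)"
      by (rule nn_integral_cball_le[OF per_compose[where g = "\<lambda>v. ennreal ((norm v)\<^sup>2)", OF LspD(1)[OF f]]]) measurable
    finally have 2: "(\<integral>\<^sup>+z. (?i z * ennreal (norm (f z))) ^ 2 \<partial>lborel) \<le> ennreal ((nrm f)\<^sup>2)"
      by (simp only: nn_integral_nrm[OF f])
    have "(\<integral>\<^sup>+z. (ennreal B * ?i z) * (?i z * ennreal (norm (f z))) \<partial>lborel)\<^sup>2
      \<le> (\<integral>\<^sup>+z. (ennreal B * ?i z) ^ 2 \<partial>lborel) * (\<integral>\<^sup>+z. (?i z * ennreal (norm (f z))) ^ 2 \<partial>lborel)"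
      by (rule Cauchy_Schwarz_nn_integral) auto
    also have "\<dots> \<le> (ennreal (B\<^sup>2) * ennreal 64) * ennreal ((nrm f)\<^sup>2)"
      by (intro mult_mono 1 2) auto
    also have "\<dots> = ennreal ((8 * B * nrm f)\<^sup>2)"
      by (simp only: ennreal_mult[symmetric] zero_le_power2 zero_le_numeral mult_nonneg_nonneg power_mult_distrib)
         (simp add: power_mult_distrib)
    finally show "(\<integral>\<^sup>+z. (ennreal B * ?i z) * (?i z * ennreal (norm (f z))) \<partial>lborel)\<^sup>2 \<le> ennreal ((8 * B * nrm f)\<^sup>2)" .
  qed
  finally show ?thesis .
qed

lemma conv_integrable:
  assumes \<kappa>: "bk B \<kappa>" and f: "f \<in> Lsp"
  shows "integrable lborel (\<lambda>z. \<kappa> (x - z) *\<^sub>R f z)"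
proof -
  note [measurable] = LspD(2)[OF f] bkD(2)[OF \<kappa>]
  show ?thesis
    unfolding integrable_iff_bounded using le_less_trans[OF conv_nn_bound[OF assms]] by auto
qed

lemma conv_norm_le:
  assumes \<kappa>: "bk B \<kappa>" and f: "f \<in> Lsp"
  shows "norm (conv \<kappa> f x) \<le> 8 * B * nrm f"
proof -
  have "ennreal (norm (conv \<kappa> f x)) \<le> (\<integral>\<^sup>+z. ennreal (norm (\<kappa> (x - z) *\<^sub>R f z)) \<partial>lborel)"
    unfolding conv_def by (rule integral_norm_bound_ennreal[OF conv_integrable[OF assms]])
  also note conv_nn_bound[OF assms]
  finally show ?thesis using bkD(1)[OF \<kappa>] by simp
qed

lemma conv_swap:
  assumes [measurable]: "\<kappa> \<in> borel_measurable borel" "f \<in> borel_measurable borel"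
  shows "conv \<kappa> f x = (\<integral>y. \<kappa> y *\<^sub>R f (x - y) \<partial>lborel)"
proof -
  have "conv \<kappa> f x = (\<integral>z. \<kappa> (- z) *\<^sub>R f (z + x) \<partial>lborel)"
    unfolding conv_def using integral_lborel_shift[of "\<lambda>z. \<kappa> (x - z) *\<^sub>R f z" x] by simp
  also have "\<dots> = (\<integral>y. \<kappa> y *\<^sub>R f (x - y) \<partial>lborel)"
    using integral_lborel_neg[of "\<lambda>z. \<kappa> (- z) *\<^sub>R f (z + x)"] by simp
  finally show ?thesis .
qed

lemma conv_integrable':
  assumes \<kappa>: "bk B \<kappa>" and f: "f \<in> Lsp"
  shows "integrable lborel (\<lambda>y. \<kappa> y *\<^sub>R f (x - y))"
proof -
  note [measurable] = LspD(2)[OF f] bkD(2)[OF \<kappa>]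
  have "integrable lborel (\<lambda>z. \<kappa> (- z) *\<^sub>R f (z + x))"
    using conv_integrable[OF assms, of x] integrable_lborel_shift[of "\<lambda>z. \<kappa> (x - z) *\<^sub>R f z" x] by simp
  then show ?thesis
    using integrable_lborel_neg[of "\<lambda>z. \<kappa> (- z) *\<^sub>R f (z + x)"] by simp
qed

lemma conv_add_kernel:
  assumes "bk B \<kappa>" "bk B' \<kappa>'" "f \<in> Lsp"
  shows "conv (\<lambda>y. \<kappa> y + \<kappa>' y) f x = conv \<kappa> f x + conv \<kappa>' f x"
  unfolding conv_def using conv_integrable[OF assms(1,3)] conv_integrable[OF assms(2,3)]
  by (simp add: scaleR_add_left)

lemma conv_diff:
  assumes "bk B \<kappa>" "f \<in> Lsp" "g \<in> Lsp"
  shows "conv \<kappa> (\<lambda>x. f x - g x) x = conv \<kappa> f x - conv \<kappa> g x"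
  unfolding conv_def using conv_integrable[OF assms(1,2)] conv_integrable[OF assms(1,3)]
  by (simp add: scaleR_diff_right)

lemma per_conv:
  assumes "\<kappa> \<in> borel_measurable borel" "f \<in> borel_measurable borel" "per f" shows "per (conv \<kappa> f)"
proof (rule perI_lat)
  fix m n x
  have "f (x + lat m n - y) = f (x - y)" for y
    using per_lat[OF assms(3), of "x - y" m n] by (simp add: algebra_simps)
  then show "conv \<kappa> f (x + lat m n) = conv \<kappa> f x" by (simp add: conv_swap[OF assms(1,2)])
qed

lemma bounded_linear_reflect: "bounded_linear reflect"
  using linear_reflect by (simp add: linear_conv_bounded_linear)

lemma conv_reflect:
  assumes \<kappa>: "bk B \<kappa>" and f: "f \<in> Lsp" and s: "\<And>y. \<kappa> (reflect y) = \<kappa> y" "\<And>x. f (reflect x) = reflect (f x)"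
  shows "conv \<kappa> f (reflect x) = reflect (conv \<kappa> f x)"
proof -
  note [measurable] = LspD(2)[OF f] bkD(2)[OF \<kappa>]
  have "conv \<kappa> f (reflect x) = (\<integral>z. \<kappa> (reflect x - reflect z) *\<^sub>R f (reflect z) \<partial>lborel)"
    unfolding conv_def using integral_lborel_reflect[of "\<lambda>z. \<kappa> (reflect x - z) *\<^sub>R f z"] by simp
  also have "\<dots> = (\<integral>z. reflect (\<kappa> (x - z) *\<^sub>R f z) \<partial>lborel)"
    by (simp add: s reflect_scale flip: reflect_diff)
  also have "\<dots> = reflect (conv \<kappa> f x)"
    unfolding conv_def by (rule integral_bounded_linear[OF bounded_linear_reflect conv_integrable[OF \<kappa> f]])
  finally show ?thesis .
qed

section \<open>Smooth kernels and derivatives of convolutions\<close>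

definition kern :: "(real^3 \<Rightarrow> real) \<Rightarrow> bool" where
  "kern \<kappa> \<longleftrightarrow> smooth_within UNIV \<kappa> \<and> (\<forall>y. 1 < norm y \<longrightarrow> \<kappa> y = 0)"

definition grad :: "(real^3 \<Rightarrow> real) \<Rightarrow> real^3 \<Rightarrow> real^3" where
  "grad \<kappa> y = (\<chi> i. frechet_derivative \<kappa> (at y) (axis i 1))"

definition bkv :: "real \<Rightarrow> (real^3 \<Rightarrow> real^3) \<Rightarrow> bool" where
  "bkv B g \<longleftrightarrow> 0 \<le> B \<and> g \<in> borel_measurable borel \<and> (\<forall>y. norm (g y) \<le> B) \<and> (\<forall>y. 2 < norm y \<longrightarrow> g y = 0)"

lemma bkvD:
  assumes "bkv B g" shows "0 \<le> B" "g \<in> borel_measurable borel" "norm (g y) \<le> B" "2 < norm y \<Longrightarrow> g y = 0"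
  using assms by (auto simp: bkv_def)

lemma bk_inner: "bkv B g \<Longrightarrow> bk (B * norm h) (\<lambda>y. g y \<bullet> h)"
  unfolding bkv_def bk_def
  by (auto intro!: order_trans[OF Cauchy_Schwarz_ineq2] mult_right_mono)

lemma has_derivative_grad:
  assumes "\<kappa> differentiable at y" shows "(\<kappa> has_derivative (\<lambda>h. grad \<kappa> y \<bullet> h)) (at y)"
proof -
  let ?D = "frechet_derivative \<kappa> (at y)"
  have D: "(\<kappa> has_derivative ?D) (at y)" using assms by (simp add: frechet_derivative_works)
  then have lin: "linear ?D" using has_derivative_linear by blast
  have "?D h = grad \<kappa> y \<bullet> h" for h
  proof -
    have "?D h = ?D (\<Sum>i\<in>UNIV. h $ i *\<^sub>R axis i 1)" by (simp add: basis_expansion[where x = h] flip: scalar_mult_eq_scaleR)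
    also have "\<dots> = (\<Sum>i\<in>UNIV. h $ i * ?D (axis i 1))"
      by (simp add: linear_sum[OF lin] linear_scale[OF lin])
    finally show ?thesis by (simp add: grad_def inner_vec_def mult.commute)
  qed
  then have "?D = (\<lambda>h. grad \<kappa> y \<bullet> h)" by blast
  with D show ?thesis by simp
qed

lemma kern_Ck: "kern \<kappa> \<Longrightarrow> Ck n \<kappa>"
  by (simp add: kern_def smooth_iff_Ck)

lemma kern_has_derivative: "kern \<kappa> \<Longrightarrow> (\<kappa> has_derivative (\<lambda>h. grad \<kappa> y \<bullet> h)) (at y)"
  by (rule has_derivative_grad[OF Ck_differentiable[OF kern_Ck[of _ 0]]])

lemma frechet_derivative_kern: "kern \<kappa> \<Longrightarrow> frechet_derivative \<kappa> (at y) h = grad \<kappa> y \<bullet> h"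
  by (rule frechet_derivative_eq[OF kern_has_derivative])

lemma has_derivative_zero_outside:
  fixes \<kappa> :: "'a::euclidean_space \<Rightarrow> real"
  assumes "\<And>y. r < norm y \<Longrightarrow> \<kappa> y = 0" "r < norm y" shows "(\<kappa> has_derivative (\<lambda>h. 0)) (at y)"
proof (rule has_derivative_transform_within_open[of "\<lambda>_. 0"])
  show "open {y. r < norm y}" by (intro open_Collect_less continuous_intros)
qed (use assms in auto)

lemma kern_derivative:
  assumes "kern \<kappa>" "b \<in> Basis" shows "kern (\<lambda>y. frechet_derivative \<kappa> (at y) b)"
  unfolding kern_def
proof (intro conjI allI impI)
  show "smooth_within UNIV (\<lambda>y. frechet_derivative \<kappa> (at y) b)"
    using assms by (auto simp: kern_def intro: smooth_frechet_derivative)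
  show "frechet_derivative \<kappa> (at y) b = 0" if "1 < norm y" for y
    by (rule frechet_derivative_eq[OF has_derivative_zero_outside[of 1]]) (use assms that in \<open>auto simp: kern_def\<close>)
qed

lemma kern_continuous: "kern \<kappa> \<Longrightarrow> continuous_on UNIV \<kappa>"
  by (rule continuous_Ck[OF kern_Ck[of _ 0]])

lemma kern_measurable: "kern \<kappa> \<Longrightarrow> \<kappa> \<in> borel_measurable borel"
  by (rule borel_measurable_continuous_onI[OF kern_continuous])

lemma kern_bk:
  assumes "kern \<kappa>" shows "\<exists>B. bk B \<kappa>"
proof -
  have "bounded (\<kappa> ` cball 0 1)"
    by (intro compact_imp_bounded compact_continuous_image continuous_on_subset[OF kern_continuous[OF assms]]) auto
  then obtain B where B: "\<forall>z\<in>\<kappa> ` cball 0 1. norm z \<le> B"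
    unfolding bounded_iff by blast
  have "\<bar>\<kappa> y\<bar> \<le> \<bar>B\<bar>" for y
    using B assms by (cases "norm y \<le> 1") (force simp: kern_def)+
  then have "bk \<bar>B\<bar> \<kappa>" using assms kern_measurable[OF assms] by (auto simp: bk_def kern_def)
  then show ?thesis ..
qed

lemma grad_nth: "grad \<kappa> y $ i = frechet_derivative \<kappa> (at y) (axis i 1)"
  by (simp add: grad_def)

lemma axis_Basis: "axis i 1 \<in> (Basis :: (real^3) set)"
  by (simp add: axis_in_Basis_iff)

lemma norm_le_3: "(\<And>i. \<bar>x $ i\<bar> \<le> B) \<Longrightarrow> norm x \<le> 3 * B" for x :: "real^3"
proof -
  assume "\<And>i. \<bar>x $ i\<bar> \<le> B"
  then have "(\<Sum>i\<in>UNIV. \<bar>x $ i\<bar>) \<le> (\<Sum>i\<in>(UNIV::3 set). B)" by (intro sum_mono)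
  then show ?thesis using norm_le_l1_cart[of x] by simp
qed

lemma kern_grad_bkv:
  assumes "kern \<kappa>" shows "\<exists>B. bkv B (grad \<kappa>)"
proof -
  have k: "kern (\<lambda>y. grad \<kappa> y $ i)" for i
    unfolding grad_nth by (rule kern_derivative[OF assms axis_Basis])
  obtain B where B: "\<And>i. bk (B i) (\<lambda>y. grad \<kappa> y $ i)" using kern_bk[OF k] by metis
  define M where "M = (\<Sum>i\<in>UNIV. B i)"
  have "norm (grad \<kappa> y) \<le> 3 * M" for y
  proof (rule norm_le_3)
    fix i
    have "\<bar>grad \<kappa> y $ i\<bar> \<le> B i" using bkD(3)[OF B] .
    also have "\<dots> \<le> M" unfolding M_def by (rule member_le_sum) (use bkD(1)[OF B] in auto)
    finally show "\<bar>grad \<kappa> y $ i\<bar> \<le> M" .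
  qed
  moreover have "0 \<le> M" unfolding M_def by (intro sum_nonneg bkD(1)[OF B])
  moreover have "grad \<kappa> \<in> borel_measurable borel"
  proof -
    have "(\<lambda>y. \<chi> i. grad \<kappa> y $ i) \<in> borel_measurable borel"
      by (intro borel_measurable_vec_lambda kern_measurable[OF k])
    then show ?thesis by simp
  qed
  moreover have "grad \<kappa> y = 0" if "2 < norm y" for y
    using k that by (simp add: kern_def vec_eq_iff)
  ultimately have "bkv (3 * M) (grad \<kappa>)" by (simp add: bkv_def)
  then show ?thesis ..
qed

lemma grad_mvt:
  assumes d: "\<And>y. (\<kappa> has_derivative (\<lambda>h. grad \<kappa> y \<bullet> h)) (at y)"
  shows "\<exists>\<xi>. 0 < \<xi> \<and> \<xi> < 1 \<and> \<kappa> (y + h) - \<kappa> y = grad \<kappa> (y + \<xi> *\<^sub>R h) \<bullet> h"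
proof -
  have "((\<lambda>t. \<kappa> (y + t *\<^sub>R h)) has_real_derivative grad \<kappa> (y + t *\<^sub>R h) \<bullet> h) (at t)" for t :: real
  proof -
    have "((\<lambda>t. y + t *\<^sub>R h) has_derivative (\<lambda>s. s *\<^sub>R h)) (at t)" by (auto intro!: derivative_eq_intros)
    from has_derivative_compose[OF this d] show ?thesis
      by (simp add: has_field_derivative_def mult.commute[of _ "grad \<kappa> (y + t *\<^sub>R h) \<bullet> h"])
  qed
  from MVT2[of 0 1 "\<lambda>t. \<kappa> (y + t *\<^sub>R h)" "\<lambda>t. grad \<kappa> (y + t *\<^sub>R h) \<bullet> h", OF _ this]
  show ?thesis by auto
qed

text \<open>The second derivatives are bounded, being kernels again, so the gradient is Lipschitz
  and the mean value theorem leaves a quadratic error. That \<open>L\<close> does not depend on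
  \<open>y\<close> makes the error, divided by \<open>(norm h)^2\<close>, a bounded kernel.\<close>

lemma kern_remainder:
  assumes "kern \<kappa>"
  shows "\<exists>L\<ge>0. \<forall>y h. \<bar>\<kappa> (y + h) - \<kappa> y - grad \<kappa> y \<bullet> h\<bar> \<le> L * (norm h)\<^sup>2"
proof -
  have k: "kern (\<lambda>y. grad \<kappa> y $ i)" for i
    unfolding grad_nth by (rule kern_derivative[OF assms axis_Basis])
  obtain B where B: "\<And>i. bkv (B i) (grad (\<lambda>y. grad \<kappa> y $ i))" using kern_grad_bkv[OF k] by metis
  define M where "M = (\<Sum>i\<in>UNIV. B i)"
  have M0: "0 \<le> M" unfolding M_def by (intro sum_nonneg bkvD(1)[OF B])
  have lip: "norm (grad \<kappa> (y + v) - grad \<kappa> y) \<le> 3 * (M * norm v)" for y v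
  proof (rule norm_le_3)
    fix i
    obtain \<xi> where "grad \<kappa> (y + v) $ i - grad \<kappa> y $ i = grad (\<lambda>y. grad \<kappa> y $ i) (y + \<xi> *\<^sub>R v) \<bullet> v"
      using grad_mvt[OF kern_has_derivative[OF k[of i]], of y v] by blast
    then have "\<bar>(grad \<kappa> (y + v) - grad \<kappa> y) $ i\<bar> \<le> norm (grad (\<lambda>y. grad \<kappa> y $ i) (y + \<xi> *\<^sub>R v)) * norm v"
      by (simp add: Cauchy_Schwarz_ineq2)
    also have "\<dots> \<le> B i * norm v" by (intro mult_right_mono bkvD(3)[OF B]) auto
    also have "\<dots> \<le> M * norm v" unfolding M_def
      by (intro mult_right_mono member_le_sum) (use bkvD(1)[OF B] in auto)
    finally show "\<bar>(grad \<kappa> (y + v) - grad \<kappa> y) $ i\<bar> \<le> M * norm v" .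
  qed
  have "\<bar>\<kappa> (y + h) - \<kappa> y - grad \<kappa> y \<bullet> h\<bar> \<le> (3 * M) * (norm h)\<^sup>2" for y h
  proof -
    obtain \<xi> where \<xi>: "0 < \<xi>" "\<xi> < 1" "\<kappa> (y + h) - \<kappa> y = grad \<kappa> (y + \<xi> *\<^sub>R h) \<bullet> h"
      using grad_mvt[OF kern_has_derivative[OF assms], of y h] by blast
    have "\<bar>\<kappa> (y + h) - \<kappa> y - grad \<kappa> y \<bullet> h\<bar> \<le> norm (grad \<kappa> (y + \<xi> *\<^sub>R h) - grad \<kappa> y) * norm h"
      unfolding \<xi>(3) by (metis inner_diff_left Cauchy_Schwarz_ineq2)
    also have "\<dots> \<le> (3 * (M * norm (\<xi> *\<^sub>R h))) * norm h" by (intro mult_right_mono lip) auto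
    also have "\<dots> \<le> (3 * (M * norm h)) * norm h"
      using \<xi>(1,2) M0 by (intro mult_right_mono mult_left_mono) (auto simp: mult_left_le_one_le)
    finally show ?thesis by (simp add: power2_eq_square mult.assoc)
  qed
  then show ?thesis using M0 by (intro exI[of _ "3 * M"]) auto
qed

text \<open>Convolution is bounded on bounded kernels, so the remainder of \<open>\<kappa>\<close>
  of size \<open>L (norm h)^2\<close> yields a remainder of the convolution of the same order. No
  regularity of \<open>f\<close> enters.\<close>

lemma conv_has_derivative:
  assumes \<kappa>: "kern \<kappa>" and f: "f \<in> Lsp"
  shows "(conv \<kappa> f has_derivative (\<lambda>h. conv (\<lambda>y. grad \<kappa> y \<bullet> h) f x)) (at x)"
proof -
  obtain L where L: "0 \<le> L" "\<And>y h. \<bar>\<kappa> (y + h) - \<kappa> y - grad \<kappa> y \<bullet> h\<bar> \<le> L * (norm h)\<^sup>2"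
    using kern_remainder[OF \<kappa>] by blast
  obtain B where B: "bk B \<kappa>" using kern_bk[OF \<kappa>] by blast
  obtain B' where B': "bkv B' (grad \<kappa>)" using kern_grad_bkv[OF \<kappa>] by blast
  note [measurable] = bkD(2)[OF B] bkvD(2)[OF B'] LspD(2)[OF f]
  let ?D = "\<lambda>h. conv (\<lambda>y. grad \<kappa> y \<bullet> h) f x"
  have bl: "bounded_linear ?D"
  proof (rule bounded_linear_intro)
    fix h k r
    show "?D (h + k) = ?D h + ?D k"
      unfolding inner_add_right by (rule conv_add_kernel[OF bk_inner[OF B'] bk_inner[OF B'] f])
    show "?D (r *\<^sub>R h) = r *\<^sub>R ?D h"
      by (simp add: conv_def mult.assoc flip: scaleR_scaleR integral_scaleR_right)
    show "norm (?D h) \<le> norm h * (8 * B' * nrm f)"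
      using conv_norm_le[OF bk_inner[OF B'] f, of h x] by (simp add: algebra_simps)
  qed
  have est: "norm (conv \<kappa> f (x + h) - conv \<kappa> f x - ?D h) \<le> (8 * L * nrm f) * (norm h)\<^sup>2" if h: "norm h \<le> 1" for h
  proof -
    let ?r = "\<lambda>y. \<kappa> (y + h) - \<kappa> y - grad \<kappa> y \<bullet> h"
    \<comment> \<open>Here \<open>norm h <= 1\<close> widens the support from 1 to 2, as provided
      for in \<open>bk\<close>.\<close>
    have r0: "?r y = 0" if "2 < norm y" for y
    proof -
      have "norm y \<le> norm (y + h) + norm h" using norm_triangle_ineq4[of "y + h" h] by simp
      then have "1 < norm (y + h)" using that h by simp
      then show ?thesis using \<kappa> that bkvD(4)[OF B'] by (simp add: kern_def)
    qed
    have bkr: "bk (L * (norm h)\<^sup>2) ?r" using r0 L by (auto simp: bk_def)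
    have i1: "integrable lborel (\<lambda>z. \<kappa> (x + h - z) *\<^sub>R f z)" by (rule conv_integrable[OF B f])
    have e: "x - z + h = x + h - z" for z by simp
    have "conv ?r f x = conv \<kappa> f (x + h) - conv \<kappa> f x - ?D h"
      unfolding conv_def e
      using i1 conv_integrable[OF B f, of x] conv_integrable[OF bk_inner[OF B', of h] f, of x]
      by (simp add: scaleR_diff_left)
    moreover have "8 * (L * (norm h)\<^sup>2) * nrm f = (8 * L * nrm f) * (norm h)\<^sup>2" by (simp add: algebra_simps)
    ultimately show ?thesis using conv_norm_le[OF bkr f, of x] by (simp only:)
  qed
  show ?thesis unfolding has_derivative_at_within
  proof (intro conjI bl tendstoI)
    fix e :: real assume e: "0 < e"
    define c where "c = 8 * L * nrm f"
    have c0: "0 \<le> c" using L(1) by (simp add: c_def)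
    have "\<forall>\<^sub>F y in at x. dist y x < min 1 (e / (c + 1))"
      unfolding eventually_at using e c0 by (intro exI[of _ "min 1 (e / (c + 1))"]) auto
    moreover have "\<forall>\<^sub>F y in at x. y \<noteq> x" by (simp add: eventually_at_filter)
    ultimately show "\<forall>\<^sub>F y in at x. dist ((conv \<kappa> f y - conv \<kappa> f x - ?D (y - x)) /\<^sub>R norm (y - x)) 0 < e"
    proof eventually_elim
      case (elim y)
      let ?n = "norm (y - x)"
      have n: "?n \<le> 1" "?n < e / (c + 1)" "0 < ?n" using elim by (auto simp: dist_norm)
      have "norm (conv \<kappa> f y - conv \<kappa> f x - ?D (y - x)) \<le> c * ?n\<^sup>2"
        using est[OF n(1)] by (simp add: c_def)
      then have "norm (conv \<kappa> f y - conv \<kappa> f x - ?D (y - x)) / ?n \<le> c * ?n"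
        using n(3) by (simp add: divide_le_eq power2_eq_square mult.assoc)
      also have "\<dots> < e"
      proof -
        have "c * ?n \<le> (c + 1) * ?n" by (intro mult_right_mono) auto
        also have "\<dots> < e" using n(2) c0 by (simp add: field_simps)
        finally show ?thesis .
      qed
      finally show ?case by (simp add: dist_norm divide_inverse mult.commute)
    qed
  qed
qed

lemma frechet_derivative_conv:
  assumes "kern \<kappa>" "f \<in> Lsp"
  shows "frechet_derivative (conv \<kappa> f) (at x) b = conv (\<lambda>y. frechet_derivative \<kappa> (at y) b) f x"
  using frechet_derivative_eq[OF conv_has_derivative[OF assms]]
  by (simp add: frechet_derivative_kern[OF assms(1)])

lemma kern_pderivs:
  "kern \<kappa> \<Longrightarrow> set bs \<subseteq> Basis \<Longrightarrow> kern (pderivs UNIV bs \<kappa>)"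
  by (induction bs) (auto simp: kern_derivative)

lemma pderivs_conv:
  assumes "kern \<kappa>" "f \<in> Lsp" "set bs \<subseteq> Basis"
  shows "pderivs UNIV bs (conv \<kappa> f) = conv (pderivs UNIV bs \<kappa>) f"
  using assms(3)
  by (induction bs) (auto simp: frechet_derivative_conv[OF kern_pderivs[OF assms(1)] assms(2)])

lemma smooth_conv:
  assumes "kern \<kappa>" "f \<in> Lsp" shows "smooth_within UNIV (conv \<kappa> f)"
  unfolding smooth_within_def differentiable_on_def differentiable_def
  using conv_has_derivative[OF kern_pderivs[OF assms(1)] assms(2)] by (auto simp: pderivs_conv[OF assms])

section \<open>The standard mollifier\<close>

lemma kern_bump_scaled:
  assumes "0 < r" "r \<le> 1" shows "kern (\<lambda>x. bump (x /\<^sub>R r))"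
  unfolding kern_def smooth_iff_Ck
proof (intro conjI allI impI Ck_bump_scaled)
  fix y :: "real^3" assume "1 < norm y"
  then have "1 \<le> norm (y /\<^sub>R r)" using assms by (simp add: field_simps)
  then show "bump (y /\<^sub>R r) = 0" by (rule bump_eq_0)
qed

lemma kern_integrable: "kern \<kappa> \<Longrightarrow> integrable lborel \<kappa>"
proof -
  assume k: "kern \<kappa>"
  then obtain B where B: "bk B \<kappa>" using kern_bk by blast
  note [measurable] = bkD(2)[OF B]
  have "integrable lborel (\<lambda>x::real^3. B * indicator (cball 0 2) x)"
    using emeasure_lborel_cball_finite[of "0::real^3" 2] by (intro integrable_mult_right integrable_real_indicator) auto
  then show ?thesis
  proof (rule Bochner_Integration.integrable_bound)
    show "AE x in lborel. norm (\<kappa> x) \<le> norm (B * indicator (cball 0 2) x)"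
    proof (intro AE_I2)
      fix x :: "real^3"
      show "norm (\<kappa> x) \<le> norm (B * indicator (cball 0 2) x)"
        using bkD(1)[OF B] bkD(3,4)[OF B, of x] by (cases "norm x \<le> 2") auto
    qed
  qed measurable
qed

lemma kern_bump: "kern bump"
  using kern_bump_scaled[of 1] by simp

definition bump_mass :: real where "bump_mass = (\<integral>x. bump x \<partial>lborel)"

lemma emeasure_ball_pos: "0 < r \<Longrightarrow> 0 < emeasure lborel (ball (x::real^3) r)"
  by (metis content_ball_pos emeasure_lborel_ball_finite emeasure_eq_ennreal_measure ennreal_less_zero_iff less_irrefl infinity_ennreal_def)

lemma bump_mass_pos: "0 < bump_mass"
proof -
  have "0 \<le> bump_mass" unfolding bump_mass_def by (intro integral_nonneg_AE AE_I2 bump_nonneg)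
  moreover have "bump_mass \<noteq> 0"
  proof
    assume "bump_mass = 0"
    then have "AE x in lborel. bump x = 0"
      unfolding bump_mass_def
      by (subst (asm) integral_nonneg_eq_0_iff_AE[OF kern_integrable[OF kern_bump]]) (auto intro: bump_nonneg)
    then have "AE x in lborel. x \<notin> ball (0::real^3) 1"
      by (rule AE_mp) (intro AE_I2, use bump_pos in force)
    then have "emeasure lborel (ball (0::real^3) 1) = 0"
      by (subst (asm) AE_iff_measurable[OF _ refl]) (auto simp: ball_def)
    with emeasure_ball_pos[of 1 0] show False by simp
  qed
  ultimately show ?thesis by simp
qed

text \<open>Normalised to mass 1. The bound \<open>\<epsilon> <= 1\<close> that accompanies it keeps
  the support in the unit ball demanded by \<open>kern\<close>.\<close>

definition Kern :: "real \<Rightarrow> real^3 \<Rightarrow> real" where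
  "Kern \<epsilon> x = (1 / (bump_mass * \<epsilon> ^ 3)) * bump (x /\<^sub>R \<epsilon>)"

lemma kern_cmult: "kern \<kappa> \<Longrightarrow> kern (\<lambda>x. c * \<kappa> x)"
  unfolding kern_def smooth_iff_Ck by (auto intro: Ck_mult Ck_const)

lemma kern_Kern: "0 < \<epsilon> \<Longrightarrow> \<epsilon> \<le> 1 \<Longrightarrow> kern (Kern \<epsilon>)"
  unfolding Kern_def[abs_def] by (intro kern_cmult kern_bump_scaled)

lemma Kern_nonneg: "0 < \<epsilon> \<Longrightarrow> 0 \<le> Kern \<epsilon> x"
  using bump_mass_pos by (simp add: Kern_def bump_nonneg)

lemma Kern_eq_0: "0 < \<epsilon> \<Longrightarrow> \<epsilon> \<le> norm x \<Longrightarrow> Kern \<epsilon> x = 0"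
  by (simp add: Kern_def bump_eq_0 field_simps)

lemma Kern_minus [simp]: "Kern \<epsilon> (- x) = Kern \<epsilon> x"
  by (simp add: Kern_def bump_def)

lemma Kern_reflect [simp]: "Kern \<epsilon> (reflect x) = Kern \<epsilon> x"
  by (simp add: Kern_def bump_def inner_reflect flip: reflect_scale)

lemma integral_Kern: "0 < \<epsilon> \<Longrightarrow> (\<integral>x. Kern \<epsilon> x \<partial>lborel) = 1"
  using bump_mass_pos integral_lborel_scale[of bump \<epsilon>] kern_measurable[OF kern_bump]
  by (simp add: Kern_def bump_mass_def[symmetric])

lemma nn_integral_Kern: "0 < \<epsilon> \<Longrightarrow> \<epsilon> \<le> 1 \<Longrightarrow> (\<integral>\<^sup>+x. ennreal (Kern \<epsilon> x) \<partial>lborel) = 1"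
  by (subst nn_integral_eq_integral) (auto intro: kern_integrable kern_Kern Kern_nonneg simp: integral_Kern)

lemma grad_Kern:
  assumes "0 < \<epsilon>" shows "grad (Kern \<epsilon>) x = (1 / (bump_mass * \<epsilon> ^ 4)) *\<^sub>R grad bump (x /\<^sub>R \<epsilon>)"
proof -
  have "(Kern \<epsilon> has_derivative (\<lambda>h. (1 / (bump_mass * \<epsilon> ^ 3)) * (grad bump (x /\<^sub>R \<epsilon>) \<bullet> (h /\<^sub>R \<epsilon>)))) (at x)"
    unfolding Kern_def[abs_def]
    by (intro has_derivative_mult_right has_derivative_compose[OF _ kern_has_derivative[OF kern_bump]])
       (auto intro!: derivative_eq_intros)
  then have "grad (Kern \<epsilon>) x $ i = (1 / (bump_mass * \<epsilon> ^ 3)) * (grad bump (x /\<^sub>R \<epsilon>) \<bullet> (axis i 1 /\<^sub>R \<epsilon>))" for i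
    unfolding grad_nth[of "Kern \<epsilon>"] by (rule frechet_derivative_eq)
  then show ?thesis by (simp add: vec_eq_iff inner_axis field_simps power4_eq_xxxx power3_eq_cube)
qed

text \<open>The gradient of a radial function is a scalar multiple of the position, here with a
  nonpositive factor. Its oddness, its compatibility with \<open>reflect\<close> and the sign of its
  moment against \<open>sgn (y $ 3)\<close> are all read off from this form.\<close>

lemma grad_bump: "grad bump x = (- 2 * flat_exp ([:0, 0, 1:]) (1 - x \<bullet> x)) *\<^sub>R x"
proof -
  have "((\<lambda>x. flat_exp 1 (1 - x \<bullet> x)) has_derivative (\<lambda>h. flat_exp ([:0, 0, 1:]) (1 - x \<bullet> x) * (- (2 * (x \<bullet> h))))) (at x)"
    using flat_exp_has_derivative[of 1 "1 - x \<bullet> x"]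
    by (intro has_derivative_compose[where f = "\<lambda>x. 1 - x \<bullet> x" and g = "flat_exp 1"])
       (auto intro!: derivative_eq_intros simp: has_field_derivative_def inner_commute pderiv_1 fun_eq_iff)
  then have "frechet_derivative bump (at x) h = flat_exp ([:0, 0, 1:]) (1 - x \<bullet> x) * (- (2 * (x \<bullet> h)))" for h
    unfolding bump_def[abs_def] by (rule frechet_derivative_eq)
  then show ?thesis by (simp add: vec_eq_iff grad_nth inner_axis)
qed

lemma grad_bump_minus: "grad bump (- x) = - grad bump x"
  by (simp add: grad_bump)

lemma grad_Kern_minus: "0 < \<epsilon> \<Longrightarrow> grad (Kern \<epsilon>) (- x) = - grad (Kern \<epsilon>) x"
  by (simp add: grad_Kern grad_bump_minus)

lemma grad_Kern_eq_0: "0 < \<epsilon> \<Longrightarrow> \<epsilon> \<le> norm x \<Longrightarrow> grad (Kern \<epsilon>) x = 0"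
proof -
  assume e: "0 < \<epsilon>" "\<epsilon> \<le> norm x"
  then have "1 \<le> (norm (x /\<^sub>R \<epsilon>))\<^sup>2" by (intro one_le_power) (simp add: field_simps)
  then have "1 \<le> (x /\<^sub>R \<epsilon>) \<bullet> (x /\<^sub>R \<epsilon>)" by (simp only: power2_norm_eq_inner)
  then show ?thesis using e(1) by (simp only: grad_Kern grad_bump flat_exp_def) simp
qed

text \<open>The gradient scales like \<open>\<epsilon>^(-4)\<close> and volume like
  \<open>\<epsilon>^3\<close>. The resulting \<open>1 / \<epsilon>\<close> is what the thickness of
  the boundary strip and the increment hypothesis have to absorb, so it matters that
  \<open>A\<close> is independent of \<open>\<epsilon>\<close>.\<close>

lemma ex_grad_Kern_L1: "\<exists>A\<ge>0. \<forall>\<epsilon>. 0 < \<epsilon> \<longrightarrow> \<epsilon> \<le> 1 \<longrightarrow> (\<integral>\<^sup>+x. ennreal (norm (grad (Kern \<epsilon>) x)) \<partial>lborel) \<le> ennreal (A / \<epsilon>)"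
proof -
  obtain B where B: "bkv B (grad bump)" using kern_grad_bkv[OF kern_bump] by blast
  note [measurable] = bkvD(2)[OF B]
  have "(\<integral>\<^sup>+x. ennreal (norm (grad bump x)) \<partial>lborel) \<le> (\<integral>\<^sup>+x. ennreal B * indicator (cball 0 2) (x::real^3) \<partial>lborel)"
  proof (rule nn_integral_mono)
    fix x :: "real^3"
    show "ennreal (norm (grad bump x)) \<le> ennreal B * indicator (cball 0 2) x"
      using bkvD(3,4)[OF B, of x] by (cases "norm x \<le> 2") (auto intro: ennreal_leI)
  qed
  also have "\<dots> \<le> ennreal (B * 64)"
    using emeasure_cball_2[of 0] bkvD(1)[OF B]
    by (subst nn_integral_cmult_indicator) (auto intro: mult_left_mono simp: ennreal_mult)
  finally have I: "(\<integral>\<^sup>+x. ennreal (norm (grad bump x)) \<partial>lborel) \<le> ennreal (B * 64)" .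
  have "(\<integral>\<^sup>+x. ennreal (norm (grad (Kern \<epsilon>) x)) \<partial>lborel) \<le> ennreal ((B * 64 / bump_mass) / \<epsilon>)" if e: "0 < \<epsilon>" for \<epsilon>
  proof -
    have "(\<integral>\<^sup>+x. ennreal (norm (grad (Kern \<epsilon>) x)) \<partial>lborel)
      = (\<integral>\<^sup>+x. ennreal (1 / (bump_mass * \<epsilon> ^ 4)) * ennreal (norm (grad bump (x /\<^sub>R \<epsilon>))) \<partial>lborel)"
      using bump_mass_pos e by (simp add: grad_Kern ennreal_mult[symmetric])
    also have "\<dots> = ennreal (1 / (bump_mass * \<epsilon> ^ 4)) * (ennreal (\<epsilon> ^ 3) * (\<integral>\<^sup>+x. ennreal (norm (grad bump x)) \<partial>lborel))"
      using nn_integral_lborel_scale[of "\<lambda>x. ennreal (norm (grad bump x))" \<epsilon>] e by (subst nn_integral_cmult) auto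
    also have "\<dots> \<le> ennreal (1 / (bump_mass * \<epsilon> ^ 4)) * (ennreal (\<epsilon> ^ 3) * ennreal (B * 64))"
      by (intro mult_left_mono I) auto
    also have "\<dots> = ennreal ((B * 64 / bump_mass) / \<epsilon>)"
      using e bump_mass_pos bkvD(1)[OF B]
      by (simp add: ennreal_mult[symmetric] power4_eq_xxxx power3_eq_cube field_simps)
    finally show ?thesis .
  qed
  then show ?thesis using bump_mass_pos bkvD(1)[OF B] by (intro exI[of _ "B * 64 / bump_mass"]) auto
qed

lemma measurable_conv' [measurable]:
  assumes [measurable]: "\<kappa> \<in> borel_measurable borel" "f \<in> borel_measurable borel"
  shows "conv \<kappa> f \<in> borel_measurable borel"
  unfolding conv_def[abs_def] by measurable

text \<open>Jensen's inequality for the powers 2 and 3, by integrating the tangent line of \<open>t \<mapsto> t ^ n\<close>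
  at the norm of the mean.\<close>

lemma jensen_norm_power:
  fixes F :: "'a \<Rightarrow> 'b::{banach, second_countable_topology}"
  assumes [measurable]: "\<kappa> \<in> borel_measurable M" "F \<in> borel_measurable M"
    and \<kappa>: "\<And>y. 0 \<le> \<kappa> y" "(\<integral>\<^sup>+y. ennreal (\<kappa> y) \<partial>M) = 1"
    and int: "integrable M (\<lambda>y. \<kappa> y *\<^sub>R F y)"
    and tan: "\<And>t. 0 \<le> t \<Longrightarrow> c * t \<le> t ^ n + d" and eq: "c * m = m ^ n + d" and c: "0 \<le> c" and d: "0 \<le> d"
    and m: "m = norm (\<integral>y. \<kappa> y *\<^sub>R F y \<partial>M)"
  shows "ennreal (m ^ n) \<le> (\<integral>\<^sup>+y. ennreal (\<kappa> y) * ennreal (norm (F y) ^ n) \<partial>M)"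
proof -
  have m0: "0 \<le> m" by (simp add: m)
  have "ennreal (m ^ n) + ennreal d = ennreal (c * m)" using m0 d by (simp add: eq)
  also have "\<dots> = ennreal c * ennreal m" using c by (simp add: ennreal_mult')
  also have "\<dots> \<le> ennreal c * (\<integral>\<^sup>+y. ennreal (norm (\<kappa> y *\<^sub>R F y)) \<partial>M)"
    unfolding m by (intro mult_left_mono integral_norm_bound_ennreal int) auto
  also have "\<dots> = (\<integral>\<^sup>+y. ennreal c * ennreal (norm (\<kappa> y *\<^sub>R F y)) \<partial>M)"
    by (subst nn_integral_cmult) auto
  also have "\<dots> \<le> (\<integral>\<^sup>+y. ennreal (\<kappa> y) * ennreal (norm (F y) ^ n) + ennreal (\<kappa> y) * ennreal d \<partial>M)"
  proof (rule nn_integral_mono)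
    fix y
    have "ennreal c * ennreal (norm (\<kappa> y *\<^sub>R F y)) = ennreal (\<kappa> y * (c * norm (F y)))"
      using \<kappa>(1)[of y] c by (simp add: ennreal_mult[symmetric] mult.left_commute)
    also have "\<dots> \<le> ennreal (\<kappa> y * (norm (F y) ^ n + d))"
      by (intro ennreal_leI mult_left_mono tan \<kappa>) auto
    also have "\<dots> = ennreal (\<kappa> y) * ennreal (norm (F y) ^ n) + ennreal (\<kappa> y) * ennreal d"
      using \<kappa>(1)[of y] d by (simp add: distrib_left ennreal_mult)
    finally show "ennreal c * ennreal (norm (\<kappa> y *\<^sub>R F y))
      \<le> ennreal (\<kappa> y) * ennreal (norm (F y) ^ n) + ennreal (\<kappa> y) * ennreal d" .
  qed
  also have "\<dots> = (\<integral>\<^sup>+y. ennreal (\<kappa> y) * ennreal (norm (F y) ^ n) \<partial>M) + ennreal d"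
    by (subst nn_integral_add) (auto simp: nn_integral_multc \<kappa>(2))
  finally show ?thesis by simp
qed

lemma jensen_norm_2:
  fixes F :: "'a \<Rightarrow> 'b::{banach, second_countable_topology}"
  assumes "\<kappa> \<in> borel_measurable M" "F \<in> borel_measurable M"
    and "\<And>y. 0 \<le> \<kappa> y" "(\<integral>\<^sup>+y. ennreal (\<kappa> y) \<partial>M) = 1" "integrable M (\<lambda>y. \<kappa> y *\<^sub>R F y)"
  shows "ennreal (norm (\<integral>y. \<kappa> y *\<^sub>R F y \<partial>M) ^ 2) \<le> (\<integral>\<^sup>+y. ennreal (\<kappa> y) * ennreal (norm (F y) ^ 2) \<partial>M)"
proof -
  define m where "m = norm (\<integral>y. \<kappa> y *\<^sub>R F y \<partial>M)"
  show ?thesis unfolding m_def[symmetric]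
  proof (rule jensen_norm_power[OF assms, where c = "2 * m" and d = "m\<^sup>2"])
    fix t :: real
    have "0 \<le> (t - m)\<^sup>2" by simp
    then show "2 * m * t \<le> t\<^sup>2 + m\<^sup>2" by (simp add: power2_diff mult.commute mult.left_commute)
  qed (auto simp: m_def power2_eq_square)
qed

lemma jensen_norm_3:
  fixes F :: "'a \<Rightarrow> 'b::{banach, second_countable_topology}"
  assumes "\<kappa> \<in> borel_measurable M" "F \<in> borel_measurable M"
    and "\<And>y. 0 \<le> \<kappa> y" "(\<integral>\<^sup>+y. ennreal (\<kappa> y) \<partial>M) = 1" "integrable M (\<lambda>y. \<kappa> y *\<^sub>R F y)"
  shows "ennreal (norm (\<integral>y. \<kappa> y *\<^sub>R F y \<partial>M) ^ 3) \<le> (\<integral>\<^sup>+y. ennreal (\<kappa> y) * ennreal (norm (F y) ^ 3) \<partial>M)"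
proof -
  define m where "m = norm (\<integral>y. \<kappa> y *\<^sub>R F y \<partial>M)"
  have m0: "0 \<le> m" by (simp add: m_def)
  show ?thesis unfolding m_def[symmetric]
  proof (rule jensen_norm_power[OF assms, where c = "3 * m\<^sup>2" and d = "2 * m ^ 3"])
    fix t :: real assume t: "0 \<le> t"
    \<comment> \<open>The tangent of the cube at \<open>m\<close> is \<open>3 m^2 t - 2 m^3\<close>;
      the gap between the cube and this line factorises with the double zero
      \<open>m\<close>.\<close>
    have "0 \<le> (t - m)\<^sup>2 * (t + 2 * m)" using t m0 by simp
    also have "\<dots> = t ^ 3 + 2 * m ^ 3 - 3 * m\<^sup>2 * t" by (simp add: power2_eq_square power3_eq_cube algebra_simps)
    finally show "3 * m\<^sup>2 * t \<le> t ^ 3 + 2 * m ^ 3" by simp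
  qed (auto simp: m_def power2_eq_square power3_eq_cube)
qed

lemma Kern_bk: "0 < \<epsilon> \<Longrightarrow> \<epsilon> \<le> 1 \<Longrightarrow> \<exists>B. bk B (Kern \<epsilon>)"
  by (rule kern_bk[OF kern_Kern])

lemma Kern_measurable: "0 < \<epsilon> \<Longrightarrow> \<epsilon> \<le> 1 \<Longrightarrow> Kern \<epsilon> \<in> borel_measurable borel"
  by (rule kern_measurable[OF kern_Kern])

text \<open>Jensen for the probability density \<open>Kern\<close>, then Tonelli and shift
  invariance. Unlike the pointwise bound on convolutions, whose constant depends on the size of the
  kernel, this bound is uniform in \<open>\<epsilon>\<close>.\<close>

lemma conv_Kern_contraction:
  assumes e: "0 < \<epsilon>" "\<epsilon> \<le> 1" and f: "f \<in> Lsp"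
  shows "conv (Kern \<epsilon>) f \<in> Lsp" "nrm (conv (Kern \<epsilon>) f) \<le> nrm f"
proof -
  note [measurable] = LspD(2)[OF f] Kern_measurable[OF e]
  obtain B where B: "bk B (Kern \<epsilon>)" using Kern_bk[OF e] by blast
  have "(\<integral>\<^sup>+x. ennreal ((norm (conv (Kern \<epsilon>) f x))\<^sup>2) \<partial>muC)
     \<le> (\<integral>\<^sup>+x. \<integral>\<^sup>+y. ennreal (Kern \<epsilon> y) * ennreal ((norm (f (x - y)))\<^sup>2) \<partial>lborel \<partial>muC)"
  proof (rule nn_integral_mono)
    fix x
    show "ennreal ((norm (conv (Kern \<epsilon>) f x))\<^sup>2) \<le> (\<integral>\<^sup>+y. ennreal (Kern \<epsilon> y) * ennreal ((norm (f (x - y)))\<^sup>2) \<partial>lborel)"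
      unfolding conv_swap[OF Kern_measurable[OF e] LspD(2)[OF f]]
      by (rule jensen_norm_2[OF _ _ Kern_nonneg[OF e(1)] nn_integral_Kern[OF e] conv_integrable'[OF B f]]) measurable
  qed
  also have "\<dots> = (\<integral>\<^sup>+y. \<integral>\<^sup>+x. ennreal (Kern \<epsilon> y) * ennreal ((norm (f (x - y)))\<^sup>2) \<partial>muC \<partial>lborel)"
    by (rule muC_lborel.Fubini'[symmetric]) measurable
  also have "\<dots> = (\<integral>\<^sup>+y. ennreal (Kern \<epsilon> y) * ennreal ((nrm f)\<^sup>2) \<partial>lborel)"
  proof (rule nn_integral_cong)
    fix y
    have "(\<integral>\<^sup>+x. ennreal ((norm (f (x - y)))\<^sup>2) \<partial>muC) = (\<integral>\<^sup>+x. ennreal ((norm (f x))\<^sup>2) \<partial>muC)"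
      using nn_integral_muC_shift[OF per_compose[OF LspD(1)[OF f], of "\<lambda>v. ennreal ((norm v)\<^sup>2)"], of "- y"] by simp
    then show "(\<integral>\<^sup>+x. ennreal (Kern \<epsilon> y) * ennreal ((norm (f (x - y)))\<^sup>2) \<partial>muC) = ennreal (Kern \<epsilon> y) * ennreal ((nrm f)\<^sup>2)"
      by (subst nn_integral_cmult) (auto simp: nn_integral_nrm[OF f])
  qed
  also have "\<dots> = ennreal ((nrm f)\<^sup>2)"
    by (subst nn_integral_multc) (auto simp: nn_integral_Kern[OF e])
  finally have I: "(\<integral>\<^sup>+x. ennreal ((norm (conv (Kern \<epsilon>) f x))\<^sup>2) \<partial>muC) \<le> ennreal ((nrm f)\<^sup>2)" .
  show L: "conv (Kern \<epsilon>) f \<in> Lsp"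
  proof (rule LspI)
    show "per (conv (Kern \<epsilon>) f)" by (rule per_conv[OF _ _ LspD(1)[OF f]]) measurable
    show "conv (Kern \<epsilon>) f \<in> borel_measurable borel" by measurable
    show "(\<integral>\<^sup>+x. ennreal ((norm (conv (Kern \<epsilon>) f x))\<^sup>2) \<partial>muC) < \<infinity>" using I le_less_trans by fastforce
  qed
  show "nrm (conv (Kern \<epsilon>) f) \<le> nrm f" by (rule nrm_le[OF L nrm_nonneg I])
qed

text \<open>What survives when a tangential Schwartz field is reflected: the result need not be
  differentiable on the plane, but it stays Lipschitz and decays. The exponent 2 makes the decay
  integrable over the infinite strip.\<close>

definition nice :: "(real^3 \<Rightarrow> real^3) \<Rightarrow> bool" where
  "nice f \<longleftrightarrow> per f \<and> (\<exists>L\<ge>0. \<forall>x y. norm (f x - f y) \<le> L * norm (x - y)) \<and>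
     (\<exists>D\<ge>0. \<forall>x. norm (f x) \<le> D / (1 + \<bar>x $ 3\<bar>)\<^sup>2)"

lemma nice_continuous: assumes "nice f" shows "continuous_on UNIV f"
proof -
  obtain L where "0 \<le> L" "\<And>x y. norm (f x - f y) \<le> L * norm (x - y)" using assms by (auto simp: nice_def)
  then have "L-lipschitz_on UNIV f" by (auto simp: lipschitz_on_def dist_norm)
  then show ?thesis by (rule lipschitz_on_continuous_on)
qed

lemma nice_measurable: "nice f \<Longrightarrow> f \<in> borel_measurable borel"
  by (rule borel_measurable_continuous_onI[OF nice_continuous])

lemma nn_integral_decay: obtains W where "0 \<le> W" "(\<integral>\<^sup>+x. ennreal (1 / (1 + \<bar>x $ 3\<bar>)\<^sup>2) \<partial>muC) = ennreal W"
proof (cases "\<integral>\<^sup>+x. ennreal (1 / (1 + \<bar>x $ 3\<bar>)\<^sup>2) \<partial>muC" rule: ennreal_cases)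
  case (real r) then show thesis using that by blast
qed (use nn_integral_decay_finite in simp)

lemma nice_Lsp: assumes "nice f" shows "f \<in> Lsp"
proof (rule LspI)
  show "per f" "f \<in> borel_measurable borel" using assms nice_measurable by (auto simp: nice_def)
  obtain D where D: "0 \<le> D" "\<And>x. norm (f x) \<le> D / (1 + \<bar>x $ 3\<bar>)\<^sup>2" using assms by (auto simp: nice_def)
  have "(\<integral>\<^sup>+x. ennreal ((norm (f x))\<^sup>2) \<partial>muC) \<le> (\<integral>\<^sup>+x. ennreal (D\<^sup>2) * ennreal (1 / (1 + \<bar>x $ 3\<bar>)\<^sup>2) \<partial>muC)"
  proof (rule nn_integral_mono)
    fix x :: "real^3"
    let ?s = "(1 + \<bar>x $ 3\<bar>)\<^sup>2"
    have s: "1 \<le> ?s" by simp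
    have "(norm (f x))\<^sup>2 \<le> (D / ?s)\<^sup>2" using D(2) by (intro power_mono) auto
    also have "\<dots> = D\<^sup>2 * (1 / ?s) * (1 / ?s)" by (simp add: power2_eq_square)
    also have "\<dots> \<le> D\<^sup>2 * (1 / ?s)" using s by (intro mult_right_le_one_le) (auto simp: divide_le_eq_1)
    finally show "ennreal ((norm (f x))\<^sup>2) \<le> ennreal (D\<^sup>2) * ennreal (1 / ?s)"
      by (simp add: ennreal_mult[symmetric] ennreal_leI)
  qed
  also have "\<dots> = ennreal (D\<^sup>2) * (\<integral>\<^sup>+x. ennreal (1 / (1 + \<bar>x $ 3\<bar>)\<^sup>2) \<partial>muC)"
    by (subst nn_integral_cmult) auto
  also have "\<dots> < \<infinity>" using nn_integral_decay_finite by (auto simp: ennreal_mult_less_top)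
  finally show "(\<integral>\<^sup>+x. ennreal ((norm (f x))\<^sup>2) \<partial>muC) < \<infinity>" .
qed

lemma conv_Kern_minus_self:
  assumes e: "0 < \<epsilon>" "\<epsilon> \<le> 1" and f: "f \<in> Lsp" and c: "\<And>y. norm y \<le> \<epsilon> \<Longrightarrow> norm (f (x - y) - f x) \<le> c"
  shows "norm (conv (Kern \<epsilon>) f x - f x) \<le> c"
proof -
  note [measurable] = LspD(2)[OF f] Kern_measurable[OF e]
  obtain B where B: "bk B (Kern \<epsilon>)" using Kern_bk[OF e] by blast
  have i2: "integrable lborel (\<lambda>y. Kern \<epsilon> y *\<^sub>R f x)"
    using kern_integrable[OF kern_Kern[OF e]] by simp
  have c0: "0 \<le> c" using c[of 0] e by simp
  have "conv (Kern \<epsilon>) f x - f x = (\<integral>y. Kern \<epsilon> y *\<^sub>R f (x - y) \<partial>lborel) - (\<integral>y. Kern \<epsilon> y *\<^sub>R f x \<partial>lborel)"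
    using kern_integrable[OF kern_Kern[OF e]] by (simp add: conv_swap integral_Kern[OF e(1)])
  also have "\<dots> = (\<integral>y. Kern \<epsilon> y *\<^sub>R (f (x - y) - f x) \<partial>lborel)"
    using conv_integrable'[OF B f, of x] i2 by (simp add: scaleR_diff_right)
  also have "norm \<dots> \<le> (\<integral>y. Kern \<epsilon> y * c \<partial>lborel)"
  proof (rule Bochner_Integration.integral_norm_bound_integral)
    show "integrable lborel (\<lambda>y. Kern \<epsilon> y *\<^sub>R (f (x - y) - f x))"
      using conv_integrable'[OF B f, of x] i2 by (simp add: scaleR_diff_right)
    show "integrable lborel (\<lambda>y. Kern \<epsilon> y * c)" using kern_integrable[OF kern_Kern[OF e]] by simp
    show "norm (Kern \<epsilon> y *\<^sub>R (f (x - y) - f x)) \<le> Kern \<epsilon> y * c" for y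
      using c[of y] Kern_nonneg[OF e(1), of y] Kern_eq_0[OF e(1), of y] c0
      by (cases "norm y \<le> \<epsilon>") (auto intro: mult_left_mono)
  qed
  also have "\<dots> = c" using kern_integrable[OF kern_Kern[OF e]] by (simp add: integral_Kern[OF e(1)])
  finally show ?thesis .
qed

text \<open>The Lipschitz bound is small but not integrable at infinity, the decay bound is
  integrable but not small. The square of the error is bounded by the product of the two, hence the
  rate \<open>sqrt \<epsilon>\<close>.\<close>

lemma conv_Kern_nice:
  assumes f: "nice f" shows "\<exists>A\<ge>0. \<forall>\<epsilon>. 0 < \<epsilon> \<longrightarrow> \<epsilon> \<le> 1 \<longrightarrow> nrm (\<lambda>x. conv (Kern \<epsilon>) f x - f x) \<le> A * sqrt \<epsilon>"
proof -
  obtain L where L: "0 \<le> L" "\<And>x y. norm (f x - f y) \<le> L * norm (x - y)" using f by (auto simp: nice_def)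
  obtain D where D: "0 \<le> D" "\<And>x. norm (f x) \<le> D / (1 + \<bar>x $ 3\<bar>)\<^sup>2" using f by (auto simp: nice_def)
  obtain W where W: "0 \<le> W" "(\<integral>\<^sup>+x. ennreal (1 / (1 + \<bar>x $ 3\<bar>)\<^sup>2) \<partial>muC) = ennreal W" by (rule nn_integral_decay)
  note fL = nice_Lsp[OF f]
  have "nrm (\<lambda>x. conv (Kern \<epsilon>) f x - f x) \<le> sqrt (5 * L * D * W) * sqrt \<epsilon>" if e: "0 < \<epsilon>" "\<epsilon> \<le> 1" for \<epsilon>
  proof (rule nrm_le)
    show "(\<lambda>x. conv (Kern \<epsilon>) f x - f x) \<in> Lsp" by (intro Lsp_diff conv_Kern_contraction e fL)
    show "0 \<le> sqrt (5 * L * D * W) * sqrt \<epsilon>" using L D W e by simp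
    have pt: "(norm (conv (Kern \<epsilon>) f x - f x))\<^sup>2 \<le> (5 * L * D * \<epsilon>) * (1 / (1 + \<bar>x $ 3\<bar>)\<^sup>2)" for x
    proof -
      let ?s = "(1 + \<bar>x $ 3\<bar>)\<^sup>2"
      have "norm (conv (Kern \<epsilon>) f x - f x) \<le> L * \<epsilon>"
      proof (rule conv_Kern_minus_self[OF e fL])
        fix y :: "real^3" assume "norm y \<le> \<epsilon>"
        then show "norm (f (x - y) - f x) \<le> L * \<epsilon>"
          using L(2)[of "x - y" x] L(1) mult_left_mono[of "norm y" \<epsilon> L] by simp
      qed
      moreover have "norm (conv (Kern \<epsilon>) f x - f x) \<le> 5 * D / ?s"
      proof (rule conv_Kern_minus_self[OF e fL])
        fix y :: "real^3" assume y: "norm y \<le> \<epsilon>"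
        have "\<bar>y $ 3\<bar> \<le> 1" using y e component_le_norm_cart[of y 3] by simp
        moreover have "\<bar>x $ 3\<bar> \<le> \<bar>(x - y) $ 3\<bar> + \<bar>y $ 3\<bar>"
          using abs_triangle_ineq[of "(x - y) $ 3" "y $ 3"] by simp
        moreover have "0 \<le> \<bar>(x - y) $ 3\<bar>" by (rule abs_ge_zero)
        moreover have "a \<le> 1 \<Longrightarrow> b \<le> c + a \<Longrightarrow> 0 \<le> c \<Longrightarrow> 1 + b \<le> 2 * (1 + c)" for a b c :: real by auto
        \<comment> \<open>A displacement of at most 1 changes \<open>1 + |x3|\<close> by a factor of
          at most 2. Squared this is 4, so the two values of \<open>f\<close> contribute
          \<open>4 D\<close> and \<open>D\<close>, together the constant 5.\<close>
        ultimately have "1 + \<bar>x $ 3\<bar> \<le> 2 * (1 + \<bar>(x - y) $ 3\<bar>)" by blast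
        then have "?s \<le> (2 * (1 + \<bar>(x - y) $ 3\<bar>))\<^sup>2" by (intro power_mono) auto
        then have q: "?s \<le> 4 * (1 + \<bar>(x - y) $ 3\<bar>)\<^sup>2" by (simp only: power_mult_distrib) simp
        have "norm (f (x - y) - f x) \<le> norm (f (x - y)) + norm (f x)" by (rule norm_triangle_ineq4)
        also have "\<dots> \<le> D / (1 + \<bar>(x - y) $ 3\<bar>)\<^sup>2 + D / ?s" by (intro add_mono D(2))
        also have "D / (1 + \<bar>(x - y) $ 3\<bar>)\<^sup>2 = (4 * D) / (4 * (1 + \<bar>(x - y) $ 3\<bar>)\<^sup>2)" by simp
        also have "(4 * D) / (4 * (1 + \<bar>(x - y) $ 3\<bar>)\<^sup>2) \<le> (4 * D) / ?s"
          using D(1) q by (intro divide_left_mono mult_pos_pos) (auto intro: add_pos_nonneg)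
        also have "4 * D / ?s + D / ?s = 5 * D / ?s" by (simp add: add_divide_distrib[symmetric])
        finally show "norm (f (x - y) - f x) \<le> 5 * D / ?s" by simp
      qed
      ultimately have "norm (conv (Kern \<epsilon>) f x - f x) * norm (conv (Kern \<epsilon>) f x - f x) \<le> (L * \<epsilon>) * (5 * D / ?s)"
        using L(1) e by (intro mult_mono) auto
      then show ?thesis by (simp add: power2_eq_square[of "norm _"] mult.commute mult.left_commute)
    qed
    have "(\<integral>\<^sup>+x. ennreal ((norm (conv (Kern \<epsilon>) f x - f x))\<^sup>2) \<partial>muC)
        \<le> (\<integral>\<^sup>+x. ennreal (5 * L * D * \<epsilon>) * ennreal (1 / (1 + \<bar>x $ 3\<bar>)\<^sup>2) \<partial>muC)"
      using pt L D e by (intro nn_integral_mono) (simp add: ennreal_mult[symmetric] ennreal_leI)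
    also have "\<dots> = ennreal (5 * L * D * \<epsilon>) * ennreal W" by (subst nn_integral_cmult) (auto simp: W)
    also have "\<dots> = ennreal ((sqrt (5 * L * D * W) * sqrt \<epsilon>)\<^sup>2)"
      using L D W e by (simp add: ennreal_mult[symmetric] power_mult_distrib mult.commute mult.left_commute)
    finally show "(\<integral>\<^sup>+x. ennreal ((norm (conv (Kern \<epsilon>) f x - f x))\<^sup>2) \<partial>muC) \<le> ennreal ((sqrt (5 * L * D * W) * sqrt \<epsilon>)\<^sup>2)" .
  qed
  then show ?thesis using L D W by (intro exI[of _ "sqrt (5 * L * D * W)"]) auto
qed

text \<open>Approximation by a nice field in three terms: contraction bounds the mollified error by
  the error itself, and the middle term has a rate.\<close>

lemma conv_Kern_tendsto:
  assumes f: "f \<in> Lsp" and ap: "\<And>e. 0 < e \<Longrightarrow> \<exists>\<phi>. nice \<phi> \<and> nrm (\<lambda>x. f x - \<phi> x) < e"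
    and d: "\<And>n. 0 < d n" "\<And>n. d n \<le> 1" "d \<longlonglongrightarrow> 0"
  shows "(\<lambda>n. nrm (\<lambda>x. conv (Kern (d n)) f x - f x)) \<longlonglongrightarrow> 0"
proof (rule LIMSEQ_I)
  fix r :: real assume r: "0 < r"
  obtain \<phi> where \<phi>: "nice \<phi>" "nrm (\<lambda>x. f x - \<phi> x) < r / 3" using ap[of "r / 3"] r by auto
  note pL = nice_Lsp[OF \<phi>(1)]
  obtain A where A: "0 \<le> A" "\<And>\<epsilon>. 0 < \<epsilon> \<Longrightarrow> \<epsilon> \<le> 1 \<Longrightarrow> nrm (\<lambda>x. conv (Kern \<epsilon>) \<phi> x - \<phi> x) \<le> A * sqrt \<epsilon>"
    using conv_Kern_nice[OF \<phi>(1)] by blast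
  have "(\<lambda>n. A * sqrt (d n)) \<longlonglongrightarrow> A * sqrt 0" by (intro tendsto_intros d)
  then obtain N where N: "\<And>n. N \<le> n \<Longrightarrow> \<bar>A * sqrt (d n)\<bar> < r / 3"
    using LIMSEQ_D[of "\<lambda>n. A * sqrt (d n)" 0 "r / 3"] r by auto
  show "\<exists>no. \<forall>n\<ge>no. norm (nrm (\<lambda>x. conv (Kern (d n)) f x - f x) - 0) < r"
  proof (intro exI allI impI)
    fix n assume n: "N \<le> n"
    obtain B where B: "bk B (Kern (d n))" using Kern_bk[OF d(1,2)] by blast
    let ?K = "conv (Kern (d n))"
    have eq: "?K f x - f x = ?K (\<lambda>x. f x - \<phi> x) x + ((?K \<phi> x - \<phi> x) + (\<phi> x - f x))" for x
      by (simp add: conv_diff[OF B f pL])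
    have L1: "?K (\<lambda>x. f x - \<phi> x) \<in> Lsp" "(\<lambda>x. ?K \<phi> x - \<phi> x) \<in> Lsp" "(\<lambda>x. \<phi> x - f x) \<in> Lsp"
      by (intro conv_Kern_contraction d Lsp_diff f pL)+
    have "nrm (\<lambda>x. ?K f x - f x) \<le> nrm (?K (\<lambda>x. f x - \<phi> x)) + nrm (\<lambda>x. (?K \<phi> x - \<phi> x) + (\<phi> x - f x))"
      unfolding eq by (rule nrm_triangle[OF L1(1) Lsp_add[OF L1(2,3)]])
    also have "nrm (\<lambda>x. (?K \<phi> x - \<phi> x) + (\<phi> x - f x)) \<le> nrm (\<lambda>x. ?K \<phi> x - \<phi> x) + nrm (\<lambda>x. \<phi> x - f x)"
      by (rule nrm_triangle[OF L1(2,3)])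
    also have "nrm (?K (\<lambda>x. f x - \<phi> x)) \<le> nrm (\<lambda>x. f x - \<phi> x)"
      by (intro conv_Kern_contraction d Lsp_diff f pL)
    also have "nrm (\<lambda>x. ?K \<phi> x - \<phi> x) \<le> A * sqrt (d n)" by (rule A(2)[OF d(1,2)])
    also have "nrm (\<lambda>x. \<phi> x - f x) = nrm (\<lambda>x. f x - \<phi> x)" by (rule nrm_minus_commute)
    finally have "nrm (\<lambda>x. ?K f x - f x) \<le> nrm (\<lambda>x. f x - \<phi> x) + (A * sqrt (d n) + nrm (\<lambda>x. f x - \<phi> x))"
      by simp
    then show "norm (nrm (\<lambda>x. ?K f x - f x) - 0) < r" using \<phi>(2) N[OF n] by simp
  qed
qed

section \<open>The trilinear flux form\<close>

text \<open>For \<open>g = grad (Kern \<epsilon>)\<close> the inner convolution is the derivative at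
  \<open>x\<close> of the mollified \<open>f\<close> in the direction \<open>p x\<close>. So
  \<open>Tri g p q f\<close> is the integral of the contraction of \<open>p (x) q\<close> with the
  gradient of the mollified \<open>f\<close>, the nonlinear term of the weak formulation.\<close>

definition Tri :: "(real^3 \<Rightarrow> real^3) \<Rightarrow> (real^3 \<Rightarrow> real^3) \<Rightarrow> (real^3 \<Rightarrow> real^3) \<Rightarrow> (real^3 \<Rightarrow> real^3) \<Rightarrow> real" where
  "Tri g p q f = (\<integral>x. q x \<bullet> conv (\<lambda>y. g y \<bullet> p x) f x \<partial>muC)"

lemma Tri_integrand_bound:
  assumes g: "bkv B g" and f: "f \<in> Lsp"
  shows "\<bar>q x \<bullet> conv (\<lambda>y. g y \<bullet> p x) f x\<bar> \<le> (8 * B * nrm f) * (norm (p x) * norm (q x))"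
proof -
  have "\<bar>q x \<bullet> conv (\<lambda>y. g y \<bullet> p x) f x\<bar> \<le> norm (q x) * norm (conv (\<lambda>y. g y \<bullet> p x) f x)"
    by (rule Cauchy_Schwarz_ineq2)
  also have "\<dots> \<le> norm (q x) * (8 * (B * norm (p x)) * nrm f)"
    by (intro mult_left_mono conv_norm_le[OF bk_inner[OF g] f]) auto
  finally show ?thesis by (simp add: algebra_simps)
qed

lemma Tri_integrable:
  assumes g: "bkv B g" and p: "p \<in> Lsp" and q: "q \<in> Lsp" and f: "f \<in> Lsp"
  shows "integrable muC (\<lambda>x. q x \<bullet> conv (\<lambda>y. g y \<bullet> p x) f x)"
proof -
  note [measurable] = LspD(2)[OF f] LspD(2)[OF p] LspD(2)[OF q] bkvD(2)[OF g]
  have "integrable muC (\<lambda>x. (8 * B * nrm f) * (norm (p x) * norm (q x)))"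
    by (intro integrable_mult_right Lsp_integrable_norm_mult p q)
  then show ?thesis
  proof (rule Bochner_Integration.integrable_bound)
    show "(\<lambda>x. q x \<bullet> conv (\<lambda>y. g y \<bullet> p x) f x) \<in> borel_measurable muC" unfolding conv_def by measurable
  qed (use Tri_integrand_bound[OF g f, of q _ p] bkvD(1)[OF g] in \<open>auto intro!: AE_I2 simp: abs_mult\<close>)
qed

lemma Tri_bound:
  assumes g: "bkv B g" and p: "p \<in> Lsp" and q: "q \<in> Lsp" and f: "f \<in> Lsp"
  shows "\<bar>Tri g p q f\<bar> \<le> 8 * B * nrm p * nrm q * nrm f"
proof -
  have "\<bar>Tri g p q f\<bar> \<le> (\<integral>x. (8 * B * nrm f) * (norm (p x) * norm (q x)) \<partial>muC)"
    unfolding Tri_def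
    by (rule order_trans[OF integral_abs_bound integral_mono])
       (auto intro!: integrable_abs Tri_integrable[OF assms] integrable_mult_right Lsp_integrable_norm_mult p q
          Tri_integrand_bound[OF g f])
  also have "\<dots> = (8 * B * nrm f) * (\<integral>x. norm (p x) * norm (q x) \<partial>muC)" by simp
  also have "\<dots> \<le> (8 * B * nrm f) * (nrm p * nrm q)"
    using bkvD(1)[OF g] by (intro mult_left_mono Lsp_integral_norm_mult p q) auto
  finally show ?thesis by (simp add: algebra_simps)
qed

lemma Tri_diff_1:
  assumes g: "bkv B g" and p: "p \<in> Lsp" "p' \<in> Lsp" and q: "q \<in> Lsp" and f: "f \<in> Lsp"
  shows "Tri g (\<lambda>x. p x - p' x) q f = Tri g p q f - Tri g p' q f"
proof -
  have "conv (\<lambda>y. g y \<bullet> (p x - p' x)) f x = conv (\<lambda>y. g y \<bullet> p x) f x - conv (\<lambda>y. g y \<bullet> p' x) f x" for x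
    unfolding conv_def using conv_integrable[OF bk_inner[OF g] f]
    by (simp add: inner_diff_right scaleR_diff_left)
  then show ?thesis unfolding Tri_def
    using Tri_integrable[OF g p(1) q f] Tri_integrable[OF g p(2) q f] by (simp add: inner_diff_right)
qed

lemma Tri_diff_2:
  assumes g: "bkv B g" and p: "p \<in> Lsp" and q: "q \<in> Lsp" "q' \<in> Lsp" and f: "f \<in> Lsp"
  shows "Tri g p (\<lambda>x. q x - q' x) f = Tri g p q f - Tri g p q' f"
  unfolding Tri_def using Tri_integrable[OF g p q(1) f] Tri_integrable[OF g p q(2) f] by (simp add: inner_diff_left)

lemma Tri_diff_3:
  assumes g: "bkv B g" and p: "p \<in> Lsp" and q: "q \<in> Lsp" and f: "f \<in> Lsp" "f' \<in> Lsp"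
  shows "Tri g p q (\<lambda>x. f x - f' x) = Tri g p q f - Tri g p q f'"
  unfolding Tri_def conv_diff[OF bk_inner[OF g] f]
  using Tri_integrable[OF g p q f(1)] Tri_integrable[OF g p q f(2)] by (simp add: inner_diff_right)

text \<open>One slot is exchanged at a time; this needs convergence in norm, since weak convergence
  does not pass through a product of two slots at the same point.\<close>

lemma Tri_tendsto:
  assumes g: "bkv B g" and w: "\<And>n. w n \<in> Lsp" and u: "u \<in> Lsp" and f: "\<And>n. f n \<in> Lsp" "f' \<in> Lsp"
    and lim: "(\<lambda>n. nrm (\<lambda>x. w n x - u x)) \<longlonglongrightarrow> 0" "(\<lambda>n. nrm (\<lambda>x. f n x - f' x)) \<longlonglongrightarrow> 0"
    and le: "\<And>n. nrm (w n) \<le> M" "\<And>n. nrm (f n) \<le> M" "nrm u \<le> M"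
  shows "(\<lambda>n. Tri g (w n) (w n) (f n)) \<longlonglongrightarrow> Tri g u u f'"
proof -
  have M: "0 \<le> M" using le(3) nrm_nonneg order_trans by blast
  have B: "0 \<le> B" using g bkvD(1) by blast
  have "\<bar>Tri g (w n) (w n) (f n) - Tri g u u f'\<bar>
      \<le> 8 * B * M\<^sup>2 * (2 * nrm (\<lambda>x. w n x - u x) + nrm (\<lambda>x. f n x - f' x))" for n
  proof -
    let ?d = "\<lambda>x. w n x - u x" and ?e = "\<lambda>x. f n x - f' x"
    have d: "?d \<in> Lsp" "?e \<in> Lsp" by (intro Lsp_diff w u f)+
    have "Tri g (w n) (w n) (f n) - Tri g u u f'
        = Tri g ?d (w n) (f n) + Tri g u ?d (f n) + Tri g u u ?e"
      by (simp add: Tri_diff_1[OF g w u w f(1)] Tri_diff_2[OF g u w u f(1)] Tri_diff_3[OF g u u f])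
    then have "\<bar>Tri g (w n) (w n) (f n) - Tri g u u f'\<bar>
        \<le> \<bar>Tri g ?d (w n) (f n)\<bar> + \<bar>Tri g u ?d (f n)\<bar> + \<bar>Tri g u u ?e\<bar>" by linarith
    also have "\<dots> \<le> 8 * B * nrm ?d * nrm (w n) * nrm (f n) + 8 * B * nrm u * nrm ?d * nrm (f n) + 8 * B * nrm u * nrm u * nrm ?e"
      by (intro add_mono Tri_bound[OF g] d w u f)
    also have "\<dots> \<le> 8 * B * nrm ?d * M * M + 8 * B * M * nrm ?d * M + 8 * B * M * M * nrm ?e"
      using B M by (intro add_mono mult_mono le) auto
    finally show ?thesis by (simp add: algebra_simps power2_eq_square)
  qed
  moreover have "(\<lambda>n. 8 * B * M\<^sup>2 * (2 * nrm (\<lambda>x. w n x - u x) + nrm (\<lambda>x. f n x - f' x))) \<longlonglongrightarrow> 0"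
  proof -
  have "(\<lambda>n. 8 * B * M\<^sup>2 * (2 * nrm (\<lambda>x. w n x - u x) + nrm (\<lambda>x. f n x - f' x))) \<longlonglongrightarrow> 8 * B * M\<^sup>2 * (2 * 0 + 0)"
    by (intro tendsto_intros lim)
  then show ?thesis by (simp only: mult_zero_right add_0_right)
  qed
  ultimately have "(\<lambda>n. Tri g (w n) (w n) (f n) - Tri g u u f') \<longlonglongrightarrow> 0"
    unfolding real_norm_def[symmetric] by (rule Lim_null_comparison[OF always_eventually[OF allI]])
  then show ?thesis by (simp add: LIM_zero_iff)
qed

section \<open>Exchanging convolutions with integrals in space\<close>

lemma conv_nn_bound':
  assumes \<kappa>: "bk B \<kappa>" and f: "f \<in> Lsp"
  shows "(\<integral>\<^sup>+y. ennreal (norm (\<kappa> y *\<^sub>R f (x - y))) \<partial>lborel) \<le> ennreal (8 * B * nrm f)"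
proof -
  note [measurable] = LspD(2)[OF f] bkD(2)[OF \<kappa>]
  have "(\<integral>\<^sup>+y. ennreal (norm (\<kappa> y *\<^sub>R f (x - y))) \<partial>lborel) = (\<integral>\<^sup>+y. ennreal (norm (\<kappa> (- y) *\<^sub>R f (y + x))) \<partial>lborel)"
    using nn_integral_lborel_neg[of "\<lambda>y. ennreal (norm (\<kappa> (- y) *\<^sub>R f (y + x)))"] by simp
  also have "\<dots> = (\<integral>\<^sup>+z. ennreal (norm (\<kappa> (x - z) *\<^sub>R f z)) \<partial>lborel)"
    using nn_integral_lborel_shift[of "\<lambda>z. ennreal (norm (\<kappa> (x - z) *\<^sub>R f z))" x] by simp
  also note conv_nn_bound[OF assms]
  finally show ?thesis .
qed

lemma Lsp_shift:
  assumes f: "f \<in> Lsp" shows "(\<lambda>x. f (x - y)) \<in> Lsp" "nrm (\<lambda>x. f (x - y)) = nrm f"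
proof -
  note [measurable] = LspD(2)[OF f]
  have p: "per (\<lambda>x. (norm (f x))\<^sup>2)" by (rule per_compose[OF LspD(1)[OF f]])
  show "(\<lambda>x. f (x - y)) \<in> Lsp"
    using integral_muC_shift(2)[OF p, of "- y"] LspD(3)[OF f] per_shift_diff[OF LspD(1)[OF f]]
    by (simp add: Lsp_def)
  show "nrm (\<lambda>x. f (x - y)) = nrm f"
    using integral_muC_shift(1)[OF p, of "- y"] by (simp add: nrm_def)
qed

lemma muC_lborel_integrableI:
  fixes H :: "real^3 \<Rightarrow> real^3 \<Rightarrow> real"
  assumes [measurable]: "(\<lambda>(x, y). H x y) \<in> borel_measurable (muC \<Otimes>\<^sub>M lborel)"
    and K: "\<And>y. (\<integral>\<^sup>+x. ennreal \<bar>H x y\<bar> \<partial>muC) \<le> ennreal K * indicator (cball 0 2) y"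
  shows "integrable (muC \<Otimes>\<^sub>M lborel) (\<lambda>(x, y). H x y)"
  unfolding integrable_iff_bounded
proof
  have "(\<integral>\<^sup>+z. ennreal (norm ((\<lambda>(x, y). H x y) z)) \<partial>(muC \<Otimes>\<^sub>M lborel)) = (\<integral>\<^sup>+y. \<integral>\<^sup>+x. ennreal \<bar>H x y\<bar> \<partial>muC \<partial>lborel)"
    by (subst muC_lborel.nn_integral_snd[symmetric]) (auto simp: split_beta)
  also have "\<dots> \<le> (\<integral>\<^sup>+y. ennreal K * indicator (cball 0 2) (y::real^3) \<partial>lborel)"
    by (intro nn_integral_mono K)
  also have "\<dots> < \<infinity>"
    using emeasure_lborel_cball_finite[of "0::real^3" 2]
    by (subst nn_integral_cmult_indicator) (auto simp: ennreal_mult_less_top)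
  finally show "(\<integral>\<^sup>+z. ennreal (norm ((\<lambda>(x, y). H x y) z)) \<partial>(muC \<Otimes>\<^sub>M lborel)) < \<infinity>" .
qed measurable

text \<open>After Fubini the shift \<open>x + y\<close> swaps the two fields and changes the sign of
  \<open>y\<close>, which an even kernel does not notice.\<close>

lemma conv_symmetric:
  assumes \<kappa>: "bk B \<kappa>" and even: "\<And>y. \<kappa> (- y) = \<kappa> y" and f: "f \<in> Lsp" and h: "h \<in> Lsp"
  shows "(\<integral>x. f x \<bullet> conv \<kappa> h x \<partial>muC) = (\<integral>x. h x \<bullet> conv \<kappa> f x \<partial>muC)"
proof -
  have main: "(\<integral>x. f x \<bullet> conv \<kappa> h x \<partial>muC) = (\<integral>y. \<integral>x. \<kappa> y * (f x \<bullet> h (x - y)) \<partial>muC \<partial>lborel)"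
    if f: "f \<in> Lsp" and h: "h \<in> Lsp" for f h
  proof -
    note [measurable] = LspD(2)[OF f] LspD(2)[OF h] bkD(2)[OF \<kappa>]
    have "(\<integral>x. f x \<bullet> conv \<kappa> h x \<partial>muC) = (\<integral>x. \<integral>y. \<kappa> y * (f x \<bullet> h (x - y)) \<partial>lborel \<partial>muC)"
    proof (rule Bochner_Integration.integral_cong[OF refl])
      fix x
      have "f x \<bullet> conv \<kappa> h x = (\<integral>y. f x \<bullet> (\<kappa> y *\<^sub>R h (x - y)) \<partial>lborel)"
        unfolding conv_swap[OF bkD(2)[OF \<kappa>] LspD(2)[OF h]]
        by (rule integral_inner_right[symmetric]) (use conv_integrable'[OF \<kappa> h] in auto)
      then show "f x \<bullet> conv \<kappa> h x = (\<integral>y. \<kappa> y * (f x \<bullet> h (x - y)) \<partial>lborel)" by simp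
    qed
    also have "\<dots> = (\<integral>y. \<integral>x. \<kappa> y * (f x \<bullet> h (x - y)) \<partial>muC \<partial>lborel)"
    proof (rule muC_lborel.Fubini_integral[symmetric], rule muC_lborel_integrableI)
      fix y
      show "(\<integral>\<^sup>+x. ennreal \<bar>\<kappa> y * (f x \<bullet> h (x - y))\<bar> \<partial>muC) \<le> ennreal (B * (nrm f * nrm h)) * indicator (cball 0 2) y"
      proof (cases "norm y \<le> 2")
        case True
        have "(\<integral>\<^sup>+x. ennreal \<bar>\<kappa> y * (f x \<bullet> h (x - y))\<bar> \<partial>muC) \<le> (\<integral>\<^sup>+x. ennreal B * ennreal (norm (f x) * norm (h (x - y))) \<partial>muC)"
          using bkD(1)[OF \<kappa>] bkD(3)[OF \<kappa>, of y]
          by (intro nn_integral_mono) (auto simp: ennreal_mult[symmetric] abs_mult intro!: ennreal_leI mult_mono Cauchy_Schwarz_ineq2)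
        also have "\<dots> = ennreal B * ennreal (\<integral>x. norm (f x) * norm (h (x - y)) \<partial>muC)"
          by (subst nn_integral_cmult, simp)
             (subst nn_integral_eq_integral[OF Lsp_integrable_norm_mult[OF f Lsp_shift(1)[OF h]]], auto)
        also have "\<dots> \<le> ennreal B * ennreal (nrm f * nrm h)"
          using Lsp_integral_norm_mult[OF f Lsp_shift(1)[OF h, of y]]
          by (intro mult_left_mono ennreal_leI) (auto simp: Lsp_shift(2)[OF h])
        finally show ?thesis using True bkD(1)[OF \<kappa>] by (simp add: ennreal_mult)
      qed (use bkD(4)[OF \<kappa>] in simp)
    qed measurable
    finally show ?thesis .
  qed
  note [measurable] = LspD(2)[OF f] LspD(2)[OF h] bkD(2)[OF \<kappa>]
  let ?J = "\<lambda>y. \<integral>x. \<kappa> y * (h x \<bullet> f (x - y)) \<partial>muC"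
  have "(\<integral>x. \<kappa> y * (f x \<bullet> h (x - y)) \<partial>muC) = ?J (- y)" for y
  proof -
    have "per (\<lambda>x. \<kappa> y * (h x \<bullet> f (x + y)))"
      using LspD(1)[OF h] per_shift[OF LspD(1)[OF f], of y] by (simp add: horiz_periodic_on_def)
    from integral_muC_shift(1)[OF this, of "- y"] show ?thesis by (simp add: even inner_commute)
  qed
  then have "(\<integral>x. f x \<bullet> conv \<kappa> h x \<partial>muC) = (\<integral>y. ?J (- y) \<partial>lborel)" by (simp add: main[OF f h])
  also have "\<dots> = (\<integral>y. ?J y \<partial>lborel)" by (rule integral_lborel_neg) measurable
  finally show ?thesis by (simp add: main[OF h f])
qed

lemma bk_norm: "bkv B g \<Longrightarrow> bk B (\<lambda>y. norm (g y))"
  by (auto simp: bkv_def bk_def)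

lemma bkv_inner_integrable:
  assumes g: "bkv B g" and f: "f \<in> Lsp" shows "integrable lborel (\<lambda>y. g y \<bullet> f (x - y))"
proof (rule Bochner_Integration.integrable_bound[OF conv_integrable'[OF bk_norm[OF g] f]])
  note [measurable] = LspD(2)[OF f] bkvD(2)[OF g]
  show "(\<lambda>y. g y \<bullet> f (x - y)) \<in> borel_measurable lborel" by measurable
qed (auto intro!: AE_I2 Cauchy_Schwarz_ineq2)

lemma bkv_inner_bound:
  assumes g: "bkv B g" and f: "f \<in> Lsp"
  shows "\<bar>\<integral>y. g y \<bullet> f (x - y) \<partial>lborel\<bar> \<le> 8 * B * nrm f"
proof -
  note [measurable] = LspD(2)[OF f] bkvD(2)[OF g]
  have "ennreal (norm (\<integral>y. g y \<bullet> f (x - y) \<partial>lborel)) \<le> (\<integral>\<^sup>+y. ennreal (norm (g y \<bullet> f (x - y))) \<partial>lborel)"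
    by (rule integral_norm_bound_ennreal[OF bkv_inner_integrable[OF assms]])
  also have "\<dots> \<le> (\<integral>\<^sup>+y. ennreal (norm (norm (g y) *\<^sub>R f (x - y))) \<partial>lborel)"
    by (intro nn_integral_mono ennreal_leI) (auto intro!: Cauchy_Schwarz_ineq2)
  also have "\<dots> \<le> ennreal (8 * B * nrm f)" by (rule conv_nn_bound'[OF bk_norm[OF g] f])
  finally show ?thesis using bkvD(1)[OF g] by simp
qed

text \<open>Both operations are convolutions and commute by Fubini; after the exchange the inner
  integral is the hypothesis at the shifted point \<open>x - z\<close>.\<close>

lemma divfree_conv:
  assumes \<kappa>: "kern \<kappa>" and g: "bkv B g" and f: "f \<in> Lsp" and c: "conv \<kappa> f \<in> Lsp"
    and div: "\<And>x. (\<integral>y. g y \<bullet> f (x - y) \<partial>lborel) = 0"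
  shows "(\<integral>y. g y \<bullet> conv \<kappa> f (x - y) \<partial>lborel) = 0"
proof -
  obtain B' where B': "bk B' \<kappa>" using kern_bk[OF \<kappa>] by blast
  note [measurable] = LspD(2)[OF f] bkvD(2)[OF g] bkD(2)[OF B']
  have "(\<integral>y. g y \<bullet> conv \<kappa> f (x - y) \<partial>lborel) = (\<integral>y. \<integral>z. \<kappa> z * (g y \<bullet> f (x - y - z)) \<partial>lborel \<partial>lborel)"
  proof (rule Bochner_Integration.integral_cong[OF refl])
    fix y
    have "g y \<bullet> conv \<kappa> f (x - y) = (\<integral>z. g y \<bullet> (\<kappa> z *\<^sub>R f (x - y - z)) \<partial>lborel)"
      unfolding conv_swap[OF bkD(2)[OF B'] LspD(2)[OF f]]
      by (rule integral_inner_right[symmetric]) (use conv_integrable'[OF B' f] in auto)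
    then show "g y \<bullet> conv \<kappa> f (x - y) = (\<integral>z. \<kappa> z * (g y \<bullet> f (x - y - z)) \<partial>lborel)" by simp
  qed
  also have "\<dots> = (\<integral>z. \<integral>y. \<kappa> z * (g y \<bullet> f (x - y - z)) \<partial>lborel \<partial>lborel)"
  proof (rule lborel_pair.Fubini_integral[symmetric])
    show "integrable (lborel \<Otimes>\<^sub>M lborel) (\<lambda>(y, z). \<kappa> z * (g y \<bullet> f (x - y - z)))"
      unfolding integrable_iff_bounded
    proof
      have "(\<integral>\<^sup>+p. ennreal (norm ((\<lambda>(y, z). \<kappa> z * (g y \<bullet> f (x - y - z))) p)) \<partial>(lborel \<Otimes>\<^sub>M lborel))
        = (\<integral>\<^sup>+z. \<integral>\<^sup>+y. ennreal \<bar>\<kappa> z * (g y \<bullet> f (x - y - z))\<bar> \<partial>lborel \<partial>lborel)"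
        by (subst lborel_pair.nn_integral_snd[symmetric]) (auto simp: split_beta)
      also have "\<dots> \<le> (\<integral>\<^sup>+z. ennreal \<bar>\<kappa> z\<bar> * ennreal (8 * B * nrm f) \<partial>lborel)"
      proof (rule nn_integral_mono)
        fix z
        have "(\<integral>\<^sup>+y. ennreal \<bar>\<kappa> z * (g y \<bullet> f (x - y - z))\<bar> \<partial>lborel)
          \<le> (\<integral>\<^sup>+y. ennreal \<bar>\<kappa> z\<bar> * ennreal (norm (norm (g y) *\<^sub>R f ((x - z) - y))) \<partial>lborel)"
          by (intro nn_integral_mono)
             (auto simp: ennreal_mult[symmetric] abs_mult diff_diff_eq add.commute intro!: ennreal_leI mult_left_mono Cauchy_Schwarz_ineq2)
        also have "\<dots> = ennreal \<bar>\<kappa> z\<bar> * (\<integral>\<^sup>+y. ennreal (norm (norm (g y) *\<^sub>R f ((x - z) - y))) \<partial>lborel)"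
          by (subst nn_integral_cmult) auto
        also have "\<dots> \<le> ennreal \<bar>\<kappa> z\<bar> * ennreal (8 * B * nrm f)"
          by (intro mult_left_mono conv_nn_bound'[OF bk_norm[OF g] f]) auto
        finally show "(\<integral>\<^sup>+y. ennreal \<bar>\<kappa> z * (g y \<bullet> f (x - y - z))\<bar> \<partial>lborel) \<le> ennreal \<bar>\<kappa> z\<bar> * ennreal (8 * B * nrm f)" .
      qed
      also have "\<dots> = (\<integral>\<^sup>+z. ennreal \<bar>\<kappa> z\<bar> \<partial>lborel) * ennreal (8 * B * nrm f)"
        by (subst nn_integral_multc) auto
      also have "\<dots> < \<infinity>"
        using kern_integrable[OF \<kappa>] by (auto simp: integrable_iff_bounded ennreal_mult_less_top)
      finally show "(\<integral>\<^sup>+p. ennreal (norm ((\<lambda>(y, z). \<kappa> z * (g y \<bullet> f (x - y - z))) p)) \<partial>(lborel \<Otimes>\<^sub>M lborel)) < \<infinity>" .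
    qed measurable
  qed
  also have "\<dots> = 0"
    using div by (simp add: diff_diff_eq add.commute) (simp add: diff_diff_eq[symmetric])
  finally show ?thesis .
qed

section \<open>The Duchon--Robert identity\<close>

text \<open>For a divergence free field the flux is a third order moment of increments: expanding
  the integrand on the right, the two terms with all factors at the same point cancel, the two with exactly two factors
  at the same point and the remaining one contracted with \<open>g\<close> vanish as \<open>w\<close> is divergence free, and the other two are
  equal to the flux because \<open>g\<close> is odd.\<close>

lemma Duchon_Robert:
  assumes g: "bkv B g" and odd: "\<And>y. g (- y) = - g y" and w: "w \<in> Lsp" and W: "\<And>x. norm (w x) \<le> W"
    and div: "\<And>x. (\<integral>y. g y \<bullet> w (x - y) \<partial>lborel) = 0"
  shows "ennreal (4 * \<bar>Tri g w w w\<bar>)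
     \<le> (\<integral>\<^sup>+y. ennreal (norm (g y)) * (\<integral>\<^sup>+x. ennreal (norm (w (x - y) - w x) ^ 3) \<partial>muC) \<partial>lborel)"
proof -
  note [measurable] = LspD(2)[OF w] bkvD(2)[OF g]
  define n2 where "n2 x = (norm (w x))\<^sup>2" for x
  have n2m [measurable]: "n2 \<in> borel_measurable borel" unfolding n2_def by measurable
  have W0: "0 \<le> W" using W norm_ge_zero order_trans by blast
  have B0: "0 \<le> B" using g by (rule bkvD(1))
  have n2i: "integrable muC n2" using LspD(3)[OF w] by (simp add: n2_def[abs_def])
  have pn2: "per n2" using per_compose[OF LspD(1)[OF w], of "\<lambda>v. (norm v)\<^sup>2"] by (simp add: n2_def[abs_def])
  have n2i': "integrable muC (\<lambda>x. n2 (x - y))" for y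
    using integral_muC_shift(2)[OF pn2, of "- y"] n2i by simp
  have gw: "\<bar>g y \<bullet> w x\<bar> \<le> B * W" for x y
  proof -
    have "\<bar>g y \<bullet> w x\<bar> \<le> norm (g y) * norm (w x)" by (rule Cauchy_Schwarz_ineq2)
    also have "\<dots> \<le> B * W" using bkvD(3)[OF g] W B0 by (intro mult_mono) auto
    finally show ?thesis .
  qed
  have ww: "\<bar>w x \<bullet> w z\<bar> \<le> n2 x + n2 z" for x z
  proof -
    have "0 \<le> (norm (w x) - norm (w z))\<^sup>2" "0 \<le> norm (w x) * norm (w z)" by simp_all
    then have "norm (w x) * norm (w z) \<le> n2 x + n2 z" unfolding n2_def power2_diff by linarith
    then show ?thesis using Cauchy_Schwarz_ineq2 order_trans by blast
  qed
  \<comment> \<open>Membership in \<open>Lsp\<close> controls quadratic expressions only. The third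
    factor is absorbed by the sup bound \<open>W\<close>, which is why the identity is applied to
    mollified fields.\<close>
  have int: "integrable muC (\<lambda>x. (g y \<bullet> w (p x)) * h x)"
    if [measurable]: "p \<in> borel_measurable borel" "h \<in> borel_measurable borel" and h: "\<And>x. \<bar>h x\<bar> \<le> n2 x + n2 (x - y)" for p y h
  proof (rule Bochner_Integration.integrable_bound)
    show "integrable muC (\<lambda>x. B * W * (n2 x + n2 (x - y)))" using n2i n2i' by simp
    show "AE x in muC. norm ((g y \<bullet> w (p x)) * h x) \<le> norm (B * W * (n2 x + n2 (x - y)))"
    proof (intro AE_I2)
      fix x
      have "\<bar>(g y \<bullet> w (p x)) * h x\<bar> \<le> B * W * (n2 x + n2 (x - y))"
        unfolding abs_mult using gw h B0 W0 by (intro mult_mono) auto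
      then show "norm ((g y \<bullet> w (p x)) * h x) \<le> norm (B * W * (n2 x + n2 (x - y)))" by simp
    qed
  qed measurable
  have n20: "0 \<le> n2 x" for x by (simp add: n2_def)
  define a where "a y = (\<integral>x. (g y \<bullet> w x) * (w x \<bullet> w (x - y)) \<partial>muC)" for y
  define c where "c y = (\<integral>x. (g y \<bullet> w (x - y)) * n2 x \<partial>muC)" for y
  define E where "E y = (\<integral>x. (g y \<bullet> (w (x - y) - w x)) * (norm (w (x - y) - w x))\<^sup>2 \<partial>muC)" for y
  have a': "(\<integral>x. (g y \<bullet> w (x - y)) * (w x \<bullet> w (x - y)) \<partial>muC) = - a (- y)" for y
  proof -
    have "per (\<lambda>x. (g y \<bullet> w x) * (w (x + y) \<bullet> w x))"
      using LspD(1)[OF w] per_shift[OF LspD(1)[OF w], of y] by (simp add: horiz_periodic_on_def)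
    from integral_muC_shift(1)[OF this, of "- y"] show ?thesis
      by (simp add: a_def odd inner_commute)
  qed
  have c': "(\<integral>x. (g y \<bullet> w x) * n2 (x - y) \<partial>muC) = - c (- y)" for y
  proof -
    have "per (\<lambda>x. (g y \<bullet> w (x + y)) * n2 x)"
      using pn2 per_shift[OF LspD(1)[OF w], of y] by (simp add: horiz_periodic_on_def)
    from integral_muC_shift(1)[OF this, of "- y"] show ?thesis by (simp add: c_def odd)
  qed
  have t: "(\<integral>x. (g y \<bullet> w (x - y)) * n2 (x - y) \<partial>muC) = (\<integral>x. (g y \<bullet> w x) * n2 x \<partial>muC)" for y
  proof -
    have "per (\<lambda>x. (g y \<bullet> w x) * n2 x)"
      using pn2 LspD(1)[OF w] by (simp add: horiz_periodic_on_def)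
    from integral_muC_shift(1)[OF this, of "- y"] show ?thesis by simp
  qed
  have E: "E y = 2 * a y + 2 * a (- y) + c y + c (- y)" for y
  proof -
    have "E y = (\<integral>x. (g y \<bullet> w (x - y)) * n2 (x - y) - 2 * ((g y \<bullet> w (x - y)) * (w x \<bullet> w (x - y)))
        + (g y \<bullet> w (x - y)) * n2 x - (g y \<bullet> w x) * n2 (x - y)
        + 2 * ((g y \<bullet> w x) * (w x \<bullet> w (x - y))) - (g y \<bullet> w x) * n2 x \<partial>muC)"
      unfolding E_def
      by (rule Bochner_Integration.integral_cong)
         (auto simp: n2_def power2_norm_eq_inner inner_diff_left inner_diff_right inner_commute algebra_simps)
    also have "\<dots> = (\<integral>x. (g y \<bullet> w (x - y)) * n2 (x - y) \<partial>muC) - 2 * (\<integral>x. (g y \<bullet> w (x - y)) * (w x \<bullet> w (x - y)) \<partial>muC)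
        + c y - (\<integral>x. (g y \<bullet> w x) * n2 (x - y) \<partial>muC) + 2 * a y - (\<integral>x. (g y \<bullet> w x) * n2 x \<partial>muC)"
      unfolding a_def c_def
      using int[of "\<lambda>x. x - y" "\<lambda>x. n2 (x - y)" y] int[of "\<lambda>x. x - y" "\<lambda>x. w x \<bullet> w (x - y)" y]
        int[of "\<lambda>x. x - y" "\<lambda>x. n2 x" y] int[of "\<lambda>x. x" "\<lambda>x. n2 (x - y)" y]
        int[of "\<lambda>x. x" "\<lambda>x. w x \<bullet> w (x - y)" y] int[of "\<lambda>x. x" "\<lambda>x. n2 x" y] ww n20
      by simp
    finally show ?thesis by (simp add: a' c' t)
  qed
  have ni: "(\<integral>\<^sup>+x. ennreal (n2 x) \<partial>muC) = ennreal ((nrm w)\<^sup>2)"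
    using nn_integral_nrm[OF w] by (simp add: n2_def)
  have ia: "integrable (muC \<Otimes>\<^sub>M lborel) (\<lambda>(x, y). (g y \<bullet> w x) * (w x \<bullet> w (x - y)))"
    and ic: "integrable (muC \<Otimes>\<^sub>M lborel) (\<lambda>(x, y). (g y \<bullet> w (x - y)) * n2 x)"
  proof -
    have *: "(\<integral>\<^sup>+x. ennreal \<bar>(g y \<bullet> w (p x)) * h x\<bar> \<partial>muC) \<le> ennreal (B * W * (2 * (nrm w)\<^sup>2)) * indicator (cball 0 2) y"
      if [measurable]: "p \<in> borel_measurable borel" "h \<in> borel_measurable borel" and h: "\<And>x. \<bar>h x\<bar> \<le> n2 x + n2 (x - y)" for p y h
    proof (cases "norm y \<le> 2")
      case True
      have "(\<integral>\<^sup>+x. ennreal \<bar>(g y \<bullet> w (p x)) * h x\<bar> \<partial>muC) \<le> (\<integral>\<^sup>+x. ennreal (B * W) * (ennreal (n2 x) + ennreal (n2 (x - y))) \<partial>muC)"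
      proof (rule nn_integral_mono)
        fix x
        have "\<bar>(g y \<bullet> w (p x)) * h x\<bar> \<le> B * W * (n2 x + n2 (x - y))"
          unfolding abs_mult using gw h B0 W0 by (intro mult_mono) auto
        then show "ennreal \<bar>(g y \<bullet> w (p x)) * h x\<bar> \<le> ennreal (B * W) * (ennreal (n2 x) + ennreal (n2 (x - y)))"
          using B0 W0 n20 by (simp add: ennreal_mult[symmetric] ennreal_plus[symmetric] ennreal_leI del: ennreal_plus)
      qed
      also have "\<dots> = ennreal (B * W) * (ennreal ((nrm w)\<^sup>2) + ennreal ((nrm w)\<^sup>2))"
        using nn_integral_muC_shift[OF per_compose[OF pn2, of ennreal], of "- y"]
        by (subst nn_integral_cmult) (auto simp: nn_integral_add ni)
      also have "\<dots> = ennreal (B * W * (2 * (nrm w)\<^sup>2))"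
        using B0 W0 by (simp add: ennreal_mult[symmetric] ennreal_plus[symmetric] del: ennreal_plus)
      finally show ?thesis using True by simp
    qed (use bkvD(4)[OF g] in simp)
    show "integrable (muC \<Otimes>\<^sub>M lborel) (\<lambda>(x, y). (g y \<bullet> w x) * (w x \<bullet> w (x - y)))"
      by (rule muC_lborel_integrableI, measurable) (rule *[of "\<lambda>x. x"], auto intro: ww)
    show "integrable (muC \<Otimes>\<^sub>M lborel) (\<lambda>(x, y). (g y \<bullet> w (x - y)) * n2 x)"
      by (rule muC_lborel_integrableI, measurable) (rule *, auto simp: n20)
  qed
  have inta: "integrable lborel a" unfolding a_def[abs_def] using muC_lborel.integrable_snd[OF ia] by simp
  have intc: "integrable lborel c" unfolding c_def[abs_def] using muC_lborel.integrable_snd[OF ic] by simp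
  have [measurable]: "a \<in> borel_measurable borel" "c \<in> borel_measurable borel"
    using inta intc by (auto dest: borel_measurable_integrable)
  have inta': "integrable lborel (\<lambda>y. a (- y))" and intc': "integrable lborel (\<lambda>y. c (- y))"
    using inta intc integrable_lborel_neg[of a] integrable_lborel_neg[of c] by auto
  have Ta: "Tri g w w w = (\<integral>y. a y \<partial>lborel)"
  proof -
    have "Tri g w w w = (\<integral>x. \<integral>y. (g y \<bullet> w x) * (w x \<bullet> w (x - y)) \<partial>lborel \<partial>muC)"
      unfolding Tri_def
    proof (rule Bochner_Integration.integral_cong[OF refl])
      fix x
      have "w x \<bullet> conv (\<lambda>y. g y \<bullet> w x) w x = (\<integral>y. w x \<bullet> ((g y \<bullet> w x) *\<^sub>R w (x - y)) \<partial>lborel)"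
        unfolding conv_swap[OF bkD(2)[OF bk_inner[OF g]] LspD(2)[OF w]]
        by (rule integral_inner_right[symmetric]) (use conv_integrable'[OF bk_inner[OF g] w] in auto)
      then show "w x \<bullet> conv (\<lambda>y. g y \<bullet> w x) w x = (\<integral>y. (g y \<bullet> w x) * (w x \<bullet> w (x - y)) \<partial>lborel)" by simp
    qed
    also have "\<dots> = (\<integral>y. a y \<partial>lborel)"
      unfolding a_def by (rule muC_lborel.Fubini_integral[OF ia, symmetric])
    finally show ?thesis .
  qed
  have c0: "(\<integral>y. c y \<partial>lborel) = 0"
    unfolding c_def using muC_lborel.Fubini_integral[OF ic] by (simp add: div)
  have "(\<integral>y. E y \<partial>lborel) = 2 * (\<integral>y. a y \<partial>lborel) + 2 * (\<integral>y. a (- y) \<partial>lborel) + (\<integral>y. c y \<partial>lborel) + (\<integral>y. c (- y) \<partial>lborel)"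
    unfolding E using inta inta' intc intc' by simp
  then have ET: "(\<integral>y. E y \<partial>lborel) = 4 * Tri g w w w"
    using integral_lborel_neg[of a] integral_lborel_neg[of c] by (simp add: Ta c0)
  have Ei: "integrable lborel E" unfolding E[abs_def] using inta inta' intc intc' by simp
  have "ennreal (4 * \<bar>Tri g w w w\<bar>) = ennreal (norm (\<integral>y. E y \<partial>lborel))" by (simp add: ET abs_mult)
  also have "\<dots> \<le> (\<integral>\<^sup>+y. ennreal (norm (E y)) \<partial>lborel)" by (rule integral_norm_bound_ennreal[OF Ei])
  also have "\<dots> \<le> (\<integral>\<^sup>+y. ennreal (norm (g y)) * (\<integral>\<^sup>+x. ennreal (norm (w (x - y) - w x) ^ 3) \<partial>muC) \<partial>lborel)"
  proof (rule nn_integral_mono)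
    fix y
    have "ennreal (norm (E y)) \<le> (\<integral>\<^sup>+x. ennreal (norm ((g y \<bullet> (w (x - y) - w x)) * (norm (w (x - y) - w x))\<^sup>2)) \<partial>muC)"
    \<comment> \<open>If the cubic integrand were not integrable, its Bochner integral would be 0 by
      convention and the bound trivial.\<close>
    proof (cases "integrable muC (\<lambda>x. (g y \<bullet> (w (x - y) - w x)) * (norm (w (x - y) - w x))\<^sup>2)")
      case True
      then show ?thesis unfolding E_def by (rule integral_norm_bound_ennreal)
    qed (simp add: E_def not_integrable_integral_eq)
    also have "\<dots> \<le> (\<integral>\<^sup>+x. ennreal (norm (g y)) * ennreal (norm (w (x - y) - w x) ^ 3) \<partial>muC)"
    proof (rule nn_integral_mono)
      fix x
      have "norm ((g y \<bullet> (w (x - y) - w x)) * (norm (w (x - y) - w x))\<^sup>2)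
        \<le> (norm (g y) * norm (w (x - y) - w x)) * (norm (w (x - y) - w x))\<^sup>2"
        by (simp add: abs_mult Cauchy_Schwarz_ineq2 mult_right_mono)
      then show "ennreal (norm ((g y \<bullet> (w (x - y) - w x)) * (norm (w (x - y) - w x))\<^sup>2))
        \<le> ennreal (norm (g y)) * ennreal (norm (w (x - y) - w x) ^ 3)"
        by (simp add: ennreal_mult[symmetric] power3_eq_cube power2_eq_square mult.assoc ennreal_leI)
    qed
    also have "\<dots> = ennreal (norm (g y)) * (\<integral>\<^sup>+x. ennreal (norm (w (x - y) - w x) ^ 3) \<partial>muC)"
      by (subst nn_integral_cmult) auto
    finally show "ennreal (norm (E y)) \<le> ennreal (norm (g y)) * (\<integral>\<^sup>+x. ennreal (norm (w (x - y) - w x) ^ 3) \<partial>muC)" .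
  qed
  finally show ?thesis .
qed

section \<open>Reflections of tangential Schwartz fields\<close>

lemma AE_nth_3_neq: "AE x in lborel. (x::real^3) $ 3 \<noteq> c"
proof -
  have "negligible {x::real^3. x $ 3 = c}" using negligible_standard_hyperplane[of "axis 3 1 :: real^3" c] by (simp add: axis_Basis inner_axis)
  then have "AE x in lebesgue. x \<notin> {x::real^3. x $ 3 = c}"
    by (simp only: negligible_iff_null_sets AE_not_in)
  then show ?thesis by (simp add: AE_completion_iff)
qed

definition refl_ext :: "(real^3 \<Rightarrow> real^3) \<Rightarrow> real^3 \<Rightarrow> real^3" where
  "refl_ext \<phi> x = (if 0 \<le> x $ 3 then \<phi> x else reflect (\<phi> (reflect x)))"

text \<open>The divergence is required to vanish above the plane only. Elements of
  \<open>H_sigma_D\<close> are limits of restrictions of Schwartz fields whose extension below the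
  plane is unconstrained, and only on the open half-space do the derivatives of the restriction and
  of its extension agree.\<close>

definition tangential :: "(real^3 \<Rightarrow> real^3) \<Rightarrow> bool" where
  "tangential \<Phi> \<longleftrightarrow> \<Phi> \<in> schwartz \<and> (\<forall>x. x $ 3 = 0 \<longrightarrow> \<Phi> x $ 3 = 0) \<and>
     (\<forall>x. 0 < x $ 3 \<longrightarrow> (\<Sum>i\<in>UNIV. frechet_derivative \<Phi> (at x) (axis i 1) $ i) = 0)"

lemma schwartz_differentiable: "\<Phi> \<in> schwartz \<Longrightarrow> set bs \<subseteq> Basis \<Longrightarrow> pderivs UNIV bs \<Phi> differentiable at x"
  by (auto simp: schwartz_def smooth_within_def differentiable_on_def)

lemma schwartz_bound:
  assumes "\<Phi> \<in> schwartz" "set bs \<subseteq> Basis"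
  shows "\<exists>D\<ge>0. \<forall>x. norm (pderivs UNIV bs \<Phi> x) * \<bar>x $ 3\<bar> ^ k \<le> D"
proof -
  have "bdd_above (range (\<lambda>x. norm (pderivs UNIV bs \<Phi> x) * \<bar>x $ 3\<bar> ^ k))"
    using assms by (auto simp: schwartz_def)
  then obtain D where D: "\<And>x. norm (pderivs UNIV bs \<Phi> x) * \<bar>x $ 3\<bar> ^ k \<le> D"
    by (auto simp: bdd_above_def)
  have "0 \<le> D" using D[of 0] by (rule order_trans[rotated]) simp
  with D show ?thesis by blast
qed

lemma schwartz_lipschitz:
  assumes S: "\<Phi> \<in> schwartz" shows "\<exists>L\<ge>0. \<forall>x y. norm (\<Phi> x - \<Phi> y) \<le> L * norm (x - y)"
proof -
  have "\<forall>b. \<exists>D. b \<in> Basis \<longrightarrow> 0 \<le> D \<and> (\<forall>x. norm (frechet_derivative \<Phi> (at x) b) \<le> D)"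
    using schwartz_bound[OF S, of "[_]" 0] by auto
  then obtain D where D: "\<And>b. b \<in> Basis \<Longrightarrow> 0 \<le> D b"
      "\<And>b x. b \<in> Basis \<Longrightarrow> norm (frechet_derivative \<Phi> (at x) b) \<le> D b" by metis
  define L where "L = (\<Sum>b\<in>Basis. D b)"
  have L0: "0 \<le> L" unfolding L_def by (intro sum_nonneg D)
  have d: "(\<Phi> has_derivative frechet_derivative \<Phi> (at x)) (at x)" for x
    using schwartz_differentiable[OF S, of "[]"] by (simp add: frechet_derivative_works)
  have "norm (frechet_derivative \<Phi> (at x) h) \<le> norm h * L" for x h
  proof -
    have lin: "linear (frechet_derivative \<Phi> (at x))" using d has_derivative_linear by blast
    have "frechet_derivative \<Phi> (at x) h = frechet_derivative \<Phi> (at x) (\<Sum>b\<in>Basis. (h \<bullet> b) *\<^sub>R b)"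
      by (simp only: euclidean_representation)
    also have "\<dots> = (\<Sum>b\<in>Basis. (h \<bullet> b) *\<^sub>R frechet_derivative \<Phi> (at x) b)"
      by (simp only: linear_sum[OF lin] linear_scale[OF lin])
    also have "norm \<dots> \<le> (\<Sum>b\<in>Basis. norm h * D b)"
      by (rule sum_norm_le) (auto intro!: mult_mono Basis_le_norm D)
    finally show ?thesis by (simp add: L_def sum_distrib_left)
  qed
  then have "onorm (frechet_derivative \<Phi> (at x)) \<le> L" for x
    using L0 by (intro onorm_bound) (simp_all add: mult.commute)
  then have "norm (\<Phi> x - \<Phi> y) \<le> L * norm (x - y)" for x y
    by (intro differentiable_bound[of UNIV \<Phi> "\<lambda>x. frechet_derivative \<Phi> (at x)"]) (use d in auto)
  with L0 show ?thesis by blast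
qed

lemma norm_axis_real: "norm (axis i c :: real^'n) = \<bar>c\<bar>"
  by (simp add: norm_eq_sqrt_inner inner_axis_axis)

lemma reflect_fixed: "x $ 3 = 0 \<Longrightarrow> reflect x = x"
  by (auto simp: vec_eq_iff)

lemma refl_ext_reflect:
  assumes "\<And>x. x $ 3 = 0 \<Longrightarrow> \<phi> x $ 3 = 0"
  shows "refl_ext \<phi> (reflect x) = reflect (refl_ext \<phi> x)"
  using assms[of x] by (cases "x $ 3 = 0") (auto simp: refl_ext_def reflect_fixed)

lemma per_refl_ext:
  assumes "per \<phi>" shows "per (refl_ext \<phi>)"
proof (rule perI_lat)
  fix m n x
  have "reflect (lat m n) = lat m n" by (rule reflect_fixed) simp
  then show "refl_ext \<phi> (x + lat m n) = refl_ext \<phi> x"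
    by (simp add: refl_ext_def reflect_add per_lat[OF assms])
qed

lemma refl_ext_decay:
  assumes S: "\<Phi> \<in> schwartz"
  shows "\<exists>D\<ge>0. \<forall>x. norm (refl_ext \<Phi> x) * \<bar>x $ 3\<bar> ^ k \<le> D"
proof -
  obtain D where D: "0 \<le> D" "\<And>x. norm (\<Phi> x) * \<bar>x $ 3\<bar> ^ k \<le> D"
    using schwartz_bound[OF S, of "[]" k] by auto
  have "norm (refl_ext \<Phi> x) * \<bar>x $ 3\<bar> ^ k \<le> D" for x
    using D(2)[of x] D(2)[of "reflect x"] by (auto simp: refl_ext_def)
  with D(1) show ?thesis by blast
qed

lemma nice_refl_ext:
  assumes t: "tangential \<Phi>" shows "nice (refl_ext \<Phi>)"
  unfolding nice_def
proof (intro conjI)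
  have S: "\<Phi> \<in> schwartz" and b: "\<And>x. x $ 3 = 0 \<Longrightarrow> \<Phi> x $ 3 = 0" using t by (auto simp: tangential_def)
  show "per (refl_ext \<Phi>)" using S by (intro per_refl_ext) (auto simp: schwartz_def)
  obtain L where L: "0 \<le> L" "\<And>x y. norm (\<Phi> x - \<Phi> y) \<le> L * norm (x - y)" using schwartz_lipschitz[OF S] by blast
  \<comment> \<open>Across the plane \<open>y\<close> is replaced by its mirror image, which is no
    farther from \<open>x\<close>. What remains is twice the normal component at the image; it
    vanishes at the foot \<open>?p\<close> on the plane, so it is at most \<open>L\<close> times the
    height. Together \<open>L + 2 L\<close>.\<close>
  have opp: "norm (\<Phi> x - reflect (\<Phi> (reflect y))) \<le> (3 * L) * norm (x - y)" if xy: "0 \<le> x $ 3" "y $ 3 < 0" for x y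
  proof -
    let ?z = "reflect y" and ?p = "(\<chi> i. if i = 3 then 0 else y $ i) :: real^3"
    have "\<bar>(x - ?z) $ i\<bar> \<le> \<bar>(x - y) $ i\<bar>" for i using xy by (auto simp: abs_if)
    then have n1: "norm (x - ?z) \<le> norm (x - y)" by (intro norm_le_componentwise_cart) auto
    have zp: "?z - ?p = axis 3 (- y $ 3)" by (auto simp: vec_eq_iff axis_def)
    have "norm (?z - ?p) = \<bar>y $ 3\<bar>" unfolding zp by (simp add: norm_axis_real)
    also have "\<dots> \<le> \<bar>(x - y) $ 3\<bar>" using xy by simp
    also have "\<dots> \<le> norm (x - y)" by (rule component_le_norm_cart)
    finally have n2: "norm (?z - ?p) \<le> norm (x - y)" .
    have "\<Phi> ?z - reflect (\<Phi> ?z) = axis 3 (2 * \<Phi> ?z $ 3)" by (auto simp: vec_eq_iff axis_def)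
    then have "norm (\<Phi> ?z - reflect (\<Phi> ?z)) = 2 * \<bar>\<Phi> ?z $ 3\<bar>" by (simp add: norm_axis_real abs_mult)
    also have "\<bar>\<Phi> ?z $ 3\<bar> = \<bar>(\<Phi> ?z - \<Phi> ?p) $ 3\<bar>" using b[of ?p] by simp
    also have "\<dots> \<le> norm (\<Phi> ?z - \<Phi> ?p)" by (rule component_le_norm_cart)
    also have "\<dots> \<le> L * norm (?z - ?p)" by (rule L(2))
    also have "\<dots> \<le> L * norm (x - y)" by (rule mult_left_mono[OF n2 L(1)])
    finally have 2: "norm (\<Phi> ?z - reflect (\<Phi> ?z)) \<le> 2 * (L * norm (x - y))" by simp
    have "norm (\<Phi> x - \<Phi> ?z) \<le> L * norm (x - ?z)" by (rule L(2))
    also have "\<dots> \<le> L * norm (x - y)" by (rule mult_left_mono[OF n1 L(1)])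
    finally have 1: "norm (\<Phi> x - \<Phi> ?z) \<le> L * norm (x - y)" .
    have "norm (\<Phi> x - reflect (\<Phi> ?z)) \<le> norm (\<Phi> x - \<Phi> ?z) + norm (\<Phi> ?z - reflect (\<Phi> ?z))"
      using norm_triangle_ineq[of "\<Phi> x - \<Phi> ?z" "\<Phi> ?z - reflect (\<Phi> ?z)"] by simp
    with 1 2 show ?thesis by (simp add: algebra_simps)
  qed
  have "norm (refl_ext \<Phi> x - refl_ext \<Phi> y) \<le> (3 * L) * norm (x - y)" for x y
  proof -
    have LL: "L * norm v \<le> 3 * L * norm v" for v :: "real^3" using L(1) by (simp add: mult_right_mono)
    consider "0 \<le> x $ 3" "0 \<le> y $ 3" | "0 \<le> x $ 3" "y $ 3 < 0" | "x $ 3 < 0" "0 \<le> y $ 3" | "x $ 3 < 0" "y $ 3 < 0"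
      by linarith
    then show ?thesis
    proof cases
      case 1 then show ?thesis using order_trans[OF L(2) LL] by (simp add: refl_ext_def)
    next
      case 2 then show ?thesis using opp by (simp add: refl_ext_def)
    next
      case 3 then show ?thesis using opp[of y x] by (simp add: refl_ext_def norm_minus_commute)
    next
      case 4
      have "norm (\<Phi> (reflect x) - \<Phi> (reflect y)) \<le> 3 * L * norm (x - y)"
        using order_trans[OF L(2) LL, of "reflect x" "reflect y"] by (simp flip: reflect_diff)
      with 4 show ?thesis by (simp add: refl_ext_def flip: reflect_diff)
    qed
  qed
  then show "\<exists>L\<ge>0. \<forall>x y. norm (refl_ext \<Phi> x - refl_ext \<Phi> y) \<le> L * norm (x - y)"
    using L(1) by (intro exI[of _ "3 * L"]) auto
  obtain D0 where D0: "0 \<le> D0" "\<And>x. norm (refl_ext \<Phi> x) * \<bar>x $ 3\<bar> ^ 0 \<le> D0"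
    using refl_ext_decay[OF S] by blast
  obtain D2 where D2: "0 \<le> D2" "\<And>x. norm (refl_ext \<Phi> x) * \<bar>x $ 3\<bar> ^ 2 \<le> D2"
    using refl_ext_decay[OF S] by blast
  have "norm (refl_ext \<Phi> x) \<le> (2 * D0 + 2 * D2) / (1 + \<bar>x $ 3\<bar>)\<^sup>2" for x
  proof -
    let ?a = "\<bar>x $ 3\<bar>" and ?f = "norm (refl_ext \<Phi> x)"
    \<comment> \<open>This splits the quadratic weight into the Schwartz bounds of orders 0 and
      2.\<close>
    have "(1 + ?a)\<^sup>2 \<le> 2 + 2 * ?a\<^sup>2" using zero_le_power2[of "1 - ?a"] by (simp add: power2_sum power2_diff)
    then have "?f * (1 + ?a)\<^sup>2 \<le> ?f * (2 + 2 * ?a\<^sup>2)" by (intro mult_left_mono) auto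
    also have "\<dots> \<le> 2 * D0 + 2 * D2" using D0(2)[of x] D2(2)[of x] by (simp add: algebra_simps)
    finally show ?thesis by (simp add: pos_le_divide_eq add_pos_nonneg)
  qed
  then show "\<exists>D\<ge>0. \<forall>x. norm (refl_ext \<Phi> x) \<le> D / (1 + \<bar>x $ 3\<bar>)\<^sup>2"
    using D0(1) D2(1) by (intro exI[of _ "2 * D0 + 2 * D2"]) auto
qed

section \<open>The divergence of mollified reflections\<close>

lemma difference_quotient_LIMSEQ:
  fixes f :: "'a::real_normed_vector \<Rightarrow> 'b::real_normed_vector"
  assumes "(f has_derivative D) (at z)"
  shows "(\<lambda>n. real (Suc n) *\<^sub>R (f (z + (1 / real (Suc n)) *\<^sub>R v) - f z)) \<longlonglongrightarrow> D v"
proof -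
  have "((\<lambda>t. z + t *\<^sub>R v) has_derivative (\<lambda>t. t *\<^sub>R v)) (at (0::real))" by (auto intro!: derivative_eq_intros)
  then have "((\<lambda>t. f (z + t *\<^sub>R v)) has_derivative (\<lambda>t. D (t *\<^sub>R v))) (at 0)"
    by (rule has_derivative_compose) (use assms in simp)
  then have "((\<lambda>t. (f (z + t *\<^sub>R v) - f z - t *\<^sub>R D v) /\<^sub>R \<bar>t\<bar>) \<longlongrightarrow> 0) (at 0)"
    using has_derivative_linear[OF assms] by (simp add: has_derivative_at_within linear_scale)
  moreover have "filterlim (\<lambda>n. 1 / real (Suc n)) (at 0) sequentially"
    by (intro filterlim_atI lim_1_over_n[THEN LIMSEQ_Suc] always_eventually) auto
  ultimately have "(\<lambda>n. (f (z + (1 / real (Suc n)) *\<^sub>R v) - f z - (1 / real (Suc n)) *\<^sub>R D v) /\<^sub>R \<bar>1 / real (Suc n)\<bar>) \<longlonglongrightarrow> 0"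
    by (rule filterlim_compose)
  moreover have "(f (z + (1 / real (Suc n)) *\<^sub>R v) - f z - (1 / real (Suc n)) *\<^sub>R D v) /\<^sub>R \<bar>1 / real (Suc n)\<bar>
      = real (Suc n) *\<^sub>R (f (z + (1 / real (Suc n)) *\<^sub>R v) - f z) - D v" for n
    by (simp add: scaleR_diff_right del: of_nat_Suc)
  ultimately show ?thesis by (simp only: LIM_zero_iff)
qed

lemma difference_quotient_bound:
  fixes f :: "'a::real_normed_vector \<Rightarrow> 'b::real_normed_vector"
  assumes "\<And>x y. norm (f x - f y) \<le> L * norm (x - y)" "norm v = 1"
  shows "norm (real (Suc n) *\<^sub>R (f (z + (1 / real (Suc n)) *\<^sub>R v) - f z)) \<le> L"
proof -
  have "norm (f (z + (1 / real (Suc n)) *\<^sub>R v) - f z) \<le> L * (1 / real (Suc n))"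
    using assms(1)[of "z + (1 / real (Suc n)) *\<^sub>R v" z] by (simp add: assms(2) del: of_nat_Suc)
  then have "real (Suc n) * norm (f (z + (1 / real (Suc n)) *\<^sub>R v) - f z) \<le> real (Suc n) * (L * (1 / real (Suc n)))"
    by (intro mult_left_mono) auto
  then show ?thesis by (simp del: of_nat_Suc)
qed

lemma refl_ext_has_derivative:
  assumes S: "\<Phi> \<in> schwartz"
  shows "0 < z $ 3 \<Longrightarrow> (refl_ext \<Phi> has_derivative frechet_derivative \<Phi> (at z)) (at z)"
    and "z $ 3 < 0 \<Longrightarrow> (refl_ext \<Phi> has_derivative (\<lambda>h. reflect (frechet_derivative \<Phi> (at (reflect z)) (reflect h)))) (at z)"
proof -
  have d: "(\<Phi> has_derivative frechet_derivative \<Phi> (at x)) (at x)" for x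
    using schwartz_differentiable[OF S, of "[]"] by (simp add: frechet_derivative_works)
  show "(refl_ext \<Phi> has_derivative frechet_derivative \<Phi> (at z)) (at z)" if "0 < z $ 3"
  proof (rule has_derivative_transform_within_open[OF d])
    show "open {x::real^3. 0 < x $ 3}" by (intro open_Collect_less continuous_intros)
  qed (use that in \<open>auto simp: refl_ext_def\<close>)
  show "(refl_ext \<Phi> has_derivative (\<lambda>h. reflect (frechet_derivative \<Phi> (at (reflect z)) (reflect h)))) (at z)" if "z $ 3 < 0"
  proof (rule has_derivative_transform_within_open)
    show "((\<lambda>x. reflect (\<Phi> (reflect x))) has_derivative (\<lambda>h. reflect (frechet_derivative \<Phi> (at (reflect z)) (reflect h)))) (at z)"
      by (intro bounded_linear.has_derivative[OF bounded_linear_reflect] has_derivative_compose[OF _ d]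
          bounded_linear_imp_has_derivative bounded_linear_reflect)
    show "open {x::real^3. x $ 3 < 0}" by (intro open_Collect_less continuous_intros)
  qed (use that in \<open>auto simp: refl_ext_def\<close>)
qed

text \<open>Weak divergence, tested with the kernel, and classical divergence of the mollification
  are the same number; this allows passing between them in both directions.\<close>

lemma divergence_conv:
  assumes k: "kern \<kappa>" and f: "f \<in> Lsp"
  shows "(\<Sum>i\<in>UNIV. frechet_derivative (conv \<kappa> f) (at x) (axis i 1) $ i) = (\<integral>y. grad \<kappa> y \<bullet> f (x - y) \<partial>lborel)"
proof -
  obtain B where B: "bkv B (grad \<kappa>)" using kern_grad_bkv[OF k] by blast
  note [measurable] = bkvD(2)[OF B] LspD(2)[OF f]
  have i: "integrable lborel (\<lambda>y. (grad \<kappa> y \<bullet> axis i 1) *\<^sub>R f (x - y))" for i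
    by (rule conv_integrable'[OF bk_inner[OF B] f])
  have i': "integrable lborel (\<lambda>y. grad \<kappa> y $ i * f (x - y) $ i)" for i
    using integrable_inner_left[of "axis i 1", OF i[of i]] by (simp add: inner_axis)
  have "frechet_derivative (conv \<kappa> f) (at x) (axis i 1) $ i = (\<integral>y. grad \<kappa> y $ i * f (x - y) $ i \<partial>lborel)" for i
  proof -
    have "frechet_derivative (conv \<kappa> f) (at x) (axis i 1) = (\<integral>y. (grad \<kappa> y \<bullet> axis i 1) *\<^sub>R f (x - y) \<partial>lborel)"
      unfolding frechet_derivative_eq[OF conv_has_derivative[OF k f]]
      by (rule conv_swap[OF bkD(2)[OF bk_inner[OF B]] LspD(2)[OF f]])
    then have "frechet_derivative (conv \<kappa> f) (at x) (axis i 1) \<bullet> axis i 1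
        = (\<integral>y. ((grad \<kappa> y \<bullet> axis i 1) *\<^sub>R f (x - y)) \<bullet> axis i 1 \<partial>lborel)"
      using integral_inner_left[of "axis i 1", OF i[of i]] by simp
    then show ?thesis by (simp add: inner_axis)
  qed
  then have "(\<Sum>i\<in>UNIV. frechet_derivative (conv \<kappa> f) (at x) (axis i 1) $ i)
      = (\<integral>y. (\<Sum>i\<in>UNIV. grad \<kappa> y $ i * f (x - y) $ i) \<partial>lborel)"
    using i' by simp
  then show ?thesis by (simp add: inner_vec_def)
qed

text \<open>The extended field is Lipschitz and divergence free off the plane \<open>x\<^sub>3 = 0\<close>, so its difference quotients may be
  differentiated under the integral.\<close>

lemma divfree_refl_ext:
  assumes k: "kern \<kappa>" and t: "tangential \<Phi>"
  shows "(\<integral>y. grad \<kappa> y \<bullet> refl_ext \<Phi> (x - y) \<partial>lborel) = 0"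
proof -
  have S: "\<Phi> \<in> schwartz" and div: "\<And>x. 0 < x $ 3 \<Longrightarrow> (\<Sum>i\<in>UNIV. frechet_derivative \<Phi> (at x) (axis i 1) $ i) = 0"
    using t by (auto simp: tangential_def)
  let ?f = "refl_ext \<Phi>"
  have n: "nice ?f" by (rule nice_refl_ext[OF t])
  have f: "?f \<in> Lsp" by (rule nice_Lsp[OF n])
  obtain B where B: "bk B \<kappa>" using kern_bk[OF k] by blast
  obtain L where L: "0 \<le> L" "\<And>x y. norm (?f x - ?f y) \<le> L * norm (x - y)" using n by (auto simp: nice_def)
  \<comment> \<open>The diagonal derivatives of the reflected field. In direction 3 the signs from
    reflecting the argument and the value cancel, so both half-spaces obey the same formula and
    their sum is the divergence of \<open>\<Phi>\<close> at a point above the plane.\<close>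
  define dd where "dd i z = (if 0 \<le> z $ 3 then frechet_derivative \<Phi> (at z) (axis i 1) $ i
    else frechet_derivative \<Phi> (at (reflect z)) (axis i 1) $ i)" for i and z :: "real^3"
  have dcont: "continuous_on UNIV (\<lambda>z. frechet_derivative \<Phi> (at z) (axis i 1))" for i
    using schwartz_differentiable[OF S, of "[axis i 1]"]
    by (intro continuous_at_imp_continuous_on ballI differentiable_imp_continuous_within) (simp add: axis_Basis)
  have dm [measurable]: "(\<lambda>z. frechet_derivative \<Phi> (at z) (axis i 1)) \<in> borel_measurable borel" for i
    by (rule borel_measurable_continuous_onI[OF dcont])
  note [measurable] = LspD(2)[OF f] bkD(2)[OF B]
  have ddm [measurable]: "dd i \<in> borel_measurable borel" for i unfolding dd_def by measurable
  let ?q = "\<lambda>i n z. real (Suc n) *\<^sub>R (?f (z + (1 / real (Suc n)) *\<^sub>R axis i 1) - ?f z)"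
  have qlim: "(\<lambda>n. ?q i n z $ i) \<longlonglongrightarrow> dd i z" if z: "z $ 3 \<noteq> 0" for i z
  proof (cases "0 < z $ 3")
    case True
    from tendsto_vec_nth[OF difference_quotient_LIMSEQ[OF refl_ext_has_derivative(1)[OF S True]], where i = i]
    show ?thesis using True by (simp add: dd_def)
  next
    case False
    with z have neg: "z $ 3 < 0" by simp
    have lin: "linear (frechet_derivative \<Phi> (at (reflect z)))"
      using schwartz_differentiable[OF S, of "[]"] by (simp add: linear_frechet_derivative)
    have "reflect (axis i 1) = (if i = 3 then - 1 else 1) *\<^sub>R axis i 1"
      by (auto simp: vec_eq_iff axis_def)
    then have "reflect (frechet_derivative \<Phi> (at (reflect z)) (reflect (axis i 1))) $ i
        = frechet_derivative \<Phi> (at (reflect z)) (axis i 1) $ i"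
      using lin by (simp add: linear_scale[OF lin] linear_neg[OF lin])
    with tendsto_vec_nth[OF difference_quotient_LIMSEQ[OF refl_ext_has_derivative(2)[OF S neg]], where i = i, of "axis i 1"]
    show ?thesis using neg by (simp add: dd_def)
  qed
  have kint: "integrable lborel (\<lambda>y. \<bar>\<kappa> y\<bar> * L)"
    using kern_integrable[OF k] by simp
  have "frechet_derivative (conv \<kappa> ?f) (at x) (axis i 1) $ i = (\<integral>y. \<kappa> y * dd i (x - y) \<partial>lborel)" for i
  proof (rule LIMSEQ_unique)
    show "(\<lambda>n. (real (Suc n) *\<^sub>R (conv \<kappa> ?f (x + (1 / real (Suc n)) *\<^sub>R axis i 1) - conv \<kappa> ?f x)) $ i)
        \<longlonglongrightarrow> frechet_derivative (conv \<kappa> ?f) (at x) (axis i 1) $ i"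
      by (intro tendsto_vec_nth difference_quotient_LIMSEQ)
         (use conv_has_derivative[OF k f, of x] frechet_derivative_works differentiableI in blast)
    have "(\<lambda>n. (\<integral>y. \<kappa> y * ?q i n (x - y) $ i \<partial>lborel)) \<longlonglongrightarrow> (\<integral>y. \<kappa> y * dd i (x - y) \<partial>lborel)"
    proof (rule integral_dominated_convergence[OF _ _ kint])
      have "AE y in lborel. (y::real^3) $ 3 \<noteq> x $ 3" by (rule AE_nth_3_neq)
      then show "AE y in lborel. (\<lambda>n. \<kappa> y * ?q i n (x - y) $ i) \<longlonglongrightarrow> \<kappa> y * dd i (x - y)"
        by eventually_elim (rule tendsto_mult_left, rule qlim, simp)
      show "AE y in lborel. norm (\<kappa> y * ?q i n (x - y) $ i) \<le> \<bar>\<kappa> y\<bar> * L" for n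
      proof (rule AE_I2)
        fix y
        have "\<bar>?q i n (x - y) $ i\<bar> \<le> norm (?q i n (x - y))" by (rule component_le_norm_cart)
        also have "\<dots> \<le> L" by (rule difference_quotient_bound[OF L(2)]) simp
        finally have "\<bar>?q i n (x - y) $ i\<bar> \<le> L" .
        then have "\<bar>\<kappa> y\<bar> * \<bar>?q i n (x - y) $ i\<bar> \<le> \<bar>\<kappa> y\<bar> * L" by (rule mult_left_mono) simp
        then show "norm (\<kappa> y * ?q i n (x - y) $ i) \<le> \<bar>\<kappa> y\<bar> * L" by (simp only: real_norm_def abs_mult)
      qed
    qed measurable
    moreover have "(\<integral>y. \<kappa> y * ?q i n (x - y) $ i \<partial>lborel)
        = (real (Suc n) *\<^sub>R (conv \<kappa> ?f (x + (1 / real (Suc n)) *\<^sub>R axis i 1) - conv \<kappa> ?f x)) $ i" for n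
    proof -
      let ?x' = "x + (1 / real (Suc n)) *\<^sub>R axis i 1"
      have e: "x - y + (1 / real (Suc n)) *\<^sub>R axis i 1 = ?x' - y" for y by simp
      have i1: "integrable lborel (\<lambda>y. \<kappa> y *\<^sub>R ?f (?x' - y))" "integrable lborel (\<lambda>y. \<kappa> y *\<^sub>R ?f (x - y))"
        by (rule conv_integrable'[OF B f])+
      have "conv \<kappa> ?f ?x' - conv \<kappa> ?f x = (\<integral>y. \<kappa> y *\<^sub>R ?f (?x' - y) - \<kappa> y *\<^sub>R ?f (x - y) \<partial>lborel)"
        unfolding conv_swap[OF bkD(2)[OF B] LspD(2)[OF f]] using i1 by simp
      moreover have "(\<integral>y. \<kappa> y *\<^sub>R ?f (?x' - y) - \<kappa> y *\<^sub>R ?f (x - y) \<partial>lborel) \<bullet> axis i 1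
          = (\<integral>y. (\<kappa> y *\<^sub>R ?f (?x' - y) - \<kappa> y *\<^sub>R ?f (x - y)) \<bullet> axis i 1 \<partial>lborel)"
        using i1 by (intro integral_inner_left[symmetric]) auto
      ultimately have "(conv \<kappa> ?f ?x' - conv \<kappa> ?f x) $ i
          = (\<integral>y. (\<kappa> y *\<^sub>R ?f (?x' - y) - \<kappa> y *\<^sub>R ?f (x - y)) $ i \<partial>lborel)" by (simp add: inner_axis)
      then have "real (Suc n) * (conv \<kappa> ?f ?x' - conv \<kappa> ?f x) $ i
          = (\<integral>y. real (Suc n) * (\<kappa> y *\<^sub>R ?f (?x' - y) - \<kappa> y *\<^sub>R ?f (x - y)) $ i \<partial>lborel)" by simp
      moreover have "real (Suc n) * (\<kappa> y *\<^sub>R ?f (?x' - y) - \<kappa> y *\<^sub>R ?f (x - y)) $ i = \<kappa> y * ?q i n (x - y) $ i" for y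
        unfolding e by (simp add: algebra_simps del: of_nat_Suc)
      ultimately show ?thesis by (simp only: vector_scaleR_component real_scaleR_def)
    qed
    ultimately show "(\<lambda>n. (real (Suc n) *\<^sub>R (conv \<kappa> ?f (x + (1 / real (Suc n)) *\<^sub>R axis i 1) - conv \<kappa> ?f x)) $ i)
        \<longlonglongrightarrow> (\<integral>y. \<kappa> y * dd i (x - y) \<partial>lborel)" by (simp only:)
  qed
  moreover have "integrable lborel (\<lambda>y. \<kappa> y * dd i (x - y))" for i
  proof (rule Bochner_Integration.integrable_bound[OF kint])
    have "AE y in lborel. (y::real^3) $ 3 \<noteq> x $ 3" by (rule AE_nth_3_neq)
    then show "AE y in lborel. norm (\<kappa> y * dd i (x - y)) \<le> norm (\<bar>\<kappa> y\<bar> * L)"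
    proof eventually_elim
      case (elim y)
      have "\<bar>dd i (x - y)\<bar> \<le> L"
      proof (rule LIMSEQ_le_const2[OF tendsto_rabs[OF qlim]])
        show "(x - y) $ 3 \<noteq> 0" using elim by simp
        have "\<bar>?q i n (x - y) $ i\<bar> \<le> L" for n
          by (rule order_trans[OF component_le_norm_cart difference_quotient_bound[OF L(2)]]) simp
        then show "\<exists>N. \<forall>n\<ge>N. \<bar>?q i n (x - y) $ i\<bar> \<le> L" by blast
      qed
      then show ?case using L(1) by (simp add: abs_mult mult_left_mono)
    qed
  qed measurable
  ultimately have "(\<Sum>i\<in>UNIV. frechet_derivative (conv \<kappa> ?f) (at x) (axis i 1) $ i)
      = (\<integral>y. (\<Sum>i\<in>UNIV. \<kappa> y * dd i (x - y)) \<partial>lborel)" by simp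
  also have "\<dots> = (\<integral>(y::real^3). 0 \<partial>lborel)"
  proof (rule integral_cong_AE)
    have "AE y in lborel. (y::real^3) $ 3 \<noteq> x $ 3" by (rule AE_nth_3_neq)
    then show "AE y in lborel. (\<Sum>i\<in>UNIV. \<kappa> y * dd i (x - y)) = 0"
    proof eventually_elim
      case (elim y)
      have "(\<Sum>i\<in>UNIV. dd i (x - y)) = 0"
        using elim div[of "x - y"] div[of "reflect (x - y)"] by (cases "0 < (x - y) $ 3") (auto simp: dd_def)
      then show ?case by (simp flip: sum_distrib_left)
    qed
  qed measurable
  finally show ?thesis by (simp add: divergence_conv[OF k f])
qed

text \<open>This produces admissible test fields: mollification makes the merely Lipschitz
  reflection smooth on the whole space, including below the plane, while keeping it divergence free
  and rapidly decreasing.\<close>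

lemma schwartz_sigma_conv:
  assumes k: "kern \<kappa>" and t: "tangential \<Phi>"
  shows "conv \<kappa> (refl_ext \<Phi>) \<in> schwartz_sigma"
proof -
  let ?f = "refl_ext \<Phi>"
  have S: "\<Phi> \<in> schwartz" using t by (simp add: tangential_def)
  have f: "?f \<in> Lsp" by (rule nice_Lsp[OF nice_refl_ext[OF t]])
  note [measurable] = LspD(2)[OF f]
  have "bdd_above (range (\<lambda>x. norm (pderivs UNIV bs (conv \<kappa> ?f) x) * \<bar>x $ 3\<bar> ^ m))" if bs: "set bs \<subseteq> Basis" for bs m
  proof -
    let ?k = "pderivs UNIV bs \<kappa>"
    have k': "kern ?k" by (rule kern_pderivs[OF k bs])
    obtain B where B: "bk B ?k" using kern_bk[OF k'] by blast
    note [measurable] = bkD(2)[OF B]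
    obtain D0 where D0: "0 \<le> D0" "\<And>x. norm (?f x) * \<bar>x $ 3\<bar> ^ 0 \<le> D0"
      using refl_ext_decay[OF S, of 0] by blast
    obtain D where D: "0 \<le> D" "\<And>x. norm (?f x) * \<bar>x $ 3\<bar> ^ m \<le> D" using refl_ext_decay[OF S, of m] by blast
    \<comment> \<open>For \<open>norm y <= 2\<close> one has
      \<open>|x3| <= 2 max |(x - y)3| 2\<close>; the \<open>m\<close>-th power of the maximum is at
      most the sum of the \<open>m\<close>-th powers, giving the two decay constants.\<close>
    define c where "c = 2 ^ m * (D + D0 * 2 ^ m)"
    have pt: "norm (?f (x - y)) * \<bar>x $ 3\<bar> ^ m \<le> c" if "norm y \<le> 2" for x y
    proof -
      let ?a = "\<bar>(x - y) $ 3\<bar>"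
      have "\<bar>y $ 3\<bar> \<le> 2" using that component_le_norm_cart[of y 3] by simp
      then have "\<bar>x $ 3\<bar> \<le> ?a + 2" using abs_triangle_ineq[of "(x - y) $ 3" "y $ 3"] by simp
      also have "\<dots> \<le> 2 * max ?a 2" by (cases "?a \<le> 2") (simp_all add: max_def)
      finally have "\<bar>x $ 3\<bar> ^ m \<le> (2 * max ?a 2) ^ m" by (intro power_mono) auto
      also have "\<dots> = 2 ^ m * (max ?a 2) ^ m" by (rule power_mult_distrib)
      also have "(max ?a 2) ^ m \<le> ?a ^ m + 2 ^ m" by (cases "?a \<le> 2") (auto simp: max_def)
      finally have "\<bar>x $ 3\<bar> ^ m \<le> 2 ^ m * (?a ^ m + 2 ^ m)" by simp
      then have "norm (?f (x - y)) * \<bar>x $ 3\<bar> ^ m \<le> norm (?f (x - y)) * (2 ^ m * (?a ^ m + 2 ^ m))"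
        by (rule mult_left_mono) simp
      also have "\<dots> = 2 ^ m * (norm (?f (x - y)) * ?a ^ m + norm (?f (x - y)) * 2 ^ m)" by (simp add: algebra_simps)
      also have "\<dots> \<le> c" unfolding c_def
        using D0(2)[of "x - y"] by (intro mult_left_mono add_mono D(2) mult_right_mono) auto
      finally show ?thesis .
    qed
    have "norm (conv ?k ?f x) * \<bar>x $ 3\<bar> ^ m \<le> (\<integral>y. \<bar>?k y\<bar> * c \<partial>lborel)" for x
    proof -
      have i: "integrable lborel (\<lambda>y. ?k y *\<^sub>R ?f (x - y))" by (rule conv_integrable'[OF B f])
      have "norm (conv ?k ?f x) * \<bar>x $ 3\<bar> ^ m = norm (\<integral>y. \<bar>x $ 3\<bar> ^ m *\<^sub>R (?k y *\<^sub>R ?f (x - y)) \<partial>lborel)"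
        unfolding conv_swap[OF bkD(2)[OF B] LspD(2)[OF f]] integral_scaleR_right by (simp add: mult.commute)
      also have "\<dots> \<le> (\<integral>y. \<bar>?k y\<bar> * c \<partial>lborel)"
      proof (rule Bochner_Integration.integral_norm_bound_integral)
        show "integrable lborel (\<lambda>y. \<bar>x $ 3\<bar> ^ m *\<^sub>R (?k y *\<^sub>R ?f (x - y)))" by (intro integrable_scaleR_right i)
        show "integrable lborel (\<lambda>y. \<bar>?k y\<bar> * c)" using kern_integrable[OF k'] by simp
        show "norm (\<bar>x $ 3\<bar> ^ m *\<^sub>R (?k y *\<^sub>R ?f (x - y))) \<le> \<bar>?k y\<bar> * c" for y
        proof (cases "norm y \<le> 2")
          case True
          from mult_left_mono[OF pt[OF True, of x], of "\<bar>?k y\<bar>"] show ?thesis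
            by (simp add: abs_mult mult.commute mult.left_commute)
        qed (use bkD(4)[OF B] in simp)
      qed
      finally show ?thesis .
    qed
    then show ?thesis unfolding pderivs_conv[OF k f bs] by (intro bdd_aboveI2)
  qed
  moreover have "per (conv \<kappa> ?f)" by (rule per_conv[OF kern_measurable[OF k] _ LspD(1)[OF f]]) measurable
  ultimately have "conv \<kappa> ?f \<in> schwartz" using smooth_conv[OF k f] by (simp add: schwartz_def)
  moreover have "divergence_within UNIV (conv \<kappa> ?f) x = 0" for x
    by (simp add: divergence_within_def divergence_conv[OF k f] divfree_refl_ext[OF k t])
  ultimately show ?thesis by (simp add: schwartz_sigma_def)
qed

section \<open>Borel representatives on the doubled domain\<close>

lemma cell_eq: "cell = full_cell \<inter> {x. 0 \<le> x $ 3}"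
  by (auto simp: cell_def full_cell_def D_plus_def)

lemma cell_measurable [measurable]: "cell \<in> sets borel"
  unfolding cell_eq by measurable

lemma integrable_muC:
  fixes h :: "real^3 \<Rightarrow> 'b::{banach, second_countable_topology}"
  assumes "h \<in> borel_measurable borel"
  shows "integrable muC h \<longleftrightarrow> integrable lborel (\<lambda>x. indicator full_cell x *\<^sub>R h x)"
  unfolding muC_def using assms
  by (subst integrable_density[where g = "indicator full_cell", unfolded ennreal_indicator]) auto

lemma indicator_full_cell_split:
  "x $ 3 \<noteq> 0 \<Longrightarrow> indicator full_cell x = indicator cell x + (indicator cell (reflect x) :: 'a::semiring_1)"
  using reflect_full_cell[of x] by (auto simp: cell_eq indicator_def)

lemma AE_nth_3_neq_0: "AE x in lborel. (x::real^3) $ 3 \<noteq> 0"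
  by (rule AE_nth_3_neq)

text \<open>The doubled cell is the cell and its mirror image up to the null plane, so a symmetric
  integrand counts twice. The lemma also passes from Lebesgue to Borel measurable functions. The
  value formula needs no integrability, because without it both sides are 0 by convention.\<close>

lemma cell_integral:
  fixes h h' :: "real^3 \<Rightarrow> real"
  assumes [measurable]: "h \<in> borel_measurable borel" and s: "\<And>x. h (reflect x) = h x"
    and ae: "AE x in lebesgue. x \<in> cell \<longrightarrow> h' x = h x"
  shows "integrable (lebesgue_on cell) h' \<longleftrightarrow> integrable muC h"
    and "(\<integral>x. h' x \<partial>lebesgue_on cell) = (\<integral>x. h x \<partial>muC) / 2"
proof -
  let ?i = "\<lambda>x. indicator cell x *\<^sub>R h x"
  have im: "?i \<in> borel_measurable lebesgue" by (rule measurable_completion) measurable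
  have ae': "AE x in lebesgue. ?i x = indicator cell x *\<^sub>R h' x"
    using ae by eventually_elim (auto simp: indicator_def)
  have im': "(\<lambda>x. indicator cell x *\<^sub>R h' x) \<in> borel_measurable lebesgue"
    by (rule borel_measurable_AE[OF im ae'])
  have aes: "AE x in lebesgue. indicator cell x *\<^sub>R h' x = ?i x"
    using ae' by eventually_elim (rule sym)
  have im0: "?i \<in> borel_measurable lborel" by measurable
  have cl: "cell \<inter> space lebesgue \<in> sets lebesgue" by simp
  have eqi: "integrable (lebesgue_on cell) h' \<longleftrightarrow> integrable lborel ?i"
    unfolding integrable_restrict_space[OF cl]
    by (simp only: integrable_cong_AE[OF im' im aes] integrable_completion[OF im0])
  have eqv: "(\<integral>x. h' x \<partial>lebesgue_on cell) = (\<integral>x. ?i x \<partial>lborel)"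
  proof -
    have "(\<integral>x. h' x \<partial>lebesgue_on cell) = (\<integral>x. ?i x \<partial>lebesgue)"
      unfolding integral_restrict_space[OF cl]
      by (rule integral_cong_AE[OF im' im aes])
    then show ?thesis by (simp only: integral_completion[OF im0])
  qed
  have ri: "integrable lborel (\<lambda>x. ?i (reflect x)) \<longleftrightarrow> integrable lborel ?i"
    by (subst (2) lborel_distr_reflect[symmetric], subst integrable_distr_eq) auto
  have sp: "AE x in lborel. indicator full_cell x *\<^sub>R h x = ?i x + ?i (reflect x)"
    using AE_nth_3_neq_0 by eventually_elim (simp add: indicator_full_cell_split s distrib_right)
  have C: "integrable muC h \<longleftrightarrow> integrable lborel (\<lambda>x. ?i x + ?i (reflect x))"
    unfolding integrable_muC[OF assms(1)] by (rule integrable_cong_AE) (use sp in auto)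
  have Ci: "integrable muC h \<longleftrightarrow> integrable lborel ?i"
  proof
    assume "integrable muC h"
    then have "integrable lborel (\<lambda>x. indicator cell x *\<^sub>R (indicator full_cell x *\<^sub>R h x))"
      unfolding integrable_muC[OF assms(1)] by (rule integrable_mult_indicator[rotated]) simp
    moreover have "indicator cell x *\<^sub>R (indicator full_cell x *\<^sub>R h x) = ?i x" for x
      by (auto simp: cell_eq indicator_def)
    ultimately show "integrable lborel ?i" by (simp only:)
  next
    assume "integrable lborel ?i"
    with ri show "integrable muC h" unfolding C by simp
  qed
  show "integrable (lebesgue_on cell) h' \<longleftrightarrow> integrable muC h" using eqi Ci by simp
  have "(\<integral>x. h x \<partial>muC) = 2 * (\<integral>x. ?i x \<partial>lborel)"
  proof (cases "integrable lborel ?i")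
    case True
    have "(\<integral>x. h x \<partial>muC) = (\<integral>x. ?i x + ?i (reflect x) \<partial>lborel)"
      unfolding integral_muC[OF assms(1)] by (rule integral_cong_AE) (use sp in auto)
    also have "\<dots> = (\<integral>x. ?i x \<partial>lborel) + (\<integral>x. ?i (reflect x) \<partial>lborel)"
      using True ri by simp
    also have "(\<integral>x. ?i (reflect x) \<partial>lborel) = (\<integral>x. ?i x \<partial>lborel)"
      by (rule integral_lborel_reflect) measurable
    finally show ?thesis by simp
  next
    case False
    with Ci show ?thesis by (simp add: not_integrable_integral_eq)
  qed
  with eqv show "(\<integral>x. h' x \<partial>lebesgue_on cell) = (\<integral>x. h x \<partial>muC) / 2" by simp
qed

lemma per_lat_D_plus:
  assumes "horiz_periodic_on D_plus f" "x \<in> D_plus" shows "f (x + lat m n) = f x"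
proof -
  \<comment> \<open>Extension by \<open>None\<close> below the plane makes the function periodic
    everywhere, so that the statement for all lattice vectors becomes available.\<close>
  have "per (\<lambda>x. if x \<in> D_plus then Some (f x) else None)"
    using assms(1) by (auto simp: horiz_periodic_on_def D_plus_def axis_def)
  from per_lat[OF this, of x m n] assms(2) show ?thesis by (auto split: if_splits)
qed

text \<open>The exceptional set of the cell has countably many lattice translates, whose union is
  still null.\<close>

lemma AE_lebesgue_lat:
  assumes "AE x in lebesgue. x \<in> cell \<longrightarrow> P x"
  shows "AE x in lebesgue. \<forall>m n. x + lat m n \<in> cell \<longrightarrow> P (x + lat m n)"
proof -
  let ?N = "{x \<in> cell. \<not> P x}"
  have N: "negligible ?N"
    using assms by (simp add: negligible_iff_null_sets AE_iff_null_sets[symmetric] eventually_ae_filter)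
      (auto simp: eventually_ae_filter completion.complete2 intro: null_sets_completion_subset)
  have "AE x in lebesgue. \<forall>z\<in>(UNIV::(int \<times> int) set). x \<notin> (+) (- lat (fst z) (snd z)) ` ?N"
    unfolding AE_ball_countable[OF countableI_type]
    by (intro ballI AE_not_in negligible_translation[OF N, unfolded negligible_iff_null_sets])
  then show ?thesis
  proof eventually_elim
    case (elim x)
    show ?case
    proof (intro allI impI)
      fix m n assume c: "x + lat m n \<in> cell"
      show "P (x + lat m n)"
      proof (rule ccontr)
        assume "\<not> P (x + lat m n)"
        with c have "x \<in> (+) (- lat m n) ` ?N" by (intro image_eqI[of _ _ "x + lat m n"]) auto
        with elim show False by (auto dest: bspec[of _ _ "(m, n)"])
      qed
    qed
  qed
qed

text \<open>Periodicity and reflection symmetry are demanded at every point and not merely almost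
  everywhere, so that they can be used inside convolutions without tracking null sets. Only the link
  to \<open>f\<close> is almost everywhere.\<close>

definition represents :: "(real^3 \<Rightarrow> real^3) \<Rightarrow> (real^3 \<Rightarrow> real^3) \<Rightarrow> bool" where
  "represents U f \<longleftrightarrow> U \<in> Lsp \<and> (\<forall>x. U (reflect x) = reflect (U x)) \<and>
     (AE x in lebesgue. x \<in> D_plus \<longrightarrow> U x = f x)"

lemma ex_represents:
  assumes f: "f \<in> L2_D" shows "\<exists>U. represents U f"
proof -
  have fp: "horiz_periodic_on D_plus f" and fm: "f \<in> borel_measurable (lebesgue_on cell)"
    and fi: "integrable (lebesgue_on cell) (\<lambda>x. (norm (f x))\<^sup>2)" using f by (auto simp: L2_D_def)
  have cl: "cell \<inter> space lebesgue \<in> sets lebesgue" by simp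
  have "\<exists>g. g \<in> borel_measurable borel \<and> (AE x in lborel. indicator cell x *\<^sub>R f x $ i = g x)" for i
  proof -
    have "(\<lambda>x. f x $ i) \<in> borel_measurable (lebesgue_on cell)" using fm by measurable
    then have "(\<lambda>x. indicator cell x *\<^sub>R f x $ i) \<in> borel_measurable lebesgue"
      by (simp add: borel_measurable_restrict_space_iff[OF cl])
    from completion_ex_borel_measurable_real[OF this] show ?thesis by auto
  qed
  then have "\<exists>g. \<forall>i. g i \<in> borel_measurable borel \<and> (AE x in lborel. indicator cell x *\<^sub>R f x $ i = g i x)"
    by (intro choice allI)
  then obtain g where g0: "\<forall>i. g i \<in> borel_measurable borel \<and> (AE x in lborel. indicator cell x *\<^sub>R f x $ i = g i x)" ..
  then have gm [measurable]: "g i \<in> borel_measurable borel" for i by blast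
  from g0 have g: "AE x in lborel. indicator cell x *\<^sub>R f x $ i = g i x" for i by blast
  define b where "b x = (\<chi> i. g i x)" for x
  have bm [measurable]: "b \<in> borel_measurable borel" unfolding b_def by measurable
  have "AE x in lborel. \<forall>i\<in>UNIV. indicator cell x *\<^sub>R f x $ i = g i x"
    unfolding AE_ball_countable[OF countable_finite[OF finite]] using g by blast
  then have bf: "AE x in lebesgue. x \<in> cell \<longrightarrow> b x = f x"
    unfolding AE_completion_iff by eventually_elim (auto simp: b_def vec_eq_iff)
  define fold where "fold x = wrap (\<chi> i. if i = 3 then \<bar>x $ 3\<bar> else x $ i)" for x :: "real^3"
  have fold_m [measurable]: "fold \<in> borel \<rightarrow>\<^sub>M borel"
  proof -
    have [measurable]: "(\<lambda>x::real^3. if i = 3 then \<bar>x $ 3\<bar> else x $ i) \<in> borel_measurable borel" for i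
      by (cases "i = 3") auto
    show ?thesis unfolding fold_def by measurable
  qed
  \<comment> \<open>Everything is read off from the folded point in the upper cell. Since
    \<open>sgn 0 = 0\<close>, the third component vanishes on the plane, so the symmetry holds there
    too and not just off a null set.\<close>
  define U where "U x = (\<chi> i. if i = 3 then sgn (x $ 3) * b (fold x) $ 3 else b (fold x) $ i)" for x :: "real^3"
  have Um [measurable]: "U \<in> borel_measurable borel"
  proof -
    have [measurable]: "(\<lambda>x::real^3. if i = 3 then sgn (x $ 3) * b (fold x) $ 3 else b (fold x) $ i) \<in> borel_measurable borel" for i
      by (cases "i = 3") auto
    show ?thesis unfolding U_def by measurable
  qed
  have pf: "per fold"
  proof (rule perI_lat)
    fix m n and x :: "real^3"
    have "(\<chi> i. if i = 3 then \<bar>(x + lat m n) $ 3\<bar> else (x + lat m n) $ i) = (\<chi> i. if i = 3 then \<bar>x $ 3\<bar> else x $ i) + lat m n"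
      by (auto simp: vec_eq_iff)
    then show "fold (x + lat m n) = fold x" by (simp add: fold_def per_lat[OF per_wrap_self])
  qed
  have Up: "per U" by (rule perI_lat) (auto simp: U_def vec_eq_iff per_lat[OF pf])
  have Us: "U (reflect x) = reflect (U x)" for x
  proof -
    have "(\<chi> i. if i = 3 then \<bar>reflect x $ 3\<bar> else reflect x $ i) = (\<chi> i. if i = 3 then \<bar>x $ 3\<bar> else x $ i)"
      by (auto simp: vec_eq_iff)
    then have fr: "fold (reflect x) = fold x" unfolding fold_def by (simp only:)
    show ?thesis by (auto simp: U_def fr vec_eq_iff sgn_minus)
  qed
  have Uf: "AE x in lebesgue. x \<in> D_plus \<longrightarrow> U x = f x"
    using AE_lebesgue_lat[OF bf] AE_completion[OF AE_nth_3_neq_0]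
  proof eventually_elim
    case (elim x)
    show ?case
    proof
      assume x: "x \<in> D_plus"
      then have pos: "0 < x $ 3" using elim(2) by (simp add: D_plus_def)
      have "(\<chi> i. if i = 3 then \<bar>x $ 3\<bar> else x $ i) = x" using pos by (auto simp: vec_eq_iff)
      then have fx: "fold x = wrap x" by (simp add: fold_def)
      have "wrap x \<in> cell" using wrap_full_cell[of x] pos by (simp add: cell_eq)
      then have "b (wrap x) = f (wrap x)" using elim(1) unfolding wrap_def by blast
      also have "\<dots> = f x" unfolding wrap_def by (rule per_lat_D_plus[OF fp x])
      finally have "b (fold x) = f x" by (simp add: fx)
      then show "U x = f x" using pos by (auto simp: U_def vec_eq_iff)
    qed
  qed
  have "integrable muC (\<lambda>x. (norm (U x))\<^sup>2)"
  proof (subst cell_integral(1)[symmetric])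
    show "AE x in lebesgue. x \<in> cell \<longrightarrow> (norm (f x))\<^sup>2 = (norm (U x))\<^sup>2"
      using Uf by eventually_elim (auto simp: cell_eq D_plus_def)
  qed (use fi in \<open>auto simp: Us\<close>)
  with Up Us Uf show ?thesis by (auto simp: represents_def Lsp_def)
qed

lemma representsD:
  assumes "represents U f"
  shows "U \<in> Lsp" "U (reflect x) = reflect (U x)" "AE x in lebesgue. x \<in> D_plus \<longrightarrow> U x = f x"
    "AE x in lebesgue. x \<in> cell \<longrightarrow> U x = f x"
proof -
  show "AE x in lebesgue. x \<in> D_plus \<longrightarrow> U x = f x" using assms by (simp add: represents_def)
  then show "AE x in lebesgue. x \<in> cell \<longrightarrow> U x = f x" by eventually_elim (auto simp: cell_eq D_plus_def)
qed (use assms in \<open>auto simp: represents_def\<close>)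

lemma L2_norm_represents:
  assumes r: "represents U f" shows "L2_norm_D f = nrm U / sqrt 2"
proof -
  note [measurable] = LspD(2)[OF representsD(1)[OF r]]
  have "(\<integral>x. (norm (f x))\<^sup>2 \<partial>lebesgue_on cell) = (\<integral>x. (norm (U x))\<^sup>2 \<partial>muC) / 2"
  proof (rule cell_integral(2))
    show "AE x in lebesgue. x \<in> cell \<longrightarrow> (norm (f x))\<^sup>2 = (norm (U x))\<^sup>2"
      using representsD(4)[OF r] by eventually_elim auto
  qed (auto simp: representsD(2)[OF r])
  then show ?thesis unfolding L2_norm_D_def nrm_def by (simp only: real_sqrt_divide)
qed

lemma Lsp_restrict_L2_D:
  assumes h: "h \<in> Lsp" and s: "\<And>x. h (reflect x) = reflect (h x)" shows "h \<in> L2_D"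
proof -
  note [measurable] = LspD(2)[OF h]
  have "integrable (lebesgue_on cell) (\<lambda>x. (norm (h x))\<^sup>2)"
    using LspD(3)[OF h] by (subst cell_integral(1)[of "\<lambda>x. (norm (h x))\<^sup>2"]) (auto simp: s)
  moreover have "h \<in> borel_measurable (lebesgue_on cell)"
    by (intro measurable_restrict_space1 measurable_completion) measurable
  ultimately show ?thesis using LspD(1)[OF h] by (auto simp: L2_D_def horiz_periodic_on_def)
qed

lemma inner_represents:
  assumes r: "represents U f" and h: "h \<in> Lsp" and s: "\<And>x. h (reflect x) = reflect (h x)"
  shows "inner_D f h = (\<integral>x. U x \<bullet> h x \<partial>muC) / 2"
proof -
  note [measurable] = LspD(2)[OF h] LspD(2)[OF representsD(1)[OF r]]
  show ?thesis unfolding inner_D_def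
  proof (rule cell_integral(2))
    show "AE x in lebesgue. x \<in> cell \<longrightarrow> f x \<bullet> h x = U x \<bullet> h x"
      using representsD(4)[OF r] by eventually_elim auto
  qed (auto simp: representsD(2)[OF r] s inner_reflect)
qed

lemma Lsp_reflect:
  assumes h: "h \<in> Lsp" shows "(\<lambda>x. reflect (h (reflect x))) \<in> Lsp"
proof -
  note [measurable] = LspD(2)[OF h]
  have "per (\<lambda>x. reflect (h (reflect x)))"
  proof (rule perI_lat)
    fix m n x
    have "reflect (lat m n) = lat m n" by (rule reflect_fixed) simp
    then show "reflect (h (reflect (x + lat m n))) = reflect (h (reflect x))"
      by (simp add: reflect_add per_lat[OF LspD(1)[OF h]])
  qed
  moreover have "integrable muC (\<lambda>x. (norm (reflect (h (reflect x))))\<^sup>2)"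
    using integral_muC_reflect(2)[of "\<lambda>x. (norm (h x))\<^sup>2"] LspD(3)[OF h] by simp
  ultimately show ?thesis by (simp add: Lsp_def)
qed

text \<open>A symmetric \<open>U\<close> sees only the symmetric part of a field. Pairings with
  arbitrary fields on the doubled domain thus reduce to pairings on the half-space, for which weak
  continuity is given.\<close>

lemma inner_symmetrize:
  assumes U: "U \<in> Lsp" "\<And>x. U (reflect x) = reflect (U x)" and h: "h \<in> Lsp"
  shows "(\<integral>x. U x \<bullet> (h x + reflect (h (reflect x))) \<partial>muC) = 2 * (\<integral>x. U x \<bullet> h x \<partial>muC)"
proof -
  note [measurable] = LspD(2)[OF h] LspD(2)[OF U(1)]
  have "(\<integral>x. U x \<bullet> reflect (h (reflect x)) \<partial>muC) = (\<integral>x. U (reflect x) \<bullet> h (reflect x) \<partial>muC)"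
    by (simp add: U(2) inner_reflect_left)
  also have "\<dots> = (\<integral>x. U x \<bullet> h x \<partial>muC)" by (rule integral_muC_reflect(1)) measurable
  finally show ?thesis
    using Lsp_integrable_inner[OF U(1) h] Lsp_integrable_inner[OF U(1) Lsp_reflect[OF h]] by (simp add: inner_add_right)
qed

lemma H_sigma_approx:
  assumes f: "f \<in> H_sigma_D" and r: "represents U f" and e: "0 < e"
  shows "\<exists>\<Phi>. tangential \<Phi> \<and> nrm (\<lambda>x. U x - refl_ext \<Phi> x) < e"
proof -
  \<comment> \<open>Doubling the domain multiplies the norm by \<open>sqrt 2\<close>, which the
    tolerance compensates.\<close>
  obtain \<phi> where \<phi>: "\<phi> \<in> schwartz_D" "\<And>x. x \<in> D_plus \<Longrightarrow> divergence_within D_plus \<phi> x = 0"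
    "\<And>x. x \<in> bdry_D_plus \<Longrightarrow> \<phi> x $ 3 = 0" "L2_norm_D (\<lambda>x. f x - \<phi> x) < e / sqrt 2"
    using f e unfolding H_sigma_D_def by (force dest: spec[of _ "e / sqrt 2"])
  then obtain \<Phi> where \<Phi>: "\<Phi> \<in> schwartz" "\<And>x. x \<in> D_plus \<Longrightarrow> \<phi> x = \<Phi> x" by (auto simp: schwartz_D_def)
  have "(\<Sum>i\<in>UNIV. frechet_derivative \<Phi> (at x) (axis i 1) $ i) = 0" if x: "0 < x $ 3" for x
  proof -
    have op: "open {x::real^3. 0 < x $ 3}" by (intro open_Collect_less continuous_intros)
    have "at x within D_plus = at x"
      by (rule at_within_interior, rule interiorI[OF op]) (use x in \<open>auto simp: D_plus_def\<close>)
    moreover have "(\<Phi> has_derivative frechet_derivative \<Phi> (at x)) (at x)"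
      using schwartz_differentiable[OF \<Phi>(1), of "[]"] by (simp add: frechet_derivative_works)
    then have "(\<phi> has_derivative frechet_derivative \<Phi> (at x)) (at x)"
      by (rule has_derivative_transform_within_open[OF _ op]) (use x \<Phi>(2) in \<open>auto simp: D_plus_def\<close>)
    then have "frechet_derivative \<phi> (at x) = frechet_derivative \<Phi> (at x)"
      by (rule frechet_derivative_at[symmetric])
    ultimately show ?thesis using \<phi>(2)[of x] x by (simp add: divergence_within_def D_plus_def)
  qed
  moreover have b: "\<Phi> x $ 3 = 0" if "x $ 3 = 0" for x
    using \<phi>(3)[of x] \<Phi>(2)[of x] that by (simp add: bdry_D_plus_def D_plus_def)
  ultimately have t: "tangential \<Phi>" using \<Phi>(1) by (simp add: tangential_def)
  note eL = nice_Lsp[OF nice_refl_ext[OF t]]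
  have "represents (\<lambda>x. U x - refl_ext \<Phi> x) (\<lambda>x. f x - \<phi> x)"
    unfolding represents_def
  proof (intro conjI allI)
    show "(\<lambda>x. U x - refl_ext \<Phi> x) \<in> Lsp" by (intro Lsp_diff representsD(1)[OF r] eL)
    show "U (reflect x) - refl_ext \<Phi> (reflect x) = reflect (U x - refl_ext \<Phi> x)" for x
      by (simp add: representsD(2)[OF r] refl_ext_reflect[OF b] reflect_diff)
    show "AE x in lebesgue. x \<in> D_plus \<longrightarrow> U x - refl_ext \<Phi> x = f x - \<phi> x"
      using representsD(3)[OF r] by eventually_elim (auto simp: refl_ext_def D_plus_def \<Phi>(2))
  qed
  from L2_norm_represents[OF this] \<phi>(4) have "nrm (\<lambda>x. U x - refl_ext \<Phi> x) < e"
    by (simp add: divide_less_cancel)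
  with t show ?thesis by blast
qed

section \<open>Uniform boundedness\<close>

lemma Fatou_nrm:
  assumes f: "\<And>n. f n \<in> Lsp" and p: "per h" and [measurable]: "h \<in> borel_measurable borel"
    and lim: "AE x in muC. (\<lambda>n. f n x) \<longlonglongrightarrow> h x" and c: "0 \<le> c" and le: "\<And>n. nrm (f n) \<le> c"
  shows "h \<in> Lsp" "nrm h \<le> c"
proof -
  have [measurable]: "f n \<in> borel_measurable borel" for n by (rule LspD(2)[OF f])
  have "(\<integral>\<^sup>+x. ennreal ((norm (h x))\<^sup>2) \<partial>muC) = (\<integral>\<^sup>+x. liminf (\<lambda>n. ennreal ((norm (f n x))\<^sup>2)) \<partial>muC)"
  proof (rule nn_integral_cong_AE)
    show "AE x in muC. ennreal ((norm (h x))\<^sup>2) = liminf (\<lambda>n. ennreal ((norm (f n x))\<^sup>2))"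
      using lim
    proof eventually_elim
      case (elim x)
      have "(\<lambda>n. ennreal ((norm (f n x))\<^sup>2)) \<longlonglongrightarrow> ennreal ((norm (h x))\<^sup>2)"
        by (intro tendsto_intros tendsto_ennrealI elim)
      then show ?case by (rule lim_imp_Liminf[OF sequentially_bot, symmetric])
    qed
  qed
  also have "\<dots> \<le> liminf (\<lambda>n. \<integral>\<^sup>+x. ennreal ((norm (f n x))\<^sup>2) \<partial>muC)"
    by (rule nn_integral_liminf) measurable
  also have "\<dots> \<le> liminf (\<lambda>n. ennreal (c\<^sup>2))"
    by (intro Liminf_mono always_eventually allI) (simp add: nn_integral_nrm[OF f] ennreal_leI power_mono le)
  also have "\<dots> = ennreal (c\<^sup>2)" by (rule Liminf_const) simp
  finally have I: "(\<integral>\<^sup>+x. ennreal ((norm (h x))\<^sup>2) \<partial>muC) \<le> ennreal (c\<^sup>2)" .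
  show L: "h \<in> Lsp" by (rule LspI[OF p]) (use le_less_trans[OF I] in auto)
  show "nrm h \<le> c" by (rule nrm_le[OF L c I])
qed

text \<open>The argument of Sokal: the limit of a sequence of partial sums, in which the \<open>n\<close>-th summand has norm \<open>3\<^sup>-\<^sup>n\<close>
  and a sign which makes the \<open>n\<close>-th functional large.\<close>

lemma uniform_boundedness:
  assumes U: "\<And>t. U t \<in> Lsp" and b: "\<And>f. f \<in> Lsp \<Longrightarrow> \<exists>C. \<forall>t. \<bar>\<integral>x. U t x \<bullet> f x \<partial>muC\<bar> \<le> C"
  shows "\<exists>M. \<forall>t. nrm (U t) \<le> M"
proof (rule ccontr)
  assume "\<not> ?thesis"
  then have "\<forall>n. \<exists>t. 4 ^ n < nrm (U t)" by (meson not_le)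
  then obtain t where t: "\<And>n::nat. 4 ^ n < nrm (U (t n))" by metis
  have pos: "0 < nrm (U (t n))" for n using less_trans[OF _ t[of n]] by simp
  define \<psi> where "\<psi> n = (\<lambda>x. (1 / nrm (U (t n))) *\<^sub>R U (t n) x)" for n
  have \<psi>L: "\<psi> n \<in> Lsp" for n unfolding \<psi>_def by (intro Lsp_scale U)
  have \<psi>1: "nrm (\<psi> n) = 1" for n unfolding \<psi>_def nrm_scale using pos[of n] by simp
  let ?J = "\<lambda>n f. \<integral>x. U (t n) x \<bullet> f x \<partial>muC"
  \<comment> \<open>Of the two signs the one with the larger functional value is taken. That value
    is at least \<open>3^(-n)\<close> times the norm of the \<open>n\<close>-th functional, whatever
    the preceding partial sum.\<close>
  define c where "c n S = (if \<bar>?J n S - (1/3) ^ n * ?J n (\<psi> n)\<bar> \<le> \<bar>?J n S + (1/3) ^ n * ?J n (\<psi> n)\<bar>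
    then (1/3) ^ n else - ((1/3) ^ n) :: real)" for n S
  define S where "S = rec_nat (\<lambda>x. 0) (\<lambda>n S x. S x + c n S *\<^sub>R \<psi> n x)"
  have S0: "S 0 = (\<lambda>x. 0)" and SS: "S (Suc n) = (\<lambda>x. S n x + c n (S n) *\<^sub>R \<psi> n x)" for n
    by (simp_all add: S_def)
  have SL: "S n \<in> Lsp" for n
  proof (induction n)
    case (Suc n) then show ?case unfolding SS by (intro Lsp_add Lsp_scale \<psi>L)
  qed (simp add: S0 Lsp_0)
  have abs_c: "\<bar>c n R\<bar> = (1/3) ^ n" for n R by (simp add: c_def)
  have J\<psi>: "?J n (\<psi> n) = nrm (U (t n))" for n
  proof -
    have "?J n (\<psi> n) = (nrm (U (t n)))\<^sup>2 / nrm (U (t n))"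
      unfolding nrm_square by (simp add: \<psi>_def power2_norm_eq_inner)
    then show ?thesis using pos[of n] by (simp add: power2_eq_square)
  qed
  have big: "(1/3) ^ n * nrm (U (t n)) \<le> \<bar>?J n (S (Suc n))\<bar>" for n
  proof -
    let ?a = "?J n (S n)" and ?b = "(1/3) ^ n * ?J n (\<psi> n)"
    have "?J n (S (Suc n)) = ?a + c n (S n) * ?J n (\<psi> n)"
      unfolding SS inner_add_right inner_scaleR_right
      using Lsp_integrable_inner[OF U SL] Lsp_integrable_inner[OF U \<psi>L] by simp
    then have "\<bar>?J n (S (Suc n))\<bar> = max \<bar>?a + ?b\<bar> \<bar>?a - ?b\<bar>" by (auto simp: c_def max_def)
    moreover have "?b \<le> max \<bar>?a + ?b\<bar> \<bar>?a - ?b\<bar>" by (auto simp: max_def abs_if)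
    ultimately show ?thesis by (simp add: J\<psi>)
  qed
  \<comment> \<open>A geometric series: the steps from \<open>n\<close> on have total norm at most
    \<open>(3/2) 3^(-n)\<close>. Beyond the \<open>n\<close>-th step this is half of
    \<open>3^(-n)\<close>, so half of the gain of that step survives in the limit.\<close>
  have Sdiff: "nrm (\<lambda>x. S (n + m) x - S n x) \<le> (3/2) * (1/3) ^ n - (3/2) * (1/3) ^ (n + m)" for n m
  proof (induction m)
    case 0 then show ?case by (simp add: nrm_def)
  next
    case (Suc m)
    have "nrm (\<lambda>x. S (n + Suc m) x - S n x) = nrm (\<lambda>x. (S (n + m) x - S n x) + c (n + m) (S (n + m)) *\<^sub>R \<psi> (n + m) x)"
      by (simp add: SS algebra_simps)
    also have "\<dots> \<le> nrm (\<lambda>x. S (n + m) x - S n x) + nrm (\<lambda>x. c (n + m) (S (n + m)) *\<^sub>R \<psi> (n + m) x)"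
      by (intro nrm_triangle Lsp_diff SL Lsp_scale \<psi>L)
    also have "nrm (\<lambda>x. c (n + m) (S (n + m)) *\<^sub>R \<psi> (n + m) x) = (1/3) ^ (n + m)"
      by (simp add: nrm_scale abs_c \<psi>1)
    finally show ?case using Suc by simp
  qed
  have [measurable]: "\<psi> n \<in> borel_measurable borel" for n by (rule LspD(2)[OF \<psi>L])
  have Ssum: "S n x = (\<Sum>k<n. c k (S k) *\<^sub>R \<psi> k x)" for n x by (induction n) (auto simp: S0 SS)
  define f where "f x = (\<Sum>k. c k (S k) *\<^sub>R \<psi> k x)" for x
  have fm [measurable]: "f \<in> borel_measurable borel" unfolding f_def by measurable
  have fp: "per f" using LspD(1)[OF \<psi>L] by (simp add: horiz_periodic_on_def f_def)
  \<comment> \<open>Pointwise convergence of the series. The weighted squares have a finite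
    integral, hence a finite sum almost everywhere, and \<open>norm v <= 1 + (norm v)^2\<close>
    reduces the norms to them.\<close>
  have "AE x in muC. (\<Sum>k. ennreal ((1/3) ^ k) * ennreal ((norm (\<psi> k x))\<^sup>2)) \<noteq> \<infinity>"
  proof (rule nn_integral_PInf_AE)
    have "(\<integral>\<^sup>+x. (\<Sum>k. ennreal ((1/3) ^ k) * ennreal ((norm (\<psi> k x))\<^sup>2)) \<partial>muC)
        = (\<Sum>k. \<integral>\<^sup>+x. ennreal ((1/3) ^ k) * ennreal ((norm (\<psi> k x))\<^sup>2) \<partial>muC)"
      by (rule nn_integral_suminf) measurable
    also have "\<dots> = (\<Sum>k. ennreal ((1/3) ^ k))"
      by (subst nn_integral_cmult) (auto simp: nn_integral_nrm[OF \<psi>L] \<psi>1)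
    also have "\<dots> < \<infinity>" by (subst suminf_ennreal2) (auto intro: summable_geometric)
    finally show "(\<integral>\<^sup>+x. (\<Sum>k. ennreal ((1/3) ^ k) * ennreal ((norm (\<psi> k x))\<^sup>2)) \<partial>muC) \<noteq> \<infinity>" by simp
  qed measurable
  then have lim: "AE x in muC. (\<lambda>n. S n x) \<longlonglongrightarrow> f x"
  proof eventually_elim
    case (elim x)
    have "summable (\<lambda>k. (1/3) ^ k * (norm (\<psi> k x))\<^sup>2)"
      using elim by (intro summable_suminf_not_top) (auto simp: ennreal_mult)
    then have "summable (\<lambda>k. (1/3) ^ k + (1/3) ^ k * (norm (\<psi> k x))\<^sup>2)"
      by (intro summable_add summable_geometric) auto
    then have "summable (\<lambda>k. c k (S k) *\<^sub>R \<psi> k x)"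
    proof (rule summable_comparison_test')
      fix k :: nat
      have "norm (\<psi> k x) \<le> 1 + (norm (\<psi> k x))\<^sup>2"
      proof -
        have "2 * norm (\<psi> k x) \<le> (norm (\<psi> k x))\<^sup>2 + 1"
          using zero_le_power2[of "norm (\<psi> k x) - 1"] by (simp add: power2_diff)
        moreover have "0 \<le> norm (\<psi> k x)" by simp
        ultimately show ?thesis by linarith
      qed
      then have "(1/3) ^ k * norm (\<psi> k x) \<le> (1/3) ^ k * (1 + (norm (\<psi> k x))\<^sup>2)" by (intro mult_left_mono) auto
      then show "norm (c k (S k) *\<^sub>R \<psi> k x) \<le> (1/3) ^ k + (1/3) ^ k * (norm (\<psi> k x))\<^sup>2"
        by (simp add: abs_c distrib_left)
    qed
    then have "(\<lambda>k. c k (S k) *\<^sub>R \<psi> k x) sums f x" unfolding f_def by (rule summable_sums)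
    then show ?case by (simp add: sums_def Ssum)
  qed
  have fd: "(\<lambda>x. f x - S n x) \<in> Lsp" "nrm (\<lambda>x. f x - S n x) \<le> (3/2) * (1/3) ^ n" for n
  proof -
    note SM [measurable] = LspD(2)[OF SL]
    have p: "per (\<lambda>x. f x - S n x)" using fp LspD(1)[OF SL[of n]] by (simp add: horiz_periodic_on_def)
    have m: "(\<lambda>x. f x - S n x) \<in> borel_measurable borel" by measurable
    have l: "AE x in muC. (\<lambda>k. S (n + k) x - S n x) \<longlonglongrightarrow> f x - S n x"
      using lim
    proof eventually_elim
      case (elim x)
      from LIMSEQ_ignore_initial_segment[OF elim, of n] show ?case
        by (intro tendsto_diff tendsto_const) (simp add: add.commute)
    qed
    have d: "(\<lambda>x. S (n + k) x - S n x) \<in> Lsp" for k by (intro Lsp_diff SL)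
    have le: "nrm (\<lambda>x. S (n + k) x - S n x) \<le> (3/2) * (1/3) ^ n" for k
      using Sdiff[of n k] by (rule order_trans) simp
    show "(\<lambda>x. f x - S n x) \<in> Lsp" "nrm (\<lambda>x. f x - S n x) \<le> (3/2) * (1/3) ^ n"
      using Fatou_nrm[of "\<lambda>k x. S (n + k) x - S n x", OF d p m l _ le] by auto
  qed
  have fL: "f \<in> Lsp" using fd(1)[of 0] by (simp add: S0)
  obtain C where C: "\<And>t. \<bar>\<integral>x. U t x \<bullet> f x \<partial>muC\<bar> \<le> C" using b[OF fL] by blast
  \<comment> \<open>The functionals grow faster than \<open>4^n\<close> and the steps shrink only
    like \<open>3^(-n)\<close>, so the surviving half grows like \<open>(4/3)^n\<close> while the
    pairing with the limit stays bounded.\<close>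
  have "(4/3) ^ n \<le> 2 * C" for n
  proof -
    have "?J n f = ?J n (S (Suc n)) + ?J n (\<lambda>x. f x - S (Suc n) x)"
      using Lsp_integrable_inner[OF U SL] Lsp_integrable_inner[OF U fd(1)]
      by (subst Bochner_Integration.integral_add[symmetric]) (auto simp: inner_add_right[symmetric])
    moreover have "\<bar>?J n (\<lambda>x. f x - S (Suc n) x)\<bar> \<le> nrm (U (t n)) * ((3/2) * (1/3) ^ Suc n)"
      by (rule order_trans[OF Lsp_Cauchy_Schwarz[OF U fd(1)] mult_left_mono[OF fd(2)]]) simp
    ultimately have "(1/3) ^ n * nrm (U (t n)) \<le> C + nrm (U (t n)) * ((3/2) * (1/3) ^ Suc n)"
      using big[of n] C[of "t n"] by linarith
    then have h: "(1/3) ^ n * nrm (U (t n)) \<le> 2 * C" by (simp add: mult.commute[of "nrm (U (t n))"])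
    have "(4/3) ^ n = (1/3) ^ n * (4::real) ^ n" by (simp add: power_divide)
    also have "\<dots> \<le> (1/3) ^ n * nrm (U (t n))" using t[of n] by (intro mult_left_mono) auto
    finally show ?thesis using h by simp
  qed
  moreover obtain n where "2 * C < (4/3) ^ n" using real_arch_pow[of "4/3" "2 * C"] by auto
  ultimately show False by (meson not_le)
qed

lemma local_Lsp:
  assumes [measurable]: "\<psi> \<in> borel_measurable borel" and b: "\<And>z. norm (\<psi> z) \<le> B" and z: "\<And>z. z \<notin> cball x 2 \<Longrightarrow> \<psi> z = 0"
  shows "(\<lambda>z. \<psi> (wrap (z + corner x) - corner x)) \<in> Lsp"
proof (rule LspI)
  show "per (\<lambda>z. \<psi> (wrap (z + corner x) - corner x))"
    using per_shift[OF per_wrap_self, of "corner x"] by (simp add: horiz_periodic_on_def)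
  show "(\<lambda>z. \<psi> (wrap (z + corner x) - corner x)) \<in> borel_measurable borel" by measurable
  let ?S = "{z::real^3. x $ 3 - 2 \<le> z $ 3 \<and> z $ 3 \<le> x $ 3 + 2}"
  have [measurable]: "?S \<in> sets borel" by measurable
  have B0: "0 \<le> B" using b[of 0] norm_ge_zero order_trans by blast
  have "(\<integral>\<^sup>+z. ennreal ((norm (\<psi> (wrap (z + corner x) - corner x)))\<^sup>2) \<partial>muC) \<le> (\<integral>\<^sup>+z. ennreal (B\<^sup>2) * indicator ?S z \<partial>muC)"
  proof (rule nn_integral_mono)
    fix z
    let ?w = "wrap (z + corner x) - corner x"
    show "ennreal ((norm (\<psi> ?w))\<^sup>2) \<le> ennreal (B\<^sup>2) * indicator ?S z"
    proof (cases "z \<in> ?S")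
      case True then show ?thesis using b[of ?w] by (simp add: ennreal_leI power_mono)
    next
      case False
      have "?w $ 3 = z $ 3" by simp
      then have "2 < \<bar>(?w - x) $ 3\<bar>" using False by auto
      also have "\<dots> \<le> norm (?w - x)" by (rule component_le_norm_cart)
      finally have "?w \<notin> cball x 2" by (simp add: dist_norm norm_minus_commute)
      then show ?thesis using z by simp
    qed
  qed
  also have "\<dots> = ennreal (B\<^sup>2) * emeasure muC ?S" by (rule nn_integral_cmult_indicator) simp
  also have "\<dots> \<le> ennreal (B\<^sup>2) * ennreal ((2 * pi)\<^sup>2 * ((x $ 3 + 2) - (x $ 3 - 2)))"
    by (intro mult_left_mono emeasure_slab) auto
  also have "\<dots> < \<infinity>" by (simp add: ennreal_mult_less_top)
  finally show "(\<integral>\<^sup>+z. ennreal ((norm (\<psi> (wrap (z + corner x) - corner x)))\<^sup>2) \<partial>muC) < \<infinity>" .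
qed

text \<open>Time ranges over all reals so that no side conditions on \<open>t\<close> arise;
  boundedness of the pairings is assumed separately because the time axis is not compact.\<close>

locale weakly_continuous_flow =
  fixes U :: "real \<Rightarrow> real^3 \<Rightarrow> real^3"
  assumes Lsp: "\<And>t. U t \<in> Lsp"
    and sym: "\<And>t x. U t (reflect x) = reflect (U t x)"
    and approx: "\<And>t e. 0 < e \<Longrightarrow> \<exists>\<Phi>. tangential \<Phi> \<and> nrm (\<lambda>x. U t x - refl_ext \<Phi> x) < e"
    and weak_cont: "\<And>f. f \<in> Lsp \<Longrightarrow> continuous_on UNIV (\<lambda>t. \<integral>x. U t x \<bullet> f x \<partial>muC)"
    and weak_bdd: "\<And>f. f \<in> Lsp \<Longrightarrow> \<exists>C. \<forall>t. \<bar>\<integral>x. U t x \<bullet> f x \<partial>muC\<bar> \<le> C"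
begin

lemma bounded_nrm: obtains M where "0 \<le> M" "\<And>t. nrm (U t) \<le> M"
proof -
  obtain M where "\<And>t. nrm (U t) \<le> M" using uniform_boundedness[of U, OF Lsp weak_bdd] by blast
  then show thesis using that[of M] nrm_nonneg[of "U 0"] order_trans by blast
qed

text \<open>The tested divergence is continuous in \<open>nrm\<close> and vanishes on the reflected
  tangential fields that approximate \<open>U t\<close>.\<close>

lemma divfree:
  assumes k: "kern \<kappa>" shows "(\<integral>y. grad \<kappa> y \<bullet> U t (x - y) \<partial>lborel) = 0"
proof -
  obtain B where B: "bkv B (grad \<kappa>)" using kern_grad_bkv[OF k] by blast
  have "\<bar>\<integral>y. grad \<kappa> y \<bullet> U t (x - y) \<partial>lborel\<bar> \<le> 8 * B * e" if e: "0 < e" for e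
  proof -
    obtain \<Phi> where \<Phi>: "tangential \<Phi>" "nrm (\<lambda>x. U t x - refl_ext \<Phi> x) < e" using approx[OF e] by blast
    have L: "refl_ext \<Phi> \<in> Lsp" by (rule nice_Lsp[OF nice_refl_ext[OF \<Phi>(1)]])
    have "(\<integral>y. grad \<kappa> y \<bullet> (U t (x - y) - refl_ext \<Phi> (x - y)) \<partial>lborel) = (\<integral>y. grad \<kappa> y \<bullet> U t (x - y) \<partial>lborel)"
      using bkv_inner_integrable[OF B Lsp] bkv_inner_integrable[OF B L]
      by (simp add: inner_diff_right divfree_refl_ext[OF k \<Phi>(1)])
    then have "\<bar>\<integral>y. grad \<kappa> y \<bullet> U t (x - y) \<partial>lborel\<bar> \<le> 8 * B * nrm (\<lambda>x. U t x - refl_ext \<Phi> x)"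
      using bkv_inner_bound[OF B Lsp_diff[OF Lsp[of t] L], where x = x] by simp
    also have "\<dots> \<le> 8 * B * e" using \<Phi>(2) bkvD(1)[OF B] by (intro mult_left_mono) auto
    finally show ?thesis .
  qed
  note bd = this
  have "\<bar>\<integral>y. grad \<kappa> y \<bullet> U t (x - y) \<partial>lborel\<bar> \<le> 8 * B * (e / (8 * B + 1))" if "0 < e" for e
    using that bkvD(1)[OF B] by (intro bd divide_pos_pos) auto
  moreover have "8 * B * (e / (8 * B + 1)) \<le> e" if "0 < e" for e
    using that bkvD(1)[OF B] by (simp add: field_simps)
  ultimately have "\<bar>\<integral>y. grad \<kappa> y \<bullet> U t (x - y) \<partial>lborel\<bar> \<le> 0 + e" if "0 < e" for e
    using that order_trans by fastforce
  then have "\<bar>\<integral>y. grad \<kappa> y \<bullet> U t (x - y) \<partial>lborel\<bar> \<le> 0" by (rule field_le_epsilon)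
  then show ?thesis by simp
qed

lemma mollify_tendsto:
  assumes d: "\<And>n. 0 < d n" "\<And>n. d n \<le> 1" "d \<longlonglongrightarrow> 0"
  shows "(\<lambda>n. nrm (\<lambda>x. conv (Kern (d n)) (U t) x - U t x)) \<longlonglongrightarrow> 0"
  by (rule conv_Kern_tendsto[OF Lsp _ d]) (use approx nice_refl_ext in blast)

text \<open>A component of the convolution at a fixed point is the pairing of \<open>U t\<close>
  with one fixed periodised kernel, so weak continuity already gives pointwise continuity.\<close>

lemma conv_continuous_time:
  assumes \<kappa>: "bk B \<kappa>" shows "continuous_on UNIV (\<lambda>t. conv \<kappa> (U t) x)"
proof (subst continuous_on_componentwise, intro ballI)
  fix b :: "real^3" assume "b \<in> Basis"
  note [measurable] = bkD(2)[OF \<kappa>]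
  let ?\<psi> = "\<lambda>z. \<kappa> (x - z) *\<^sub>R b"
  have bd: "norm (?\<psi> z) \<le> B * norm b" for z using bkD(3)[OF \<kappa>] by (simp add: mult_right_mono)
  have z: "?\<psi> z = 0" if "z \<notin> cball x 2" for z using that bkD(4)[OF \<kappa>, of "x - z"] by (simp add: dist_norm)
  have L: "(\<lambda>z. ?\<psi> (wrap (z + corner x) - corner x)) \<in> Lsp" by (rule local_Lsp[OF _ bd z]) auto
  have "conv \<kappa> (U t) x \<bullet> b = (\<integral>z. U t z \<bullet> ?\<psi> (wrap (z + corner x) - corner x) \<partial>muC)" for t
  proof -
    note [measurable] = LspD(2)[OF Lsp]
    have "conv \<kappa> (U t) x \<bullet> b = (\<integral>z. (\<kappa> (x - z) *\<^sub>R U t z) \<bullet> b \<partial>lborel)"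
      unfolding conv_def by (rule integral_inner_left[symmetric]) (use conv_integrable[OF \<kappa> Lsp] in auto)
    also have "\<dots> = (\<integral>z. ?\<psi> z \<bullet> U t z \<partial>lborel)" by (simp add: inner_commute)
    also have "\<dots> = (\<integral>z. ?\<psi> (wrap (z + corner x) - corner x) \<bullet> U t z \<partial>muC)"
    proof (rule integral_local_eq_muC)
      show "?\<psi> z = 0" if "z \<notin> cball x 3" for z using z[of z] that by auto
    qed (use LspD(1)[OF Lsp] in auto)
    finally show ?thesis by (simp only: inner_commute)
  qed
  then show "continuous_on UNIV (\<lambda>t. conv \<kappa> (U t) x \<bullet> b)" using weak_cont[OF L] by simp
qed

text \<open>Continuity in time at each point combines with a Lipschitz bound in space that is
  uniform in time, owing to the bound on \<open>nrm (U t)\<close>. It is the only source of joint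
  measurability, as \<open>U\<close> is chosen separately for each time.\<close>

lemma conv_continuous_joint:
  assumes k: "kern \<kappa>" shows "continuous_on UNIV (\<lambda>(t, x). conv \<kappa> (U t) x)"
proof -
  obtain M where M: "0 \<le> M" "\<And>t. nrm (U t) \<le> M" by (rule bounded_nrm) (rule that)
  obtain B where B: "bk B \<kappa>" using kern_bk[OF k] by blast
  obtain B' where B': "bkv B' (grad \<kappa>)" using kern_grad_bkv[OF k] by blast
  note B'0 = bkvD(1)[OF B']
  have lip: "norm (conv \<kappa> (U t) x - conv \<kappa> (U t) x') \<le> 8 * B' * M * norm (x - x')" if h: "norm (x - x') \<le> 1" for t x x'
  proof -
    let ?h = "x - x'"
    note [measurable] = bkD(2)[OF B]
    have b: "bk (B' * norm ?h) (\<lambda>y. \<kappa> (y + ?h) - \<kappa> y)"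
      unfolding bk_def
    proof (intro conjI allI impI)
      fix y
      obtain \<xi> where "\<kappa> (y + ?h) - \<kappa> y = grad \<kappa> (y + \<xi> *\<^sub>R ?h) \<bullet> ?h"
        using grad_mvt[OF kern_has_derivative[OF k]] by blast
      then have "\<bar>\<kappa> (y + ?h) - \<kappa> y\<bar> \<le> norm (grad \<kappa> (y + \<xi> *\<^sub>R ?h)) * norm ?h" by (simp add: Cauchy_Schwarz_ineq2)
      also have "\<dots> \<le> B' * norm ?h" by (intro mult_right_mono bkvD(3)[OF B']) auto
      finally show "\<bar>\<kappa> (y + ?h) - \<kappa> y\<bar> \<le> B' * norm ?h" .
      show "\<kappa> (y + ?h) - \<kappa> y = 0" if y: "2 < norm y"
      proof -
        have "norm y \<le> norm (y + ?h) + norm ?h" using norm_triangle_ineq4[of "y + ?h" ?h] by simp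
        then have "1 < norm (y + ?h)" using y h by simp
        then show ?thesis using k y by (simp add: kern_def)
      qed
    qed (use B'0 in auto)
    have e: "x' - z + ?h = x - z" for z by simp
    have "conv (\<lambda>y. \<kappa> (y + ?h) - \<kappa> y) (U t) x' = conv \<kappa> (U t) x - conv \<kappa> (U t) x'"
      unfolding conv_def e using conv_integrable[OF B Lsp[of t], of x] conv_integrable[OF B Lsp[of t], of x']
      by (simp add: scaleR_diff_left)
    then have "norm (conv \<kappa> (U t) x - conv \<kappa> (U t) x') \<le> 8 * (B' * norm ?h) * nrm (U t)"
      using conv_norm_le[OF b Lsp[of t], of x'] by simp
    also have "\<dots> \<le> 8 * (B' * norm ?h) * M" using B'0 by (intro mult_left_mono M) auto
    finally show ?thesis by (simp add: algebra_simps)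
  qed
  have "((\<lambda>p. conv \<kappa> (U (fst p)) (snd p)) \<longlongrightarrow> conv \<kappa> (U (fst q)) (snd q)) (at q)" for q
  proof -
    have ft: "(fst \<longlongrightarrow> fst q) (at q)" "(snd \<longlongrightarrow> snd q) (at q)" by (intro tendsto_intros)+
    have "((\<lambda>p. 8 * B' * M * norm (snd p - snd q)) \<longlongrightarrow> 8 * B' * M * norm (snd q - snd q)) (at q)"
      by (intro tendsto_intros ft)
    then have 1: "((\<lambda>p. 8 * B' * M * norm (snd p - snd q)) \<longlongrightarrow> 0) (at q)" by simp
    have "\<forall>\<^sub>F p in at q. dist (snd p) (snd q) < 1" using tendstoD[OF ft(2)] by simp
    then have ev: "\<forall>\<^sub>F p in at q. norm (conv \<kappa> (U (fst p)) (snd p) - conv \<kappa> (U (fst p)) (snd q)) \<le> 8 * B' * M * norm (snd p - snd q)"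
      by eventually_elim (rule lip, simp add: dist_norm)
    have A: "((\<lambda>p. conv \<kappa> (U (fst p)) (snd p) - conv \<kappa> (U (fst p)) (snd q)) \<longlongrightarrow> 0) (at q)"
      by (rule Lim_null_comparison[OF ev 1])
    have "isCont (\<lambda>t. conv \<kappa> (U t) (snd q)) (fst q)"
      using conv_continuous_time[OF B, of "snd q"] by (simp add: continuous_on_eq_continuous_at)
    then have "((\<lambda>p. conv \<kappa> (U (fst p)) (snd q)) \<longlongrightarrow> conv \<kappa> (U (fst q)) (snd q)) (at q)"
      by (rule isCont_tendsto_compose[OF _ ft(1)])
    from tendsto_add[OF A this] show ?thesis by simp
  qed
  then show ?thesis by (simp add: continuous_on_eq_continuous_at continuous_at split_beta)
qed

lemma conv_measurable_joint:
  assumes k: "kern \<kappa>" shows "(\<lambda>(t, x). conv \<kappa> (U t) x) \<in> borel_measurable (borel \<Otimes>\<^sub>M borel)"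
  unfolding borel_prod by (rule borel_measurable_continuous_onI[OF conv_continuous_joint[OF k]])

end

lemma measurable_Tri:
  assumes [measurable]: "(\<lambda>(t, x). p t x) \<in> borel_measurable (borel \<Otimes>\<^sub>M borel)" "(\<lambda>(t, x). f t x) \<in> borel_measurable (borel \<Otimes>\<^sub>M borel)"
    "g \<in> borel_measurable borel"
  shows "(\<lambda>t::real. Tri g (p t) (p t) (f t)) \<in> borel_measurable borel"
  unfolding Tri_def conv_def by measurable

lemma ex_mollifier_seq:
  obtains d :: "nat \<Rightarrow> real" where "\<And>n. 0 < d n" "\<And>n. d n \<le> 1" "d \<longlonglongrightarrow> 0"
proof (rule that[of "\<lambda>n. 1 / real (Suc n)"])
  show "(\<lambda>n. 1 / real (Suc n)) \<longlonglongrightarrow> 0" by (rule lim_1_over_n[THEN LIMSEQ_Suc])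
qed auto

context weakly_continuous_flow
begin

lemma Tri_mollify_tendsto:
  assumes g: "bkv B g" and f: "f \<in> Lsp" and d: "\<And>n. 0 < d n" "\<And>n. d n \<le> 1" "d \<longlonglongrightarrow> 0"
  shows "(\<lambda>n. Tri g (conv (Kern (d n)) (U t)) (conv (Kern (d n)) (U t)) f) \<longlonglongrightarrow> Tri g (U t) (U t) f"
proof (rule Tri_tendsto[OF g _ Lsp f f mollify_tendsto[OF d]])
  let ?M = "max (nrm (U t)) (nrm f)"
  show "conv (Kern (d n)) (U t) \<in> Lsp" for n by (intro conv_Kern_contraction d Lsp)
  show "nrm (conv (Kern (d n)) (U t)) \<le> ?M" for n
    by (rule max.coboundedI1) (intro conv_Kern_contraction d Lsp)
  show "(\<lambda>n. nrm (\<lambda>x. f x - f x)) \<longlonglongrightarrow> 0" by (simp add: nrm_def)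
qed auto

text \<open>A limit, at each time, of the same expression for mollified fields, where joint
  measurability is available.\<close>

lemma Tri_measurable:
  assumes g: "bkv B g" and f: "f \<in> Lsp"
  shows "(\<lambda>t. Tri g (U t) (U t) f) \<in> borel_measurable borel"
proof -
  obtain d :: "nat \<Rightarrow> real" where d: "\<And>n. 0 < d n" "\<And>n. d n \<le> 1" "d \<longlonglongrightarrow> 0" by (rule ex_mollifier_seq) (rule that)
  note [measurable] = bkvD(2)[OF g] LspD(2)[OF f]
  show ?thesis
  proof (rule borel_measurable_LIMSEQ_real)
    show "(\<lambda>n. Tri g (conv (Kern (d n)) (U t)) (conv (Kern (d n)) (U t)) f) \<longlonglongrightarrow> Tri g (U t) (U t) f" for t
      by (rule Tri_mollify_tendsto[OF g f d])
    show "(\<lambda>t. Tri g (conv (Kern (d n)) (U t)) (conv (Kern (d n)) (U t)) f) \<in> borel_measurable borel" for n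
    proof -
      have [measurable]: "(\<lambda>(t, x). conv (Kern (d n)) (U t) x) \<in> borel_measurable (borel \<Otimes>\<^sub>M borel)"
        by (rule conv_measurable_joint[OF kern_Kern[OF d(1,2)]])
      show ?thesis by (rule measurable_Tri) measurable
    qed
  qed
qed

text \<open>The third slot enters only through a convolution, so weak continuity suffices and the
  uniform norm bound gives domination. No such continuity is available in the first two slots, which
  stay frozen.\<close>

lemma Tri_continuous_third:
  assumes g: "bkv B g" and p: "p \<in> Lsp" and s: "s \<longlonglongrightarrow> s'"
  shows "(\<lambda>n. Tri g p p (U (s n))) \<longlonglongrightarrow> Tri g p p (U s')"
proof -
  obtain M where M: "0 \<le> M" "\<And>t. nrm (U t) \<le> M" by (rule bounded_nrm) (rule that)
  have B0: "0 \<le> B" by (rule bkvD(1)[OF g])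
  note [measurable] = LspD(2)[OF p] bkvD(2)[OF g] LspD(2)[OF Lsp]
  show ?thesis unfolding Tri_def
  proof (rule integral_dominated_convergence)
    show "integrable muC (\<lambda>x. 8 * B * M * (norm (p x) * norm (p x)))"
      by (intro integrable_mult_right Lsp_integrable_norm_mult p)
    show "AE x in muC. (\<lambda>n. p x \<bullet> conv (\<lambda>y. g y \<bullet> p x) (U (s n)) x) \<longlonglongrightarrow> p x \<bullet> conv (\<lambda>y. g y \<bullet> p x) (U s') x"
    proof (rule AE_I2)
      fix x
      have "isCont (\<lambda>t. conv (\<lambda>y. g y \<bullet> p x) (U t) x) s'"
        using conv_continuous_time[OF bk_inner[OF g]] by (simp add: continuous_on_eq_continuous_at)
      then show "(\<lambda>n. p x \<bullet> conv (\<lambda>y. g y \<bullet> p x) (U (s n)) x) \<longlonglongrightarrow> p x \<bullet> conv (\<lambda>y. g y \<bullet> p x) (U s') x"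
        by (intro tendsto_intros isCont_tendsto_compose[OF _ s])
    qed
    show "AE x in muC. norm (p x \<bullet> conv (\<lambda>y. g y \<bullet> p x) (U (s n)) x) \<le> 8 * B * M * (norm (p x) * norm (p x))" for n
    proof (rule AE_I2)
      fix x
      have "\<bar>p x \<bullet> conv (\<lambda>y. g y \<bullet> p x) (U (s n)) x\<bar> \<le> 8 * B * nrm (U (s n)) * (norm (p x) * norm (p x))"
        by (rule Tri_integrand_bound[OF g Lsp])
      also have "\<dots> \<le> 8 * B * M * (norm (p x) * norm (p x))"
        using B0 by (intro mult_right_mono mult_left_mono M) auto
      finally show "norm (p x \<bullet> conv (\<lambda>y. g y \<bullet> p x) (U (s n)) x) \<le> 8 * B * M * (norm (p x) * norm (p x))" by simp
    qed
    show "(\<lambda>x. p x \<bullet> conv (\<lambda>y. g y \<bullet> p x) (U (s n)) x) \<in> borel_measurable muC" for n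
      unfolding conv_def by measurable
    show "(\<lambda>x. p x \<bullet> conv (\<lambda>y. g y \<bullet> p x) (U s') x) \<in> borel_measurable muC"
      unfolding conv_def by measurable
  qed
qed

end

section \<open>The weak formulation tested with mollified fields\<close>

text \<open>Arbitrarily small nonzero steps along every axis that stay in \<open>S\<close>: this is
  what makes the derivative within \<open>S\<close> unique, hence equal to the full derivative when
  that exists.\<close>

definition thick :: "'a::euclidean_space set \<Rightarrow> bool" where
  "thick S \<longleftrightarrow> (\<forall>x\<in>S. \<forall>i\<in>Basis. \<forall>e>0. \<exists>d. 0 < \<bar>d\<bar> \<and> \<bar>d\<bar> < e \<and> x + d *\<^sub>R i \<in> S)"

lemma frechet_derivative_thick:
  assumes "thick S" "x \<in> S" "(f has_derivative D) (at x within S)"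
  shows "frechet_derivative f (at x within S) = D"
proof -
  have "(f has_derivative frechet_derivative f (at x within S)) (at x within S)"
    using assms(3) frechet_derivative_works differentiableI by blast
  then show ?thesis
    by (rule frechet_derivative_unique_within[OF _ assms(3)]) (use assms(1,2) in \<open>auto simp: thick_def\<close>)
qed

lemma thick_UNIV: "thick UNIV"
  unfolding thick_def by (intro ballI allI impI, rule_tac x = "e / 2" in exI) auto

lemma thick_D_plus: "thick D_plus"
  unfolding thick_def
proof (intro ballI allI impI)
  fix x i :: "real^3" and e :: real
  assume x: "x \<in> D_plus" and i: "i \<in> Basis" and e: "0 < e"
  obtain j where "i = axis j 1" using i by (auto simp: Basis_vec_def)
  then have "0 \<le> i $ 3" by (simp add: axis_def)
  then show "\<exists>d. 0 < \<bar>d\<bar> \<and> \<bar>d\<bar> < e \<and> x + d *\<^sub>R i \<in> D_plus"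
    using x e by (intro exI[of _ "e / 2"]) (auto simp: D_plus_def)
qed

lemma thick_Times_interval:
  fixes S :: "'a::euclidean_space set"
  assumes "thick S" "0 < T" shows "thick (S \<times> {0..T::real})"
  unfolding thick_def
proof (intro ballI allI impI)
  fix z i :: "'a \<times> real" and e :: real
  assume z: "z \<in> S \<times> {0..T}" and i: "i \<in> Basis" and e: "0 < e"
  from i consider j where "j \<in> Basis" "i = (j, 0)" | "i = (0, 1)" by (auto simp: Basis_prod_def)
  then show "\<exists>d. 0 < \<bar>d\<bar> \<and> \<bar>d\<bar> < e \<and> z + d *\<^sub>R i \<in> S \<times> {0..T}"
  proof cases
    case 1
    then obtain d where "0 < \<bar>d\<bar>" "\<bar>d\<bar> < e" "fst z + d *\<^sub>R j \<in> S"
      using assms(1) z e unfolding thick_def by (metis mem_Times_iff)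
    then show ?thesis using z 1 by (intro exI[of _ d]) (auto simp: mem_Times_iff)
  next
    case 2
    show ?thesis
    proof (cases "snd z < T")
      case True
      then show ?thesis using z 2 e
        by (intro exI[of _ "min (e / 2) (T - snd z)"]) (auto simp: mem_Times_iff min_def abs_if)
    next
      case False
      then show ?thesis using z 2 e assms(2)
        by (intro exI[of _ "- min (e / 2) T"]) (auto simp: mem_Times_iff min_def abs_if)
    qed
  qed
qed

text \<open>Each mixed derivative is a multiple of a purely spatial one; the coefficient becomes 0
  as soon as one direction is time and is 1 otherwise.\<close>

lemma pderivs_time_independent:
  fixes F :: "'a::euclidean_space \<Rightarrow> 'b::real_normed_vector"
  assumes S: "thick S" "0 < T" and F: "smooth_within UNIV F" and bs: "set bs \<subseteq> Basis"
  shows "\<exists>c cs. set cs \<subseteq> Basis \<and> (\<forall>z\<in>S \<times> {0..T::real}. pderivs (S \<times> {0..T}) bs (\<lambda>(x, t). F x) z = c *\<^sub>R pderivs UNIV cs F (fst z))"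
    and "pderivs (S \<times> {0..T}) bs (\<lambda>(x, t). F x) differentiable_on S \<times> {0..T}"
proof -
  let ?S = "S \<times> {0..T}" and ?f = "\<lambda>(x, t). F x"
  have hd: "(pderivs ?S bs ?f has_derivative (\<lambda>h. c *\<^sub>R frechet_derivative (pderivs UNIV cs F) (at (fst z)) (fst h))) (at z within ?S)"
    if z: "z \<in> ?S" and cs: "set cs \<subseteq> Basis" and eq: "\<forall>z\<in>?S. pderivs ?S bs ?f z = c *\<^sub>R pderivs UNIV cs F (fst z)" for bs c cs z
  proof (rule has_derivative_transform)
    have "pderivs UNIV cs F differentiable at (fst z)"
      using F cs by (auto simp: smooth_within_def differentiable_on_def)
    then have "(pderivs UNIV cs F has_derivative frechet_derivative (pderivs UNIV cs F) (at (fst z))) (at (fst z))"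
      by (simp add: frechet_derivative_works)
    then show "((\<lambda>z. c *\<^sub>R pderivs UNIV cs F (fst z)) has_derivative (\<lambda>h. c *\<^sub>R frechet_derivative (pderivs UNIV cs F) (at (fst z)) (fst h))) (at z within ?S)"
      by (intro has_derivative_scaleR_right has_derivative_compose[OF has_derivative_fst[OF has_derivative_ident]])
  qed (use z eq in auto)
  have ex: "\<exists>c cs. set cs \<subseteq> Basis \<and> (\<forall>z\<in>?S. pderivs ?S bs ?f z = c *\<^sub>R pderivs UNIV cs F (fst z))"
    using bs
  proof (induction bs)
    case Nil
    show ?case by (intro exI[of _ 1] exI[of _ "[]"]) auto
  next
    case (Cons b bs)
    then obtain c cs where cs: "set cs \<subseteq> Basis" and eq: "\<forall>z\<in>?S. pderivs ?S bs ?f z = c *\<^sub>R pderivs UNIV cs F (fst z)" by auto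
    have fd: "pderivs ?S (b # bs) ?f z = c *\<^sub>R frechet_derivative (pderivs UNIV cs F) (at (fst z)) (fst b)" if "z \<in> ?S" for z
      using frechet_derivative_thick[OF thick_Times_interval[OF S] that hd[OF that cs eq]] by simp
    from Cons.prems consider j where "j \<in> Basis" "b = (j, 0)" | "b = (0, 1)" by (auto simp: Basis_prod_def)
    then show ?case
    proof cases
      case 1
      then show ?thesis using fd cs by (intro exI[of _ c] exI[of _ "j # cs"]) auto
    next
      case 2
      have "frechet_derivative (pderivs UNIV cs F) (at x) 0 = 0" for x
        using F cs by (intro linear_0 linear_frechet_derivative) (auto simp: smooth_within_def differentiable_on_def)
      then show ?thesis using fd 2 by (intro exI[of _ 0] exI[of _ "[]"]) auto
    qed
  qed
  then show "\<exists>c cs. set cs \<subseteq> Basis \<and> (\<forall>z\<in>?S. pderivs ?S bs ?f z = c *\<^sub>R pderivs UNIV cs F (fst z))" .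
  show "pderivs ?S bs ?f differentiable_on ?S"
    using ex hd unfolding differentiable_on_def differentiable_def by blast
qed

lemma smooth_time_independent:
  "thick S \<Longrightarrow> 0 < T \<Longrightarrow> smooth_within UNIV F \<Longrightarrow> smooth_within (S \<times> {0..T::real}) (\<lambda>(x, t). F x)"
  unfolding smooth_within_def using pderivs_time_independent(2)[of S T F] by (simp add: smooth_within_def)

text \<open>Linearity with zero coefficients gives \<open>p 0 = 0\<close>, and the existence of a
  cutoff sequence forces the limit. This is how the pressure disappears for fields tangential at the
  boundary.\<close>

lemma bdry_pairing_0:
  assumes T: "0 < T" and p: "bdry_distribution T p" and h: "has_bdry_pairing p t (\<lambda>z. 0) c"
  shows "c = 0"
proof -
  have "smooth_within (UNIV \<times> {0..T}) (\<lambda>(x::real^2, t::real). 0::real)"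
    by (rule smooth_time_independent[OF thick_UNIV T]) (simp add: smooth_iff_Ck Ck_const)
  moreover have "(\<lambda>(x::real^2, t::real). 0::real) = (\<lambda>z. 0)" by auto
  ultimately have z: "(\<lambda>z. 0) \<in> bdry_test T" by (simp add: bdry_test_def)
  have "\<forall>f\<in>bdry_test T. \<forall>g\<in>bdry_test T. \<forall>a b. p (\<lambda>z. a * f z + b * g z) = a * p f + b * p g"
    using p unfolding bdry_distribution_def by (rule conjunct1)
  from this[rule_format, OF z z, of 0 0] have p0: "p (\<lambda>z. 0) = 0" by simp
  obtain \<eta> where "time_cutoffs t \<eta>" using ex_time_cutoffs by blast
  with h have "(\<lambda>n. p (\<lambda>(x, \<tau>). \<eta> n \<tau> * 0)) \<longlonglongrightarrow> c" unfolding has_bdry_pairing_def by auto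
  moreover have "(\<lambda>(x::real^2, \<tau>). \<eta> n \<tau> * (0::real)) = (\<lambda>z. 0)" for n by auto
  ultimately have "(\<lambda>n. 0 :: real) \<longlonglongrightarrow> c" by (simp only: p0)
  then show ?thesis by (simp add: LIMSEQ_const_iff)
qed

text \<open>For kernels such as \<open>g y\<close> contracted with a fixed direction, which are not
  themselves invariant under the reflection.\<close>

lemma conv_reflect':
  assumes \<kappa>: "bk B \<kappa>" and f: "f \<in> Lsp" and s: "\<And>x. f (reflect x) = reflect (f x)"
  shows "conv \<kappa> f (reflect x) = reflect (conv (\<lambda>y. \<kappa> (reflect y)) f x)"
proof -
  note [measurable] = LspD(2)[OF f] bkD(2)[OF \<kappa>]
  have b: "bk B (\<lambda>y. \<kappa> (reflect y))" using \<kappa> by (auto simp: bk_def)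
  have "conv \<kappa> f (reflect x) = (\<integral>z. \<kappa> (reflect x - reflect z) *\<^sub>R f (reflect z) \<partial>lborel)"
    unfolding conv_def using integral_lborel_reflect[of "\<lambda>z. \<kappa> (reflect x - z) *\<^sub>R f z"] by simp
  also have "\<dots> = (\<integral>z. reflect (\<kappa> (reflect (x - z)) *\<^sub>R f z) \<partial>lborel)"
    by (simp add: s reflect_scale flip: reflect_diff)
  also have "\<dots> = reflect (conv (\<lambda>y. \<kappa> (reflect y)) f x)"
    unfolding conv_def by (rule integral_bounded_linear[OF bounded_linear_reflect conv_integrable[OF b f]])
  finally show ?thesis .
qed

lemma grad_Kern_reflect: "0 < \<epsilon> \<Longrightarrow> grad (Kern \<epsilon>) (reflect x) = reflect (grad (Kern \<epsilon>) x)"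
proof -
  have "grad bump (reflect x) = reflect (grad bump x)" for x
    by (simp only: grad_bump inner_reflect reflect_scale)
  then show "0 < \<epsilon> \<Longrightarrow> ?thesis" by (simp only: grad_Kern reflect_scale[symmetric])
qed

text \<open>The gradient of the radial kernel commutes with the reflection, so the integrand takes
  equal values at mirror points, and the factor 1/2 is that of the doubled domain.\<close>

lemma flux_represents:
  assumes e: "0 < \<epsilon>" "\<epsilon> \<le> 1" and r: "represents V v" and f: "f \<in> Lsp" and s: "\<And>x. f (reflect x) = reflect (f x)"
  shows "flux_D v (conv (Kern \<epsilon>) f) = Tri (grad (Kern \<epsilon>)) V V f / 2"
proof -
  let ?g = "grad (Kern \<epsilon>)" and ?W = "conv (Kern \<epsilon>) f"
  note k = kern_Kern[OF e]
  obtain B where B: "bkv B ?g" using kern_grad_bkv[OF k] by blast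
  note V = representsD(1,2)[OF r]
  note [measurable] = LspD(2)[OF f] LspD(2)[OF V(1)] bkvD(2)[OF B]
  let ?h = "\<lambda>x. V x \<bullet> conv (\<lambda>y. ?g y \<bullet> V x) f x"
  have hm: "?h \<in> borel_measurable borel" unfolding conv_def by measurable
  have hs: "?h (reflect x) = ?h x" for x
  proof -
    have "conv (\<lambda>y. ?g y \<bullet> V (reflect x)) f (reflect x) = reflect (conv (\<lambda>y. ?g (reflect y) \<bullet> V (reflect x)) f x)"
      by (rule conv_reflect'[OF bk_inner[OF B] f s])
    also have "\<dots> = reflect (conv (\<lambda>y. ?g y \<bullet> V x) f x)"
      by (simp add: grad_Kern_reflect[OF e(1)] V(2) inner_reflect)
    finally show ?thesis by (simp add: V(2) inner_reflect)
  qed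
  have "(\<Sum>i\<in>UNIV. \<Sum>j\<in>UNIV. v x $ i * v x $ j * frechet_derivative ?W (at x within D_plus) (axis i 1) $ j)
      = v x \<bullet> conv (\<lambda>y. ?g y \<bullet> v x) f x" if x: "x \<in> D_plus" for x
  proof -
    let ?D = "\<lambda>h. conv (\<lambda>y. ?g y \<bullet> h) f x"
    have hd: "(?W has_derivative ?D) (at x)" by (rule conv_has_derivative[OF k f])
    have lin: "linear ?D" using has_derivative_linear[OF hd] .
    have fd: "frechet_derivative ?W (at x within D_plus) = ?D"
      by (rule frechet_derivative_thick[OF thick_D_plus x has_derivative_at_withinI[OF hd]])
    \<comment> \<open>Expanding \<open>v x\<close> in the basis collapses the double sum of the
      tensor contraction to one directional derivative.\<close>
    have "?D (v x) = ?D (\<Sum>i\<in>UNIV. v x $ i *\<^sub>R axis i 1)"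
      by (simp add: basis_expansion[where x = "v x"] flip: scalar_mult_eq_scaleR)
    also have "\<dots> = (\<Sum>i\<in>UNIV. v x $ i *\<^sub>R ?D (axis i 1))"
      by (simp only: linear_sum[OF lin] linear_scale[OF lin])
    finally have D: "?D (v x) $ j = (\<Sum>i\<in>UNIV. v x $ i * ?D (axis i 1) $ j)" for j by simp
    have "v x \<bullet> ?D (v x) = (\<Sum>j\<in>UNIV. v x $ j \<bullet> ?D (v x) $ j)" by (rule inner_vec_def)
    also have "\<dots> = (\<Sum>j\<in>UNIV. \<Sum>i\<in>UNIV. v x $ i * v x $ j * ?D (axis i 1) $ j)"
      by (rule sum.cong[OF refl]) (simp only: D inner_real_def sum_distrib_left mult_ac)
    also have "\<dots> = (\<Sum>i\<in>UNIV. \<Sum>j\<in>UNIV. v x $ i * v x $ j * ?D (axis i 1) $ j)" by (rule sum.swap)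
    finally show ?thesis unfolding fd by simp
  qed
  note sum_eq = this
  show ?thesis unfolding flux_D_def Tri_def
  proof (rule cell_integral(2)[OF hm hs])
    show "AE x in lebesgue. x \<in> cell \<longrightarrow> (\<Sum>i\<in>UNIV. \<Sum>j\<in>UNIV. v x $ i * v x $ j * frechet_derivative ?W (at x within D_plus) (axis i 1) $ j) = ?h x"
      using representsD(4)[OF r]
    proof eventually_elim
      case (elim x)
      show ?case
      proof
        assume x: "x \<in> cell"
        then have "x \<in> D_plus" by (simp add: cell_eq D_plus_def)
        from sum_eq[OF this] elim x show "(\<Sum>i\<in>UNIV. \<Sum>j\<in>UNIV. v x $ i * v x $ j * frechet_derivative ?W (at x within D_plus) (axis i 1) $ j) = ?h x"
          by simp
      qed
    qed
  qed
qed

lemma lebesgue_on_interval_integral: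
  fixes q :: "real \<Rightarrow> real"
  assumes "q \<in> borel_measurable borel"
  shows "(\<integral>t. q t \<partial>lebesgue_on {a..b}) = (\<integral>t. indicator {a..b} t *\<^sub>R q t \<partial>lborel)"
    and "integrable (lebesgue_on {a..b}) q \<longleftrightarrow> integrable lborel (\<lambda>t. indicator {a..b} t *\<^sub>R q t)"
proof -
  note [measurable] = assms
  have cl: "{a..b} \<inter> space lebesgue \<in> sets lebesgue" by simp
  show "(\<integral>t. q t \<partial>lebesgue_on {a..b}) = (\<integral>t. indicator {a..b} t *\<^sub>R q t \<partial>lborel)"
    unfolding integral_restrict_space[OF cl] by (rule integral_completion) measurable
  show "integrable (lebesgue_on {a..b}) q \<longleftrightarrow> integrable lborel (\<lambda>t. indicator {a..b} t *\<^sub>R q t)"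
    unfolding integrable_restrict_space[OF cl] by (rule integrable_completion) measurable
qed

lemma integrable_bounded_interval:
  fixes q :: "real \<Rightarrow> real"
  assumes [measurable]: "q \<in> borel_measurable borel" and b: "\<And>t. \<bar>q t\<bar> \<le> K"
  shows "integrable lborel (\<lambda>t. indicator {a..b} t *\<^sub>R q t)"
proof (rule Bochner_Integration.integrable_bound)
  show "integrable lborel (\<lambda>t. K * indicator {a..b} t)" 
    by (intro integrable_mult_right integrable_real_indicator) (auto simp: emeasure_lborel_Icc_eq)
  show "AE t in lborel. norm (indicator {a..b} t *\<^sub>R q t) \<le> norm (K * indicator {a..b} t)"
  proof (rule AE_I2)
    fix t :: real
    show "norm (indicator {a..b} t *\<^sub>R q t) \<le> norm (K * indicator {a..b} t)"
      using b[of t] by (cases "t \<in> {a..b}") auto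
  qed
qed measurable

lemma weak_solution_flow:
  assumes T: "0 < T" and ws: "weak_solution T u p"
  obtains U where "weakly_continuous_flow U" "\<And>t. t \<in> {0..T} \<Longrightarrow> represents (U t) (u t)"
    "\<And>\<Phi> \<epsilon> a b. tangential \<Phi> \<Longrightarrow> 0 < \<epsilon> \<Longrightarrow> \<epsilon> \<le> 1 \<Longrightarrow> 0 \<le> a \<Longrightarrow> a \<le> b \<Longrightarrow> b \<le> T \<Longrightarrow>
      (\<integral>x. U b x \<bullet> conv (Kern \<epsilon>) (refl_ext \<Phi>) x \<partial>muC) - (\<integral>x. U a x \<bullet> conv (Kern \<epsilon>) (refl_ext \<Phi>) x \<partial>muC)
      = (\<integral>t. indicator {a..b} t *\<^sub>R Tri (grad (Kern \<epsilon>)) (U t) (U t) (refl_ext \<Phi>) \<partial>lborel)"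
proof -
  \<comment> \<open>Freezing the flow outside \<open>[0, T]\<close> extends weak continuity and
    boundedness to all real times.\<close>
  define cl where "cl t = max 0 (min T t)" for t
  have clT: "cl t \<in> {0..T}" for t using T by (auto simp: cl_def)
  have cl_id: "t \<in> {0..T} \<Longrightarrow> cl t = t" for t by (auto simp: cl_def)
  have uH: "u (cl t) \<in> H_sigma_D" for t using ws clT by (auto simp: weak_solution_def Cw_H_sigma_D_def)
  have uL: "u (cl t) \<in> L2_D" for t using uH by (auto simp: H_sigma_D_def)
  define U where "U t = (SOME V. represents V (u (cl t)))" for t
  have rep: "represents (U t) (u (cl t))" for t
    unfolding U_def by (rule someI_ex[OF ex_represents[OF uL]])
  have rep': "represents (U t) (u t)" if "t \<in> {0..T}" for t using rep[of t] cl_id[OF that] by simp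
  note UL = representsD(1)[OF rep] and Us = representsD(2)[OF rep]
  have pair: "\<exists>h\<in>L2_D. \<forall>t. (\<integral>x. U t x \<bullet> f x \<partial>muC) = inner_D (u (cl t)) h" if f: "f \<in> Lsp" for f
  proof (intro bexI allI)
    let ?h = "\<lambda>x. f x + reflect (f (reflect x))"
    have hL: "?h \<in> Lsp" by (intro Lsp_add f Lsp_reflect)
    have hs: "?h (reflect x) = reflect (?h x)" for x by (simp add: reflect_add add.commute)
    show "?h \<in> L2_D" by (rule Lsp_restrict_L2_D[OF hL hs])
    show "(\<integral>x. U t x \<bullet> f x \<partial>muC) = inner_D (u (cl t)) ?h" for t
      using inner_symmetrize[OF UL Us f, of t] inner_represents[OF rep hL hs, of t] by simp
  qed
  have cont: "continuous_on {0..T} (\<lambda>t. inner_D (u t) h)" if "h \<in> L2_D" for h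
    using ws that by (auto simp: weak_solution_def Cw_H_sigma_D_def)
  have flow: "weakly_continuous_flow U"
  proof
    show "U t \<in> Lsp" "U t (reflect x) = reflect (U t x)" for t x by (rule UL, rule Us)
    show "\<exists>\<Phi>. tangential \<Phi> \<and> nrm (\<lambda>x. U t x - refl_ext \<Phi> x) < e" if "0 < e" for t e
      by (rule H_sigma_approx[OF uH rep that])
    fix f assume "f \<in> Lsp"
    then obtain h where h: "h \<in> L2_D" "\<And>t. (\<integral>x. U t x \<bullet> f x \<partial>muC) = inner_D (u (cl t)) h" using pair by blast
    have "continuous_on UNIV cl" unfolding cl_def by (intro continuous_intros)
    then show "continuous_on UNIV (\<lambda>t. \<integral>x. U t x \<bullet> f x \<partial>muC)"
      unfolding h(2) by (rule continuous_on_compose2[OF cont[OF h(1)]]) (use clT in auto)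
    have "bounded ((\<lambda>t. inner_D (u t) h) ` {0..T})"
      by (intro compact_imp_bounded compact_continuous_image cont[OF h(1)]) auto
    then obtain C where "\<forall>z\<in>(\<lambda>t. inner_D (u t) h) ` {0..T}. norm z \<le> C" unfolding bounded_iff by blast
    then show "\<exists>C. \<forall>t. \<bar>\<integral>x. U t x \<bullet> f x \<partial>muC\<bar> \<le> C" unfolding h(2) using clT
      by (intro exI[of _ C]) auto
  qed
  interpret weakly_continuous_flow U by (rule flow)
  obtain M where M: "0 \<le> M" "\<And>t. nrm (U t) \<le> M" by (rule bounded_nrm) (rule that)
  have eqn: "(\<integral>x. U b x \<bullet> conv (Kern \<epsilon>) (refl_ext \<Phi>) x \<partial>muC) - (\<integral>x. U a x \<bullet> conv (Kern \<epsilon>) (refl_ext \<Phi>) x \<partial>muC)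
      = (\<integral>t. indicator {a..b} t *\<^sub>R Tri (grad (Kern \<epsilon>)) (U t) (U t) (refl_ext \<Phi>) \<partial>lborel)"
    if t: "tangential \<Phi>" and e: "0 < \<epsilon>" "\<epsilon> \<le> 1" and ab: "0 \<le> a" "a \<le> b" "b \<le> T" for \<Phi> \<epsilon> a b
  proof -
    let ?f = "refl_ext \<Phi>" and ?g = "grad (Kern \<epsilon>)"
    let ?W = "conv (Kern \<epsilon>) ?f"
    note k = kern_Kern[OF e]
    obtain B where B: "bkv B ?g" using kern_grad_bkv[OF k] by blast
    obtain B0 where B0: "bk B0 (Kern \<epsilon>)" using kern_bk[OF k] by blast
    have f: "?f \<in> Lsp" by (rule nice_Lsp[OF nice_refl_ext[OF t]])
    have fs: "?f (reflect x) = reflect (?f x)" for x by (rule refl_ext_reflect) (use t in \<open>auto simp: tangential_def\<close>)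
    have WL: "?W \<in> Lsp" by (rule conv_Kern_contraction(1)[OF e f])
    have Ws: "?W (reflect x) = reflect (?W x)" for x by (rule conv_reflect[OF B0 f Kern_reflect fs])
    \<comment> \<open>A point of the plane is its own mirror image, so the symmetric field is fixed
      by the reflection there, and its normal component equals its own negative.\<close>
    have W3: "?W x $ 3 = 0" if "x $ 3 = 0" for x
    proof -
      have "reflect (?W x) $ 3 = ?W x $ 3" using Ws[of x] reflect_fixed[OF that] by (simp only:)
      then show ?thesis by simp
    qed
    define q where "q \<tau> = Tri ?g (U \<tau>) (U \<tau>) ?f / 2" for \<tau>
    have qm [measurable]: "q \<in> borel_measurable borel"
      unfolding q_def[abs_def] by (intro borel_measurable_divide Tri_measurable[OF B f]) auto
    have qb: "\<bar>q \<tau>\<bar> \<le> 8 * B * M * M * nrm ?f" for \<tau>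
    proof -
      have "\<bar>q \<tau>\<bar> \<le> \<bar>Tri ?g (U \<tau>) (U \<tau>) ?f\<bar>" by (simp add: q_def)
      also have "\<dots> \<le> 8 * B * nrm (U \<tau>) * nrm (U \<tau>) * nrm ?f" by (rule Tri_bound[OF B UL UL f])
      also have "\<dots> \<le> 8 * B * M * M * nrm ?f"
        using bkvD(1)[OF B] M by (intro mult_right_mono mult_mono) auto
      finally show ?thesis .
    qed
    have fl: "flux_D (u \<tau>) ?W = q \<tau>" if "\<tau> \<in> {0..T}" for \<tau>
      unfolding q_def by (rule flux_represents[OF e rep'[OF that] f fs])
    let ?\<phi> = "\<lambda>_::real. ?W"
    have test: "?\<phi> \<in> schwartz_sigma_time_D T"
      unfolding schwartz_sigma_time_D_def schwartz_sigma_D_def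
      using smooth_time_independent[OF thick_D_plus T smooth_conv[OF k f]] schwartz_sigma_conv[OF k t] by auto
    \<comment> \<open>The test field does not depend on time, so only the values at the end points
      and the flux remain in the weak formulation.\<close>
    have td: "time_deriv T ?\<phi> \<tau> x = 0" if "\<tau> \<in> {0..T}" for \<tau> x
    proof -
      have "vector_derivative (\<lambda>s. ?W x) (at \<tau> within cbox 0 T) = 0"
        by (rule vector_derivative_within_cbox) (use T that in \<open>auto intro!: derivative_eq_intros\<close>)
      then show ?thesis by (simp add: time_deriv_def)
    qed
    have nt: "normal_trace ?\<phi> = (\<lambda>z. 0)"
      using W3 by (auto simp: normal_trace_def outer_normal_def inner_3 fun_eq_iff)
    have main: "inner_D (u s) ?W - inner_D (u 0) ?W = (\<integral>\<tau>. indicator {0..s} \<tau> *\<^sub>R q \<tau> \<partial>lborel)" if s: "s \<in> {0..T}" for s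
    proof -
      have in0: "inner_D (u \<tau>) (time_deriv T ?\<phi> \<tau>) = 0" if "\<tau> \<in> {0..T}" for \<tau>
        by (simp add: inner_D_def td[OF that])
      have sub: "\<tau> \<in> {0..T}" if "\<tau> \<in> {0..s}" for \<tau> using that s by auto
      have c1: "integrable (lebesgue_on {0..s}) (\<lambda>\<tau>. flux_D (u \<tau>) ?W) \<longleftrightarrow> integrable (lebesgue_on {0..s}) q"
        by (rule Bochner_Integration.integrable_cong) (use fl sub in auto)
      have c2: "(\<integral>\<tau>. flux_D (u \<tau>) ?W \<partial>lebesgue_on {0..s}) = (\<integral>\<tau>. q \<tau> \<partial>lebesgue_on {0..s})"
        by (rule Bochner_Integration.integral_cong) (use fl sub in auto)
      have c3: "(\<integral>\<tau>. inner_D (u \<tau>) (time_deriv T ?\<phi> \<tau>) \<partial>lebesgue_on {0..s}) = (\<integral>\<tau>. 0 \<partial>lebesgue_on {0..s})"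
        by (rule Bochner_Integration.integral_cong) (use in0 sub in auto)
      have c4: "integrable (lebesgue_on {0..s}) (\<lambda>\<tau>. inner_D (u \<tau>) (time_deriv T ?\<phi> \<tau>)) \<longleftrightarrow> integrable (lebesgue_on {0..s}) (\<lambda>\<tau>. 0::real)"
        by (rule Bochner_Integration.integrable_cong) (use in0 sub in auto)
      have c5: "AE \<tau> in lebesgue_on {0..s}. integrable (lebesgue_on cell) (\<lambda>x. u \<tau> x \<bullet> time_deriv T ?\<phi> \<tau> x)"
        by (rule AE_I2) (use td sub in auto)
      have "weak_terms_defined T u ?\<phi> s"
        unfolding weak_terms_defined_def using c1 c4 c5 integrable_bounded_interval[OF qm qb, of 0 s]
        by (simp add: lebesgue_on_interval_integral(2)[OF qm])
      then obtain c where c: "has_bdry_pairing p s (normal_trace ?\<phi>) c"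
        and eq: "inner_D (u s) ?W - inner_D (u 0) ?W - (LINT \<tau>|lebesgue_on {0..s}. inner_D (u \<tau>) (time_deriv T ?\<phi> \<tau>))
           = (LINT \<tau>|lebesgue_on {0..s}. flux_D (u \<tau>) ?W) - c"
        using ws s test unfolding weak_solution_def by blast
      have "c = 0" using bdry_pairing_0[OF T _ c[unfolded nt]] ws by (simp add: weak_solution_def)
      with eq show ?thesis by (simp add: c2 c3 lebesgue_on_interval_integral(1)[OF qm])
    qed
    have inn: "inner_D (u s) ?W = (\<integral>x. U s x \<bullet> ?W x \<partial>muC) / 2" if "s \<in> {0..T}" for s
      by (rule inner_represents[OF rep'[OF that] WL Ws])
    have ab': "a \<in> {0..T}" "b \<in> {0..T}" using ab by auto
    \<comment> \<open>The weak formulation starts at time 0. Subtracting two instances gives the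
      interval from \<open>a\<close> to \<open>b\<close>, except at the point \<open>a\<close>,
      which is null.\<close>
    have "(\<integral>\<tau>. indicator {0..b} \<tau> *\<^sub>R q \<tau> \<partial>lborel) - (\<integral>\<tau>. indicator {0..a} \<tau> *\<^sub>R q \<tau> \<partial>lborel)
        = (\<integral>\<tau>. indicator {0..b} \<tau> *\<^sub>R q \<tau> - indicator {0..a} \<tau> *\<^sub>R q \<tau> \<partial>lborel)"
      by (rule Bochner_Integration.integral_diff[symmetric]) (intro integrable_bounded_interval[OF qm qb])+
    also have "\<dots> = (\<integral>\<tau>. indicator {a..b} \<tau> *\<^sub>R q \<tau> \<partial>lborel)"
    proof (rule integral_cong_AE)
      have "AE \<tau> in lborel. \<tau> \<noteq> a" by (rule AE_lborel_singleton)
      then show "AE \<tau> in lborel. indicator {0..b} \<tau> *\<^sub>R q \<tau> - indicator {0..a} \<tau> *\<^sub>R q \<tau> = indicator {a..b} \<tau> *\<^sub>R q \<tau>"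
        by eventually_elim (use ab in \<open>auto simp: indicator_def\<close>)
    qed measurable
    also have "\<dots> = (\<integral>t. indicator {a..b} t *\<^sub>R Tri ?g (U t) (U t) ?f \<partial>lborel) / 2"
      unfolding q_def by simp
    finally show ?thesis using main[OF ab'(1)] main[OF ab'(2)] inn[OF ab'(1)] inn[OF ab'(2)] by simp
  qed
  show thesis by (rule that[OF flow rep' eqn])
qed

section \<open>The energy balance of the mollified field\<close>

locale euler_flow = weakly_continuous_flow U for U +
  fixes T :: real
  assumes weak_eq: "\<And>\<Phi> \<epsilon> a b. tangential \<Phi> \<Longrightarrow> 0 < \<epsilon> \<Longrightarrow> \<epsilon> \<le> 1 \<Longrightarrow> 0 \<le> a \<Longrightarrow> a \<le> b \<Longrightarrow> b \<le> T \<Longrightarrow>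
      (\<integral>x. U b x \<bullet> conv (Kern \<epsilon>) (refl_ext \<Phi>) x \<partial>muC) - (\<integral>x. U a x \<bullet> conv (Kern \<epsilon>) (refl_ext \<Phi>) x \<partial>muC)
      = (\<integral>t. indicator {a..b} t *\<^sub>R Tri (grad (Kern \<epsilon>)) (U t) (U t) (refl_ext \<Phi>) \<partial>lborel)"
begin

lemma Tri_cubic_tendsto:
  assumes g: "bkv B g" and d: "\<And>n. 0 < d n" "\<And>n. d n \<le> 1" "d \<longlonglongrightarrow> 0"
  shows "(\<lambda>n. Tri g (conv (Kern (d n)) (U t)) (conv (Kern (d n)) (U t)) (conv (Kern (d n)) (U t))) \<longlonglongrightarrow> Tri g (U t) (U t) (U t)"
  by (rule Tri_tendsto[OF g _ Lsp _ Lsp mollify_tendsto[OF d] mollify_tendsto[OF d], where M = "nrm (U t)"])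
     (intro conv_Kern_contraction d Lsp order_refl)+

lemma Tri_cubic_measurable:
  assumes g: "bkv B g" shows "(\<lambda>t. Tri g (U t) (U t) (U t)) \<in> borel_measurable borel"
proof -
  obtain d :: "nat \<Rightarrow> real" where d: "\<And>n. 0 < d n" "\<And>n. d n \<le> 1" "d \<longlonglongrightarrow> 0" by (rule ex_mollifier_seq) (rule that)
  note [measurable] = bkvD(2)[OF g]
  show ?thesis
  proof (rule borel_measurable_LIMSEQ_real)
    show "(\<lambda>n. Tri g (conv (Kern (d n)) (U t)) (conv (Kern (d n)) (U t)) (conv (Kern (d n)) (U t))) \<longlonglongrightarrow> Tri g (U t) (U t) (U t)" for t
      by (rule Tri_cubic_tendsto[OF g d])
    show "(\<lambda>t. Tri g (conv (Kern (d n)) (U t)) (conv (Kern (d n)) (U t)) (conv (Kern (d n)) (U t))) \<in> borel_measurable borel" for n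
    proof -
      have [measurable]: "(\<lambda>(t, x). conv (Kern (d n)) (U t) x) \<in> borel_measurable (borel \<Otimes>\<^sub>M borel)"
        by (rule conv_measurable_joint[OF kern_Kern[OF d(1,2)]])
      show ?thesis by (rule measurable_Tri) measurable
    qed
  qed
qed

definition mollified_pairing :: "real \<Rightarrow> real \<Rightarrow> real \<Rightarrow> real" where
  "mollified_pairing \<epsilon> s t = (\<integral>x. U s x \<bullet> conv (Kern \<epsilon>) (U t) x \<partial>muC)"

lemma mollified_pairing_commute:
  assumes e: "0 < \<epsilon>" "\<epsilon> \<le> 1" shows "mollified_pairing \<epsilon> s t = mollified_pairing \<epsilon> t s"
proof -
  obtain B where B: "bk B (Kern \<epsilon>)" using Kern_bk[OF e] by blast
  show ?thesis unfolding mollified_pairing_def by (rule conv_symmetric[OF B]) (simp_all add: Lsp)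
qed

lemma mollified_pairing_diff:
  assumes e: "0 < \<epsilon>" "\<epsilon> \<le> 1" and ab: "0 \<le> a" "a \<le> b" "b \<le> T"
  shows "mollified_pairing \<epsilon> b s - mollified_pairing \<epsilon> a s
    = (\<integral>t. indicator {a..<b} t *\<^sub>R Tri (grad (Kern \<epsilon>)) (U t) (U t) (U s) \<partial>lborel)"
proof -
  let ?g = "grad (Kern \<epsilon>)" and ?K = "conv (Kern \<epsilon>)"
  obtain M where M: "0 \<le> M" "\<And>t. nrm (U t) \<le> M" by (rule bounded_nrm) (rule that)
  obtain B where B: "bkv B ?g" using kern_grad_bkv[OF kern_Kern[OF e]] by blast
  obtain B0 where B0: "bk B0 (Kern \<epsilon>)" using Kern_bk[OF e] by blast
  note B00 = bkvD(1)[OF B]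
  have tb: "\<bar>Tri ?g (U t) (U t) f\<bar> \<le> 8 * B * M * M * nrm f" if f: "f \<in> Lsp" for t f
  proof -
    have "\<bar>Tri ?g (U t) (U t) f\<bar> \<le> 8 * B * nrm (U t) * nrm (U t) * nrm f" by (rule Tri_bound[OF B Lsp Lsp f])
    also have "\<dots> \<le> 8 * B * M * M * nrm f" using B00 M by (intro mult_right_mono mult_mono) auto
    finally show ?thesis .
  qed
  have ti: "integrable lborel (\<lambda>t. indicator {a..b} t *\<^sub>R Tri ?g (U t) (U t) f)" if f: "f \<in> Lsp" for f
    by (rule integrable_bounded_interval[OF Tri_measurable[OF B f] tb[OF f]])
  let ?L = "mollified_pairing \<epsilon> b s - mollified_pairing \<epsilon> a s"
  let ?R = "\<integral>t. indicator {a..b} t *\<^sub>R Tri ?g (U t) (U t) (U s) \<partial>lborel"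
  define K where "K = 2 * M + (b - a) * (8 * B * M * M)"
  have K0: "0 \<le> K" using M B00 ab by (simp add: K_def)
  have "\<bar>?L - ?R\<bar> \<le> K * r" if r: "0 < r" for r
  proof -
    obtain \<Phi> where \<Phi>: "tangential \<Phi>" "nrm (\<lambda>x. U s x - refl_ext \<Phi> x) < r" using approx[OF r] by blast
    let ?f = "refl_ext \<Phi>"
    have f: "?f \<in> Lsp" by (rule nice_Lsp[OF nice_refl_ext[OF \<Phi>(1)]])
    let ?d = "\<lambda>x. U s x - ?f x"
    have d: "?d \<in> Lsp" by (intro Lsp_diff Lsp f)
    have Kd: "?K ?d \<in> Lsp" "nrm (?K ?d) \<le> nrm ?d" by (intro conv_Kern_contraction e d)+
    have p: "(\<integral>x. U t x \<bullet> ?K (U s) x \<partial>muC) = (\<integral>x. U t x \<bullet> ?K ?f x \<partial>muC) + (\<integral>x. U t x \<bullet> ?K ?d x \<partial>muC)" for t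
      using Lsp_integrable_inner[OF Lsp conv_Kern_contraction(1)[OF e f]] Lsp_integrable_inner[OF Lsp conv_Kern_contraction(1)[OF e Lsp]]
      by (simp add: conv_diff[OF B0 Lsp f] inner_diff_right)
    have pb: "\<bar>\<integral>x. U t x \<bullet> ?K ?d x \<partial>muC\<bar> \<le> M * r" for t
    proof -
      have "\<bar>\<integral>x. U t x \<bullet> ?K ?d x \<partial>muC\<bar> \<le> nrm (U t) * nrm (?K ?d)" by (rule Lsp_Cauchy_Schwarz[OF Lsp Kd(1)])
      also have "\<dots> \<le> M * r" using M Kd(2) \<Phi>(2) by (intro mult_mono) auto
      finally show ?thesis .
    qed
    have R: "?R = (\<integral>t. indicator {a..b} t *\<^sub>R Tri ?g (U t) (U t) ?f \<partial>lborel) + (\<integral>t. indicator {a..b} t *\<^sub>R Tri ?g (U t) (U t) ?d \<partial>lborel)"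
      unfolding Bochner_Integration.integral_add[OF ti[OF f] ti[OF d], symmetric]
      by (rule Bochner_Integration.integral_cong[OF refl]) (simp add: Tri_diff_3[OF B Lsp Lsp Lsp f] algebra_simps)
    have Rb: "\<bar>\<integral>t. indicator {a..b} t *\<^sub>R Tri ?g (U t) (U t) ?d \<partial>lborel\<bar> \<le> (b - a) * (8 * B * M * M * r)"
    proof -
      have c0: "8 * B * M * M * nrm ?d \<le> 8 * B * M * M * r" using \<Phi>(2) B00 M by (intro mult_left_mono) auto
      have "norm (\<integral>t. indicator {a..b} t *\<^sub>R Tri ?g (U t) (U t) ?d \<partial>lborel) \<le> (\<integral>t. (8 * B * M * M * r) * indicator {a..b} t \<partial>lborel)"
      proof (rule Bochner_Integration.integral_norm_bound_integral[OF ti[OF d]])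
        show "integrable lborel (\<lambda>t. (8 * B * M * M * r) * indicator {a..b} t)"
          by (intro integrable_mult_right integrable_real_indicator) (auto simp: emeasure_lborel_Icc_eq)
        show "norm (indicator {a..b} t *\<^sub>R Tri ?g (U t) (U t) ?d) \<le> (8 * B * M * M * r) * indicator {a..b} t" for t
          using order_trans[OF tb[OF d, of t] c0] by (simp add: indicator_def)
      qed
      also have "\<dots> = (b - a) * (8 * B * M * M * r)" using ab by simp
      finally show ?thesis by simp
    qed
    have "?L - ?R = (\<integral>x. U b x \<bullet> ?K ?d x \<partial>muC) - (\<integral>x. U a x \<bullet> ?K ?d x \<partial>muC)
        - (\<integral>t. indicator {a..b} t *\<^sub>R Tri ?g (U t) (U t) ?d \<partial>lborel)"
      unfolding mollified_pairing_def p R using weak_eq[OF \<Phi>(1) e ab] by simp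
    then have "\<bar>?L - ?R\<bar> \<le> M * r + M * r + (b - a) * (8 * B * M * M * r)"
      using pb[of b] pb[of a] Rb by linarith
    then show ?thesis by (simp add: K_def algebra_simps)
  qed
  note bd = this
  have "\<bar>?L - ?R\<bar> \<le> K * (r / (K + 1))" if "0 < r" for r
    using that K0 by (intro bd divide_pos_pos) auto
  moreover have "K * (r / (K + 1)) \<le> r" if "0 < r" for r using that K0 by (simp add: field_simps)
  ultimately have "\<bar>?L - ?R\<bar> \<le> 0 + r" if "0 < r" for r using that order_trans by fastforce
  then have "\<bar>?L - ?R\<bar> \<le> 0" by (rule field_le_epsilon)
  then have "?L = ?R" by simp
  also have "?R = (\<integral>t. indicator {a..<b} t *\<^sub>R Tri ?g (U t) (U t) (U s) \<partial>lborel)"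
  proof (rule integral_cong_AE)
    note [measurable] = Tri_measurable[OF B Lsp[of s]]
    show "(\<lambda>t. indicator {a..b} t *\<^sub>R Tri ?g (U t) (U t) (U s)) \<in> borel_measurable lborel"
      "(\<lambda>t. indicator {a..<b} t *\<^sub>R Tri ?g (U t) (U t) (U s)) \<in> borel_measurable lborel" by measurable
    have "AE t in lborel. t \<noteq> b" by (rule AE_lborel_singleton)
    then show "AE t in lborel. indicator {a..b} t *\<^sub>R Tri ?g (U t) (U t) (U s) = indicator {a..<b} t *\<^sub>R Tri ?g (U t) (U t) (U s)"
      by eventually_elim (auto simp: indicator_def)
  qed
  finally show ?thesis .
qed

text \<open>Riemann sums turn the balance for a frozen test field into the one for the diagonal.\<close>

lemma energy_balance:
  assumes e: "0 < \<epsilon>" "\<epsilon> \<le> 1" and ab: "0 \<le> a" "a < b" "b \<le> T"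
  shows "mollified_pairing \<epsilon> b b - mollified_pairing \<epsilon> a a
    = 2 * (\<integral>t. indicator {a..<b} t *\<^sub>R Tri (grad (Kern \<epsilon>)) (U t) (U t) (U t) \<partial>lborel)"
proof -
  let ?g = "grad (Kern \<epsilon>)" and ?G = "mollified_pairing \<epsilon>"
  define F where "F t s = Tri ?g (U t) (U t) (U s)" for t s
  obtain M where M: "0 \<le> M" "\<And>t. nrm (U t) \<le> M" by (rule bounded_nrm) (rule that)
  obtain B where B: "bkv B ?g" using kern_grad_bkv[OF kern_Kern[OF e]] by blast
  note B00 = bkvD(1)[OF B]
  define K where "K = 8 * B * M * M * M"
  have Fb: "\<bar>F t s\<bar> \<le> K" for t s
  proof -
    have "\<bar>F t s\<bar> \<le> 8 * B * nrm (U t) * nrm (U t) * nrm (U s)" unfolding F_def by (rule Tri_bound[OF B Lsp Lsp Lsp])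
    also have "\<dots> \<le> 8 * B * M * M * M" using B00 M by (intro mult_mono) auto
    finally show ?thesis by (simp add: K_def)
  qed
  have Fm [measurable]: "(\<lambda>t. F t s) \<in> borel_measurable borel" for s unfolding F_def by (rule Tri_measurable[OF B Lsp])
  have Dm [measurable]: "(\<lambda>t. F t t) \<in> borel_measurable borel" unfolding F_def by (rule Tri_cubic_measurable[OF B])
  have K0: "0 \<le> K" using Fb[of 0 0] by linarith
  define h where "h N = (b - a) / real (Suc N)" for N
  define p where "p N k = a + real k * h N" for N k
  have h0: "0 < h N" for N using ab by (simp add: h_def)
  have p0: "p N 0 = a" and pN: "p N (Suc N) = b" for N by (simp_all add: p_def h_def)
  have pS: "p N (Suc k) = p N k + h N" for N k by (simp add: p_def algebra_simps)
  have prange: "a \<le> p N k" for N k using h0[of N] by (simp add: p_def)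
  have prange': "p N k \<le> b" if "k \<le> Suc N" for N k
  proof -
    have "real k * h N \<le> real (Suc N) * h N" using that h0[of N] by (intro mult_right_mono) auto
    also have "\<dots> = b - a" by (simp add: h_def)
    finally show ?thesis by (simp add: p_def)
  qed
  define R where "R N t = (\<Sum>k<Suc N. indicator {p N k..<p N (Suc k)} t * (F t (p N k) + F t (p N (Suc k))))" for N t
  have Rm [measurable]: "R N \<in> borel_measurable borel" for N unfolding R_def by measurable
  have Rint: "?G b b - ?G a a = (\<integral>t. R N t \<partial>lborel)" for N
  proof -
    have step: "?G (p N (Suc k)) (p N (Suc k)) - ?G (p N k) (p N k)
        = (\<integral>t. indicator {p N k..<p N (Suc k)} t * (F t (p N k) + F t (p N (Suc k))) \<partial>lborel)" if k: "k < Suc N" for k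
    proof -
      have ord: "0 \<le> p N k" "p N k \<le> p N (Suc k)" "p N (Suc k) \<le> T"
        using prange[of N k] prange'[of "Suc k" N] k h0[of N] ab by (auto simp: pS)
      have ii: "integrable lborel (\<lambda>t. indicator {p N k..<p N (Suc k)} t * F t s)" for s
      proof (rule Bochner_Integration.integrable_bound[OF integrable_bounded_interval[of "\<lambda>_. K" K "p N k" "p N (Suc k)"]])
        show "AE t in lborel. norm (indicator {p N k..<p N (Suc k)} t * F t s) \<le> norm (indicator {p N k..p N (Suc k)} t *\<^sub>R K)"
          using Fb K0 by (intro AE_I2) (auto simp: indicator_def)
      qed (use K0 in auto)
      \<comment> \<open>The change of the diagonal splits into two changes in the first argument,
        with the second frozen at either end point. Symmetry of the pairing makes the mixed terms
        cancel.\<close>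
      have "?G (p N (Suc k)) (p N (Suc k)) - ?G (p N k) (p N k)
          = (?G (p N (Suc k)) (p N k) - ?G (p N k) (p N k)) + (?G (p N (Suc k)) (p N (Suc k)) - ?G (p N k) (p N (Suc k)))"
        using mollified_pairing_commute[OF e, of "p N k" "p N (Suc k)"] by simp
      also have "\<dots> = (\<integral>t. indicator {p N k..<p N (Suc k)} t * F t (p N k) \<partial>lborel)
          + (\<integral>t. indicator {p N k..<p N (Suc k)} t * F t (p N (Suc k)) \<partial>lborel)"
        unfolding mollified_pairing_diff[OF e ord] F_def by simp
      finally show ?thesis using ii by (simp add: distrib_left)
    qed
    have ii: "integrable lborel (\<lambda>t. indicator {p N k..<p N (Suc k)} t * (F t (p N k) + F t (p N (Suc k))))" for k
    proof (rule Bochner_Integration.integrable_bound[OF integrable_bounded_interval[of "\<lambda>_. 2 * K" "2 * K" "p N k" "p N (Suc k)"]])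
      have "\<bar>F t (p N k) + F t (p N (Suc k))\<bar> \<le> 2 * K" for t using Fb[of t "p N k"] Fb[of t "p N (Suc k)"] by linarith
      then show "AE t in lborel. norm (indicator {p N k..<p N (Suc k)} t * (F t (p N k) + F t (p N (Suc k))))
          \<le> norm (indicator {p N k..p N (Suc k)} t *\<^sub>R (2 * K))"
        using K0 by (intro AE_I2) (auto simp: indicator_def)
    qed (use K0 in auto)
    have "?G b b - ?G a a = (\<Sum>k<Suc N. ?G (p N (Suc k)) (p N (Suc k)) - ?G (p N k) (p N k))"
      using sum_lessThan_telescope[of "\<lambda>k. ?G (p N k) (p N k)" "Suc N"] by (simp only: p0 pN)
    also have "\<dots> = (\<Sum>k<Suc N. \<integral>t. indicator {p N k..<p N (Suc k)} t * (F t (p N k) + F t (p N (Suc k))) \<partial>lborel)"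
      using step by (intro sum.cong) auto
    also have "\<dots> = (\<integral>t. R N t \<partial>lborel)"
      unfolding R_def using ii by (intro Bochner_Integration.integral_sum[symmetric]) auto
    finally show ?thesis .
  qed
  define ix where "ix N t = nat \<lfloor>(t - a) / h N\<rfloor>" for N t
  have ind: "indicator {p N k..<p N (Suc k)} t = (if k = ix N t then 1 else 0 :: real)" if "a \<le> t" for N k t
  proof -
    have "t \<in> {p N k..<p N (Suc k)} \<longleftrightarrow> real k \<le> (t - a) / h N \<and> (t - a) / h N < real k + 1"
      using h0[of N] by (simp add: p_def pS field_simps)
    also have "\<dots> \<longleftrightarrow> \<lfloor>(t - a) / h N\<rfloor> = int k" by (simp add: floor_eq_iff)
    also have "\<dots> \<longleftrightarrow> k = ix N t" using that h0[of N] by (auto simp: ix_def)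
    finally show ?thesis by (simp add: indicator_def)
  qed
  have Reval: "R N t = (if t \<in> {a..<b} then F t (p N (ix N t)) + F t (p N (Suc (ix N t))) else 0)" for N t
  proof (cases "t \<in> {a..<b}")
    case True
    have "(t - a) / h N < real (Suc N)"
    proof -
      have "real (Suc N) * h N = b - a" by (simp add: h_def)
      then show ?thesis using True h0[of N] by (simp add: divide_less_eq)
    qed
    then have "ix N t < Suc N" using True h0[of N] unfolding ix_def by (simp add: nat_less_iff floor_less_iff)
    then show ?thesis using True unfolding R_def by (simp add: ind if_distrib[of "\<lambda>c. c * _"] sum.delta cong: if_cong)
  next
    case False
    have "indicator {p N k..<p N (Suc k)} t = (0::real)" if "k < Suc N" for k
      using False prange[of N k] prange'[of "Suc k" N] that by (auto simp: indicator_def)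
    then have "R N t = 0" unfolding R_def by (intro sum.neutral) simp
    with False show ?thesis by (simp only: if_False)
  qed
  have plim: "(\<lambda>N. p N (ix N t)) \<longlonglongrightarrow> t" "(\<lambda>N. p N (Suc (ix N t))) \<longlonglongrightarrow> t" if t: "a \<le> t" for t
  proof -
    have hl: "h \<longlonglongrightarrow> 0"
    proof -
      have "(\<lambda>N. (b - a) * (1 / real (Suc N))) \<longlonglongrightarrow> (b - a) * 0"
        by (intro tendsto_mult tendsto_const lim_1_over_n[THEN LIMSEQ_Suc])
      then show ?thesis by (simp add: h_def[abs_def])
    qed
    have b1: "t - h N \<le> p N (ix N t)" "p N (ix N t) \<le> t" for N
    proof -
      have "indicator {p N (ix N t)..<p N (Suc (ix N t))} t = (1::real)" using ind[OF t, of N "ix N t"] by simp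
      then have "t \<in> {p N (ix N t)..<p N (Suc (ix N t))}" by (simp add: indicator_def split: if_splits)
      then show "t - h N \<le> p N (ix N t)" "p N (ix N t) \<le> t" by (auto simp: pS)
    qed
    have "(\<lambda>N. t - h N) \<longlonglongrightarrow> t - 0" by (intro tendsto_diff tendsto_const hl)
    then have l: "(\<lambda>N. t - h N) \<longlonglongrightarrow> t" by simp
    show 1: "(\<lambda>N. p N (ix N t)) \<longlonglongrightarrow> t"
      by (rule tendsto_sandwich[OF always_eventually always_eventually l tendsto_const]) (intro allI b1)+
    show "(\<lambda>N. p N (Suc (ix N t))) \<longlonglongrightarrow> t" using tendsto_add[OF 1 hl] by (simp add: pS)
  qed
  have Rlim: "(\<lambda>N. R N t) \<longlonglongrightarrow> indicator {a..<b} t * (2 * F t t)" for t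
  proof (cases "t \<in> {a..<b}")
    case True
    \<comment> \<open>Only the third slot carries partition points; the first two stay at the time
      \<open>t\<close> of integration, where no continuity is available.\<close>
    then have "(\<lambda>N. F t (p N (ix N t)) + F t (p N (Suc (ix N t)))) \<longlonglongrightarrow> F t t + F t t"
      unfolding F_def by (intro tendsto_add Tri_continuous_third[OF B Lsp] plim) auto
    then show ?thesis using True by (simp add: Reval)
  next
    case False
    then have "R N t = 0" for N unfolding Reval by (simp only: if_False)
    then show ?thesis using False by simp
  qed
  have "(\<lambda>N. \<integral>t. R N t \<partial>lborel) \<longlonglongrightarrow> (\<integral>t. indicator {a..<b} t * (2 * F t t) \<partial>lborel)"
  proof (rule integral_dominated_convergence)
    show "integrable lborel (\<lambda>t. indicator {a..b} t *\<^sub>R (2 * K))"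
      by (rule integrable_bounded_interval[of _ "2 * K"]) (use K0 in auto)
    show "AE t in lborel. (\<lambda>N. R N t) \<longlonglongrightarrow> indicator {a..<b} t * (2 * F t t)" using Rlim by (intro AE_I2)
    have "\<bar>F t s + F t s'\<bar> \<le> 2 * K" for t s s' using Fb[of t s] Fb[of t s'] by linarith
    then show "AE t in lborel. norm (R N t) \<le> indicator {a..b} t *\<^sub>R (2 * K)" for N
      using K0 by (intro AE_I2) (auto simp: Reval indicator_def)
  qed measurable
  then have "(\<lambda>N::nat. ?G b b - ?G a a) \<longlonglongrightarrow> (\<integral>t. indicator {a..<b} t * (2 * F t t) \<partial>lborel)" by (simp flip: Rint)
  then have "?G b b - ?G a a = (\<integral>t. indicator {a..<b} t * (2 * F t t) \<partial>lborel)" by (simp add: LIMSEQ_const_iff)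
  also have "\<dots> = (\<integral>t. 2 * (indicator {a..<b} t * F t t) \<partial>lborel)" by (simp add: mult.left_commute)
  finally show ?thesis by (simp add: F_def)
qed

lemma mollified_pairing_tendsto:
  assumes d: "\<And>n. 0 < d n" "\<And>n. d n \<le> 1" "d \<longlonglongrightarrow> 0"
  shows "(\<lambda>n. mollified_pairing (d n) t t) \<longlonglongrightarrow> (nrm (U t))\<^sup>2"
proof -
  have "\<bar>mollified_pairing (d n) t t - (nrm (U t))\<^sup>2\<bar> \<le> nrm (U t) * nrm (\<lambda>x. conv (Kern (d n)) (U t) x - U t x)" for n
  proof -
    note L = conv_Kern_contraction(1)[OF d(1,2) Lsp]
    have "mollified_pairing (d n) t t - (nrm (U t))\<^sup>2 = (\<integral>x. U t x \<bullet> (conv (Kern (d n)) (U t) x - U t x) \<partial>muC)"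
      unfolding mollified_pairing_def nrm_square power2_norm_eq_inner inner_diff_right
      by (rule Bochner_Integration.integral_diff[symmetric]) (intro Lsp_integrable_inner L Lsp)+
    then show ?thesis using Lsp_Cauchy_Schwarz[OF Lsp Lsp_diff[OF L Lsp]] by simp
  qed
  moreover have "(\<lambda>n. nrm (U t) * nrm (\<lambda>x. conv (Kern (d n)) (U t) x - U t x)) \<longlonglongrightarrow> 0"
    by (rule tendsto_mult_right_zero[OF mollify_tendsto[OF d]])
  ultimately have "(\<lambda>n. mollified_pairing (d n) t t - (nrm (U t))\<^sup>2) \<longlonglongrightarrow> 0"
    unfolding real_norm_def[symmetric] by (rule Lim_null_comparison[OF always_eventually[OF allI]])
  then show ?thesis by (simp only: LIM_zero_iff)
qed

end

section \<open>Boundary behaviour\<close>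

lemma AE_lborel_minus:
  fixes c :: "'a::euclidean_space"
  assumes "AE z in lborel. P z" shows "AE z in lborel. P (c - z)"
proof -
  obtain N where N: "N \<in> null_sets lborel" "{z \<in> space lborel. \<not> P z} \<subseteq> N"
    using assms by (auto simp: eventually_ae_filter)
  have [measurable]: "N \<in> sets borel" using N(1) by auto
  have "(\<integral>\<^sup>+z. indicator N (c - z) \<partial>lborel) = (\<integral>\<^sup>+z. indicator N (c + z) \<partial>lborel)"
    using nn_integral_lborel_neg[of "\<lambda>z. indicator N (c + z)"] by simp
  also have "\<dots> = (\<integral>\<^sup>+z. indicator N z \<partial>lborel)"
    using nn_integral_lborel_shift[of "indicator N" c] by (simp add: add.commute)
  also have "\<dots> = 0" using N(1) by auto
  finally have "AE z in lborel. indicator N (c - z) = (0::ennreal)"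
    by (subst (asm) nn_integral_0_iff_AE) auto
  then show ?thesis
    by eventually_elim (use N(2) in \<open>auto simp: indicator_def split: if_splits\<close>)
qed

lemma bdry_continuousD:
  assumes "continuous_at_subset bdry_D_plus D_plus v" "x $ 3 = 0" "0 < e"
  shows "\<exists>d>0. \<forall>y\<in>D_plus. dist y x < d \<longrightarrow> dist (v x) (v y) < e"
proof -
  have "x \<in> bdry_D_plus" using assms(2) by (simp add: bdry_D_plus_def)
  then show ?thesis using assms(1,3) unfolding continuous_at_subset_def by blast
qed

text \<open>By the radial form of the gradient the integrand is a nonnegative function times
  \<open>|y3|\<close>, positive in the unit ball off the plane.\<close>

lemma bump_moment_pos: "0 < (\<integral>y. - (grad bump y $ 3 * sgn (y $ 3)) \<partial>lborel)"
proof -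
  let ?m = "\<lambda>y::real^3. - (grad bump y $ 3 * sgn (y $ 3))"
  have q0: "0 \<le> flat_exp [:0, 0, 1:] s" for s by (simp add: flat_exp_def)
  have m: "?m y = 2 * flat_exp [:0, 0, 1:] (1 - y \<bullet> y) * \<bar>y $ 3\<bar>" for y
    by (simp add: grad_bump abs_sgn)
  have nn: "0 \<le> ?m y" for y unfolding m using q0 by simp
  obtain B where B: "bkv B (grad bump)" using kern_grad_bkv[OF kern_bump] by blast
  note [measurable] = bkvD(2)[OF B]
  have ki: "integrable lborel (\<lambda>y. grad bump y $ 3)"
    unfolding grad_nth by (rule kern_integrable[OF kern_derivative[OF kern_bump axis_Basis]])
  have i: "integrable lborel ?m"
  proof (rule Bochner_Integration.integrable_bound[OF ki])
    show "AE y in lborel. norm (?m y) \<le> norm (grad bump y $ 3)"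
      by (rule AE_I2) (simp add: abs_mult sgn_real_def)
  qed measurable
  have "0 \<le> (\<integral>y. ?m y \<partial>lborel)" by (rule integral_nonneg_AE) (use nn in auto)
  moreover have "(\<integral>y. ?m y \<partial>lborel) \<noteq> 0"
  proof
    assume "(\<integral>y. ?m y \<partial>lborel) = 0"
    then have "AE y in lborel. ?m y = 0" by (subst (asm) integral_nonneg_eq_0_iff_AE[OF i]) (use nn in auto)
    then have "AE y in lborel. y \<notin> ball (0::real^3) 1" using AE_nth_3_neq_0
    proof eventually_elim
      case (elim y)
      show ?case
      proof
        assume "y \<in> ball 0 1"
        then have "norm y < 1" by simp
        then have "(norm y)\<^sup>2 < 1" by (simp add: power_less_one_iff abs_square_less_1)
        then have "0 < 1 - y \<bullet> y" by (simp add: power2_norm_eq_inner)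
        then have "0 < flat_exp [:0, 0, 1:] (1 - y \<bullet> y)" by (simp add: flat_exp_def)
        then show False using elim unfolding m by simp
      qed
    qed
    then have "emeasure lborel (ball (0::real^3) 1) = 0"
      by (subst (asm) AE_iff_measurable[OF _ refl]) (auto simp: ball_def)
    with emeasure_ball_pos[of 1 0] show False by simp
  qed
  ultimately show "0 < (\<integral>y. ?m y \<partial>lborel)" by simp
qed

lemma Kern_moment:
  assumes e: "0 < \<epsilon>"
  shows "(\<integral>y. - (grad (Kern \<epsilon>) y $ 3 * sgn (y $ 3)) \<partial>lborel) = (\<integral>y. - (grad bump y $ 3 * sgn (y $ 3)) \<partial>lborel) / bump_mass / \<epsilon>"
proof -
  obtain B where B: "bkv B (grad bump)" using kern_grad_bkv[OF kern_bump] by blast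
  note [measurable] = bkvD(2)[OF B]
  let ?m = "\<lambda>y::real^3. - (grad bump y $ 3 * sgn (y $ 3))"
  have "- (grad (Kern \<epsilon>) y $ 3 * sgn (y $ 3)) = (1 / (bump_mass * \<epsilon> ^ 4)) * ?m (y /\<^sub>R \<epsilon>)" for y
    using e by (simp add: grad_Kern sgn_mult)
  then have "(\<integral>y. - (grad (Kern \<epsilon>) y $ 3 * sgn (y $ 3)) \<partial>lborel) = (1 / (bump_mass * \<epsilon> ^ 4)) * (\<integral>y. ?m (y /\<^sub>R \<epsilon>) \<partial>lborel)"
    by (simp only: integral_mult_right_zero)
  also have "(\<integral>y. ?m (y /\<^sub>R \<epsilon>) \<partial>lborel) = \<epsilon> ^ 3 * (\<integral>y. ?m y \<partial>lborel)"
    by (rule integral_lborel_scale[OF _ e]) measurable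
  also have "(1 / (bump_mass * \<epsilon> ^ 4)) * (\<epsilon> ^ 3 * (\<integral>y. ?m y \<partial>lborel)) = (\<integral>y. ?m y \<partial>lborel) / bump_mass / \<epsilon>"
  proof -
    have "\<epsilon> ^ 4 = \<epsilon> ^ 3 * \<epsilon>" by (simp add: power4_eq_xxxx power3_eq_cube)
    then show ?thesis using e bump_mass_pos by (simp add: field_simps)
  qed
  finally show ?thesis .
qed

text \<open>If \<open>v\<close> had a nonzero normal component at the boundary point \<open>x0\<close>, its reflection would look like a jump there.
  The divergence of a mollification at scale \<open>\<epsilon>\<close> would then be of exact order \<open>1 / \<epsilon>\<close>.\<close>

lemma normal_component_zero:
  assumes V: "V \<in> Lsp" and div: "\<And>\<kappa> x. kern \<kappa> \<Longrightarrow> (\<integral>y. grad \<kappa> y \<bullet> V (x - y) \<partial>lborel) = 0"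
    and Vv: "AE z in lborel. V z = refl_ext v z"
    and x0: "x0 $ 3 = 0" and c: "continuous_at_subset bdry_D_plus D_plus v"
  shows "v x0 $ 3 = 0"
proof -
  obtain A where A: "0 \<le> A" "\<And>\<epsilon>. 0 < \<epsilon> \<Longrightarrow> \<epsilon> \<le> 1 \<Longrightarrow> (\<integral>\<^sup>+x. ennreal (norm (grad (Kern \<epsilon>) x)) \<partial>lborel) \<le> ennreal (A / \<epsilon>)"
    using ex_grad_Kern_L1 by blast
  define m where "m = (\<integral>y. - (grad bump y $ 3 * sgn (y $ 3)) \<partial>lborel) / bump_mass"
  have m0: "0 < m" unfolding m_def by (rule divide_pos_pos[OF bump_moment_pos bump_mass_pos])
  let ?a = "v x0 $ 3"
  \<comment> \<open>The jump yields exactly \<open>|a| m / \<epsilon>\<close>, and oscillation at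
    most \<open>r\<close> near \<open>x0\<close> allows an error of \<open>r A / \<epsilon>\<close>;
    the scale cancels, so \<open>r\<close> is free to tend to 0.\<close>
  have "\<bar>?a\<bar> * m \<le> r * A" if r: "0 < r" for r
  proof -
    obtain \<delta> where \<delta>: "0 < \<delta>" "\<And>y. y \<in> D_plus \<Longrightarrow> dist y x0 < \<delta> \<Longrightarrow> dist (v x0) (v y) < r"
      using bdry_continuousD[OF c x0 r] by blast
    define \<epsilon> where "\<epsilon> = min 1 (\<delta> / 2)"
    have e: "0 < \<epsilon>" "\<epsilon> \<le> 1" "\<epsilon> < \<delta>" using \<delta>(1) by (auto simp: \<epsilon>_def min_def)
    let ?g = "grad (Kern \<epsilon>)"
    note k = kern_Kern[OF e(1,2)]
    obtain B where B: "bkv B ?g" using kern_grad_bkv[OF k] by blast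
    note [measurable] = bkvD(2)[OF B] LspD(2)[OF V]
    \<comment> \<open>The reflected extension near \<open>x0\<close> with \<open>v\<close> replaced
      by its value at \<open>x0\<close>. The argument is \<open>x0 - y\<close>, so the side above
      the plane is \<open>y $ 3 < 0\<close>.\<close>
    define c' where "c' y = (if y $ 3 < 0 then v x0 else reflect (v x0))" for y :: "real^3"
    have c'm [measurable]: "c' \<in> borel_measurable borel" unfolding c'_def by measurable
    have gi: "integrable lborel (\<lambda>y. norm (?g y))"
      unfolding integrable_iff_bounded using le_less_trans[OF A(2)[OF e(1,2)]] by simp
    have gc: "integrable lborel (\<lambda>y. ?g y \<bullet> c' y)"
    proof (rule Bochner_Integration.integrable_bound)
      show "integrable lborel (\<lambda>y. norm (?g y) * norm (v x0))" using gi by simp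
      have nc: "norm (c' y) = norm (v x0)" for y by (simp add: c'_def)
      have "\<bar>?g y \<bullet> c' y\<bar> \<le> norm (?g y) * norm (v x0)" for y
        using Cauchy_Schwarz_ineq2[of "?g y" "c' y"] by (simp only: nc)
      then show "AE y in lborel. norm (?g y \<bullet> c' y) \<le> norm (norm (?g y) * norm (v x0))"
        by (intro AE_I2) simp
    qed measurable
    have gV: "integrable lborel (\<lambda>y. ?g y \<bullet> V (x0 - y))" by (rule bkv_inner_integrable[OF B V])
    have near: "AE y in lborel. norm (?g y \<bullet> (c' y - V (x0 - y))) \<le> norm (?g y) * r"
      using AE_lborel_minus[OF Vv, of x0] AE_nth_3_neq_0
    proof eventually_elim
      case (elim y)
      show ?case
      proof (cases "norm y < \<epsilon>")
        case True
        let ?z = "x0 - y"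
        have "norm (c' y - V ?z) \<le> r"
        proof (cases "y $ 3 < 0")
          case neg: True
          then have "V ?z = v ?z" using elim x0 by (simp add: refl_ext_def)
          moreover have "dist (v x0) (v ?z) < r"
            by (rule \<delta>(2)) (use neg x0 True e in \<open>auto simp: D_plus_def dist_norm\<close>)
          ultimately show ?thesis using neg by (simp add: c'_def dist_norm)
        next
          case False
          with elim(2) have pos: "0 < y $ 3" by simp
          then have "V ?z = reflect (v (reflect ?z))" using elim x0 by (simp add: refl_ext_def)
          moreover have "dist (v x0) (v (reflect ?z)) < r"
          proof (rule \<delta>(2))
            show "reflect ?z \<in> D_plus" using pos x0 by (simp add: D_plus_def)
            have "reflect ?z - x0 = - reflect y" using reflect_fixed[OF x0] by (simp add: reflect_diff)
            then show "dist (reflect ?z) x0 < \<delta>" using True e by (simp add: dist_norm)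
          qed
          ultimately show ?thesis using pos
            by (simp add: c'_def dist_norm less_imp_le flip: reflect_diff)
        qed
        then have "norm (?g y) * norm (c' y - V ?z) \<le> norm (?g y) * r" by (rule mult_left_mono) simp
        then show ?thesis using Cauchy_Schwarz_ineq2[of "?g y" "c' y - V ?z"] by simp
      qed (use grad_Kern_eq_0[OF e(1)] in simp)
    qed
    have "\<bar>\<integral>y. ?g y \<bullet> c' y \<partial>lborel\<bar> = norm (\<integral>y. ?g y \<bullet> (c' y - V (x0 - y)) \<partial>lborel)"
      using gc gV div[OF k, of x0] by (simp add: inner_diff_right)
    also have "\<dots> \<le> (\<integral>y. norm (?g y \<bullet> (c' y - V (x0 - y))) \<partial>lborel)" by (rule integral_norm_bound)
    also have "\<dots> \<le> (\<integral>y. norm (?g y) * r \<partial>lborel)"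
    proof (rule integral_mono_AE[OF _ _ near])
      have "integrable lborel (\<lambda>y. ?g y \<bullet> (c' y - V (x0 - y)))" using gc gV by (simp add: inner_diff_right)
      then show "integrable lborel (\<lambda>y. norm (?g y \<bullet> (c' y - V (x0 - y))))" by (rule integrable_norm)
      show "integrable lborel (\<lambda>y. norm (?g y) * r)" using gi by simp
    qed
    also have "\<dots> = (\<integral>y. norm (?g y) \<partial>lborel) * r" by simp
    also have "\<dots> \<le> (A / \<epsilon>) * r"
    proof (intro mult_right_mono)
      have "ennreal (\<integral>y. norm (?g y) \<partial>lborel) \<le> ennreal (A / \<epsilon>)"
        using A(2)[OF e(1,2)] nn_integral_eq_integral[OF gi] by simp
      then show "(\<integral>y. norm (?g y) \<partial>lborel) \<le> A / \<epsilon>" using A(1) e by (simp add: divide_nonneg_nonneg)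
    qed (use r in simp)
    finally have up: "\<bar>\<integral>y. ?g y \<bullet> c' y \<partial>lborel\<bar> \<le> (A / \<epsilon>) * r" .
    have "(\<integral>y. ?g y \<bullet> c' y \<partial>lborel) = ?a * (m / \<epsilon>)"
    proof -
      \<comment> \<open>The mean of the two one-sided values is annihilated because the gradient is
        odd. The remaining part is the jump, of height given by the normal component and with the
        sign of \<open>- y $ 3\<close>.\<close>
      define h where "h = (v x0 + reflect (v x0)) /\<^sub>R 2"
      have ae: "AE y in lborel. ?g y \<bullet> c' y = ?g y \<bullet> h + ?a * - (?g y $ 3 * sgn (y $ 3))"
        using AE_nth_3_neq_0
        by eventually_elim (auto simp: c'_def h_def inner_3 sgn_real_def algebra_simps)
      have gh: "integrable lborel (\<lambda>y. ?g y \<bullet> h)"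
        by (rule Bochner_Integration.integrable_bound[of _ "\<lambda>y. norm (?g y) * norm h"])
           (use gi in \<open>auto intro!: AE_I2 Cauchy_Schwarz_ineq2\<close>)
      have g3: "integrable lborel (\<lambda>y. ?a * - (?g y $ 3 * sgn (y $ 3)))"
      proof (rule integrable_mult_right, rule Bochner_Integration.integrable_bound[OF gi])
        show "AE y in lborel. norm (- (?g y $ 3 * sgn (y $ 3))) \<le> norm (norm (?g y))"
          by (intro AE_I2) (auto simp: abs_mult sgn_real_def component_le_norm_cart)
      qed measurable
      have "(\<integral>y. ?g y \<bullet> h \<partial>lborel) = (\<integral>y. ?g (- y) \<bullet> h \<partial>lborel)"
        by (rule integral_lborel_neg[symmetric]) measurable
      then have gh0: "(\<integral>y. ?g y \<bullet> h \<partial>lborel) = 0" by (simp add: grad_Kern_minus[OF e(1)])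
      have "(\<integral>y. ?g y \<bullet> c' y \<partial>lborel) = (\<integral>y. ?g y \<bullet> h + ?a * - (?g y $ 3 * sgn (y $ 3)) \<partial>lborel)"
        by (rule integral_cong_AE[OF _ _ ae]) measurable
      also have "\<dots> = (\<integral>y. ?g y \<bullet> h \<partial>lborel) + (\<integral>y. ?a * - (?g y $ 3 * sgn (y $ 3)) \<partial>lborel)"
        by (rule Bochner_Integration.integral_add[OF gh g3])
      also have "\<dots> = ?a * (m / \<epsilon>)"
        unfolding gh0 integral_mult_right_zero Kern_moment[OF e(1)] m_def by simp
      finally show ?thesis .
    qed
    with up have "\<bar>?a\<bar> * m / \<epsilon> \<le> r * A / \<epsilon>" using m0 e by (simp add: abs_mult mult.commute)
    then show ?thesis using e by (simp add: divide_le_cancel)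
  qed
  note bd = this
  have "\<bar>?a\<bar> * m \<le> 0 + r" if r: "0 < r" for r
  proof -
    have "\<bar>?a\<bar> * m \<le> (r / (A + 1)) * A" by (rule bd) (use r A in auto)
    also have "\<dots> \<le> r" using r A(1) by (simp add: field_simps)
    finally show ?thesis by simp
  qed
  then have "\<bar>?a\<bar> * m \<le> 0" by (rule field_le_epsilon)
  then show ?thesis using m0 by (simp add: mult_le_0_iff)
qed

text \<open>Tangential values on the plane are fixed by the reflection, so the extension is
  continuous at each boundary point from both sides. A Lebesgue number for a cover of one period
  square, which is compact, makes this uniform, and periodicity carries it to the whole
  plane.\<close>

lemma boundary_oscillation:
  assumes p: "horiz_periodic_on D_plus v" and c: "continuous_at_subset bdry_D_plus D_plus v"
    and n: "\<And>x. x $ 3 = 0 \<Longrightarrow> v x $ 3 = 0" and r: "0 < r"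
  shows "\<exists>\<rho>>0. \<forall>z z'. \<bar>z $ 3\<bar> < \<rho> \<longrightarrow> norm (z - z') < \<rho> \<longrightarrow> norm (refl_ext v z - refl_ext v z') < r"
proof -
  let ?w = "refl_ext v"
  have per_w: "?w (x + lat m n) = ?w x" for x m n
  proof -
    have "reflect (lat m n) = lat m n" by (rule reflect_fixed) simp
    then show ?thesis using per_lat_D_plus[OF p, of x m n] per_lat_D_plus[OF p, of "reflect x" m n]
      by (simp add: refl_ext_def reflect_add D_plus_def)
  qed
  have loc: "\<exists>d>0. \<forall>y. dist y x < d \<longrightarrow> dist (?w y) (v x) < r / 2" if x: "x $ 3 = 0" for x
  proof -
    obtain d where d: "0 < d" "\<And>y. y \<in> D_plus \<Longrightarrow> dist y x < d \<Longrightarrow> dist (v x) (v y) < r / 2"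
      using bdry_continuousD[OF c x half_gt_zero[OF r]] by blast
    have "dist (?w y) (v x) < r / 2" if y: "dist y x < d" for y
    proof (cases "0 \<le> y $ 3")
      case True
      then show ?thesis using d(2)[of y] y by (simp add: refl_ext_def D_plus_def dist_commute)
    next
      case False
      have "reflect y - x = reflect (y - x)" using reflect_fixed[OF x] by (simp add: reflect_diff)
      then have "dist (reflect y) x < d" using y by (simp add: dist_norm)
      then have "dist (v x) (v (reflect y)) < r / 2" using False by (intro d(2)) (auto simp: D_plus_def)
      moreover have "reflect (v (reflect y)) - v x = reflect (v (reflect y) - v x)"
        using reflect_fixed[OF n[OF x]] by (simp add: reflect_diff)
      ultimately show ?thesis using False by (simp add: refl_ext_def dist_norm norm_minus_commute)
    qed
    with d(1) show ?thesis by blast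
  qed
  then have "\<forall>x\<in>{x. x $ 3 = 0}. \<exists>d. 0 < d \<and> (\<forall>y. dist y x < d \<longrightarrow> dist (?w y) (v x) < r / 2)" by simp
  from bchoice[OF this] obtain d
    where d': "\<forall>x\<in>{x. x $ 3 = 0}. 0 < d x \<and> (\<forall>y. dist y x < d x \<longrightarrow> dist (?w y) (v x) < r / 2)" ..
  then have d: "\<And>x. x $ 3 = 0 \<Longrightarrow> 0 < d x" "\<And>x y. x $ 3 = 0 \<Longrightarrow> dist y x < d x \<Longrightarrow> dist (?w y) (v x) < r / 2"
    by simp_all
  define S where "S = cbox (0::real^3) (\<chi> i. if i = 3 then 0 else 2 * pi)"
  have S3: "x $ 3 = 0" if "x \<in> S" for x
  proof -
    have "0 \<le> x $ 3" "x $ 3 \<le> 0" using that by (auto simp: S_def mem_box_cart dest: spec[of _ 3])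
    then show ?thesis by simp
  qed
  have "compact S" by (simp add: S_def)
  moreover have "S \<subseteq> (\<Union>x\<in>S. ball x (d x))" using d(1) S3 by auto
  ultimately obtain e where e: "0 < e" "\<And>x. x \<in> S \<Longrightarrow> \<exists>G\<in>(\<lambda>x. ball x (d x)) ` S. ball x e \<subseteq> G"
  proof (rule Heine_Borel_lemma)
    fix G assume "G \<in> (\<lambda>x. ball x (d x)) ` S"
    then show "open G" by auto
  qed (rule that)
  have key: "norm (?w z - ?w z') < r" if z: "\<bar>z $ 3\<bar> < e / 2" "norm (z - z') < e / 2" and zC: "z \<in> full_cell" for z z'
  proof -
    define x where "x = (\<chi> i. if i = 3 then 0 else z $ i)"
    have xS: "x \<in> S" using zC by (auto simp: S_def x_def mem_box_cart full_cell_def forall_3 less_imp_le)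
    obtain s where s: "s \<in> S" "ball x e \<subseteq> ball s (d s)" using e(2)[OF xS] by blast
    have "z - x = axis 3 (z $ 3)" by (auto simp: vec_eq_iff x_def axis_def)
    then have zx: "norm (z - x) < e / 2" using z(1) by (simp add: norm_axis_real)
    have "norm (z' - x) \<le> norm (z' - z) + norm (z - x)" using norm_triangle_ineq[of "z' - z" "z - x"] by simp
    then have z'x: "norm (z' - x) < e" using zx z(2) by (simp add: norm_minus_commute)
    have "norm (z - x) < e" using zx e(1) by linarith
    then have "z \<in> ball x e" "z' \<in> ball x e" using z'x by (simp_all add: dist_norm norm_minus_commute)
    then have "z \<in> ball s (d s)" "z' \<in> ball s (d s)" using s(2) by blast+
    then have "dist (?w z) (v s) < r / 2" "dist (?w z') (v s) < r / 2"
      using d(2)[OF S3[OF s(1)]] by (auto simp: dist_commute)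
    then show ?thesis using dist_triangle_half_r[of "v s" "?w z" r "?w z'"] by (simp add: dist_norm norm_minus_commute)
  qed
  have "norm (?w z - ?w z') < r" if z: "\<bar>z $ 3\<bar> < e / 2" "norm (z - z') < e / 2" for z z'
  proof -
    let ?l = "lat (- \<lfloor>z $ 1 / (2 * pi)\<rfloor>) (- \<lfloor>z $ 2 / (2 * pi)\<rfloor>)"
    have "norm (?w (z + ?l) - ?w (z' + ?l)) < r"
      by (rule key) (use z wrap_full_cell[of z] in \<open>auto simp: wrap_def\<close>)
    then show ?thesis by (simp add: per_w)
  qed
  then show ?thesis using e(1) by (intro exI[of _ "e / 2"]) auto
qed

section \<open>The flux vanishes in the limit\<close>

definition increment :: "(real^3 \<Rightarrow> real^3) \<Rightarrow> real^3 \<Rightarrow> ennreal" where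
  "increment f y = (\<integral>\<^sup>+x. indicator {x. norm y \<le> x $ 3} x * ennreal (norm (f (x + y) - f x) ^ 3) \<partial>muC)"

definition moll_incr :: "(real^3) set \<Rightarrow> real \<Rightarrow> (real^3 \<Rightarrow> real^3) \<Rightarrow> real^3 \<Rightarrow> ennreal" where
  "moll_incr S \<delta> f y = (\<integral>\<^sup>+x. indicator S x * ennreal (norm (conv (Kern \<delta>) f (x - y) - conv (Kern \<delta>) f x) ^ 3) \<partial>muC)"

text \<open>The share of the points \<open>x\<close> in \<open>S\<close> in the bound of
  \<open>Duchon_Robert\<close>, for a field already mollified at scale \<open>\<delta>\<close> and a
  flux at scale \<open>\<epsilon>\<close>.\<close>

definition flux_part :: "(real^3) set \<Rightarrow> real \<Rightarrow> real \<Rightarrow> (real^3 \<Rightarrow> real^3) \<Rightarrow> ennreal" where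
  "flux_part S \<epsilon> \<delta> f = (\<integral>\<^sup>+y. ennreal (norm (grad (Kern \<epsilon>) y)) * moll_incr S \<delta> f y \<partial>lborel)"

lemma conv_Kern_diff:
  assumes d: "0 < \<delta>" "\<delta> \<le> 1" and f: "f \<in> Lsp"
  shows "conv (Kern \<delta>) f (x - y) - conv (Kern \<delta>) f x = (\<integral>z. Kern \<delta> z *\<^sub>R (f (x - z - y) - f (x - z)) \<partial>lborel)"
    and "integrable lborel (\<lambda>z. Kern \<delta> z *\<^sub>R (f (x - z - y) - f (x - z)))"
proof -
  obtain B where B: "bk B (Kern \<delta>)" using Kern_bk[OF d] by blast
  have e: "x - z - y = x - y - z" for z by simp
  note i = conv_integrable'[OF B f, of "x - y"] conv_integrable'[OF B f, of x]
  show "conv (Kern \<delta>) f (x - y) - conv (Kern \<delta>) f x = (\<integral>z. Kern \<delta> z *\<^sub>R (f (x - z - y) - f (x - z)) \<partial>lborel)"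
    unfolding conv_swap[OF bkD(2)[OF B] LspD(2)[OF f]] scaleR_diff_right e
    by (rule Bochner_Integration.integral_diff[OF i, symmetric])
  show "integrable lborel (\<lambda>z. Kern \<delta> z *\<^sub>R (f (x - z - y) - f (x - z)))"
    unfolding scaleR_diff_right e by (rule Bochner_Integration.integrable_diff[OF i])
qed

text \<open>The increment of a mollification is an average of increments at points displaced by at
  most \<open>\<delta>\<close>. Jensen moves the cube inside, and shift invariance removes the
  average at the price of the larger set \<open>S'\<close>.\<close>

lemma moll_incr_le:
  assumes d: "0 < \<delta>" "\<delta> \<le> 1" and f: "f \<in> Lsp" and [measurable]: "S \<in> sets borel" "S' \<in> sets borel"
    and p: "\<And>x m n. x + lat m n \<in> S' \<longleftrightarrow> x \<in> S'" and sub: "\<And>x z. x \<in> S \<Longrightarrow> norm z \<le> \<delta> \<Longrightarrow> x - z \<in> S'"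
  shows "moll_incr S \<delta> f y \<le> (\<integral>\<^sup>+x. indicator S' x * ennreal (norm (f (x - y) - f x) ^ 3) \<partial>muC)"
proof -
  note [measurable] = LspD(2)[OF f] Kern_measurable[OF d]
  let ?h = "\<lambda>x. indicator S' x * ennreal (norm (f (x - y) - f x) ^ 3)"
  have ph: "per ?h"
  proof (rule perI_lat)
    fix m n x
    have "f (x + lat m n - y) = f (x - y)" using per_lat[OF LspD(1)[OF f], of "x - y" m n] by (simp add: algebra_simps)
    then show "?h (x + lat m n) = ?h x" by (simp add: per_lat[OF LspD(1)[OF f]] indicator_def p)
  qed
  have "moll_incr S \<delta> f y \<le> (\<integral>\<^sup>+x. \<integral>\<^sup>+z. ennreal (Kern \<delta> z) * ?h (x - z) \<partial>lborel \<partial>muC)"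
    unfolding moll_incr_def
  proof (rule nn_integral_mono)
    fix x
    have "indicator S x * ennreal (norm (conv (Kern \<delta>) f (x - y) - conv (Kern \<delta>) f x) ^ 3)
        \<le> indicator S x * (\<integral>\<^sup>+z. ennreal (Kern \<delta> z) * ennreal (norm (f (x - z - y) - f (x - z)) ^ 3) \<partial>lborel)"
      unfolding conv_Kern_diff(1)[OF d f]
      by (intro mult_left_mono jensen_norm_3[OF _ _ Kern_nonneg[OF d(1)] nn_integral_Kern[OF d] conv_Kern_diff(2)[OF d f]]) auto
    also have "\<dots> = (\<integral>\<^sup>+z. indicator S x * (ennreal (Kern \<delta> z) * ennreal (norm (f (x - z - y) - f (x - z)) ^ 3)) \<partial>lborel)"
      by (rule nn_integral_cmult[symmetric]) measurable
    also have "\<dots> \<le> (\<integral>\<^sup>+z. ennreal (Kern \<delta> z) * ?h (x - z) \<partial>lborel)"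
    proof (rule nn_integral_mono)
      fix z
      show "indicator S x * (ennreal (Kern \<delta> z) * ennreal (norm (f (x - z - y) - f (x - z)) ^ 3)) \<le> ennreal (Kern \<delta> z) * ?h (x - z)"
      proof (cases "x \<in> S \<and> norm z \<le> \<delta>")
        case True
        then have "x - z \<in> S'" using sub by blast
        then show ?thesis using True by simp
      next
        case False
        then show ?thesis using Kern_eq_0[OF d(1), of z] by (auto simp: indicator_def)
      qed
    qed
    finally show "indicator S x * ennreal (norm (conv (Kern \<delta>) f (x - y) - conv (Kern \<delta>) f x) ^ 3)
        \<le> (\<integral>\<^sup>+z. ennreal (Kern \<delta> z) * ?h (x - z) \<partial>lborel)" .
  qed
  also have "\<dots> = (\<integral>\<^sup>+z. \<integral>\<^sup>+x. ennreal (Kern \<delta> z) * ?h (x - z) \<partial>muC \<partial>lborel)"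
    by (rule muC_lborel.Fubini'[symmetric]) measurable
  also have "\<dots> = (\<integral>\<^sup>+z. ennreal (Kern \<delta> z) * integral\<^sup>N muC ?h \<partial>lborel)"
  proof (rule nn_integral_cong)
    fix z
    have "(\<integral>\<^sup>+x. ?h (x + (- z)) \<partial>muC) = integral\<^sup>N muC ?h" by (rule nn_integral_muC_shift[OF ph]) measurable
    then show "(\<integral>\<^sup>+x. ennreal (Kern \<delta> z) * ?h (x - z) \<partial>muC) = ennreal (Kern \<delta> z) * integral\<^sup>N muC ?h"
      by (subst nn_integral_cmult) (auto simp del: add_uminus_conv_diff simp: diff_conv_add_uminus)
  qed
  also have "\<dots> = integral\<^sup>N muC ?h" by (subst nn_integral_multc) (auto simp: nn_integral_Kern[OF d])
  finally show ?thesis .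
qed

lemma nn_integral_add3:
  fixes f g h :: "'a \<Rightarrow> ennreal"
  assumes "f \<in> borel_measurable M" "g \<in> borel_measurable M" "h \<in> borel_measurable M"
  shows "(\<integral>\<^sup>+x. f x + g x + h x \<partial>M) = integral\<^sup>N M f + integral\<^sup>N M g + integral\<^sup>N M h"
  using assms by (simp add: nn_integral_add)

lemma nth_3_bounds: "norm z \<le> \<delta> \<Longrightarrow> \<bar>z $ 3\<bar> \<le> \<delta>" for z :: "real^3"
  using component_le_norm_cart[of z 3] by simp

text \<open>This fixes the margin \<open>2 * \<epsilon>\<close>: one \<open>\<epsilon>\<close> is
  lost to the displacement by the inner mollification, the other is the height \<open>norm y\<close>
  required by \<open>increment\<close>.\<close>

lemma moll_incr_upper:
  assumes d: "0 < \<delta>" "\<delta> \<le> \<epsilon>" "\<epsilon> \<le> 1" and f: "f \<in> Lsp" and y: "norm y \<le> \<epsilon>"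
  shows "moll_incr {x. 2 * \<epsilon> \<le> x $ 3} \<delta> f y \<le> increment f (- y)"
proof -
  have "moll_incr {x. 2 * \<epsilon> \<le> x $ 3} \<delta> f y \<le> (\<integral>\<^sup>+x. indicator {x. norm y \<le> x $ 3} x * ennreal (norm (f (x - y) - f x) ^ 3) \<partial>muC)"
  proof (rule moll_incr_le[OF d(1) _ f])
    fix x z :: "real^3" assume xz: "x \<in> {x. 2 * \<epsilon> \<le> x $ 3}" "norm z \<le> \<delta>"
    have "\<bar>z $ 3\<bar> \<le> \<epsilon>" using nth_3_bounds[OF xz(2)] d by linarith
    then have "z $ 3 \<le> \<epsilon>" by (rule abs_le_D1)
    then show "x - z \<in> {x. norm y \<le> x $ 3}" using xz(1) y by simp
  qed (use d in auto)
  then show ?thesis by (simp add: increment_def)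
qed

text \<open>By symmetry the increments below the plane are those above it for the reflected
  displacement, which has the same norm.\<close>

lemma moll_incr_lower:
  assumes d: "0 < \<delta>" "\<delta> \<le> \<epsilon>" "\<epsilon> \<le> 1" and f: "f \<in> Lsp" and s: "\<And>x. f (reflect x) = reflect (f x)" and y: "norm y \<le> \<epsilon>"
  shows "moll_incr {x. x $ 3 \<le> - 2 * \<epsilon>} \<delta> f y \<le> increment f (- reflect y)"
proof -
  note [measurable] = LspD(2)[OF f]
  let ?h = "\<lambda>x. indicator {x. x $ 3 \<le> - norm y} x * ennreal (norm (f (x - y) - f x) ^ 3)"
  have "moll_incr {x. x $ 3 \<le> - 2 * \<epsilon>} \<delta> f y \<le> integral\<^sup>N muC ?h"
  proof (rule moll_incr_le[OF d(1) _ f])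
    fix x z :: "real^3" assume xz: "x \<in> {x. x $ 3 \<le> - 2 * \<epsilon>}" "norm z \<le> \<delta>"
    have "\<bar>z $ 3\<bar> \<le> \<epsilon>" using nth_3_bounds[OF xz(2)] d by linarith
    then have "- z $ 3 \<le> \<epsilon>" by (simp add: abs_le_iff)
    then show "x - z \<in> {x. x $ 3 \<le> - norm y}" using xz(1) y by simp
  qed (use d in auto)
  also have "\<dots> = (\<integral>\<^sup>+x. ?h (reflect x) \<partial>muC)" by (rule nn_integral_muC_reflect[symmetric]) measurable
  also have "\<dots> = increment f (- reflect y)"
    unfolding increment_def
  proof (rule nn_integral_cong)
    fix x
    have "f (reflect x - y) - f (reflect x) = reflect (f (x + - reflect y) - f x)"
      using s[of "x - reflect y"] by (simp add: s reflect_diff)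
    then have "norm (f (reflect x - y) - f (reflect x)) = norm (f (x + - reflect y) - f x)" by (simp only: norm_reflect)
    then show "?h (reflect x) = indicator {x. norm (- reflect y) \<le> x $ 3} x * ennreal (norm (f (x + - reflect y) - f x) ^ 3)"
      by (simp add: indicator_def)
  qed
  finally show ?thesis .
qed

lemma moll_incr_strip:
  assumes d: "0 < \<delta>" "\<delta> \<le> 1" and f: "f \<in> Lsp" and e: "0 < \<epsilon>" and c: "0 \<le> c"
    and le: "\<And>x. \<bar>x $ 3\<bar> < 2 * \<epsilon> \<Longrightarrow> AE z in lborel. norm z \<le> \<delta> \<longrightarrow> norm (f (x - z - y) - f (x - z)) \<le> c"
  shows "moll_incr {x. \<bar>x $ 3\<bar> < 2 * \<epsilon>} \<delta> f y \<le> ennreal (c ^ 3 * ((2 * pi)\<^sup>2 * (4 * \<epsilon>)))"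
proof -
  have pt: "norm (conv (Kern \<delta>) f (x - y) - conv (Kern \<delta>) f x) \<le> c" if x: "\<bar>x $ 3\<bar> < 2 * \<epsilon>" for x
  proof -
    have "ennreal (norm (conv (Kern \<delta>) f (x - y) - conv (Kern \<delta>) f x))
        \<le> (\<integral>\<^sup>+z. ennreal (norm (Kern \<delta> z *\<^sub>R (f (x - z - y) - f (x - z)))) \<partial>lborel)"
      unfolding conv_Kern_diff(1)[OF d f] by (rule integral_norm_bound_ennreal[OF conv_Kern_diff(2)[OF d f]])
    also have "\<dots> \<le> (\<integral>\<^sup>+z. ennreal (Kern \<delta> z) * ennreal c \<partial>lborel)"
    proof (rule nn_integral_mono_AE)
      show "AE z in lborel. ennreal (norm (Kern \<delta> z *\<^sub>R (f (x - z - y) - f (x - z)))) \<le> ennreal (Kern \<delta> z) * ennreal c"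
        using le[OF x]
      proof eventually_elim
        case (elim z)
        show ?case
        proof (cases "norm z \<le> \<delta>")
          case True
          then show ?thesis using elim Kern_nonneg[OF d(1), of z] c
            by (auto simp: ennreal_mult[symmetric] intro!: ennreal_leI mult_left_mono)
        qed (use Kern_eq_0[OF d(1)] in simp)
      qed
    qed
    also have "\<dots> = ennreal c"
      using Kern_measurable[OF d] by (subst nn_integral_multc) (auto simp: nn_integral_Kern[OF d])
    finally show ?thesis using c by simp
  qed
  let ?S = "{x::real^3. - (2 * \<epsilon>) \<le> x $ 3 \<and> x $ 3 \<le> 2 * \<epsilon>}"
  have "moll_incr {x. \<bar>x $ 3\<bar> < 2 * \<epsilon>} \<delta> f y \<le> (\<integral>\<^sup>+x. ennreal (c ^ 3) * indicator ?S x \<partial>muC)"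
    unfolding moll_incr_def
  proof (rule nn_integral_mono)
    fix x :: "real^3"
    show "indicator {x. \<bar>x $ 3\<bar> < 2 * \<epsilon>} x * ennreal (norm (conv (Kern \<delta>) f (x - y) - conv (Kern \<delta>) f x) ^ 3)
        \<le> ennreal (c ^ 3) * indicator ?S x"
    proof (cases "\<bar>x $ 3\<bar> < 2 * \<epsilon>")
      case True
      then have "x \<in> ?S" by (simp add: abs_less_iff)
      then show ?thesis using pt[OF True] True by (simp add: ennreal_leI power_mono)
    qed simp
  qed
  also have "\<dots> = ennreal (c ^ 3) * emeasure muC ?S" by (rule nn_integral_cmult_indicator) simp
  also have "\<dots> \<le> ennreal (c ^ 3) * ennreal ((2 * pi)\<^sup>2 * (2 * \<epsilon> - - (2 * \<epsilon>)))"
    using e by (intro mult_left_mono emeasure_slab) auto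
  also have "\<dots> = ennreal (c ^ 3 * ((2 * pi)\<^sup>2 * (4 * \<epsilon>)))" using c e by (subst ennreal_mult) auto
  finally show ?thesis .
qed

text \<open>The strip has measure at most \<open>(2 pi)^2 * 4 \<epsilon>\<close> and the gradient
  costs \<open>A / \<epsilon>\<close>. The scale cancels, leaving the cube of the oscillation as the
  only small quantity.\<close>

lemma flux_part_strip:
  assumes A: "\<And>\<epsilon>. 0 < \<epsilon> \<Longrightarrow> \<epsilon> \<le> 1 \<Longrightarrow> (\<integral>\<^sup>+x. ennreal (norm (grad (Kern \<epsilon>) x)) \<partial>lborel) \<le> ennreal (A / \<epsilon>)" and A0: "0 \<le> A"
    and e: "0 < \<epsilon>" "\<epsilon> \<le> 1" and d: "0 < \<delta>" "\<delta> \<le> 1" and f: "f \<in> Lsp" and c: "0 \<le> c"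
    and le: "\<And>x y. \<bar>x $ 3\<bar> < 2 * \<epsilon> \<Longrightarrow> norm y \<le> \<epsilon> \<Longrightarrow> AE z in lborel. norm z \<le> \<delta> \<longrightarrow> norm (f (x - z - y) - f (x - z)) \<le> c"
  shows "flux_part {x. \<bar>x $ 3\<bar> < 2 * \<epsilon>} \<epsilon> \<delta> f \<le> ennreal (16 * pi\<^sup>2 * A * c ^ 3)"
proof -
  obtain B where B: "bkv B (grad (Kern \<epsilon>))" using kern_grad_bkv[OF kern_Kern[OF e]] by blast
  note [measurable] = bkvD(2)[OF B]
  let ?V = "c ^ 3 * ((2 * pi)\<^sup>2 * (4 * \<epsilon>))"
  have "flux_part {x. \<bar>x $ 3\<bar> < 2 * \<epsilon>} \<epsilon> \<delta> f \<le> (\<integral>\<^sup>+y. ennreal (norm (grad (Kern \<epsilon>) y)) * ennreal ?V \<partial>lborel)"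
    unfolding flux_part_def
  proof (rule nn_integral_mono)
    fix y
    show "ennreal (norm (grad (Kern \<epsilon>) y)) * moll_incr {x. \<bar>x $ 3\<bar> < 2 * \<epsilon>} \<delta> f y \<le> ennreal (norm (grad (Kern \<epsilon>) y)) * ennreal ?V"
    proof (cases "norm y \<le> \<epsilon>")
      case True
      then show ?thesis by (intro mult_left_mono moll_incr_strip[OF d f e(1) c] le) auto
    qed (use grad_Kern_eq_0[OF e(1)] in simp)
  qed
  also have "\<dots> = (\<integral>\<^sup>+y. ennreal (norm (grad (Kern \<epsilon>) y)) \<partial>lborel) * ennreal ?V"
    by (subst nn_integral_multc) auto
  also have "\<dots> \<le> ennreal (A / \<epsilon>) * ennreal ?V" by (intro mult_right_mono A e) simp
  also have "\<dots> = ennreal (16 * pi\<^sup>2 * A * c ^ 3)"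
    using e c A0 by (subst ennreal_mult[symmetric]) (auto simp: power_mult_distrib field_simps)
  finally show ?thesis .
qed

context weakly_continuous_flow
begin

lemma moll_incr_measurable:
  assumes d: "0 < \<delta>" "\<delta> \<le> 1" and [measurable]: "S \<in> sets borel"
  shows "(\<lambda>(t, y). moll_incr S \<delta> (U t) y) \<in> borel_measurable (borel \<Otimes>\<^sub>M borel)"
proof -
  have [measurable]: "(\<lambda>(t, x). conv (Kern \<delta>) (U t) x) \<in> borel_measurable (borel \<Otimes>\<^sub>M borel)"
    by (rule conv_measurable_joint[OF kern_Kern[OF d]])
  show ?thesis unfolding moll_incr_def by measurable
qed

lemma flux_part_measurable:
  assumes e: "0 < \<epsilon>" "\<epsilon> \<le> 1" and d: "0 < \<delta>" "\<delta> \<le> 1" and S: "S \<in> sets borel"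
  shows "(\<lambda>t. flux_part S \<epsilon> \<delta> (U t)) \<in> borel_measurable borel"
proof -
  obtain B where B: "bkv B (grad (Kern \<epsilon>))" using kern_grad_bkv[OF kern_Kern[OF e]] by blast
  note [measurable] = bkvD(2)[OF B] moll_incr_measurable[OF d S]
  show ?thesis unfolding flux_part_def by measurable
qed

text \<open>The inner mollification serves twice: it gives the bounded field required by
  \<open>Duchon_Robert\<close>, and it makes each part measurable in time.\<close>

lemma flux_le_parts:
  assumes e: "0 < \<epsilon>" "\<epsilon> \<le> 1" and d: "0 < \<delta>" "\<delta> \<le> 1"
  defines "V \<equiv> \<lambda>t. conv (Kern \<delta>) (U t)"
  shows "ennreal (4 * \<bar>Tri (grad (Kern \<epsilon>)) (V t) (V t) (V t)\<bar>)
    \<le> flux_part {x. 2 * \<epsilon> \<le> x $ 3} \<epsilon> \<delta> (U t) + flux_part {x. x $ 3 \<le> - 2 * \<epsilon>} \<epsilon> \<delta> (U t) + flux_part {x. \<bar>x $ 3\<bar> < 2 * \<epsilon>} \<epsilon> \<delta> (U t)"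
proof -
  let ?g = "grad (Kern \<epsilon>)"
  obtain B where B: "bkv B ?g" using kern_grad_bkv[OF kern_Kern[OF e]] by blast
  obtain B0 where B0: "bk B0 (Kern \<delta>)" using Kern_bk[OF d] by blast
  have VL: "V t \<in> Lsp" unfolding V_def by (rule conv_Kern_contraction(1)[OF d Lsp])
  note [measurable] = bkvD(2)[OF B] LspD(2)[OF VL]
  let ?Sp = "{x::real^3. 2 * \<epsilon> \<le> x $ 3}" and ?Sm = "{x::real^3. x $ 3 \<le> - 2 * \<epsilon>}" and ?Si = "{x::real^3. \<bar>x $ 3\<bar> < 2 * \<epsilon>}"
  have Sb: "?Sp \<in> sets borel" "?Sm \<in> sets borel" "?Si \<in> sets borel" by measurable
  have mm: "(\<lambda>y. moll_incr S \<delta> (U t) y) \<in> borel_measurable borel" if "S \<in> sets borel" for S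
    using measurable_compose[OF measurable_Pair1' moll_incr_measurable[OF d that], of t] by simp
  note [measurable] = mm[OF Sb(1)] mm[OF Sb(2)] mm[OF Sb(3)]
  have "ennreal (4 * \<bar>Tri ?g (V t) (V t) (V t)\<bar>)
      \<le> (\<integral>\<^sup>+y. ennreal (norm (?g y)) * (\<integral>\<^sup>+x. ennreal (norm (V t (x - y) - V t x) ^ 3) \<partial>muC) \<partial>lborel)"
  proof (rule Duchon_Robert[OF B grad_Kern_minus[OF e(1)] VL])
    show "norm (V t x) \<le> 8 * B0 * nrm (U t)" for x unfolding V_def by (rule conv_norm_le[OF B0 Lsp])
    show "(\<integral>y. ?g y \<bullet> V t (x - y) \<partial>lborel) = 0" for x
      unfolding V_def using VL[unfolded V_def]
      by (intro divfree_conv[OF kern_Kern[OF d] B Lsp] divfree kern_Kern e)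
  qed
  also have "\<dots> = (\<integral>\<^sup>+y. ennreal (norm (?g y)) * (moll_incr ?Sp \<delta> (U t) y + moll_incr ?Sm \<delta> (U t) y + moll_incr ?Si \<delta> (U t) y) \<partial>lborel)"
  proof (rule nn_integral_cong)
    fix y
    let ?c = "\<lambda>x. ennreal (norm (V t (x - y) - V t x) ^ 3)"
    have "(\<integral>\<^sup>+x. ennreal (norm (V t (x - y) - V t x) ^ 3) \<partial>muC)
        = (\<integral>\<^sup>+x. indicator ?Sp x * ennreal (norm (V t (x - y) - V t x) ^ 3) + indicator ?Sm x * ennreal (norm (V t (x - y) - V t x) ^ 3)
            + indicator ?Si x * ennreal (norm (V t (x - y) - V t x) ^ 3) \<partial>muC)"
    proof (rule nn_integral_cong)
      fix x :: "real^3"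
      consider "2 * \<epsilon> \<le> x $ 3" | "x $ 3 \<le> - (2 * \<epsilon>)" | "\<bar>x $ 3\<bar> < 2 * \<epsilon>" by linarith
      then have "indicator ?Sp x + indicator ?Sm x + indicator ?Si x = (1::ennreal)"
        using e by cases (auto simp: abs_less_iff)
      then have "?c x = (indicator ?Sp x + indicator ?Sm x + indicator ?Si x) * ?c x" by (simp only: mult_1)
      then show "?c x = indicator ?Sp x * ?c x + indicator ?Sm x * ?c x + indicator ?Si x * ?c x" by (simp only: distrib_right)
    qed
    also have "\<dots> = moll_incr ?Sp \<delta> (U t) y + moll_incr ?Sm \<delta> (U t) y + moll_incr ?Si \<delta> (U t) y"
    proof -
      have mi: "moll_incr S \<delta> (U t) y = (\<integral>\<^sup>+x. indicator S x * ?c x \<partial>muC)" for S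
        by (simp add: moll_incr_def V_def)
      show ?thesis unfolding mi by (rule nn_integral_add3; measurable)
    qed
    finally show "ennreal (norm (?g y)) * (\<integral>\<^sup>+x. ennreal (norm (V t (x - y) - V t x) ^ 3) \<partial>muC)
        = ennreal (norm (?g y)) * (moll_incr ?Sp \<delta> (U t) y + moll_incr ?Sm \<delta> (U t) y + moll_incr ?Si \<delta> (U t) y)" by simp
  qed
  also have "\<dots> = flux_part ?Sp \<epsilon> \<delta> (U t) + flux_part ?Sm \<epsilon> \<delta> (U t) + flux_part ?Si \<epsilon> \<delta> (U t)"
    unfolding flux_part_def distrib_left by (rule nn_integral_add3; measurable)
  finally show ?thesis .
qed

text \<open>Tonelli puts the time integral innermost, where increments of order
  \<open>r \<epsilon>\<close> meet the mass \<open>A / \<epsilon>\<close> of the gradient.\<close>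

lemma flux_part_outer_integral:
  assumes A: "\<And>\<epsilon>. 0 < \<epsilon> \<Longrightarrow> \<epsilon> \<le> 1 \<Longrightarrow> (\<integral>\<^sup>+x. ennreal (norm (grad (Kern \<epsilon>) x)) \<partial>lborel) \<le> ennreal (A / \<epsilon>)" and A0: "0 \<le> A"
    and e: "0 < \<epsilon>" "\<epsilon> \<le> 1" and d: "0 < \<delta>" "\<delta> \<le> \<epsilon>" and r: "0 \<le> r"
    and S: "S \<in> sets borel"
    and inc: "\<And>y. norm y \<le> \<epsilon> \<Longrightarrow> (\<integral>\<^sup>+t. indicator {a..b} t * moll_incr S \<delta> (U t) y \<partial>lborel) \<le> ennreal (r * \<epsilon>)"
  shows "(\<integral>\<^sup>+t. indicator {a..b} t * flux_part S \<epsilon> \<delta> (U t) \<partial>lborel) \<le> ennreal (r * A)"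
proof -
  have d1: "\<delta> \<le> 1" using d e by simp
  obtain B where B: "bkv B (grad (Kern \<epsilon>))" using kern_grad_bkv[OF kern_Kern[OF e]] by blast
  note [measurable] = bkvD(2)[OF B] moll_incr_measurable[OF d(1) d1 S]
  let ?n = "\<lambda>y. ennreal (norm (grad (Kern \<epsilon>) y))"
  have "(\<integral>\<^sup>+t. indicator {a..b} t * flux_part S \<epsilon> \<delta> (U t) \<partial>lborel)
      = (\<integral>\<^sup>+t. \<integral>\<^sup>+y. ?n y * (indicator {a..b} t * moll_incr S \<delta> (U t) y) \<partial>lborel \<partial>lborel)"
    unfolding flux_part_def by (subst nn_integral_cmult[symmetric]) (auto simp: mult.left_commute)
  also have "\<dots> = (\<integral>\<^sup>+y. \<integral>\<^sup>+t. ?n y * (indicator {a..b} t * moll_incr S \<delta> (U t) y) \<partial>lborel \<partial>lborel)"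
    by (rule lborel_pair.Fubini'[symmetric]) measurable
  also have "\<dots> = (\<integral>\<^sup>+y. ?n y * (\<integral>\<^sup>+t. indicator {a..b} t * moll_incr S \<delta> (U t) y \<partial>lborel) \<partial>lborel)"
    by (subst nn_integral_cmult) auto
  also have "\<dots> \<le> (\<integral>\<^sup>+y. ?n y * ennreal (r * \<epsilon>) \<partial>lborel)"
  proof (rule nn_integral_mono)
    fix y
    show "?n y * (\<integral>\<^sup>+t. indicator {a..b} t * moll_incr S \<delta> (U t) y \<partial>lborel) \<le> ?n y * ennreal (r * \<epsilon>)"
    proof (cases "norm y \<le> \<epsilon>")
      case True then show ?thesis by (intro mult_left_mono inc) auto
    qed (use grad_Kern_eq_0[OF e(1)] in simp)
  qed
  also have "\<dots> = (\<integral>\<^sup>+y. ?n y \<partial>lborel) * ennreal (r * \<epsilon>)" by (subst nn_integral_multc) auto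
  also have "\<dots> \<le> ennreal (A / \<epsilon>) * ennreal (r * \<epsilon>)" by (intro mult_right_mono A e) simp
  also have "\<dots> = ennreal (r * A)" using e A0 r by (subst ennreal_mult[symmetric]) auto
  finally show ?thesis .
qed

end

lemma ennreal_tendsto_0I:
  fixes f :: "nat \<Rightarrow> ennreal"
  assumes "\<And>e. 0 < e \<Longrightarrow> \<forall>\<^sub>F n in sequentially. f n \<le> ennreal e"
  shows "f \<longlonglongrightarrow> 0"
proof (rule order_tendstoI)
  fix c :: ennreal assume "0 < c"
  then obtain e where e: "0 < e" "e < c" using dense by blast
  then obtain r where r: "e = ennreal r" "0 \<le> r" by (cases e) auto
  have "0 < r" using e(1) r by simp
  then have "\<forall>\<^sub>F n in sequentially. f n \<le> ennreal r" by (rule assms)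
  then show "\<forall>\<^sub>F n in sequentially. f n < c" by eventually_elim (use e(2) r(1) in auto)
qed simp

context euler_flow
begin

text \<open>The inner scale tends to 0 first, for a fixed outer scale and by Fatou, so all bounds
  have to be independent of it. Away from the plane this is a bound on time integrals; in the strip
  it is dominated convergence in time as the outer scale tends to 0.\<close>

lemma flux_tendsto_0:
  assumes inc: "\<And>r. 0 < r \<Longrightarrow> \<exists>\<rho>>0. \<forall>y. 0 < norm y \<longrightarrow> norm y < \<rho> \<longrightarrow>
      (\<integral>\<^sup>+t. indicator {a..b} t * increment (U t) y \<partial>lborel) \<le> ennreal (r * norm y)"
    and strip: "0 < \<delta>0" "\<And>t. t \<in> {a..b} \<Longrightarrow> AE z in lborel. \<bar>z $ 3\<bar> < \<delta>0 \<longrightarrow> ennreal (norm (U t z)) \<le> gg t"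
      "(\<integral>\<^sup>+t. indicator {a..b} t * gg t ^ 3 \<partial>lborel) < \<infinity>"
    and bdry: "AE t in lborel. t \<in> {a..b} \<longrightarrow> (\<exists>w. (AE z in lborel. U t z = w z) \<and>
      (\<forall>r>0. \<exists>\<rho>>0. \<forall>z z'. \<bar>z $ 3\<bar> < \<rho> \<longrightarrow> norm (z - z') < \<rho> \<longrightarrow> norm (w z - w z') < r))"
    and en: "\<And>n. 0 < en n" "\<And>n. en n \<le> 1" "en \<longlonglongrightarrow> 0"
  shows "(\<lambda>n. \<integral>t. indicator {a..<b} t *\<^sub>R Tri (grad (Kern (en n))) (U t) (U t) (U t) \<partial>lborel) \<longlonglongrightarrow> 0"
proof -
  obtain A where A: "0 \<le> A" "\<And>\<epsilon>. 0 < \<epsilon> \<Longrightarrow> \<epsilon> \<le> 1 \<Longrightarrow> (\<integral>\<^sup>+x. ennreal (norm (grad (Kern \<epsilon>) x)) \<partial>lborel) \<le> ennreal (A / \<epsilon>)"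
    using ex_grad_Kern_L1 by blast
  define d where "d n m = en n / real (Suc m)" for n m
  have d: "0 < d n m" "d n m \<le> en n" "d n m \<le> 1" for n m
  proof -
    show "0 < d n m" using en(1)[of n] by (simp add: d_def)
    show le: "d n m \<le> en n" using en(1)[of n] by (simp add: d_def field_simps)
    show "d n m \<le> 1" using le en(2)[of n] by linarith
  qed
  have dlim: "d n \<longlonglongrightarrow> 0" for n
  proof -
    have "(\<lambda>m. en n * (1 / real (Suc m))) \<longlonglongrightarrow> en n * 0" by (intro tendsto_mult tendsto_const lim_1_over_n[THEN LIMSEQ_Suc])
    then show ?thesis by (simp add: d_def[abs_def])
  qed
  define Sp Sm Si where "Sp n = {x::real^3. 2 * en n \<le> x $ 3}" and "Sm n = {x::real^3. x $ 3 \<le> - 2 * en n}"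
    and "Si n = {x::real^3. \<bar>x $ 3\<bar> < 2 * en n}" for n
  have Sb: "Sp n \<in> sets borel" "Sm n \<in> sets borel" "Si n \<in> sets borel" for n unfolding Sp_def Sm_def Si_def by measurable
  define Q where "Q S n m t = flux_part S (en n) (d n m) (U t)" for S n m t
  have Qm [measurable]: "Q S n m \<in> borel_measurable borel" if "S \<in> sets borel" for S n m
    unfolding Q_def by (rule flux_part_measurable[OF en(1,2) d(1,3) that])
  \<comment> \<open>The supremum over the inner scales makes the strip term independent of
    \<open>m\<close>; being countable, it remains measurable in time.\<close>
  define H where "H n t = (SUP m. Q (Si n) n m t)" for n t
  have Hm [measurable]: "H n \<in> borel_measurable borel" for n
    unfolding H_def using Qm[OF Sb(3)] by (intro borel_measurable_SUP) auto
  let ?I = "\<lambda>t. indicator {a..b} t :: ennreal"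
  have Hle: "H n t \<le> ennreal (16 * pi\<^sup>2 * A * c ^ 3)"
    if c: "0 \<le> c" and le: "\<And>x y \<delta>. \<bar>x $ 3\<bar> < 2 * en n \<Longrightarrow> norm y \<le> en n \<Longrightarrow> \<delta> \<le> en n \<Longrightarrow>
        AE z in lborel. norm z \<le> \<delta> \<longrightarrow> norm (U t (x - z - y) - U t (x - z)) \<le> c" for n t c
    unfolding H_def Q_def Si_def
    by (rule SUP_least, rule flux_part_strip[OF A(2,1) en(1,2) d(1,3) Lsp c], assumption, assumption) (rule le[OF _ _ d(2)])
  \<comment> \<open>The oscillation is at most twice the sup bound, and
    \<open>16 * 2^3 = 128\<close>; the added 1 keeps the constant positive for the later
    division.\<close>
  define C1 where "C1 = 128 * pi\<^sup>2 * A + 1"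
  have C1: "0 < C1" using A(1) by (simp add: C1_def add_nonneg_pos)
  \<comment> \<open>The height \<open>2 \<epsilon>\<close> of the strip and displacements of
    \<open>\<epsilon>\<close> each by the increment and by the inner mollification stay below
    \<open>4 \<epsilon>\<close>, hence inside the strip of the hypothesis.\<close>
  have Hgg: "H n t \<le> ennreal C1 * gg t ^ 3" if n: "4 * en n < \<delta>0" and t: "t \<in> {a..b}" for n t
  proof (cases "gg t")
    case (real r)
    have "H n t \<le> ennreal (16 * pi\<^sup>2 * A * (2 * r) ^ 3)"
    proof (rule Hle)
      show "0 \<le> 2 * r" using real by simp
      fix x y :: "real^3" and \<delta> assume xy: "\<bar>x $ 3\<bar> < 2 * en n" "norm y \<le> en n" "\<delta> \<le> en n"
      show "AE z in lborel. norm z \<le> \<delta> \<longrightarrow> norm (U t (x - z - y) - U t (x - z)) \<le> 2 * r"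
        using AE_lborel_minus[OF strip(2)[OF t], of x] AE_lborel_minus[OF strip(2)[OF t], of "x - y"]
      proof eventually_elim
        case (elim z)
        show ?case
        proof
          assume z: "norm z \<le> \<delta>"
          have z3: "\<bar>z $ 3\<bar> \<le> en n" using nth_3_bounds[OF z] xy(3) by linarith
          have y3: "\<bar>y $ 3\<bar> \<le> en n" by (rule nth_3_bounds[OF xy(2)])
          have xz: "\<bar>(x - z) $ 3\<bar> < \<delta>0" using z3 xy(1) n en(1)[of n] by (simp add: abs_less_iff abs_le_iff) 
          have xyz: "\<bar>(x - y - z) $ 3\<bar> < \<delta>0" using z3 y3 xy(1) n en(1)[of n] by (simp add: abs_less_iff abs_le_iff)
          have "norm (U t (x - z)) \<le> r" using elim(1) xz real by simp
          moreover have "norm (U t (x - y - z)) \<le> r" using elim(2) xyz real by simp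
          moreover have e1: "x - z - y = x - y - z" by simp
          ultimately show "norm (U t (x - z - y) - U t (x - z)) \<le> 2 * r"
            unfolding e1 using norm_triangle_ineq4[of "U t (x - y - z)" "U t (x - z)"] by linarith
        qed
      qed
    qed
    also have "\<dots> \<le> ennreal (C1 * r ^ 3)"
      using real by (intro ennreal_leI) (simp add: C1_def power_mult_distrib distrib_right)
    also have "\<dots> = ennreal C1 * gg t ^ 3" using real C1 by (simp add: ennreal_mult ennreal_power)
    finally show ?thesis .
  next
    case top
    have "ennreal C1 * gg t ^ 3 = top" using C1 by (simp add: top power3_eq_cube ennreal_mult_top ennreal_mult_eq_top_iff)
    then show ?thesis by simp
  qed
  have Hlim: "AE t in lborel. t \<in> {a..b} \<longrightarrow> (\<lambda>n. H n t) \<longlonglongrightarrow> 0"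
    using bdry
  proof eventually_elim
    case (elim t)
    show ?case
    proof
      assume "t \<in> {a..b}"
      with elim obtain w where w: "AE z in lborel. U t z = w z"
        and osc: "\<And>r. 0 < r \<Longrightarrow> \<exists>\<rho>>0. \<forall>z z'. \<bar>z $ 3\<bar> < \<rho> \<longrightarrow> norm (z - z') < \<rho> \<longrightarrow> norm (w z - w z') < r" by blast
      show "(\<lambda>n. H n t) \<longlonglongrightarrow> 0"
      proof (rule ennreal_tendsto_0I)
        fix e :: real assume e: "0 < e"
        define K where "K = 16 * pi\<^sup>2 * A"
        have K0: "0 \<le> K" using A(1) by (simp add: K_def)
        define r where "r = min 1 (e / (K + 1))"
        have r: "0 < r" "r \<le> 1" "r \<le> e / (K + 1)" using e K0 by (auto simp: r_def)
        have "r ^ 3 \<le> r" using power_decreasing[of 1 3 r] r by simp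
        then have "K * r ^ 3 \<le> K * (e / (K + 1))" using r(3) K0 by (intro mult_left_mono) auto
        also have "\<dots> \<le> e" using e K0 by (simp add: field_simps)
        finally have Kr: "K * r ^ 3 \<le> e" .
        obtain \<rho> where \<rho>: "0 < \<rho>" "\<And>z z'. \<bar>z $ 3\<bar> < \<rho> \<Longrightarrow> norm (z - z') < \<rho> \<Longrightarrow> norm (w z - w z') < r"
          using osc[OF r(1)] by blast
        have "\<forall>\<^sub>F n in sequentially. en n < \<rho> / 3" using order_tendstoD(2)[OF en(3), of "\<rho> / 3"] \<rho>(1) by simp
        then show "\<forall>\<^sub>F n in sequentially. H n t \<le> ennreal e"
        proof eventually_elim
          case (elim n)
          have "H n t \<le> ennreal (16 * pi\<^sup>2 * A * r ^ 3)"
          proof (rule Hle)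
            show "0 \<le> r" using r by simp
            fix x y :: "real^3" and \<delta> assume xy: "\<bar>x $ 3\<bar> < 2 * en n" "norm y \<le> en n" "\<delta> \<le> en n"
            show "AE z in lborel. norm z \<le> \<delta> \<longrightarrow> norm (U t (x - z - y) - U t (x - z)) \<le> r"
              using AE_lborel_minus[OF w, of x] AE_lborel_minus[OF w, of "x - y"]
            proof eventually_elim
              case el: (elim z)
              show ?case
              proof
                assume z: "norm z \<le> \<delta>"
                have z3: "\<bar>z $ 3\<bar> \<le> en n" using nth_3_bounds[OF z] xy(3) by linarith
                have xz: "\<bar>(x - z) $ 3\<bar> < \<rho>" using z3 xy(1) elim by (simp add: abs_less_iff abs_le_iff)
                have e1: "x - z - y = x - y - z" by simp
                have "norm ((x - z) - (x - y - z)) < \<rho>" using xy(2) elim \<rho>(1) by simp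
                from \<rho>(2)[OF xz this] show "norm (U t (x - z - y) - U t (x - z)) \<le> r"
                  unfolding e1 using el by (simp add: norm_minus_commute)
              qed
            qed
          qed
          also have "\<dots> \<le> ennreal e" using Kr by (simp add: K_def ennreal_leI)
          finally show ?case .
        qed
      qed
    qed
  qed
  have HI: "(\<lambda>n. \<integral>\<^sup>+t. ?I t * H n t \<partial>lborel) \<longlonglongrightarrow> 0"
  proof -
    have "\<forall>\<^sub>F n in sequentially. en n < \<delta>0 / 4" using order_tendstoD(2)[OF en(3), of "\<delta>0 / 4"] strip(1) by simp
    then obtain n0 where "\<forall>n\<ge>n0. en n < \<delta>0 / 4" unfolding eventually_sequentially by blast
    then have n0: "4 * en n < \<delta>0" if "n0 \<le> n" for n using that by (simp add: field_simps)
    \<comment> \<open>A dominating function that is measurable by construction; for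
      \<open>gg\<close> only the finiteness of an integral is assumed.\<close>
    define W where "W t = (SUP j. ?I t * H (j + n0) t)" for t
    have Wm [measurable]: "W \<in> borel_measurable borel" unfolding W_def by measurable
    have "(\<lambda>j. \<integral>\<^sup>+t. ?I t * H (j + n0) t \<partial>lborel) \<longlonglongrightarrow> (\<integral>\<^sup>+t. 0 \<partial>(lborel :: real measure))"
    proof (rule nn_integral_dominated_convergence)
      show "(\<lambda>t. ?I t * H (j + n0) t) \<in> borel_measurable lborel" for j by measurable
      show "W \<in> borel_measurable lborel" by measurable
      show "AE t in lborel. ?I t * H (j + n0) t \<le> W t" for j
        unfolding W_def by (intro AE_I2 SUP_upper) simp
      show "(\<integral>\<^sup>+t. W t \<partial>lborel) < \<infinity>"
      proof -
        \<comment> \<open>The constant is pulled out of the integral of the measurable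
          \<open>W\<close>, so that \<open>gg\<close> enters through monotonicity alone.\<close>
        have "ennreal (1 / C1) * (\<integral>\<^sup>+t. W t \<partial>lborel) = (\<integral>\<^sup>+t. ennreal (1 / C1) * W t \<partial>lborel)"
          by (subst nn_integral_cmult) auto
        also have "\<dots> \<le> (\<integral>\<^sup>+t. ?I t * gg t ^ 3 \<partial>lborel)"
        proof (rule nn_integral_mono)
          fix t :: real
          have "W t \<le> ennreal C1 * (?I t * gg t ^ 3)"
            unfolding W_def
          proof (rule SUP_least)
            fix j
            show "?I t * H (j + n0) t \<le> ennreal C1 * (?I t * gg t ^ 3)"
              using Hgg[OF n0, of "j + n0" t] by (cases "t \<in> {a..b}") auto
          qed
          then have "ennreal (1 / C1) * W t \<le> ennreal (1 / C1) * (ennreal C1 * (?I t * gg t ^ 3))" by (rule mult_left_mono) simp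
          also have "\<dots> = ?I t * gg t ^ 3" using C1 by (simp add: mult.assoc[symmetric] ennreal_mult[symmetric])
          finally show "ennreal (1 / C1) * W t \<le> ?I t * gg t ^ 3" .
        qed
        also note strip(3)
        finally have "ennreal (1 / C1) * (\<integral>\<^sup>+t. W t \<partial>lborel) < \<infinity>" .
        then show ?thesis using C1 by (auto simp: ennreal_mult_less_top)
      qed
      show "AE t in lborel. (\<lambda>j. ?I t * H (j + n0) t) \<longlonglongrightarrow> 0"
        using Hlim
      proof eventually_elim
        case (elim t)
        show ?case
        proof (cases "t \<in> {a..b}")
          case True
          then have "(\<lambda>j. H (j + n0) t) \<longlonglongrightarrow> 0" using elim LIMSEQ_ignore_initial_segment[of "\<lambda>n. H n t" 0 n0] by simp
          then show ?thesis using True by simp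
        qed simp
      qed
    qed simp
    then show ?thesis unfolding nn_integral_const mult_zero_left
      by (rule LIMSEQ_offset[where k = n0 and f = "\<lambda>n. \<integral>\<^sup>+t. ?I t * H n t \<partial>lborel"])
  qed
  define F where "F n t = Tri (grad (Kern (en n))) (U t) (U t) (U t)" for n t
  have main: "\<forall>\<^sub>F n in sequentially. (\<integral>\<^sup>+t. ?I t * ennreal (4 * \<bar>F n t\<bar>) \<partial>lborel)
      \<le> ennreal (r * A) + ennreal (r * A) + (\<integral>\<^sup>+t. ?I t * H n t \<partial>lborel)" if r: "0 < r" for r
  proof -
    from inc[OF r] obtain \<rho> where \<rho>0: "0 < \<rho>" and "\<forall>y. 0 < norm y \<longrightarrow> norm y < \<rho> \<longrightarrow>
        (\<integral>\<^sup>+t. ?I t * increment (U t) y \<partial>lborel) \<le> ennreal (r * norm y)" by (elim exE conjE)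
    then have \<rho>: "(\<integral>\<^sup>+t. ?I t * increment (U t) y \<partial>lborel) \<le> ennreal (r * norm y)"
      if "0 < norm y" "norm y < \<rho>" for y using that by (simp only: simp_thms)
    have "\<forall>\<^sub>F n in sequentially. en n < \<rho>" using order_tendstoD(2)[OF en(3) \<rho>0] .
    then show ?thesis
    proof eventually_elim
      case (elim n)
      have inc_le: "(\<integral>\<^sup>+t. ?I t * moll_incr S (d n m) (U t) y \<partial>lborel) \<le> ennreal (r * en n)"
        if y: "norm y \<le> en n" and y': "norm y' = norm y" and le: "\<And>t. moll_incr S (d n m) (U t) y \<le> increment (U t) y'" for S m y y'
      \<comment> \<open>The hypothesis covers nonzero displacements only; for \<open>y = 0\<close>
        the increment vanishes.\<close>
      proof (cases "y = 0")
        case True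
        then show ?thesis by (simp add: moll_incr_def)
      next
        case False
        have "(\<integral>\<^sup>+t. ?I t * moll_incr S (d n m) (U t) y \<partial>lborel) \<le> (\<integral>\<^sup>+t. ?I t * increment (U t) y' \<partial>lborel)"
          by (intro nn_integral_mono mult_left_mono le) simp
        also have "\<dots> \<le> ennreal (r * norm y')" by (rule \<rho>) (use False y y' elim in auto)
        also have "\<dots> \<le> ennreal (r * en n)" using y y' r by (intro ennreal_leI mult_left_mono) auto
        finally show ?thesis .
      qed
      have outer_p: "(\<integral>\<^sup>+t. ?I t * Q (Sp n) n m t \<partial>lborel) \<le> ennreal (r * A)" for m
        unfolding Q_def
        by (rule flux_part_outer_integral[OF A(2,1) en(1,2) d(1,2) less_imp_le[OF r] Sb(1)], assumption, assumption)
           (rule inc_le, assumption, rule norm_minus_cancel, unfold Sp_def, rule moll_incr_upper[OF d(1,2) en(2) Lsp])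
      have nr: "norm (- reflect y) = norm y" for y by simp
      have outer_m: "(\<integral>\<^sup>+t. ?I t * Q (Sm n) n m t \<partial>lborel) \<le> ennreal (r * A)" for m
        unfolding Q_def
        by (rule flux_part_outer_integral[OF A(2,1) en(1,2) d(1,2) less_imp_le[OF r] Sb(2)], assumption, assumption)
           (rule inc_le, assumption, rule nr, unfold Sm_def, rule moll_incr_lower[OF d(1,2) en(2) Lsp sym])
      note [measurable] = Qm[OF Sb(1)] Qm[OF Sb(2)]
      let ?P = "\<lambda>m t. ?I t * Q (Sp n) n m t + ?I t * Q (Sm n) n m t + ?I t * H n t"
      \<comment> \<open>At each time the flux is the limit of the fluxes of the mollified fields, so
        Fatou applies as the inner scale vanishes and no domination in \<open>m\<close> is
        needed.\<close>
      have "(\<integral>\<^sup>+t. ?I t * ennreal (4 * \<bar>F n t\<bar>) \<partial>lborel) \<le> (\<integral>\<^sup>+t. liminf (\<lambda>m. ?P m t) \<partial>lborel)"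
      proof (rule nn_integral_mono)
        fix t
        show "?I t * ennreal (4 * \<bar>F n t\<bar>) \<le> liminf (\<lambda>m. ?P m t)"
        proof (cases "t \<in> {a..b}")
          case True
          obtain B where B: "bkv B (grad (Kern (en n)))" using kern_grad_bkv[OF kern_Kern[OF en(1,2)]] by blast
          let ?T = "\<lambda>m. Tri (grad (Kern (en n))) (conv (Kern (d n m)) (U t)) (conv (Kern (d n m)) (U t)) (conv (Kern (d n m)) (U t))"
          have "?T \<longlonglongrightarrow> F n t" unfolding F_def by (rule Tri_cubic_tendsto[OF B d(1,3) dlim])
          then have "(\<lambda>m. ennreal (4 * \<bar>?T m\<bar>)) \<longlonglongrightarrow> ennreal (4 * \<bar>F n t\<bar>)"
            by (intro tendsto_ennrealI tendsto_intros)
          then have "ennreal (4 * \<bar>F n t\<bar>) = liminf (\<lambda>m. ennreal (4 * \<bar>?T m\<bar>))"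
            by (rule lim_imp_Liminf[OF sequentially_bot, symmetric])
          also have "\<dots> \<le> liminf (\<lambda>m. ?P m t)"
          proof (rule Liminf_mono, rule always_eventually, rule allI)
            fix m
            have "ennreal (4 * \<bar>?T m\<bar>) \<le> Q (Sp n) n m t + Q (Sm n) n m t + Q (Si n) n m t"
              unfolding Q_def Sp_def Sm_def Si_def by (rule flux_le_parts[OF en(1,2) d(1,3)])
            also have "\<dots> \<le> Q (Sp n) n m t + Q (Sm n) n m t + H n t"
              unfolding H_def by (intro add_left_mono SUP_upper) simp
            finally show "ennreal (4 * \<bar>?T m\<bar>) \<le> ?P m t" using True by simp
          qed
          finally show ?thesis using True by simp
        qed simp
      qed
      also have "\<dots> \<le> liminf (\<lambda>m. \<integral>\<^sup>+t. ?P m t \<partial>lborel)" by (rule nn_integral_liminf) measurable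
      also have "\<dots> \<le> liminf (\<lambda>m::nat. ennreal (r * A) + ennreal (r * A) + (\<integral>\<^sup>+t. ?I t * H n t \<partial>lborel))"
      proof (rule Liminf_mono, rule always_eventually, rule allI)
        fix m
        have "(\<integral>\<^sup>+t. ?P m t \<partial>lborel) = (\<integral>\<^sup>+t. ?I t * Q (Sp n) n m t \<partial>lborel) + (\<integral>\<^sup>+t. ?I t * Q (Sm n) n m t \<partial>lborel) + (\<integral>\<^sup>+t. ?I t * H n t \<partial>lborel)"
          by (rule nn_integral_add3; measurable)
        also have "\<dots> \<le> ennreal (r * A) + ennreal (r * A) + (\<integral>\<^sup>+t. ?I t * H n t \<partial>lborel)"
          by (intro add_mono outer_p outer_m order_refl)
        finally show "(\<integral>\<^sup>+t. ?P m t \<partial>lborel) \<le> ennreal (r * A) + ennreal (r * A) + (\<integral>\<^sup>+t. ?I t * H n t \<partial>lborel)" .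
      qed
      also have "\<dots> = ennreal (r * A) + ennreal (r * A) + (\<integral>\<^sup>+t. ?I t * H n t \<partial>lborel)" by (rule Liminf_const) simp
      finally show ?case .
    qed
  qed
  show ?thesis
  proof (rule tendstoI)
    fix e :: real assume e: "0 < e"
    define r where "r = e / (8 * (A + 1))"
    have r: "0 < r" using e A(1) by (simp add: r_def)
    have "r * A \<le> e / 8" using e A(1) by (simp add: r_def field_simps)
    then have rA: "r * A + r * A \<le> e / 4" by linarith
    have "\<forall>\<^sub>F n in sequentially. (\<integral>\<^sup>+t. ?I t * H n t \<partial>lborel) < ennreal (e / 4)"
      using order_tendstoD(2)[OF HI, of "ennreal (e / 4)"] e by simp
    with main[OF r] show "\<forall>\<^sub>F n in sequentially. dist (\<integral>t. indicator {a..<b} t *\<^sub>R Tri (grad (Kern (en n))) (U t) (U t) (U t) \<partial>lborel) 0 < e"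
    proof eventually_elim
      case (elim n)
      let ?X = "\<integral>t. indicator {a..<b} t *\<^sub>R F n t \<partial>lborel"
      have "ennreal (norm ?X) \<le> (\<integral>\<^sup>+t. ?I t * ennreal (4 * \<bar>F n t\<bar>) \<partial>lborel)"
      proof (cases "integrable lborel (\<lambda>t. indicator {a..<b} t *\<^sub>R F n t)")
        case True
        have "ennreal (norm ?X) \<le> (\<integral>\<^sup>+t. ennreal (norm (indicator {a..<b} t *\<^sub>R F n t)) \<partial>lborel)"
          by (rule integral_norm_bound_ennreal[OF True])
        also have "\<dots> \<le> (\<integral>\<^sup>+t. ?I t * ennreal (4 * \<bar>F n t\<bar>) \<partial>lborel)"
        proof (rule nn_integral_mono)
          fix t :: real
          show "ennreal (norm (indicator {a..<b} t *\<^sub>R F n t)) \<le> ?I t * ennreal (4 * \<bar>F n t\<bar>)"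
            by (cases "t \<in> {a..<b}") (auto intro!: ennreal_leI)
        qed
        finally show ?thesis .
      qed (simp add: not_integrable_integral_eq)
      also have "\<dots> \<le> ennreal (r * A) + ennreal (r * A) + (\<integral>\<^sup>+t. ?I t * H n t \<partial>lborel)" by (rule elim(1))
      also have "\<dots> \<le> ennreal (r * A) + ennreal (r * A) + ennreal (e / 4)" using elim(2) by (intro add_left_mono) auto
      also have "\<dots> = ennreal (r * A + r * A + e / 4)" using r A(1) e by (simp add: ennreal_plus[symmetric] del: ennreal_plus)
      finally have "norm ?X \<le> r * A + r * A + e / 4" using r A(1) e by (subst (asm) ennreal_le_iff) auto
      also have "\<dots> < e" using rA e by linarith
      finally show ?case by (simp add: F_def)
    qed
  qed
qed

end

section \<open>Transfer of the hypotheses to the doubled domain\<close>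

lemma AE_lborel_reflect:
  assumes "AE z in lborel. P z" shows "AE z in lborel. P (reflect z)"
proof -
  obtain N where N: "N \<in> null_sets lborel" "{z \<in> space lborel. \<not> P z} \<subseteq> N"
    using assms by (auto simp: eventually_ae_filter)
  have [measurable]: "N \<in> sets borel" using N(1) by auto
  have "(\<integral>\<^sup>+z. indicator N (reflect z) \<partial>lborel) = (\<integral>\<^sup>+z. indicator N z \<partial>lborel)"
    by (rule nn_integral_lborel_reflect) measurable
  also have "\<dots> = 0" using N(1) by auto
  finally have "AE z in lborel. indicator N (reflect z) = (0::ennreal)"
    by (subst (asm) nn_integral_0_iff_AE) auto
  then show ?thesis
    by eventually_elim (use N(2) in \<open>auto simp: indicator_def split: if_splits\<close>)
qed

text \<open>Lattice translates reach almost every point above the plane, and the reflection, which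
  preserves null sets, reaches those below.\<close>

lemma AE_extend_cell:
  assumes "AE x in lebesgue. x \<in> cell \<longrightarrow> P x" and p: "\<And>x m n. x \<in> D_plus \<Longrightarrow> P (x + lat m n) \<Longrightarrow> P x"
  shows "AE z in lborel. P (if 0 \<le> z $ 3 then z else reflect z)"
proof -
  have up: "AE z in lborel. 0 \<le> z $ 3 \<longrightarrow> P z"
    using AE_lebesgue_lat[OF assms(1)] unfolding AE_completion_iff
  proof eventually_elim
    case (elim z)
    show ?case
    proof
      assume z: "0 \<le> z $ 3"
      let ?m = "- \<lfloor>z $ 1 / (2 * pi)\<rfloor>" and ?n = "- \<lfloor>z $ 2 / (2 * pi)\<rfloor>"
      have "z + lat ?m ?n \<in> cell" using wrap_full_cell[of z] z by (simp add: cell_eq wrap_def)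
      then have "P (z + lat ?m ?n)" using elim by blast
      from p[OF _ this] show "P z" using z by (simp add: D_plus_def)
    qed
  qed
  have lo: "AE z in lborel. 0 \<le> reflect z $ 3 \<longrightarrow> P (reflect z)" by (rule AE_lborel_reflect[OF up])
  show ?thesis using up lo
  proof eventually_elim
    case (elim z)
    then show ?case by (cases "0 \<le> z $ 3") simp_all
  qed
qed

text \<open>On the set \<open>norm y <= x $ 3\<close> both \<open>x\<close> and \<open>x + y\<close>
  lie in the half-space, so the increments of \<open>U\<close> are those of \<open>f\<close> and
  never cross the plane. The restriction in the hypothesis is exactly what is needed here.\<close>

lemma increment_represents:
  assumes r: "represents U f"
  shows "increment U y = (\<integral>\<^sup>+x\<in>{x \<in> cell. norm y \<le> x $ 3}. ennreal (norm (f (x + y) - f x) ^ 3) \<partial>lebesgue)"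
proof -
  note [measurable] = LspD(2)[OF representsD(1)[OF r]]
  have ae: "AE x in lborel. x \<in> D_plus \<longrightarrow> U x = f x" using representsD(3)[OF r] by (simp only: AE_completion_iff)
  have "AE x in lborel. y - (0 - x) \<in> D_plus \<longrightarrow> U (y - (0 - x)) = f (y - (0 - x))"
    by (rule AE_lborel_minus[OF AE_lborel_minus[OF ae]])
  then have ae': "AE x in lborel. x + y \<in> D_plus \<longrightarrow> U (x + y) = f (x + y)" by (simp add: add.commute)
  have "increment U y = (\<integral>\<^sup>+x. indicator full_cell x * (indicator {x. norm y \<le> x $ 3} x * ennreal (norm (U (x + y) - U x) ^ 3)) \<partial>lborel)"
    unfolding increment_def by (rule nn_integral_muC) measurable
  also have "\<dots> = (\<integral>\<^sup>+x. ennreal (norm (f (x + y) - f x) ^ 3) * indicator {x \<in> cell. norm y \<le> x $ 3} x \<partial>lborel)"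
  proof (rule nn_integral_cong_AE)
    show "AE x in lborel. indicator full_cell x * (indicator {x. norm y \<le> x $ 3} x * ennreal (norm (U (x + y) - U x) ^ 3))
        = ennreal (norm (f (x + y) - f x) ^ 3) * indicator {x \<in> cell. norm y \<le> x $ 3} x"
      using ae ae'
    proof eventually_elim
      case (elim x)
      show ?case
      proof (cases "x \<in> full_cell \<and> norm y \<le> x $ 3")
        case True
        have "0 \<le> norm y" by simp
        then have "0 \<le> x $ 3" using True by linarith
        moreover have "- y $ 3 \<le> norm y" using component_le_norm_cart[of y 3] by (simp add: abs_le_iff)
        then have "0 \<le> (x + y) $ 3" using True by simp
        ultimately show ?thesis using elim True by (simp add: D_plus_def cell_eq)
      next
        case False
        have "x \<notin> {x \<in> cell. norm y \<le> x $ 3}" using False by (auto simp: cell_eq)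
        then show ?thesis using False by (auto simp: indicator_def)
      qed
    qed
  qed
  finally show ?thesis by (simp only: nn_integral_completion)
qed

lemma ennreal_divide_less_imp_le:
  assumes "x / ennreal c < ennreal r" "0 < c" shows "x \<le> ennreal (r * c)"
proof (cases x)
  case (real i)
  then have "ennreal (i / c) < ennreal r" using assms by (simp add: divide_ennreal)
  then have "i / c < r" using real assms(2) by (simp add: ennreal_less_iff)
  then show ?thesis using real assms(2) by (simp add: ennreal_leI field_simps)
next
  case top
  then show ?thesis using assms by (simp add: ennreal_top_divide)
qed

text \<open>Periodicity and the isometry of the reflection spread the essential bound from the upper
  cell to the two-sided strip.\<close>

lemma represents_strip_bound:
  assumes r: "represents U f"
  shows "AE z in lborel. \<bar>z $ 3\<bar> < \<delta> \<longrightarrow>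
    ennreal (norm (U z)) \<le> esssup (lebesgue_on {x \<in> cell. x $ 3 < \<delta>}) (\<lambda>x. ennreal (norm (f x)))"
proof -
  let ?S = "{x \<in> cell. x $ 3 < \<delta>}"
  let ?E = "esssup (lebesgue_on ?S) (\<lambda>x. ennreal (norm (f x)))"
  let ?P = "\<lambda>x. x $ 3 < \<delta> \<longrightarrow> ennreal (norm (U x)) \<le> ?E"
  have "?S = cell \<inter> {x. x $ 3 < \<delta>}" by auto
  also have "\<dots> \<in> sets borel" by measurable
  finally have S: "?S \<inter> space lebesgue \<in> sets lebesgue" by simp
  have "AE x in lebesgue_on ?S. ennreal (norm (f x)) \<le> ?E" by (rule esssup_AE)
  then have "AE x in lebesgue. x \<in> ?S \<longrightarrow> ennreal (norm (f x)) \<le> ?E"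
    by (simp only: AE_restrict_space_iff[OF S])
  then have "AE x in lebesgue. x \<in> cell \<longrightarrow> ?P x"
    using representsD(4)[OF r] by eventually_elim simp
  then have "AE z in lborel. ?P (if 0 \<le> z $ 3 then z else reflect z)"
  proof (rule AE_extend_cell)
    fix x m n assume "?P (x + lat m n)"
    then show "?P x" by (simp add: per_lat[OF LspD(1)[OF representsD(1)[OF r]]])
  qed
  then show ?thesis
  proof eventually_elim
    case (elim z)
    then show ?case by (cases "0 \<le> z $ 3") (simp_all add: representsD(2)[OF r])
  qed
qed

text \<open>Closure in the square norm does not preserve pointwise boundary values, so tangency of
  the continuous representative cannot be read off from the approximants. It comes from the
  divergence condition on the reflected field, and then reflection creates no jump.\<close>

lemma represents_boundary_continuous:
  assumes r: "represents U f" and c: "C_bdry_D f"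
    and div: "\<And>\<kappa> x. kern \<kappa> \<Longrightarrow> (\<integral>y. grad \<kappa> y \<bullet> U (x - y) \<partial>lborel) = 0"
  shows "\<exists>w. (AE z in lborel. U z = w z) \<and>
    (\<forall>r>0. \<exists>\<rho>>0. \<forall>z z'. \<bar>z $ 3\<bar> < \<rho> \<longrightarrow> norm (z - z') < \<rho> \<longrightarrow> norm (w z - w z') < r)"
proof -
  obtain v where v: "horiz_periodic_on D_plus v" "AE x in lebesgue_on cell. v x = f x"
    "continuous_at_subset bdry_D_plus D_plus v"
    using c unfolding C_bdry_D_def by blast
  have cl: "cell \<inter> space lebesgue \<in> sets lebesgue" by simp
  have "AE x in lebesgue. x \<in> cell \<longrightarrow> U x = v x"
    using v(2)[unfolded AE_restrict_space_iff[OF cl]] representsD(4)[OF r] by eventually_elim simp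
  then have "AE z in lborel. U (if 0 \<le> z $ 3 then z else reflect z) = v (if 0 \<le> z $ 3 then z else reflect z)"
  proof (rule AE_extend_cell)
    fix x m n assume "x \<in> D_plus" "U (x + lat m n) = v (x + lat m n)"
    then show "U x = v x" by (simp add: per_lat[OF LspD(1)[OF representsD(1)[OF r]]] per_lat_D_plus[OF v(1)])
  qed
  then have ae: "AE z in lborel. U z = refl_ext v z"
  proof eventually_elim
    case (elim z)
    then show ?case
      using representsD(2)[OF r, of "reflect z"] by (cases "0 \<le> z $ 3") (simp_all add: refl_ext_def)
  qed
  have "v x $ 3 = 0" if "x $ 3 = 0" for x
    by (rule normal_component_zero[OF representsD(1)[OF r] div ae that v(3)])
  then show ?thesis using ae boundary_oscillation[OF v(1,3)] by blast
qed

theorem theorem17: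
  fixes T t1 t2 :: real and u :: "real \<Rightarrow> real^3 \<Rightarrow> real^3"
  assumes T: "0 < T"
    and sol: "\<exists>p. weak_solution T u p"
    and L3: "L3_L3_D T u"
    and times: "0 \<le> t1" "t1 < t2" "t2 \<le> T"
    and bounded_strip: "\<exists>\<delta>>0. L3_Linf_strip T \<delta> u"
    and cont_bdry: "AE t in lebesgue_on {0..T}. C_bdry_D (u t)"
    and increments: "((\<lambda>y::real^3. (\<integral>\<^sup>+t\<in>{t1..t2}.
           (\<integral>\<^sup>+x\<in>{x \<in> cell. norm y \<le> x $ 3}. ennreal (norm (u t (x + y) - u t x) ^ 3) \<partial>lebesgue)
           \<partial>lebesgue) / ennreal (norm y)) \<longlongrightarrow> 0) (at 0)"
  shows "conserves_energy u t1 t2"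
proof -
  from sol obtain p where p: "weak_solution T u p" ..
  obtain U where flow: "weakly_continuous_flow U" and rep: "\<And>t. t \<in> {0..T} \<Longrightarrow> represents (U t) (u t)"
    and weq: "\<And>\<Phi> \<epsilon> a b. tangential \<Phi> \<Longrightarrow> 0 < \<epsilon> \<Longrightarrow> \<epsilon> \<le> 1 \<Longrightarrow> 0 \<le> a \<Longrightarrow> a \<le> b \<Longrightarrow> b \<le> T \<Longrightarrow>
      (\<integral>x. U b x \<bullet> conv (Kern \<epsilon>) (refl_ext \<Phi>) x \<partial>muC) - (\<integral>x. U a x \<bullet> conv (Kern \<epsilon>) (refl_ext \<Phi>) x \<partial>muC)
      = (\<integral>t. indicator {a..b} t *\<^sub>R Tri (grad (Kern \<epsilon>)) (U t) (U t) (refl_ext \<Phi>) \<partial>lborel)"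
    by (rule weak_solution_flow[OF T p]) (rule that)
  interpret euler_flow U T by (intro euler_flow.intro euler_flow_axioms.intro flow weq)
  have "L2_norm_D (u b) = L2_norm_D (u t1)" if "b \<in> {t1..t2}" for b
  \<comment> \<open>The balance is run on \<open>[t1, b]\<close> for each later time
    \<open>b\<close> separately; it is stated for nondegenerate intervals.\<close>
  proof (cases "b = t1")
    case False
    then have b: "t1 < b" "b \<le> t2" "b \<le> T" using that times by auto
    have rep': "represents (U t) (u t)" if "t \<in> {t1..b}" for t using that b times by (intro rep) auto
    have inc: "\<exists>\<rho>>0. \<forall>y. 0 < norm y \<longrightarrow> norm y < \<rho> \<longrightarrow>
      (\<integral>\<^sup>+t. indicator {t1..b} t * increment (U t) y \<partial>lborel) \<le> ennreal (r * norm y)" if r: "0 < r" for r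
    proof -
      let ?J = "\<lambda>y. \<integral>\<^sup>+t\<in>{t1..t2}.
         (\<integral>\<^sup>+x\<in>{x \<in> cell. norm y \<le> x $ 3}. ennreal (norm (u t (x + y) - u t x) ^ 3) \<partial>lebesgue) \<partial>lebesgue"
      \<comment> \<open>Shortening the time interval only decreases the integral, so the limit
        assumed on \<open>[t1, t2]\<close> serves every \<open>b\<close>.\<close>
      have le: "(\<integral>\<^sup>+t. indicator {t1..b} t * increment (U t) y \<partial>lborel) \<le> ?J y" for y
        unfolding nn_integral_completion[of lborel, symmetric]
      proof (rule nn_integral_mono)
        fix t
        show "indicator {t1..b} t * increment (U t) y \<le>
           (\<integral>\<^sup>+x\<in>{x \<in> cell. norm y \<le> x $ 3}. ennreal (norm (u t (x + y) - u t x) ^ 3) \<partial>lebesgue) * indicator {t1..t2} t"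
          using increment_represents[OF rep', of t y] b by (cases "t \<in> {t1..b}") simp_all
      qed
      have "\<forall>\<^sub>F y in at 0. ?J y / ennreal (norm y) < ennreal r"
        using order_tendstoD(2)[OF increments, of "ennreal r"] r by simp
      then obtain \<rho> where \<rho>: "0 < \<rho>" "\<And>y. y \<noteq> 0 \<Longrightarrow> norm y < \<rho> \<Longrightarrow> ?J y / ennreal (norm y) < ennreal r"
        unfolding eventually_at by auto
      show ?thesis
      proof (intro exI[of _ \<rho>] conjI allI impI)
        fix y :: "real^3" assume y: "0 < norm y" "norm y < \<rho>"
        then have "?J y / ennreal (norm y) < ennreal r" by (intro \<rho>(2)) auto
        then show "(\<integral>\<^sup>+t. indicator {t1..b} t * increment (U t) y \<partial>lborel) \<le> ennreal (r * norm y)"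
          by (intro order_trans[OF le] ennreal_divide_less_imp_le y)
      qed (rule \<rho>(1))
    qed
    obtain \<delta> where \<delta>: "0 < \<delta>" "L3_Linf_strip T \<delta> u" using bounded_strip by blast
    define gg where "gg t = esssup (lebesgue_on {x \<in> cell. x $ 3 < \<delta>}) (\<lambda>x. ennreal (norm (u t x)))" for t
    have gg: "AE z in lborel. \<bar>z $ 3\<bar> < \<delta> \<longrightarrow> ennreal (norm (U t z)) \<le> gg t" if "t \<in> {t1..b}" for t
      unfolding gg_def by (rule represents_strip_bound[OF rep'[OF that]])
    have "(\<integral>\<^sup>+t. indicator {t1..b} t * gg t ^ 3 \<partial>lborel) \<le> (\<integral>\<^sup>+t\<in>{0..T}. gg t ^ 3 \<partial>lebesgue)"
      unfolding nn_integral_completion using b times by (intro nn_integral_mono) (simp add: indicator_def)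
    also have "\<dots> < \<infinity>" using \<delta>(2) by (simp only: L3_Linf_strip_def gg_def)
    finally have gg_int: "(\<integral>\<^sup>+t. indicator {t1..b} t * gg t ^ 3 \<partial>lborel) < \<infinity>" .
    have iv: "{0..T} \<inter> space lebesgue \<in> sets lebesgue" by simp
    have "AE t in lborel. t \<in> {0..T} \<longrightarrow> C_bdry_D (u t)"
      using cont_bdry by (simp only: AE_restrict_space_iff[OF iv] AE_completion_iff)
    then have bdry: "AE t in lborel. t \<in> {t1..b} \<longrightarrow> (\<exists>w. (AE z in lborel. U t z = w z) \<and>
      (\<forall>r>0. \<exists>\<rho>>0. \<forall>z z'. \<bar>z $ 3\<bar> < \<rho> \<longrightarrow> norm (z - z') < \<rho> \<longrightarrow> norm (w z - w z') < r))"
    proof eventually_elim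
      case (elim t)
      show ?case
      proof
        assume t: "t \<in> {t1..b}"
        have "t \<in> {0..T}" using t b times by auto
        with elim have c: "C_bdry_D (u t)" ..
        show "\<exists>w. (AE z in lborel. U t z = w z) \<and>
          (\<forall>r>0. \<exists>\<rho>>0. \<forall>z z'. \<bar>z $ 3\<bar> < \<rho> \<longrightarrow> norm (z - z') < \<rho> \<longrightarrow> norm (w z - w z') < r)"
          by (rule represents_boundary_continuous[OF rep'[OF t] c divfree])
      qed
    qed
    define en where "en n = 1 / real (Suc n)" for n
    have en: "0 < en n" "en n \<le> 1" for n by (simp_all add: en_def)
    have en0: "en \<longlonglongrightarrow> 0" unfolding en_def[abs_def] by (rule lim_1_over_n[THEN LIMSEQ_Suc])
    \<comment> \<open>The same difference is evaluated twice: the energy balance sends it to 0,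
      strong convergence of the mollifications sends it to the difference of the energies.\<close>
    have "(\<lambda>n. mollified_pairing (en n) b b - mollified_pairing (en n) t1 t1) \<longlonglongrightarrow> 2 * 0"
      unfolding energy_balance[OF en times(1) b(1,3)]
      by (intro tendsto_mult tendsto_const flux_tendsto_0[OF inc \<delta>(1) gg gg_int bdry en en0])
    moreover have "(\<lambda>n. mollified_pairing (en n) b b - mollified_pairing (en n) t1 t1) \<longlonglongrightarrow> (nrm (U b))\<^sup>2 - (nrm (U t1))\<^sup>2"
      by (intro tendsto_diff mollified_pairing_tendsto en en0)
    ultimately have "(nrm (U b))\<^sup>2 - (nrm (U t1))\<^sup>2 = 2 * 0" by (rule LIMSEQ_unique[rotated])
    then have "nrm (U b) = nrm (U t1)" by simp
    then show ?thesis using b by (simp add: L2_norm_represents[OF rep'])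
  qed simp
  then show ?thesis unfolding conserves_energy_def by blast
qed

end
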